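(* Assume (C1), (GC), (C2), $(\mathcal L_V)$, (U), (S) hold (see context). Let $\beta\in(0,1]$, let $\varphi\in\mathcal C^{3,\beta}(\mathbb R^d,\mathbb R)$ be Lipschitz continuous with $|\varphi(x)|\le C_{V,\varphi}(1+\sqrt{V(x)})$ for all $x$ and some $C_{V,\varphi}>0$, and let $\gamma_k\asymp k^{-\theta}$. Let $|||\cdot|||$ be a matrix norm with $\|\cdot\|\le|||\cdot|||$, put $|||\sigma|||_\infty:=\sup_x|||\sigma(x)|||$, and assume that there exists a solution $\vartheta$ of $\mathcal A\vartheta=|||\sigma|||^2-\nu(|||\sigma|||^2)$ satisfying the assumptions made on $\varphi$: $\vartheta\in\mathcal C^{3,\beta}(\mathbb R^d,\mathbb R)$ is Lipschitz continuous and $|\vartheta(x)|\le C_{V,\vartheta}(1+\sqrt{V(x)})$ for all $x$ and some $C_{V,\vartheta}>0$. For a positive sequence $(\check c_n)_{n\ge1}$ set $\bar c_n:=\Big(\frac{[\varphi]_1}{[\vartheta]_1}\Big)^{2/3}\nu(|||\sigma|||^2)\,|||\sigma|||_\infty^{-2/3}\,\check c_n$ and, with $x_+=\max(x,0)$, $$\Phi_n(a):=\Bigg[a^2\Bigg(1-\frac2{1+\sqrt{1+4\,\bar c_n^3\frac{\Gamma_n}{a^2}}}\Bigg)\Bigg]\vee\Bigg[a^{\frac43}\Gamma_n^{\frac13}\,\bar c_n\Big(1-\frac23\bar c_n\Big(\frac{\Gamma_n}{a^2}\Big)^{\frac13}\Big)_+\Bigg].$$ (a) If $\theta\in(\frac1{2+\beta},1]$,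 there exist two (explicit) monotonic sequences $\tilde c_n\le1\le\tilde C_n$, $n\ge1$, with $\lim_n\tilde C_n=\lim_n\tilde c_n=1$, and an (explicit) positive sequence $\check c_n\downarrow1$, such that for all $n\ge1$ and all $a>0$: $$\mathbb P\big[|\sqrt{\Gamma_n}\,\nu_n(\mathcal A\varphi)|\ge a\big]\le2\,\tilde C_n\exp\Big(-\frac{\tilde c_n}{2\nu(|||\sigma|||^2)\|\nabla\varphi\|_\infty^2}\,\Phi_n(a)\Big).$$ (b) If $\theta=\frac1{2+\beta}$, there exist two (explicit) monotonic sequences $\tilde c_n\le1\le\tilde C_n$, $n\ge1$, with $\lim_n\tilde C_n=\lim_n\tilde c_n=1$, and a positive sequence $\check c_n\downarrow1$, such that for all $n\ge1$ and all $a>0$: $$\mathbb P\big[|\sqrt{\Gamma_n}\,\nu_n(\mathcal A\varphi)+\mathcal B_{n,\beta}|\ge a\big]\le2\,\tilde C_n\exp\Big(-\frac{\tilde c_n}{2\nu(|||\sigma|||^2)\|\nabla\varphi\|_\infty^2}\,\Phi_n(a)\Big),$$ where $\mathcal B_{n,\beta}$ is the bias term defined in the context.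
   Context: Setting. $b:\mathbb R^d\to\mathbb R^d$ and $\sigma:\mathbb R^d\to\mathbb R^d\otimes\mathbb R^r$ ($d\times r$ matrices) are Lipschitz continuous; $dY_t=b(Y_t)dt+\sigma(Y_t)dW_t$, $W$ an $r$-dimensional Wiener process. $\Sigma:=\sigma\sigma^*$, and the generator is $\mathcal A\varphi(x)=\langle b(x),\nabla\varphi(x)\rangle+\frac12\mathrm{Tr}(\Sigma(x)D^2\varphi(x))$. Scheme: $X_{n+1}=X_n+\gamma_{n+1}b(X_n)+\sqrt{\gamma_{n+1}}\,\sigma(X_n)U_{n+1}$, $n\ge0$, with $X_0\in L^2$, $(U_n)_{n\ge1}$ i.i.d. $\mathbb R^r$-valued, positive steps $\gamma_k\downarrow0$ with $\sum_k\gamma_k=+\infty$. $\Gamma_n:=\sum_{k=1}^n\gamma_k$. Empirical measure: $\nu_n(f):=\frac1{\Gamma_n}\sum_{k=1}^n\gamma_kf(X_{k-1})$. For a function $g$ on $\mathbb R^d$, $g_k:=g(X_k)$. $u_n\asymp v_n$ means: there are $n_0$, $C\ge1$ with $C^{-1}v_n\le u_n\le Cv_n$ for $n\ge n_0$. Norms: $|\cdot|$ Euclidean norm; $\|\cdot\|$ operator norm; $[g]_1$ the Lipschitz constant of $g$; $\|\nabla\varphi\|_\infty:=\sup_x|\nabla\varphi(x)|$. $\mathcal C^{k,\beta}$ is the set of $\mathcal C^k$ functions whose partial derivatives of orders $1,\dots,k$ are bounded and whose order-$k$ partial derivatives are $\beta$-Hölder continuous (the function itself need not be bounded). $|||\sigma|||^2$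 is the function $x\mapsto|||\sigma(x)|||^2$. $D^3\varphi(x)v$ denotes the $d\times d$ matrix with entries $\sum_k\partial^3_{x_ix_jx_k}\varphi(x)v_k$. Bias term: $\Lambda_{k-1}^\beta(t,u,x):=\mathbb E\big[\mathrm{Tr}\big((D^3\varphi(x+\gamma_kb(x)+ut\sqrt{\gamma_k}\sigma(x)U_k)\,\sigma(x)U_k)(\sigma(x)U_k\otimes U_k\sigma(x)^* )\big)\big]$, $E_n^\beta:=\frac1{\sqrt{\Gamma_n}}\sum_{k=1}^n\gamma_k^{3/2}\int_0^1dt(1-t)t\int_0^1du\,\Lambda_{k-1}^\beta(t,u,X_{k-1})$; $\mathcal B_{n,\beta}:=E_n^\beta$ if $\beta\in(0,1)$, and $$\mathcal B_{n,1}:=E_n^1+\frac1{\sqrt{\Gamma_n}}\sum_{k=1}^n\gamma_k^2\int_0^1(1-t)\mathrm{Tr}\big(D^2\varphi(X_{k-1}+t\gamma_kb_{k-1})b_{k-1}\otimes b_{k-1}\big)dt+\frac1{2\sqrt{\Gamma_n}}\sum_{k=1}^n\gamma_k\mathrm{Tr}\big((D^2\varphi(X_{k-1}+\gamma_kb_{k-1})-D^2\varphi(X_{k-1}))\Sigma_{k-1}\big).$$ Assumptions. (C1): there is $\lambda_0>0$ with $\mathbb E[\exp(\lambda|X_0|^2)]<\infty$ for all $\lambda<\lambda_0$. (GC): $\mathbb E[U_1]=0$, $\mathbb E[U_1^iU_1^j]=\delta_{ij}$, $\mathbb E[U_1^iU_1^jU_1^k]=0$ for all $i,j,k$; $(U_n)$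 and $X_0$ are independent; and for every $1$-Lipschitz $g:\mathbb R^r\to\mathbb R$ and every $\lambda>0$, $\mathbb E[\exp(\lambda g(U_1))]\le\exp(\lambda\mathbb E[g(U_1)]+\lambda^2/2)$. (C2): $\sup_x\|\sigma(x)\|^2\le\kappa<\infty$. $(\mathcal L_V)$: there is $V:\mathbb R^d\to[v^*,+\infty)$, $v^*>0$, with (i) $V\in\mathcal C^2$, $\|D^2V\|_\infty<\infty$, $V(x)\to+\infty$ as $|x|\to\infty$; (ii) $|\nabla V(x)|^2+|b(x)|^2\le C_VV(x)$ for all $x$, some $C_V\in(0,\infty)$; (iii) $\mathcal AV(x)\le-\alpha_VV(x)+\beta_V$ for all $x$, some $\alpha_V>0$, $\beta_V\ge0$. (By (i) there are $K,\bar c$ with $|V(x)|\le\bar c|x|^2$ for $|x|\ge K$.) (U): the diffusion has a unique invariant distribution $\nu$. (S): $\gamma_k\le\frac12\min\big(\frac1{\sqrt{C_V\bar c}},\frac{\alpha_V}{C_V\|D^2V\|_\infty}\big)$ for all $k\ge1$ (here $\bar c$ is the constant from $(\mathcal L_V)$, unrelated to the sequence $\bar c_n$). *)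

theory Defs
  imports "HOL-Probability.Probability"
begin

section \<open>Differential calculus\<close>

definition partial :: "'n \<Rightarrow> (real^'n \<Rightarrow> real) \<Rightarrow> real^'n \<Rightarrow> real" where
  "partial i f x = frechet_derivative f (at x) (axis i 1)"

text \<open>The iterated partial derivative with respect to a list of indices \<open>is\<close> is
  \<open>foldr partial is f\<close>.\<close>

definition Ck :: "nat \<Rightarrow> (real^'n \<Rightarrow> real) \<Rightarrow> bool" where
  "Ck k f \<longleftrightarrow>
     (\<forall>is. length is < k \<longrightarrow> (\<forall>x. foldr partial is f differentiable at x)) \<and>
     (\<forall>is. length is \<le> k \<longrightarrow> continuous_on UNIV (foldr partial is f))"

definition Ck_hoelder :: "nat \<Rightarrow> real \<Rightarrow> (real^'n \<Rightarrow> real) \<Rightarrow> bool" where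
  "Ck_hoelder k \<beta> f \<longleftrightarrow> Ck k f \<and>
     (\<forall>is. 1 \<le> length is \<and> length is \<le> k \<longrightarrow> bounded (range (foldr partial is f))) \<and>
     (\<forall>is. length is = k \<longrightarrow>
        (\<exists>L. \<forall>x y. \<bar>foldr partial is f x - foldr partial is f y\<bar> \<le> L * dist x y powr \<beta>))"

definition grad :: "(real^'n \<Rightarrow> real) \<Rightarrow> real^'n \<Rightarrow> real^'n" where
  "grad f x = (\<chi> i. partial i f x)"

definition hess :: "(real^'n \<Rightarrow> real) \<Rightarrow> real^'n \<Rightarrow> real^'n^'n" where
  "hess f x = (\<chi> i j. partial i (partial j f) x)"

definition third_deriv :: "(real^'n \<Rightarrow> real) \<Rightarrow> real^'n \<Rightarrow> real^'n \<Rightarrow> real^'n^'n" where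
  "third_deriv f x v = (\<chi> i j. \<Sum>k\<in>UNIV. partial i (partial j (partial k f)) x * v $ k)"

section \<open>Norms\<close>

definition op_norm :: "real^'m^'n \<Rightarrow> real" where
  "op_norm A = onorm (\<lambda>v. A *v v)"

definition matrix_norm :: "(real^'m^'n \<Rightarrow> real) \<Rightarrow> bool" where
  "matrix_norm N \<longleftrightarrow>
     (\<forall>A. 0 \<le> N A) \<and> (\<forall>A. N A = 0 \<longleftrightarrow> A = 0) \<and>
     (\<forall>c A. N (c *\<^sub>R A) = \<bar>c\<bar> * N A) \<and> (\<forall>A B. N (A + B) \<le> N A + N B)"

definition lip_const :: "('a::metric_space \<Rightarrow> real) \<Rightarrow> real" where
  "lip_const g = (SUP p\<in>{(x, y). x \<noteq> y}. \<bar>g (fst p) - g (snd p)\<bar> / dist (fst p) (snd p))"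

definition outer :: "real^'n \<Rightarrow> real^'n \<Rightarrow> real^'n^'n" where
  "outer v w = (\<chi> i j. v $ i * w $ j)"

section \<open>The diffusion and its invariant distributions\<close>

definition diffusion_matrix :: "(real^'d \<Rightarrow> real^'r^'d) \<Rightarrow> real^'d \<Rightarrow> real^'d^'d" where
  "diffusion_matrix \<sigma> x = \<sigma> x ** transpose (\<sigma> x)"

definition generator ::
  "(real^'d \<Rightarrow> real^'d) \<Rightarrow> (real^'d \<Rightarrow> real^'r^'d) \<Rightarrow> (real^'d \<Rightarrow> real) \<Rightarrow> real^'d \<Rightarrow> real" where
  "generator b \<sigma> f x = b x \<bullet> grad f x + 1/2 * trace (diffusion_matrix \<sigma> x ** hess f x)"

text \<open>Time is the half-line \<open>{0..}\<close> inside \<open>real\<close>; values of processes and filtrations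
  at negative times play no role.\<close>

definition wiener_process ::
  "'w measure \<Rightarrow> (real \<Rightarrow> 'w measure) \<Rightarrow> (real \<Rightarrow> 'w \<Rightarrow> real^'r) \<Rightarrow> bool" where
  "wiener_process M F W \<longleftrightarrow>
     (\<forall>t\<ge>0. W t \<in> borel_measurable (F t)) \<and>
     (AE \<omega> in M. W 0 \<omega> = 0) \<and>
     (\<forall>\<omega>\<in>space M. continuous_on {0..} (\<lambda>t. W t \<omega>)) \<and>
     (\<forall>s t. 0 \<le> s \<and> s < t \<longrightarrow>
        (\<forall>i. distributed M lborel (\<lambda>\<omega>. (W t \<omega> - W s \<omega>) $ i)
               (\<lambda>x. ennreal (normal_density 0 (sqrt (t - s)) x))) \<and>
        prob_space.indep_vars M (\<lambda>_. borel) (\<lambda>i \<omega>. (W t \<omega> - W s \<omega>) $ i) UNIV \<and>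
        prob_space.indep_set M (sets (F s))
          (sets (vimage_algebra (space M) (\<lambda>\<omega>. W t \<omega> - W s \<omega>) borel)))"

text \<open>A simple integrand on \<open>[0,T]\<close> is given by times \<open>0 = \<tau> 0 \<le> \<dots> \<le> \<tau> n = T\<close> and bounded
  \<open>F (\<tau> i)\<close>-measurable values \<open>\<xi> i\<close> on \<open>(\<tau> i, \<tau> (i+1)]\<close>.\<close>

definition simple_integrand ::
  "'w measure \<Rightarrow> (real \<Rightarrow> 'w measure) \<Rightarrow> real \<Rightarrow> nat \<Rightarrow> (nat \<Rightarrow> real) \<Rightarrow> (nat \<Rightarrow> 'w \<Rightarrow> real^'r^'d) \<Rightarrow> bool"
where
  "simple_integrand M F T n \<tau> \<xi> \<longleftrightarrow>
     \<tau> 0 = 0 \<and> \<tau> n = T \<and> (\<forall>i<n. \<tau> i \<le> \<tau> (Suc i)) \<and>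
     (\<forall>i<n. \<xi> i \<in> borel_measurable (F (\<tau> i)) \<and> (\<exists>B. \<forall>\<omega>\<in>space M. norm (\<xi> i \<omega>) \<le> B))"

definition simple_process ::
  "nat \<Rightarrow> (nat \<Rightarrow> real) \<Rightarrow> (nat \<Rightarrow> 'w \<Rightarrow> real^'r^'d) \<Rightarrow> real \<Rightarrow> 'w \<Rightarrow> real^'r^'d" where
  "simple_process n \<tau> \<xi> s \<omega> = (\<Sum>i<n. indicator {\<tau> i<..\<tau> (Suc i)} s *\<^sub>R \<xi> i \<omega>)"

definition simple_integral ::
  "(real \<Rightarrow> 'w \<Rightarrow> real^'r) \<Rightarrow> nat \<Rightarrow> (nat \<Rightarrow> real) \<Rightarrow> (nat \<Rightarrow> 'w \<Rightarrow> real^'r^'d) \<Rightarrow> 'w \<Rightarrow> real^'d" where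
  "simple_integral W n \<tau> \<xi> \<omega> = (\<Sum>i<n. \<xi> i \<omega> *v (W (\<tau> (Suc i)) \<omega> - W (\<tau> i) \<omega>))"

text \<open>\<open>I\<close> is a version of the Ito integral of \<open>H\<close> over \<open>[0,T]\<close>: the limit in probability of the
  integrals of simple integrands \<open>H\<^sub>m\<close> such that the integral of \<open>|H\<^sub>m - H|\<^sup>2\<close> over \<open>[0,T]\<close> tends
  to \<open>0\<close> in probability.\<close>

definition is_ito_integral ::
  "'w measure \<Rightarrow> (real \<Rightarrow> 'w measure) \<Rightarrow> (real \<Rightarrow> 'w \<Rightarrow> real^'r) \<Rightarrow> (real \<Rightarrow> 'w \<Rightarrow> real^'r^'d)
    \<Rightarrow> real \<Rightarrow> ('w \<Rightarrow> real^'d) \<Rightarrow> bool" where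
  "is_ito_integral M F W H T I \<longleftrightarrow> I \<in> borel_measurable M \<and>
     (\<exists>n \<tau> \<xi>. (\<forall>m. simple_integrand M F T (n m) (\<tau> m) (\<xi> m)) \<and>
        (\<forall>\<epsilon>>0. (\<lambda>m. measure M {\<omega>\<in>space M. ennreal \<epsilon> <
            (\<integral>\<^sup>+s\<in>{0..T}. ennreal ((norm (simple_process (n m) (\<tau> m) (\<xi> m) s \<omega> - H s \<omega>))\<^sup>2) \<partial>lborel)})
          \<longlonglongrightarrow> 0) \<and>
        (\<forall>\<epsilon>>0. (\<lambda>m. measure M {\<omega>\<in>space M. \<epsilon> < norm (simple_integral W (n m) (\<tau> m) (\<xi> m) \<omega> - I \<omega>)})
          \<longlonglongrightarrow> 0))"

definition sde_solution ::
  "(real^'d \<Rightarrow> real^'d) \<Rightarrow> (real^'d \<Rightarrow> real^'r^'d) \<Rightarrow> 'w measure \<Rightarrow> (real \<Rightarrow> 'w measure)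
    \<Rightarrow> (real \<Rightarrow> 'w \<Rightarrow> real^'r) \<Rightarrow> (real \<Rightarrow> 'w \<Rightarrow> real^'d) \<Rightarrow> bool" where
  "sde_solution b \<sigma> M F W Y \<longleftrightarrow>
     prob_space M \<and> filtration (space M) F \<and> (\<forall>t. subalgebra M (F t)) \<and>
     wiener_process M F W \<and>
     (\<forall>t\<ge>0. Y t \<in> borel_measurable (F t)) \<and>
     (\<forall>\<omega>\<in>space M. continuous_on {0..} (\<lambda>t. Y t \<omega>)) \<and>
     (\<forall>t\<ge>0. \<exists>I. is_ito_integral M F W (\<lambda>s \<omega>. \<sigma> (Y s \<omega>)) t I \<and>
        (AE \<omega> in M. Y t \<omega> = Y 0 \<omega> + integral {0..t} (\<lambda>s. b (Y s \<omega>)) + I \<omega>))"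

text \<open>\<open>\<nu>\<close> is invariant if the diffusion started from \<open>\<nu>\<close> has law \<open>\<nu>\<close> at all times. Solutions
  are sought on the space of paths of the pair \<open>(Y, W)\<close>, to which every solution can be
  transferred. For Lipschitz coefficients a solution started from \<open>\<nu>\<close> exists and its law is
  determined by \<open>\<nu>\<close>, so it does not matter which solution is taken.\<close>

definition invariant_distribution ::
  "(real^'d \<Rightarrow> real^'d) \<Rightarrow> (real^'d \<Rightarrow> real^'r^'d) \<Rightarrow> (real^'d) measure \<Rightarrow> bool" where
  "invariant_distribution b \<sigma> \<nu> \<longleftrightarrow> prob_space \<nu> \<and> sets \<nu> = sets borel \<and>
     (\<exists>(M :: (real \<Rightarrow> (real^'d) \<times> (real^'r)) measure) F W Y.
        sde_solution b \<sigma> M F W Y \<and> (\<forall>t\<ge>0. distr M borel (Y t) = \<nu>))"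

section \<open>The scheme\<close>

text \<open>Steps and innovations are indexed from \<open>1\<close>; \<open>\<gamma> 0\<close> and \<open>U 0\<close> are never used.\<close>

primrec scheme ::
  "(real^'d \<Rightarrow> real^'d) \<Rightarrow> (real^'d \<Rightarrow> real^'r^'d) \<Rightarrow> (nat \<Rightarrow> real) \<Rightarrow> ('w \<Rightarrow> real^'d)
    \<Rightarrow> (nat \<Rightarrow> 'w \<Rightarrow> real^'r) \<Rightarrow> nat \<Rightarrow> 'w \<Rightarrow> real^'d" where
  "scheme b \<sigma> \<gamma> X0 U 0 \<omega> = X0 \<omega>"
| "scheme b \<sigma> \<gamma> X0 U (Suc n) \<omega> =
     scheme b \<sigma> \<gamma> X0 U n \<omega> + \<gamma> (Suc n) *\<^sub>R b (scheme b \<sigma> \<gamma> X0 U n \<omega>)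
     + sqrt (\<gamma> (Suc n)) *\<^sub>R (\<sigma> (scheme b \<sigma> \<gamma> X0 U n \<omega>) *v U (Suc n) \<omega>)"

definition Gam :: "(nat \<Rightarrow> real) \<Rightarrow> nat \<Rightarrow> real" where
  "Gam \<gamma> n = (\<Sum>k=1..n. \<gamma> k)"

definition emp_measure ::
  "(nat \<Rightarrow> real) \<Rightarrow> (nat \<Rightarrow> 'w \<Rightarrow> real^'d) \<Rightarrow> nat \<Rightarrow> (real^'d \<Rightarrow> real) \<Rightarrow> 'w \<Rightarrow> real" where
  "emp_measure \<gamma> X n f \<omega> = 1 / Gam \<gamma> n * (\<Sum>k=1..n. \<gamma> k * f (X (k - 1) \<omega>))"

definition asymp_seq :: "(nat \<Rightarrow> real) \<Rightarrow> (nat \<Rightarrow> real) \<Rightarrow> bool" where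
  "asymp_seq u v \<longleftrightarrow> (\<exists>n0 C. C \<ge> 1 \<and> (\<forall>n\<ge>n0. v n / C \<le> u n \<and> u n \<le> C * v n))"

section \<open>Assumptions on the innovations and Lyapunov condition\<close>

text \<open>\<^const>\<open>has_bochner_integral\<close> is used for the moments because the Bochner integral of a
  non-integrable function is \<open>0\<close>; for the same reason integrability is explicit in the
  concentration inequality.\<close>

definition gaussian_concentration ::
  "'w measure \<Rightarrow> ('w \<Rightarrow> real^'d) \<Rightarrow> (nat \<Rightarrow> 'w \<Rightarrow> real^'r) \<Rightarrow> bool" where
  "gaussian_concentration M X0 U \<longleftrightarrow>
     has_bochner_integral M (U 1) 0 \<and>
     (\<forall>i j. has_bochner_integral M (\<lambda>\<omega>. U 1 \<omega> $ i * U 1 \<omega> $ j) (if i = j then 1 else 0)) \<and>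
     (\<forall>i j k. has_bochner_integral M (\<lambda>\<omega>. U 1 \<omega> $ i * U 1 \<omega> $ j * U 1 \<omega> $ k) 0) \<and>
     prob_space.indep_set M
       (sets (vimage_algebra (space M) (\<lambda>\<omega>. \<lambda>n\<in>{1..}. U n \<omega>) (\<Pi>\<^sub>M n\<in>{1..}. borel)))
       (sets (vimage_algebra (space M) X0 borel)) \<and>
     (\<forall>g :: real^'r \<Rightarrow> real. 1-lipschitz_on UNIV g \<longrightarrow> (\<forall>l>0.
        integrable M (\<lambda>\<omega>. g (U 1 \<omega>)) \<and> integrable M (\<lambda>\<omega>. exp (l * g (U 1 \<omega>))) \<and>
        (\<integral>\<omega>. exp (l * g (U 1 \<omega>)) \<partial>M) \<le> exp (l * (\<integral>\<omega>. g (U 1 \<omega>) \<partial>M) + l\<^sup>2 / 2)))"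

definition lyapunov ::
  "(real^'d \<Rightarrow> real^'d) \<Rightarrow> (real^'d \<Rightarrow> real^'r^'d) \<Rightarrow> (real^'d \<Rightarrow> real) \<Rightarrow> real \<Rightarrow> real \<Rightarrow> real \<Rightarrow> real \<Rightarrow> bool"
where
  "lyapunov b \<sigma> V v CV \<alpha>V \<beta>V \<longleftrightarrow>
     0 < v \<and> (\<forall>x. v \<le> V x) \<and>
     Ck 2 V \<and> bdd_above (range (\<lambda>x. op_norm (hess V x))) \<and> filterlim V at_top at_infinity \<and>
     0 < CV \<and> (\<forall>x. (norm (grad V x))\<^sup>2 + (norm (b x))\<^sup>2 \<le> CV * V x) \<and>
     0 < \<alpha>V \<and> 0 \<le> \<beta>V \<and> (\<forall>x. generator b \<sigma> V x \<le> - \<alpha>V * V x + \<beta>V)"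

section \<open>Bias term\<close>

definition bias_Lambda ::
  "'w measure \<Rightarrow> (real^'d \<Rightarrow> real^'d) \<Rightarrow> (real^'d \<Rightarrow> real^'r^'d) \<Rightarrow> (nat \<Rightarrow> real)
    \<Rightarrow> (nat \<Rightarrow> 'w \<Rightarrow> real^'r) \<Rightarrow> (real^'d \<Rightarrow> real) \<Rightarrow> nat \<Rightarrow> real \<Rightarrow> real \<Rightarrow> real^'d \<Rightarrow> real" where
  \<comment> \<open>\<open>bias_Lambda \<dots> k\<close> involves \<open>\<gamma> k\<close> and \<open>U k\<close>: it is the function with subscript \<open>k - 1\<close>.\<close>
  "bias_Lambda M b \<sigma> \<gamma> U \<phi> k t u x =
     (\<integral>\<omega>. trace (third_deriv \<phi> (x + \<gamma> k *\<^sub>R b x + (u * t * sqrt (\<gamma> k)) *\<^sub>R (\<sigma> x *v U k \<omega>)) (\<sigma> x *v U k \<omega>)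
                ** outer (\<sigma> x *v U k \<omega>) (\<sigma> x *v U k \<omega>)) \<partial>M)"

definition bias_E ::
  "'w measure \<Rightarrow> (real^'d \<Rightarrow> real^'d) \<Rightarrow> (real^'d \<Rightarrow> real^'r^'d) \<Rightarrow> (nat \<Rightarrow> real)
    \<Rightarrow> (nat \<Rightarrow> 'w \<Rightarrow> real^'r) \<Rightarrow> (real^'d \<Rightarrow> real) \<Rightarrow> (nat \<Rightarrow> 'w \<Rightarrow> real^'d) \<Rightarrow> nat \<Rightarrow> 'w \<Rightarrow> real" where
  "bias_E M b \<sigma> \<gamma> U \<phi> X n \<omega> =
     1 / sqrt (Gam \<gamma> n) * (\<Sum>k=1..n. \<gamma> k powr (3/2) *
       integral {0..1} (\<lambda>t. (1 - t) * t *
         integral {0..1} (\<lambda>u. bias_Lambda M b \<sigma> \<gamma> U \<phi> k t u (X (k - 1) \<omega>))))"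

definition bias ::
  "'w measure \<Rightarrow> (real^'d \<Rightarrow> real^'d) \<Rightarrow> (real^'d \<Rightarrow> real^'r^'d) \<Rightarrow> (nat \<Rightarrow> real)
    \<Rightarrow> (nat \<Rightarrow> 'w \<Rightarrow> real^'r) \<Rightarrow> (real^'d \<Rightarrow> real) \<Rightarrow> (nat \<Rightarrow> 'w \<Rightarrow> real^'d) \<Rightarrow> real \<Rightarrow> nat \<Rightarrow> 'w \<Rightarrow> real" where
  "bias M b \<sigma> \<gamma> U \<phi> X \<beta> n \<omega> =
     (if \<beta> < 1 then bias_E M b \<sigma> \<gamma> U \<phi> X n \<omega>
      else bias_E M b \<sigma> \<gamma> U \<phi> X n \<omega>
        + 1 / sqrt (Gam \<gamma> n) * (\<Sum>k=1..n. (\<gamma> k)\<^sup>2 *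
            integral {0..1} (\<lambda>t. (1 - t) *
              trace (hess \<phi> (X (k - 1) \<omega> + (t * \<gamma> k) *\<^sub>R b (X (k - 1) \<omega>))
                     ** outer (b (X (k - 1) \<omega>)) (b (X (k - 1) \<omega>)))))
        + 1 / (2 * sqrt (Gam \<gamma> n)) * (\<Sum>k=1..n. \<gamma> k *
            trace ((hess \<phi> (X (k - 1) \<omega> + \<gamma> k *\<^sub>R b (X (k - 1) \<omega>)) - hess \<phi> (X (k - 1) \<omega>))
                   ** diffusion_matrix \<sigma> (X (k - 1) \<omega>))))"

section \<open>The exponent of the deviation bound\<close>

definition bar_c ::
  "(real^'d \<Rightarrow> real) \<Rightarrow> (real^'d \<Rightarrow> real) \<Rightarrow> real \<Rightarrow> real \<Rightarrow> (nat \<Rightarrow> real) \<Rightarrow> nat \<Rightarrow> real" where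
  \<comment> \<open>\<open>m\<close> and \<open>s\<close> stand for the \<open>\<nu>\<close>-mean of \<open>|||\<sigma>|||\<^sup>2\<close> and the supremum of \<open>|||\<sigma>|||\<close>.\<close>
  "bar_c \<phi> \<psi> m s cc n =
     (lip_const \<phi> / lip_const \<psi>) powr (2/3) * m * s powr (- (2/3)) * cc n"

definition Phi :: "(nat \<Rightarrow> real) \<Rightarrow> (nat \<Rightarrow> real) \<Rightarrow> nat \<Rightarrow> real \<Rightarrow> real" where
  "Phi \<gamma> c n a =
     max (a\<^sup>2 * (1 - 2 / (1 + sqrt (1 + 4 * c n ^ 3 * Gam \<gamma> n / a\<^sup>2))))
         (a powr (4/3) * Gam \<gamma> n powr (1/3) * c n *
            max (1 - 2/3 * c n * (Gam \<gamma> n / a\<^sup>2) powr (1/3)) 0)"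

end

theory Submission
  imports Defs
begin

text \<open>
  Write \<open>f (X n) - f (X 0) = mart f n + \<Sum> (transition k f - f) (X (k - 1))\<close>. A Taylor expansion turns
  the compensator of \<open>\<phi>\<close> into the weighted sum of the generator (plus the bias term) up to small remainders,
  and each martingale increment is a Lipschitz function of the innovation with constant
  \<open>sqrt (\<gamma> k) |\<sigma>| [\<phi>]\<close>. Gaussian concentration thus bounds the Laplace transform of the martingale by the
  random bracket \<open>\<Sum> \<gamma> k N(\<sigma>)\<^sup>2\<close>. By the Poisson equation this bracket equals \<open>\<Gamma>\<close> times its mean up to
  the martingale of \<open>\<psi>\<close> and remainders; applying the supermartingale to one combination
  \<open>- a \<phi> - q \<psi>\<close> makes the two \<open>\<psi>\<close>-martingales cancel and leaves
  \<open>q m + p / (p - 1) q\<^sup>2 [\<psi>]\<^sup>2 S\<^sup>2 / 2\<close> with \<open>q = p a\<^sup>2 [\<phi>]\<^sup>2 / 2\<close>. The two branches of \<open>\<Phi>\<close> are the values of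
  the Chernoff exponent at two choices of \<open>(a, p)\<close>: with \<open>p = r / (r - 1)\<close>, \<open>r = sqrt (1 + 4 z)\<close>, and with
  \<open>p = 3/2\<close>. Only deviations \<open>a\<close> up to a multiple of \<open>sqrt \<Gamma>\<close> need sharp constants, so only bounded Laplace
  parameters occur there; beyond that a crude Gaussian bound beats the exponent, which grows like
  \<open>a powr (4/3)\<close>. The remainders are controlled by exponential moments of weighted sums of \<open>V (X k)\<close>.
\<close>

section \<open>Derivatives along lines and Taylor expansions\<close>

text \<open>The range of \<theta> in (a) comes from small deviations. At the level
  \<open>y = a / sqrt \<Gamma>\<close> the Laplace parameter is of order \<open>y\<close> and
  \<open>q\<close> of order \<open>y\<^sup>2\<close>. The remainder of \<psi> enters with factor
  \<open>q\<close>, so the exponent, itself of order \<open>y\<^sup>2 \<Gamma>\<close>, absorbs it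
  as soon as its size is \<open>o(\<Gamma>)\<close>. The remainder of \<phi> enters with a factor of
  order \<open>y\<close> only; near \<open>y = 1 / sqrt \<Gamma>\<close> it has to be
  \<open>o(sqrt \<Gamma>)\<close> if the prefactor is to tend to \<open>1\<close>. One step leaves
  errors of order \<open>\<gamma>\<^sup>2\<close> and
  \<open>\<gamma> powr ((3 + \<beta>) / 2)\<close>, and Cauchy--Schwarz against the weights \<gamma>
  reduces this to summability of \<open>\<gamma> ^ 3\<close> and
  \<open>\<gamma> powr (2 + \<beta>)\<close>, that is to
  \<open>\<theta> > 1 / (2 + \<beta>)\<close>. At equality the errors that escape this criterion are
  those collected in the bias.

  Remainders and martingale are dependent, so convexity splits them with weights \<epsilon> and
  \<open>1 - \<epsilon>\<close>. Estimates then hold for fixed \<epsilon> and large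
  \<open>n\<close>; a diagonal choice of \<epsilon> gives the monotone sequences, and at
  \<open>\<epsilon> = 1/2\<close> the bound is trivial, which settles small
  \<open>n\<close>.\<close>

lemma frechet_derivative_eq_sum_partial:
  fixes f :: "real^'n \<Rightarrow> real"
  assumes "f differentiable at x"
  shows "frechet_derivative f (at x) h = (\<Sum>i\<in>UNIV. h $ i * partial i f x)"
proof -
  interpret linear "frechet_derivative f (at x)"
    using assms by (rule linear_frechet_derivative)
  have "frechet_derivative f (at x) h
      = frechet_derivative f (at x) (\<Sum>i\<in>UNIV. (h $ i) *\<^sub>R axis i 1)"
    by (simp add: basis_expansion scalar_mult_eq_scaleR[symmetric])
  then show ?thesis
    by (simp add: sum scale partial_def)
qed

lemma line_derivative:
  fixes f :: "real^'n \<Rightarrow> real"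
  assumes "\<And>x. f differentiable at x"
  shows "((\<lambda>t. f (y + t *\<^sub>R h)) has_real_derivative
           (\<Sum>i\<in>UNIV. h $ i * partial i f (y + t *\<^sub>R h))) (at t within S)"
proof -
  have 1: "(f has_derivative frechet_derivative f (at (y + t *\<^sub>R h))) (at (y + t *\<^sub>R h))"
    using assms frechet_derivative_works by blast
  have 2: "((\<lambda>t. y + t *\<^sub>R h) has_derivative (\<lambda>s. s *\<^sub>R h)) (at t within S)"
    by (auto intro!: derivative_eq_intros)
  have "((\<lambda>t. f (y + t *\<^sub>R h)) has_derivative
      (\<lambda>s. frechet_derivative f (at (y + t *\<^sub>R h)) (s *\<^sub>R h))) (at t within S)"
    using diff_chain_within[OF 2 has_derivative_at_withinI[OF 1]] by (simp add: o_def)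
  moreover have "frechet_derivative f (at (y + t *\<^sub>R h)) (s *\<^sub>R h)
      = s * (\<Sum>i\<in>UNIV. h $ i * partial i f (y + t *\<^sub>R h))" for s
    by (simp add: frechet_derivative_eq_sum_partial[OF assms] sum_distrib_left mult.assoc)
  ultimately show ?thesis
    by (simp add: has_field_derivative_def mult.commute[of _ "sum _ _"])
qed

lemma inner_mult_vec_eq_sum:
  fixes A :: "real^'n^'n"
  shows "h \<bullet> (A *v h) = (\<Sum>i\<in>UNIV. \<Sum>j\<in>UNIV. A $ i $ j * h $ i * h $ j)"
  by (simp add: inner_vec_def matrix_vector_mult_def sum_distrib_left mult_ac)

text \<open>Translates the traces in the bias term into quadratic forms, the shape in which the
  Taylor formulas below are stated.\<close>

lemma trace_mult_outer:
  fixes A :: "real^'n^'n"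
  shows "trace (A ** outer h h) = h \<bullet> (A *v h)"
  by (simp add: inner_mult_vec_eq_sum trace_def matrix_matrix_mult_def outer_def mult_ac)

lemma Ck_differentiable:
  assumes "Ck k f" "length is < k"
  shows "foldr partial is f differentiable at x"
  using assms by (auto simp: Ck_def)

lemma Ck_continuous:
  assumes "Ck k f" "length is \<le> k"
  shows "continuous_on UNIV (foldr partial is f)"
  using assms by (auto simp: Ck_def)

lemma Ck_line1:
  fixes f :: "real^'n \<Rightarrow> real"
  assumes "Ck k f" "1 \<le> k"
  shows "((\<lambda>t. f (y + t *\<^sub>R h)) has_real_derivative grad f (y + t *\<^sub>R h) \<bullet> h) (at t within S)"
  using line_derivative[of f y h t S] Ck_differentiable[OF assms(1), of "[]"] assms(2)
  by (simp add: grad_def inner_vec_def mult.commute)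

lemma Ck_line2:
  fixes f :: "real^'n \<Rightarrow> real"
  assumes "Ck k f" "2 \<le> k"
  shows "((\<lambda>t. grad f (y + t *\<^sub>R h) \<bullet> h) has_real_derivative
            h \<bullet> (hess f (y + t *\<^sub>R h) *v h)) (at t within S)"
proof -
  have "((\<lambda>t. \<Sum>j\<in>UNIV. partial j f (y + t *\<^sub>R h) * h $ j) has_real_derivative
      (\<Sum>j\<in>UNIV. (\<Sum>i\<in>UNIV. h $ i * partial i (partial j f) (y + t *\<^sub>R h)) * h $ j)) (at t within S)"
    by (intro DERIV_sum DERIV_cmult_right line_derivative)
      (use Ck_differentiable[OF assms(1), of "[j]" for j] assms(2) in auto)
  moreover have "(\<Sum>j\<in>UNIV. (\<Sum>i\<in>UNIV. h $ i * partial i (partial j f) (y + t *\<^sub>R h)) * h $ j)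
     = h \<bullet> (hess f (y + t *\<^sub>R h) *v h)"
    unfolding inner_mult_vec_eq_sum
    by (subst sum.swap) (simp add: hess_def sum_distrib_right sum_distrib_left mult_ac)
  ultimately show ?thesis
    by (simp add: grad_def inner_vec_def)
qed

lemma Ck_line3:
  fixes f :: "real^'n \<Rightarrow> real"
  assumes "Ck k f" "3 \<le> k"
  shows "((\<lambda>t. h \<bullet> (hess f (y + t *\<^sub>R h) *v h)) has_real_derivative
            h \<bullet> (third_deriv f (y + t *\<^sub>R h) h *v h)) (at t within S)"
proof -
  have "((\<lambda>t. \<Sum>i\<in>UNIV. \<Sum>j\<in>UNIV. partial i (partial j f) (y + t *\<^sub>R h) * (h $ i * h $ j)) has_real_derivative
      (\<Sum>i\<in>UNIV. \<Sum>j\<in>UNIV. (\<Sum>l\<in>UNIV. h $ l * partial l (partial i (partial j f)) (y + t *\<^sub>R h)) * (h $ i * h $ j)))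
      (at t within S)"
    by (intro DERIV_sum DERIV_cmult_right line_derivative)
      (use Ck_differentiable[OF assms(1), of "[i, j]" for i j] assms(2) in auto)
  \<comment> \<open>The index \<open>l\<close> created by the last differentiation is the outermost
    partial derivative. Moving its sum to the front matches \<open>third_deriv\<close> by a mere
    renaming of the three indices.\<close>
  moreover have "(\<Sum>i\<in>UNIV. \<Sum>j\<in>UNIV. (\<Sum>l\<in>UNIV. h $ l * partial l (partial i (partial j f)) z) * (h $ i * h $ j))
     = h \<bullet> (third_deriv f z h *v h)" for z
  proof -
    have "(\<Sum>i\<in>UNIV. \<Sum>j\<in>UNIV. (\<Sum>l\<in>UNIV. h $ l * partial l (partial i (partial j f)) z) * (h $ i * h $ j))
       = (\<Sum>i\<in>UNIV. \<Sum>j\<in>UNIV. \<Sum>l\<in>UNIV. h $ l * partial l (partial i (partial j f)) z * h $ i * h $ j)"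
      by (simp add: sum_distrib_right mult.assoc)
    also have "\<dots> = (\<Sum>i\<in>UNIV. \<Sum>l\<in>UNIV. \<Sum>j\<in>UNIV. h $ l * partial l (partial i (partial j f)) z * h $ i * h $ j)"
      by (intro sum.cong refl sum.swap)
    also have "\<dots> = (\<Sum>l\<in>UNIV. \<Sum>i\<in>UNIV. \<Sum>j\<in>UNIV. h $ l * partial l (partial i (partial j f)) z * h $ i * h $ j)"
      by (rule sum.swap)
    finally show ?thesis
      by (simp add: inner_mult_vec_eq_sum third_deriv_def sum_distrib_right sum_distrib_left mult_ac)
  qed
  ultimately show ?thesis
    by (simp add: inner_mult_vec_eq_sum hess_def mult.assoc)
qed

lemma continuous_on_hess:
  fixes f :: "real^'n \<Rightarrow> real"
  assumes "Ck k f" "2 \<le> k"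
  shows "continuous_on UNIV (hess f)"
  unfolding hess_def
  by (intro continuous_on_vec_lambda) (use Ck_continuous[OF assms(1), of "[_,_]"] assms(2) in auto)

lemma continuous_on_grad:
  fixes f :: "real^'n \<Rightarrow> real"
  assumes "Ck k f" "1 \<le> k"
  shows "continuous_on UNIV (grad f)"
  unfolding grad_def
  by (intro continuous_on_vec_lambda) (use Ck_continuous[OF assms(1), of "[_]"] assms(2) in auto)

text \<open>Integration by parts is built into the antiderivative: with
  \<open>g t = f (y + t *\<^sub>R h)\<close>, the function \<open>(1 - t) * g' t + g t\<close> has
  derivative \<open>(1 - t) * g'' t\<close>.\<close>

lemma taylor2:
  fixes f :: "real^'n \<Rightarrow> real"
  assumes "Ck k f" "2 \<le> k"
  shows "((\<lambda>t. (1 - t) * (h \<bullet> (hess f (y + t *\<^sub>R h) *v h))) has_integral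
           f (y + h) - f y - grad f y \<bullet> h) {0..1}"
proof -
  have "((\<lambda>t. (1 - t) * (h \<bullet> (hess f (y + t *\<^sub>R h) *v h))) has_integral
      (\<lambda>t. (1 - t) * (grad f (y + t *\<^sub>R h) \<bullet> h) + f (y + t *\<^sub>R h)) 1
      - (\<lambda>t. (1 - t) * (grad f (y + t *\<^sub>R h) \<bullet> h) + f (y + t *\<^sub>R h)) 0) {0..1}"
    by (rule fundamental_theorem_of_calculus)
      (use assms in \<open>auto simp flip: has_real_derivative_iff_has_vector_derivative
         intro!: derivative_eq_intros Ck_line1 Ck_line2\<close>)
  then show ?thesis by (simp add: algebra_simps)
qed

lemma taylor3_inner:
  fixes f :: "real^'n \<Rightarrow> real"
  assumes "Ck k f" "3 \<le> k"
  shows "((\<lambda>u. t * (h \<bullet> (third_deriv f (y + (u * t) *\<^sub>R h) h *v h))) has_integral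
           h \<bullet> (hess f (y + t *\<^sub>R h) *v h) - h \<bullet> (hess f y *v h)) {0..1}"
proof -
  have "((\<lambda>u. t * (h \<bullet> (third_deriv f (y + (u * t) *\<^sub>R h) h *v h))) has_integral
      (\<lambda>u. h \<bullet> (hess f (y + (u * t) *\<^sub>R h) *v h)) 1 - (\<lambda>u. h \<bullet> (hess f (y + (u * t) *\<^sub>R h) *v h)) 0) {0..1}"
  proof (rule fundamental_theorem_of_calculus)
    fix u :: real assume "u \<in> {0..1}"
    show "((\<lambda>u. h \<bullet> (hess f (y + (u * t) *\<^sub>R h) *v h)) has_vector_derivative
           t * (h \<bullet> (third_deriv f (y + (u * t) *\<^sub>R h) h *v h))) (at u within {0..1})"
      unfolding has_real_derivative_iff_has_vector_derivative[symmetric]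
    proof -
      have "((\<lambda>u. u * t) has_real_derivative t) (at u within {0..1})"
        by (auto intro!: derivative_eq_intros)
      from DERIV_chain2[where f = "\<lambda>t. h \<bullet> (hess f (y + t *\<^sub>R h) *v h)" and g = "\<lambda>u. u * t" and x = u,
          OF Ck_line3[OF assms, of h y "u * t" UNIV] this]
      show "((\<lambda>u. h \<bullet> (hess f (y + (u * t) *\<^sub>R h) *v h)) has_real_derivative
           t * (h \<bullet> (third_deriv f (y + (u * t) *\<^sub>R h) h *v h))) (at u within {0..1})"
        by (simp only: mult.commute)
    qed
  qed auto
  then show ?thesis by simp
qed

text \<open>The nested integral is kept unsimplified because the bias term has this form. Subtract
  from \<open>taylor2\<close> the same integral with the Hessian frozen at \<open>y\<close>, whose
  weight integrates to \<open>1/2\<close>, and write the difference of the Hessian forms as an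
  integral along the segment.\<close>

lemma taylor3:
  fixes f :: "real^'n \<Rightarrow> real"
  assumes "Ck k f" "3 \<le> k"
  shows "f (y + h) - f y - grad f y \<bullet> h - 1/2 * (h \<bullet> (hess f y *v h))
     = integral {0..1} (\<lambda>t. (1 - t) * t *
         integral {0..1} (\<lambda>u. h \<bullet> (third_deriv f (y + (u * t) *\<^sub>R h) h *v h)))"
proof -
  have *: "((\<lambda>t. (1 - t) * (h \<bullet> (hess f y *v h))) has_integral 1/2 * (h \<bullet> (hess f y *v h))) {0..1}"
  proof -
    have "((\<lambda>t. (1 - t) * (h \<bullet> (hess f y *v h))) has_integral
       (\<lambda>t. (t - t^2/2) * (h \<bullet> (hess f y *v h))) 1 - (\<lambda>t. (t - t^2/2) * (h \<bullet> (hess f y *v h))) 0) {0..1}"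
      by (rule fundamental_theorem_of_calculus)
        (auto simp flip: has_real_derivative_iff_has_vector_derivative
           intro!: derivative_eq_intros)
    then show ?thesis by simp
  qed
  have "((\<lambda>t. (1 - t) * (h \<bullet> (hess f (y + t *\<^sub>R h) *v h)) - (1 - t) * (h \<bullet> (hess f y *v h))) has_integral
         f (y + h) - f y - grad f y \<bullet> h - 1/2 * (h \<bullet> (hess f y *v h))) {0..1}"
    using assms by (intro has_integral_diff taylor2[of k] *) auto
  moreover have "(1 - t) * (h \<bullet> (hess f (y + t *\<^sub>R h) *v h)) - (1 - t) * (h \<bullet> (hess f y *v h))
     = (1 - t) * t * integral {0..1} (\<lambda>u. h \<bullet> (third_deriv f (y + (u * t) *\<^sub>R h) h *v h))" for t
  proof -
    have "h \<bullet> (hess f (y + t *\<^sub>R h) *v h) - h \<bullet> (hess f y *v h)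
        = t * integral {0..1} (\<lambda>u. h \<bullet> (third_deriv f (y + (u * t) *\<^sub>R h) h *v h))"
      using integral_unique[OF taylor3_inner[OF assms, of t h y]] by simp
    then show ?thesis
      by (simp only: right_diff_distrib[symmetric] mult.assoc)
  qed
  ultimately show ?thesis
    by (simp add: integral_unique)
qed


section \<open>Uniform bounds for derivatives in the Hoelder class\<close>

lemma lipschitz_of_bounded_grad:
  fixes f :: "real^'n \<Rightarrow> real"
  assumes "\<And>x. f differentiable at x" "\<And>x. norm (grad f x) \<le> B"
  shows "\<bar>f x - f y\<bar> \<le> B * norm (x - y)"
proof -
  have "norm (f x - f y) \<le> B * norm (x - y)"
  proof (rule differentiable_bound[of UNIV])
    fix z show "(f has_derivative frechet_derivative f (at z)) (at z within UNIV)"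
      using assms(1) frechet_derivative_works by blast
    show "onorm (frechet_derivative f (at z)) \<le> B"
    proof (rule onorm_le)
      fix h
      have "norm (frechet_derivative f (at z) h) = \<bar>grad f z \<bullet> h\<bar>"
        by (simp add: frechet_derivative_eq_sum_partial[OF assms(1)] grad_def inner_vec_def mult.commute)
      also have "\<dots> \<le> norm (grad f z) * norm h"
        by (rule Cauchy_Schwarz_ineq2)
      finally show "norm (frechet_derivative f (at z) h) \<le> B * norm h"
        using mult_right_mono[OF assms(2) norm_ge_zero[of h]] by (meson order_trans)
    qed
  qed auto
  then show ?thesis by simp
qed

lemma abs_quadratic_form_le:
  fixes A :: "real^'n^'n"
  assumes "\<And>i j. \<bar>A $ i $ j\<bar> \<le> B"
  shows "\<bar>h \<bullet> (A *v h)\<bar> \<le> real CARD('n) ^ 2 * B * (norm h)\<^sup>2"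
proof -
  have B: "0 \<le> B" using assms[of undefined undefined] by linarith
  have "\<bar>h \<bullet> (A *v h)\<bar> \<le> (\<Sum>i\<in>UNIV. \<Sum>j\<in>UNIV. \<bar>A $ i $ j * h $ i * h $ j\<bar>)"
    unfolding inner_mult_vec_eq_sum by (intro order_trans[OF sum_abs] sum_mono) simp
  also have "\<dots> \<le> (\<Sum>i\<in>(UNIV::'n set). \<Sum>j\<in>(UNIV::'n set). B * norm h * norm h)"
    unfolding abs_mult using component_le_norm_cart[of h] assms B
    by (intro sum_mono mult_mono) auto
  finally show ?thesis
    by (simp add: power2_eq_square mult_ac)
qed

lemma Ck_hoelderD:
  assumes "Ck_hoelder k \<beta> f"
  shows "Ck k f"
    and "1 \<le> length is \<Longrightarrow> length is \<le> k \<Longrightarrow> \<exists>B. \<forall>x. \<bar>foldr partial is f x\<bar> \<le> B"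
    and "length is = k \<Longrightarrow>
      \<exists>L. \<forall>x y. \<bar>foldr partial is f x - foldr partial is f y\<bar> \<le> L * dist x y powr \<beta>"
  using assms by (auto simp: Ck_hoelder_def bounded_iff)

text \<open>One constant for finitely many indices, obtained by summing absolute values. The weight
  \<open>g\<close> lets the same lemma serve plain bounds, with \<open>g = 1\<close>, and Lipschitz
  or Hoelder bounds, where \<open>g\<close> is a power of the distance.\<close>

lemma uniform_bound2:
  fixes P :: "'i::finite \<Rightarrow> 'j::finite \<Rightarrow> 'b \<Rightarrow> real"
  assumes "\<And>i j. \<exists>B. \<forall>x. P i j x \<le> B * g x" "\<And>x. 0 \<le> g x"
  shows "\<exists>B\<ge>0. \<forall>i j x. P i j x \<le> B * g x"
proof -
  obtain B where B: "\<And>i j x. P i j x \<le> B i j * g x" using assms by metis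
  define C where "C = (\<Sum>i\<in>UNIV. \<Sum>j\<in>UNIV. \<bar>B i j\<bar>)"
  have "B i j \<le> C" for i j
  proof -
    have "B i j \<le> \<bar>B i j\<bar>" by simp
    also have "\<dots> \<le> (\<Sum>j\<in>UNIV. \<bar>B i j\<bar>)" by (rule member_le_sum) auto
    also have "\<dots> \<le> C" unfolding C_def
      by (rule member_le_sum) (auto intro: sum_nonneg)
    finally show ?thesis .
  qed
  then have "P i j x \<le> C * g x" for i j x
    using B[of i j x] assms(2)[of x] by (meson mult_right_mono order_trans)
  moreover have "0 \<le> C" by (auto simp: C_def intro!: sum_nonneg)
  ultimately show ?thesis by blast
qed

lemma Ck_hoelder_grad_bounded:
  fixes f :: "real^'n \<Rightarrow> real"
  assumes "Ck_hoelder 3 \<beta> f"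
  obtains B where "0 \<le> B" "\<And>x. norm (grad f x) \<le> B"
proof -
  \<comment> \<open>The index \<open>j\<close> of type \<open>unit\<close> is a dummy that turns the
    two-index lemma into a one-index one.\<close>
  have "\<exists>B\<ge>0. \<forall>i (j::unit) x. \<bar>partial i f x\<bar> \<le> B * 1"
    using Ck_hoelderD(2)[OF assms, of "[_]"] by (intro uniform_bound2) simp_all
  then obtain B where B: "0 \<le> B" "\<And>i x. \<bar>partial i f x\<bar> \<le> B" by auto
  have "norm (grad f x) \<le> real CARD('n) * B" for x
  proof -
    have "norm (grad f x) \<le> (\<Sum>i\<in>UNIV. \<bar>grad f x $ i\<bar>)" by (rule norm_le_l1_cart)
    also have "\<dots> \<le> (\<Sum>i\<in>(UNIV::'n set). B)" by (intro sum_mono) (simp add: grad_def B)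
    finally show ?thesis by simp
  qed
  with B(1) show ?thesis by (intro that[of "real CARD('n) * B"]) auto
qed

lemma Ck_hoelder_hess_bounded:
  fixes f :: "real^'n \<Rightarrow> real"
  assumes "Ck_hoelder 3 \<beta> f"
  obtains B where "0 \<le> B" "\<And>x h. \<bar>h \<bullet> (hess f x *v h)\<bar> \<le> B * (norm h)\<^sup>2"
proof -
  have "\<exists>B\<ge>0. \<forall>i j x. \<bar>partial i (partial j f) x\<bar> \<le> B * 1"
    using Ck_hoelderD(2)[OF assms, of "[_,_]"] by (intro uniform_bound2) simp_all
  then obtain B where B: "0 \<le> B" "\<And>i j x. \<bar>partial i (partial j f) x\<bar> \<le> B" by auto
  have "\<bar>h \<bullet> (hess f x *v h)\<bar> \<le> real CARD('n) ^ 2 * B * (norm h)\<^sup>2" for x h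
    by (rule abs_quadratic_form_le) (simp add: hess_def B)
  then show ?thesis using B(1) by (intro that[of "real CARD('n) ^ 2 * B"]) auto
qed

lemma Ck_hoelder_hess_lipschitz:
  fixes f :: "real^'n \<Rightarrow> real"
  assumes "Ck_hoelder 3 \<beta> f"
  obtains B where "0 \<le> B"
    "\<And>x y h. \<bar>h \<bullet> ((hess f x - hess f y) *v h)\<bar> \<le> B * norm (x - y) * (norm h)\<^sup>2"
proof -
  have "\<exists>B. \<forall>p. \<bar>partial i (partial j f) (fst p) - partial i (partial j f) (snd p)\<bar> \<le> B * norm (fst p - snd p)"
    for i j
  proof -
    have "\<exists>B\<ge>0. \<forall>l (k::unit) x. \<bar>partial l (partial i (partial j f)) x\<bar> \<le> B * 1"
      using Ck_hoelderD(2)[OF assms, of "[_,i,j]"] by (intro uniform_bound2) simp_all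
    then obtain B where B: "0 \<le> B" "\<And>l x. \<bar>partial l (partial i (partial j f)) x\<bar> \<le> B" by auto
    have "norm (grad (partial i (partial j f)) x) \<le> real CARD('n) * B" for x
    proof -
      have "norm (grad (partial i (partial j f)) x) \<le> (\<Sum>l\<in>UNIV. \<bar>grad (partial i (partial j f)) x $ l\<bar>)"
        by (rule norm_le_l1_cart)
      also have "\<dots> \<le> (\<Sum>i\<in>(UNIV::'n set). B)" by (intro sum_mono) (simp add: grad_def B)
      finally show ?thesis by simp
    qed
    then show ?thesis
      using Ck_differentiable[OF Ck_hoelderD(1)[OF assms], of "[i,j]"]
        lipschitz_of_bounded_grad[of "partial i (partial j f)" "real CARD('n) * B"] by auto
  qed
  then have "\<exists>B\<ge>0. \<forall>i j p. \<bar>partial i (partial j f) (fst p) - partial i (partial j f) (snd p)\<bar> \<le> B * norm (fst p - snd p)"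
    by (intro uniform_bound2) auto
  then obtain B where B: "0 \<le> B"
    "\<And>i j x y. \<bar>partial i (partial j f) x - partial i (partial j f) y\<bar> \<le> B * norm (x - y)" by auto
  have "\<bar>h \<bullet> ((hess f x - hess f y) *v h)\<bar> \<le> real CARD('n) ^ 2 * (B * norm (x - y)) * (norm h)\<^sup>2" for x y h
    by (rule abs_quadratic_form_le) (simp add: hess_def B)
  then show ?thesis using B(1) by (intro that[of "real CARD('n) ^ 2 * B"]) (auto simp: mult_ac)
qed

text \<open>The factor \<open>c\<close> merges two uses: \<open>c = 0\<close> yields boundedness of
  the cubic form, \<open>c = 1\<close> its Hoelder continuity.\<close>

lemma third_deriv_form_bound:
  fixes f :: "real^'n \<Rightarrow> real"
  assumes "\<And>i j l. \<bar>partial i (partial j (partial l f)) x - c * partial i (partial j (partial l f)) y\<bar> \<le> B"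
  shows "\<bar>h \<bullet> (third_deriv f x h *v h) - c * (h \<bullet> (third_deriv f y h *v h))\<bar>
    \<le> real CARD('n) ^ 3 * B * norm h ^ 3"
proof -
  have B: "0 \<le> B" using assms[of undefined undefined undefined] by linarith
  have "\<bar>(third_deriv f x h - c *\<^sub>R third_deriv f y h) $ i $ j\<bar> \<le> real CARD('n) * (B * norm h)" for i j
  proof -
    have "(third_deriv f x h - c *\<^sub>R third_deriv f y h) $ i $ j
      = (\<Sum>l\<in>UNIV. (partial i (partial j (partial l f)) x - c * partial i (partial j (partial l f)) y) * h $ l)"
      by (simp add: third_deriv_def sum_distrib_left sum_subtractf left_diff_distrib mult.assoc)
    also have "\<bar>\<dots>\<bar> \<le> (\<Sum>l\<in>(UNIV::'n set). B * norm h)"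
      by (intro order_trans[OF sum_abs] sum_mono)
        (auto simp: abs_mult intro!: mult_mono assms component_le_norm_cart B)
    finally show ?thesis by simp
  qed
  from abs_quadratic_form_le[OF this, of h] show ?thesis
    by (simp add: matrix_vector_mult_diff_rdistrib scaleR_matrix_vector_assoc[symmetric] inner_diff_right
        power2_eq_square power3_eq_cube mult_ac)
qed

lemma uniform_bound3:
  fixes P :: "'i::finite \<Rightarrow> 'j::finite \<Rightarrow> 'k::finite \<Rightarrow> 'b \<Rightarrow> real"
  assumes "\<And>i j l. \<exists>B. \<forall>x. P i j l x \<le> B * g x" "\<And>x. 0 \<le> g x"
  shows "\<exists>B\<ge>0. \<forall>i j l x. P i j l x \<le> B * g x"
proof -
  have "\<exists>B\<ge>0. \<forall>i jl x. P i (fst jl) (snd jl) x \<le> B * g x"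
    using assms by (intro uniform_bound2) auto
  then show ?thesis by auto
qed

lemma Ck_hoelder_third_bounded:
  fixes f :: "real^'n \<Rightarrow> real"
  assumes "Ck_hoelder 3 \<beta> f"
  obtains B where "0 \<le> B" "\<And>x h. \<bar>h \<bullet> (third_deriv f x h *v h)\<bar> \<le> B * norm h ^ 3"
proof -
  have "\<exists>B\<ge>0. \<forall>i j l x. \<bar>partial i (partial j (partial l f)) x\<bar> \<le> B * 1"
    using Ck_hoelderD(2)[OF assms, of "[_,_,_]"] by (intro uniform_bound3) simp_all
  then obtain B where B: "0 \<le> B" "\<And>i j l x. \<bar>partial i (partial j (partial l f)) x\<bar> \<le> B" by auto
  have "\<bar>h \<bullet> (third_deriv f x h *v h)\<bar> \<le> real CARD('n) ^ 3 * B * norm h ^ 3" for x h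
    using third_deriv_form_bound[of f x 0 x B h] B by simp
  then show ?thesis using B(1) by (intro that[of "real CARD('n) ^ 3 * B"]) auto
qed

lemma Ck_hoelder_third_hoelder:
  fixes f :: "real^'n \<Rightarrow> real"
  assumes "Ck_hoelder 3 \<beta> f"
  obtains B where "0 \<le> B"
    "\<And>x y h. \<bar>h \<bullet> (third_deriv f x h *v h) - h \<bullet> (third_deriv f y h *v h)\<bar>
       \<le> B * norm (x - y) powr \<beta> * norm h ^ 3"
proof -
  have "\<exists>B\<ge>0. \<forall>i j l p. \<bar>partial i (partial j (partial l f)) (fst p) - partial i (partial j (partial l f)) (snd p)\<bar>
      \<le> B * norm (fst p - snd p) powr \<beta>"
  proof (intro uniform_bound3)
    fix i j l
    show "\<exists>B. \<forall>p. \<bar>partial i (partial j (partial l f)) (fst p) - partial i (partial j (partial l f)) (snd p)\<bar>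
      \<le> B * norm (fst p - snd p) powr \<beta>"
      using Ck_hoelderD(3)[OF assms, of "[i,j,l]"] by (auto simp: dist_norm)
  qed auto
  then obtain B where B: "0 \<le> B"
    "\<And>i j l x y. \<bar>partial i (partial j (partial l f)) x - partial i (partial j (partial l f)) y\<bar>
      \<le> B * norm (x - y) powr \<beta>" by auto
  have "\<bar>h \<bullet> (third_deriv f x h *v h) - h \<bullet> (third_deriv f y h *v h)\<bar>
      \<le> real CARD('n) ^ 3 * (B * norm (x - y) powr \<beta>) * norm h ^ 3" for x y h
    using third_deriv_form_bound[of f x 1 y _ h] B(2) by simp
  then show ?thesis using B(1) by (intro that[of "real CARD('n) ^ 3 * B"]) (auto simp: mult_ac)
qed

section \<open>Lipschitz constants and matrix norms\<close>

lemma lip_const_bound: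
  fixes f :: "real^'n \<Rightarrow> real"
  assumes "L-lipschitz_on UNIV f"
  shows "0 \<le> lip_const f" "\<bar>f x - f y\<bar> \<le> lip_const f * norm (x - y)"
proof -
  have *: "\<bar>f x - f y\<bar> / dist x y \<le> lip_const f" if "x \<noteq> y" for x y
    unfolding lip_const_def
  proof (rule cSUP_upper2[where x = "(x, y)"])
    have "\<bar>f x - f y\<bar> / dist x y \<le> L" if "x \<noteq> y" for x y
      using lipschitz_onD[OF assms, of x y] that by (simp add: dist_real_def field_simps)
    then show "bdd_above ((\<lambda>p. \<bar>f (fst p) - f (snd p)\<bar> / dist (fst p) (snd p)) ` {(x, y). x \<noteq> y})"
      by (auto intro!: bdd_aboveI[of _ L])
  qed (use that in auto)
  \<comment> \<open>A nonzero vector shows that the supremum runs over a nonempty set; its value is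
    then at least one of the nonnegative quotients.\<close>
  obtain z where "z \<noteq> (0::real^'n)" using axis_eq_0_iff[of undefined "1::real"] by blast
  from *[OF this] show "0 \<le> lip_const f"
    by (meson abs_ge_zero divide_nonneg_nonneg order_trans zero_le_dist)
  show "\<bar>f x - f y\<bar> \<le> lip_const f * norm (x - y)"
    using *[of x y] by (cases "x = y") (auto simp: dist_norm field_simps)
qed

lemma lip_const_le:
  fixes f :: "real^'n \<Rightarrow> real"
  assumes "\<And>x y. \<bar>f x - f y\<bar> \<le> B * norm (x - y)"
  shows "lip_const f \<le> B"
  unfolding lip_const_def
proof (rule cSUP_least)
  obtain z where "z \<noteq> (0::real^'n)" using axis_eq_0_iff[of undefined "1::real"] by blast
  then show "{(x, y). x \<noteq> (y::real^'n)} \<noteq> {}" by blast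
qed (use assms in \<open>auto simp: dist_norm field_simps\<close>)

lemma norm_mult_vec_le: "norm (A *v x) \<le> op_norm A * norm x"
  unfolding op_norm_def by (rule onorm[OF matrix_vector_mul_bounded_linear])

lemma op_norm_nonneg: "0 \<le> op_norm A"
  unfolding op_norm_def by (rule onorm_pos_le[OF matrix_vector_mul_bounded_linear])

lemma matrix_norm_sum:
  assumes "matrix_norm N" "finite I"
  shows "N (\<Sum>i\<in>I. F i) \<le> (\<Sum>i\<in>I. N (F i))"
  using assms(2)
proof (induction I)
  case empty
  have "N 0 = 0" using assms by (simp add: matrix_norm_def)
  then show ?case by simp
next
  case (insert i I)
  have "N (F i + (\<Sum>i\<in>I. F i)) \<le> N (F i) + N (\<Sum>i\<in>I. F i)"
    using assms(1) by (simp add: matrix_norm_def)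
  with insert show ?case by simp
qed

text \<open>Expansion in matrix units compares \<open>N\<close> with the Euclidean norm. Two
  consequences are used: \<open>N\<close> is continuous, so \<open>N (\<sigma> x)\<close> is
  measurable in \<open>x\<close>, and \<open>N (\<sigma> x)\<close> has a finite supremum.\<close>

lemma matrix_norm_le_norm:
  fixes N :: "real^'m^'n \<Rightarrow> real"
  assumes "matrix_norm N"
  obtains C where "0 \<le> C" "\<And>A. N A \<le> C * norm A"
proof -
  define E :: "'n \<Rightarrow> 'm \<Rightarrow> real^'m^'n" where "E i j = axis i (axis j 1)" for i j
  define C where "C = (\<Sum>i\<in>UNIV. \<Sum>j\<in>UNIV. N (E i j))"
  have "N A \<le> C * norm A" for A
  proof -
    have "A = (\<Sum>i\<in>UNIV. \<Sum>j\<in>UNIV. (A $ i $ j) *\<^sub>R E i j)"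
    proof -
      have "(\<Sum>j\<in>UNIV. A $ i $ j * E i j $ k $ l) = (if i = k then A $ i $ l else 0)" for i k l
      proof -
        have "A $ i $ j * E i j $ k $ l = (if l = j then if i = k then A $ i $ j else 0 else 0)" for j
          by (simp add: E_def axis_def)
        then show ?thesis by simp
      qed
      then show ?thesis by (simp add: vec_eq_iff)
    qed
    then have "N A = N (\<Sum>i\<in>UNIV. \<Sum>j\<in>UNIV. (A $ i $ j) *\<^sub>R E i j)" by simp
    also have "\<dots> \<le> (\<Sum>i\<in>UNIV. N (\<Sum>j\<in>UNIV. (A $ i $ j) *\<^sub>R E i j))"
      by (rule matrix_norm_sum[OF assms]) simp
    also have "\<dots> \<le> (\<Sum>i\<in>UNIV. \<Sum>j\<in>UNIV. N ((A $ i $ j) *\<^sub>R E i j))"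
      by (intro sum_mono matrix_norm_sum[OF assms]) simp
    also have "\<dots> \<le> (\<Sum>i\<in>UNIV. \<Sum>j\<in>UNIV. norm A * N (E i j))"
    proof (intro sum_mono)
      fix i j
      have "\<bar>A $ i $ j\<bar> \<le> norm A"
        using component_le_norm_cart[of "A $ i" j] Finite_Cartesian_Product.norm_nth_le[of A i] by simp
      then show "N ((A $ i $ j) *\<^sub>R E i j) \<le> norm A * N (E i j)"
        using assms by (simp add: matrix_norm_def mult_right_mono)
    qed
    finally show ?thesis by (simp add: C_def sum_distrib_left sum_distrib_right mult_ac)
  qed
  moreover have "0 \<le> C" using assms by (auto simp: C_def matrix_norm_def intro!: sum_nonneg)
  ultimately show ?thesis by (rule that[rotated])
qed

lemma matrix_norm_continuous:
  fixes N :: "real^'m^'n \<Rightarrow> real"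
  assumes "matrix_norm N"
  shows "continuous_on UNIV N"
proof -
  obtain C where C: "0 \<le> C" "\<And>A. N A \<le> C * norm A"
    using matrix_norm_le_norm[OF assms] by blast
  have le: "N A - N B \<le> C * norm (A - B)" for A B
  proof -
    have "N A \<le> N (A - B) + N B"
      using assms by (metis diff_add_cancel matrix_norm_def)
    then show ?thesis using C(2)[of "A - B"] by simp
  qed
  have "C-lipschitz_on UNIV N"
  proof (rule lipschitz_onI)
    fix A B
    show "dist (N A) (N B) \<le> C * dist A B"
      using le[of A B] le[of B A] by (simp add: dist_real_def dist_norm abs_le_iff norm_minus_commute)
  qed (fact C(1))
  then show ?thesis by (rule lipschitz_on_continuous_on)
qed

text \<open>(C2) bounds \<sigma> in the operator norm, and \<open>N\<close> is only assumed to
  dominate that norm. Boundedness of \<open>N (\<sigma> x)\<close> therefore passes through the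
  Euclidean norm, which this inequality controls.\<close>

lemma norm_matrix_le_op_norm:
  fixes A :: "real^'m^'n"
  shows "norm A \<le> real CARD('m) * real CARD('n) * op_norm A"
proof -
  have "\<bar>A $ i $ j\<bar> \<le> op_norm A" for i j
  proof -
    have "A $ i $ j = (A *v axis j 1) $ i" by (simp add: matrix_vector_mul_component inner_axis)
    also have "\<bar>\<dots>\<bar> \<le> norm (A *v axis j 1)" by (rule component_le_norm_cart)
    also have "\<dots> \<le> op_norm A * norm (axis j 1 :: real^'m)" by (rule norm_mult_vec_le)
    finally show ?thesis by simp
  qed
  then have "norm (A $ i) \<le> real CARD('m) * op_norm A" for i
    using sum_bounded_above[of UNIV "\<lambda>j. \<bar>A $ i $ j\<bar>" "op_norm A"] norm_le_l1_cart[of "A $ i"]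
    by (meson order_trans UNIV_I)
  then have "(\<Sum>i\<in>UNIV. norm (A $ i)) \<le> real CARD('n) * (real CARD('m) * op_norm A)"
    using sum_bounded_above[of UNIV "\<lambda>i. norm (A $ i)" "real CARD('m) * op_norm A"] by simp
  moreover have "norm A \<le> (\<Sum>i\<in>UNIV. norm (A $ i))"
    unfolding norm_vec_def by (rule L2_set_le_sum) auto
  ultimately show ?thesis by (simp add: mult_ac)
qed

section \<open>Independence of the innovations\<close>

lemma measurable_fst_borel: "fst \<in> borel_measurable borel"
  by (intro borel_measurable_continuous_onI continuous_intros)

lemma measurable_snd_borel: "snd \<in> borel_measurable borel"
  by (intro borel_measurable_continuous_onI continuous_intros)

locale innovations = prob_space M for M :: "'w measure" +
  fixes X0 :: "'w \<Rightarrow> real^'d" and U :: "nat \<Rightarrow> 'w \<Rightarrow> real^'r"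
  assumes X0_measurable: "X0 \<in> borel_measurable M"
    and indep_U: "indep_vars (\<lambda>_. borel) U {1..}"
    and distr_U: "\<And>n. 1 \<le> n \<Longrightarrow> distr M borel (U n) = distr M borel (U 1)"
    and concentration: "gaussian_concentration M X0 U"
begin

definition mu :: "(real^'r) measure" where "mu = distr M borel (U 1)"

lemma U_measurable: "1 \<le> n \<Longrightarrow> U n \<in> borel_measurable M"
  using indep_U by (auto simp: indep_vars_def)

lemma sets_mu [measurable_cong, simp]: "sets mu = sets borel"
  by (simp add: mu_def)

lemma space_mu [simp]: "space mu = UNIV"
  by (simp add: mu_def)

sublocale mu: prob_space mu
  unfolding mu_def by (rule prob_space_distr) (simp add: U_measurable)

text \<open>The initial value and the innovations live in different types; putting them into one
  product type makes the whole noise a single independent family.\<close>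

definition noise :: "nat \<Rightarrow> 'w \<Rightarrow> (real^'d) \<times> (real^'r)" where
  "noise n \<omega> = (if n = 0 then (X0 \<omega>, 0) else (0, U n \<omega>))"

definition history :: "nat \<Rightarrow> 'w measure" where
  "history n = vimage_algebra (space M) (\<lambda>\<omega>. \<lambda>i\<in>{..n}. noise i \<omega>) (Pi\<^sub>M {..n} (\<lambda>_. borel))"

lemma noise_measurable: "noise n \<in> borel_measurable M"
  using X0_measurable U_measurable[of n] by (cases "n = 0") (simp_all add: noise_def[abs_def])

text \<open>The hypotheses give independence of the innovations among themselves and of
  \<open>X0\<close> from their whole sequence. In a finite intersection the factor with index
  \<open>0\<close> is split off; the others lie in the sigma-algebra of the sequence, so the second
  hypothesis separates the two groups and the first one factorises the rest.\<close>

lemma indep_noise: "indep_vars (\<lambda>_. borel) noise UNIV"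
  unfolding indep_vars_def2
proof (intro conjI ballI)
  let ?F = "\<lambda>i. {noise i -` A \<inter> space M |A. A \<in> sets borel}"
  let ?G = "\<lambda>i. {U i -` A \<inter> space M |A. A \<in> sets borel}"
  let ?S = "vimage_algebra (space M) (\<lambda>\<omega>. \<lambda>n\<in>{1..}. U n \<omega>) (\<Pi>\<^sub>M n\<in>{1..}. borel)"
  have FG: "?F i \<subseteq> ?G i" if "1 \<le> i" for i
  proof
    fix E assume "E \<in> ?F i"
    then obtain B where B: "B \<in> sets borel" "E = noise i -` B \<inter> space M" by auto
    have "(\<lambda>u::real^'r. (0::real^'d, u)) \<in> borel_measurable borel" by measurable
    from measurable_sets[OF this B(1)]
    have "(\<lambda>u. (0, u)) -` B \<in> sets borel" by simp
    moreover have "E = U i -` ((\<lambda>u. (0, u)) -` B) \<inter> space M"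
      using that by (auto simp: B noise_def)
    ultimately show "E \<in> ?G i" by blast
  qed
  have GS: "?G i \<subseteq> sets ?S" if "1 \<le> i" for i
  proof
    fix E assume "E \<in> ?G i"
    then obtain B where B: "B \<in> sets borel" "E = U i -` B \<inter> space M" by auto
    have "(\<lambda>\<omega>. \<lambda>n\<in>{1..}. U n \<omega>) \<in> ?S \<rightarrow>\<^sub>M (\<Pi>\<^sub>M n\<in>{1..}. borel)"
      by (rule measurable_vimage_algebra1) (auto simp: space_PiM)
    from measurable_compose[OF this measurable_component_singleton[of i]]
    have "(\<lambda>\<omega>. (\<lambda>n\<in>{1..}. U n \<omega>) i) \<in> ?S \<rightarrow>\<^sub>M borel" using that by simp
    then have "U i \<in> ?S \<rightarrow>\<^sub>M borel" using that by simp
    from measurable_sets[OF this B(1)] show "E \<in> sets ?S" by (simp add: B)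
  qed
  show "indep_sets ?F UNIV"
  proof (rule indep_setsI)
    fix i show "?F i \<subseteq> events" using measurable_sets[OF noise_measurable] by auto
  next
    fix A J assume J: "J \<noteq> {}" "J \<subseteq> UNIV" "finite J" and A: "\<forall>j\<in>J. A j \<in> ?F j"
    let ?J = "J - {0}"
    have J': "prob (\<Inter>j\<in>?J. A j) = (\<Prod>j\<in>?J. prob (A j))" if "?J \<noteq> {}"
    proof (rule indep_setsD)
      show "indep_sets ?G {1..}" using indep_U by (simp add: indep_vars_def2)
      show "\<forall>j\<in>?J. A j \<in> ?G j"
      proof
        fix j assume "j \<in> ?J"
        then show "A j \<in> ?G j" using A by (intro subsetD[OF FG[of j]]) auto
      qed
    qed (use J that in auto)
    show "prob (\<Inter>j\<in>J. A j) = (\<Prod>j\<in>J. prob (A j))"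
    proof (cases "0 \<in> J \<and> ?J \<noteq> {}")
      case False
      then have "J = {0} \<or> J = ?J" using J by auto
      then show ?thesis
      proof
        assume "J = {0}" then show ?thesis by simp
      next
        assume "J = ?J" then show ?thesis using J' J(1) by simp
      qed
    next
      case True
      have "(\<Inter>j\<in>?J. A j) \<in> sets ?S"
      proof (rule sets.finite_INT)
        fix j assume "j \<in> ?J"
        then show "A j \<in> sets ?S" using A
          by (intro subsetD[OF GS[of j]] subsetD[OF FG[of j]]) auto
      qed (use J True in auto)
      moreover have "A 0 \<in> sets (vimage_algebra (space M) X0 borel)"
      proof -
        obtain B where B: "B \<in> sets borel" "A 0 = noise 0 -` B \<inter> space M" using A True by blast
        have "(\<lambda>u::real^'d. (u, 0::real^'r)) \<in> borel_measurable borel" by measurable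
        from measurable_sets[OF this B(1)]
        have "(\<lambda>u. (u, 0)) -` B \<in> sets borel" by simp
        moreover have "A 0 = X0 -` ((\<lambda>u. (u, 0)) -` B) \<inter> space M"
          by (auto simp: B noise_def)
        ultimately show ?thesis by (auto simp: sets_vimage_algebra)
      qed
      ultimately have "prob ((\<Inter>j\<in>?J. A j) \<inter> A 0) = prob (\<Inter>j\<in>?J. A j) * prob (A 0)"
        using concentration by (intro indep_setD) (auto simp: gaussian_concentration_def)
      moreover have "(\<Inter>j\<in>J. A j) = (\<Inter>j\<in>?J. A j) \<inter> A 0" using True by auto
      moreover have "(\<Prod>j\<in>J. prob (A j)) = prob (A 0) * (\<Prod>j\<in>?J. prob (A j))"
        using True J by (intro prod.remove) auto
      ultimately show ?thesis using J' True by simp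
    qed
  qed
qed (use noise_measurable in auto)

lemma history_measurable: "Z \<in> history n \<rightarrow>\<^sub>M N \<Longrightarrow> Z \<in> M \<rightarrow>\<^sub>M N"
proof -
  assume Z: "Z \<in> history n \<rightarrow>\<^sub>M N"
  have "id \<in> M \<rightarrow>\<^sub>M history n" unfolding history_def
    using noise_measurable
    by (intro measurable_vimage_algebra2) (auto intro!: measurable_restrict)
  from measurable_compose[OF this Z] show ?thesis by simp
qed

lemma noise_history: "i \<le> n \<Longrightarrow> noise i \<in> borel_measurable (history n)"
proof -
  assume i: "i \<le> n"
  have "(\<lambda>\<omega>. \<lambda>i\<in>{..n}. noise i \<omega>) \<in> history n \<rightarrow>\<^sub>M Pi\<^sub>M {..n} (\<lambda>_. borel)"
    unfolding history_def by (rule measurable_vimage_algebra1) (auto simp: space_PiM)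
  from measurable_compose[OF this measurable_component_singleton[of i]] i
  show ?thesis by simp
qed

lemma X0_history: "X0 \<in> borel_measurable (history n)"
  using measurable_compose[OF noise_history[of 0 n] measurable_fst_borel] by (simp add: noise_def)

lemma U_history: "1 \<le> i \<Longrightarrow> i \<le> n \<Longrightarrow> U i \<in> borel_measurable (history n)"
  using measurable_compose[OF noise_history[of i n] measurable_snd_borel] by (simp add: noise_def)

lemma prob_history_Int:
  assumes E: "E \<in> sets (history n)" and B: "B \<in> sets borel"
  shows "prob (E \<inter> (U (Suc n) -` B \<inter> space M)) = prob E * prob (U (Suc n) -` B \<inter> space M)"
proof -
  let ?P = "Pi\<^sub>M {Suc n} (\<lambda>_. borel :: ((real^'d) \<times> (real^'r)) measure)"
  let ?h = "\<lambda>\<omega>. \<lambda>i\<in>{Suc n}. noise i \<omega>"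
  have "indep_var (Pi\<^sub>M {..n} (\<lambda>_. borel)) (\<lambda>\<omega>. restrict (\<lambda>i. noise i \<omega>) {..n}) ?P ?h"
    by (rule indep_var_restrict[OF indep_noise]) auto
  then have "indep_set (sets (history n)) (sigma_sets (space M) {?h -` A \<inter> space M |A. A \<in> sets ?P})"
    by (simp add: indep_var_eq history_def sets_vimage_algebra)
  moreover have "U (Suc n) -` B \<inter> space M \<in> sigma_sets (space M) {?h -` A \<inter> space M |A. A \<in> sets ?P}"
  proof (rule sigma_sets.Basic)
    have "(\<lambda>f. snd (f (Suc n))) \<in> ?P \<rightarrow>\<^sub>M borel"
      by (rule measurable_compose[where g = snd and N = borel, OF _ measurable_snd_borel])
        (rule measurable_component_singleton, simp)
    from measurable_sets[OF this B]
    have "(\<lambda>f. snd (f (Suc n))) -` B \<inter> space ?P \<in> sets ?P" .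
    moreover have "U (Suc n) -` B \<inter> space M = ?h -` ((\<lambda>f. snd (f (Suc n))) -` B \<inter> space ?P) \<inter> space M"
      by (auto simp: space_PiM noise_def)
    ultimately show "U (Suc n) -` B \<inter> space M \<in> {?h -` A \<inter> space M |A. A \<in> sets ?P}" by blast
  qed
  ultimately show ?thesis using E by (intro indep_setD)
qed

lemma distr_U_mu: "1 \<le> n \<Longrightarrow> distr M borel (U n) = mu"
  unfolding mu_def by (rule distr_U)

text \<open>The law of the pair is a product because \<open>history n\<close> and the next
  innovation are independent; Tonelli then integrates the innovation with the past frozen. This
  replaces conditional expectations throughout, and nonnegative integrals keep integrability out of
  the inductions.\<close>

lemma nn_integral_history:
  assumes Z: "Z \<in> history n \<rightarrow>\<^sub>M N" and f: "f \<in> borel_measurable (N \<Otimes>\<^sub>M borel)"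
  shows "(\<integral>\<^sup>+\<omega>. f (Z \<omega>, U (Suc n) \<omega>) \<partial>M) = (\<integral>\<^sup>+\<omega>. (\<integral>\<^sup>+u. f (Z \<omega>, u) \<partial>mu) \<partial>M)"
proof -
  have Zm: "Z \<in> M \<rightarrow>\<^sub>M N" by (rule history_measurable[OF Z])
  have Um: "U (Suc n) \<in> borel_measurable M" by (simp add: U_measurable)
  have f': "f \<in> borel_measurable (N \<Otimes>\<^sub>M mu)"
    using f measurable_cong_sets[OF sets_pair_measure_cong[OF refl sets_mu, of N] refl] by blast
  interpret DZ: prob_space "distr M N Z" by (rule prob_space_distr[OF Zm])
  have "(\<integral>\<^sup>+\<omega>. f (Z \<omega>, U (Suc n) \<omega>) \<partial>M) = (\<integral>\<^sup>+p. f p \<partial>distr M (N \<Otimes>\<^sub>M borel) (\<lambda>\<omega>. (Z \<omega>, U (Suc n) \<omega>)))"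
    using f Zm Um by (subst nn_integral_distr) auto
  also have "distr M (N \<Otimes>\<^sub>M borel) (\<lambda>\<omega>. (Z \<omega>, U (Suc n) \<omega>)) = distr M N Z \<Otimes>\<^sub>M mu"
  proof (rule pair_measure_eqI[symmetric])
    fix A B assume A: "A \<in> sets (distr M N Z)" and B: "B \<in> sets mu"
    have E: "Z -` A \<inter> space M \<in> sets (history n)"
      using measurable_sets[OF Z] A by (simp add: history_def)
    have "emeasure (distr M (N \<Otimes>\<^sub>M borel) (\<lambda>\<omega>. (Z \<omega>, U (Suc n) \<omega>))) (A \<times> B)
       = emeasure M ((Z -` A \<inter> space M) \<inter> (U (Suc n) -` B \<inter> space M))"
      using A B Zm Um by (subst emeasure_distr) (auto intro!: arg_cong[where f = "emeasure M"])
    also have "\<dots> = emeasure M (Z -` A \<inter> space M) * emeasure M (U (Suc n) -` B \<inter> space M)"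
      using prob_history_Int[OF E, of B] B by (simp add: emeasure_eq_measure ennreal_mult)
    also have "\<dots> = emeasure (distr M N Z) A * emeasure mu B"
    proof -
      have "emeasure mu B = emeasure (distr M borel (U (Suc n))) B"
        by (rule arg_cong[where f = "\<lambda>m. emeasure m B"]) (rule distr_U_mu[symmetric], simp)
      also have "\<dots> = emeasure M (U (Suc n) -` B \<inter> space M)"
        using B by (intro emeasure_distr Um) simp
      finally show ?thesis using A Zm by (simp add: emeasure_distr)
    qed
    finally show "emeasure (distr M N Z) A * emeasure mu B
       = emeasure (distr M (N \<Otimes>\<^sub>M borel) (\<lambda>\<omega>. (Z \<omega>, U (Suc n) \<omega>))) (A \<times> B)" by simp
  qed (auto intro: DZ.sigma_finite_measure mu.sigma_finite_measure)
  also have "(\<integral>\<^sup>+p. f p \<partial>(distr M N Z \<Otimes>\<^sub>M mu)) = (\<integral>\<^sup>+z. \<integral>\<^sup>+u. f (z, u) \<partial>mu \<partial>distr M N Z)"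
    using f' by (subst mu.nn_integral_fst[symmetric]) auto
  also have "\<dots> = (\<integral>\<^sup>+\<omega>. (\<integral>\<^sup>+u. f (Z \<omega>, u) \<partial>mu) \<partial>M)"
    using Zm mu.borel_measurable_nn_integral_fst[OF f'] by (subst nn_integral_distr) auto
  finally show ?thesis .
qed

text \<open>The conditioning step shared by all inductions over time: the fresh innovation is
  integrated out for each fixed state, and the resulting bound returns to the exponent as a function
  of the past.\<close>

lemma nn_integral_exp_history_le:
  fixes x :: "'w \<Rightarrow> real^'d"
  assumes A: "A \<in> borel_measurable (history n)" and x: "x \<in> borel_measurable (history n)"
    and h [measurable]: "case_prod h \<in> borel_measurable (borel \<Otimes>\<^sub>M borel)"
    and le: "\<And>x. (\<integral>\<^sup>+u. ennreal (exp (h x u)) \<partial>mu) \<le> ennreal (exp (g x))"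
  shows "(\<integral>\<^sup>+\<omega>. ennreal (exp (A \<omega> + h (x \<omega>) (U (Suc n) \<omega>))) \<partial>M)
      \<le> (\<integral>\<^sup>+\<omega>. ennreal (exp (A \<omega> + g (x \<omega>))) \<partial>M)"
proof -
  have Z: "(\<lambda>\<omega>. (A \<omega>, x \<omega>)) \<in> history n \<rightarrow>\<^sub>M (borel \<Otimes>\<^sub>M borel)" using A x by measurable
  have "(\<integral>\<^sup>+\<omega>. ennreal (exp (A \<omega> + h (x \<omega>) (U (Suc n) \<omega>))) \<partial>M)
      = (\<integral>\<^sup>+\<omega>. (\<integral>\<^sup>+u. ennreal (exp (A \<omega> + h (x \<omega>) u)) \<partial>mu) \<partial>M)"
  proof -
    have "(\<lambda>p. ennreal (exp (fst (fst p) + case_prod h (snd (fst p), snd p)))) \<in> borel_measurable ((borel \<Otimes>\<^sub>M borel) \<Otimes>\<^sub>M borel)"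
      by measurable
    from nn_integral_history[OF Z this] show ?thesis by simp
  qed
  also have "\<dots> \<le> (\<integral>\<^sup>+\<omega>. ennreal (exp (A \<omega> + g (x \<omega>))) \<partial>M)"
  proof (intro nn_integral_mono)
    fix \<omega>
    have [measurable]: "h (x \<omega>) \<in> borel_measurable borel"
      using measurable_Pair2[OF h, of "x \<omega>"] by simp
    have "(\<integral>\<^sup>+u. ennreal (exp (A \<omega> + h (x \<omega>) u)) \<partial>mu) = ennreal (exp (A \<omega>)) * (\<integral>\<^sup>+u. ennreal (exp (h (x \<omega>) u)) \<partial>mu)"
      by (simp add: exp_add ennreal_mult nn_integral_cmult)
    also have "\<dots> \<le> ennreal (exp (A \<omega>)) * ennreal (exp (g (x \<omega>)))"
      by (intro mult_left_mono le) auto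
    finally show "(\<integral>\<^sup>+u. ennreal (exp (A \<omega> + h (x \<omega>) u)) \<partial>mu) \<le> ennreal (exp (A \<omega> + g (x \<omega>)))"
      by (simp add: exp_add ennreal_mult)
  qed
  finally show ?thesis .
qed

end

section \<open>Gaussian concentration and moments\<close>

lemma power_le_exp:
  fixes x :: real assumes "0 \<le> x" shows "x ^ k \<le> real k ^ k * exp x"
proof (cases "k = 0")
  case False
  have "x / k \<le> exp (x / k)" using exp_ge_add_one_self[of "x / k"] by linarith
  then have "(x / k) ^ k \<le> exp (x / k) ^ k" using assms by (intro power_mono) auto
  also have "\<dots> = exp x" using False by (simp flip: exp_of_nat_mult)
  finally show ?thesis using False by (simp add: power_divide field_simps)
qed (use assms in simp)

text \<open>Completing the square with \<open>s\<^sup>2 = 1 - 2 * c\<close> turns the integrand into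
  a multiple of the normal density with mean \<open>m / s\<^sup>2\<close> and standard deviation
  \<open>1 / s\<close>.\<close>

lemma nn_integral_gaussian:
  fixes m c :: real assumes "c < 1/2"
  shows "(\<integral>\<^sup>+z. ennreal (exp (m * z + c * z\<^sup>2) * std_normal_density z) \<partial>lborel)
    = ennreal (exp (m\<^sup>2 / (2 * (1 - 2 * c))) / sqrt (1 - 2 * c))"
proof -
  define s where "s = sqrt (1 - 2 * c)"
  have s: "0 < s" "s\<^sup>2 = 1 - 2 * c" using assms by (auto simp: s_def)
  have s': "c = (1 - s\<^sup>2) / 2" using s by simp
  have "exp (m * z + c * z\<^sup>2) * std_normal_density z
      = exp (m\<^sup>2 / (2 * s\<^sup>2)) / s * normal_density (m / s\<^sup>2) (1 / s) z" for z
  proof -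
    have "m * z + c * z\<^sup>2 + (- z\<^sup>2 / 2) = m\<^sup>2 / (2 * s\<^sup>2) + (- (z - m / s\<^sup>2)\<^sup>2 / (2 * (1 / s)\<^sup>2))"
      using s(1) unfolding s' by (simp add: field_simps power2_eq_square)
    then have "exp (m * z + c * z\<^sup>2) * exp (- z\<^sup>2 / 2) = exp (m\<^sup>2 / (2 * s\<^sup>2)) * exp (- (z - m / s\<^sup>2)\<^sup>2 / (2 * (1 / s)\<^sup>2))"
      by (simp only: exp_add[symmetric])
    moreover have "sqrt (2 * pi * (1 / s)\<^sup>2) = sqrt (2 * pi) / s"
      using s(1) by (simp add: real_sqrt_mult real_sqrt_divide power_divide)
    ultimately show ?thesis using s(1)
      by (simp add: std_normal_density_def normal_density_def)
  qed
  then have "(\<integral>\<^sup>+z. ennreal (exp (m * z + c * z\<^sup>2) * std_normal_density z) \<partial>lborel)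
     = (\<integral>\<^sup>+z. ennreal (exp (m\<^sup>2 / (2 * s\<^sup>2)) / s) * ennreal (normal_density (m / s\<^sup>2) (1 / s) z) \<partial>lborel)"
    using s(1) by (simp flip: ennreal_mult)
  also have "\<dots> = ennreal (exp (m\<^sup>2 / (2 * s\<^sup>2)) / s) * (\<integral>\<^sup>+z. ennreal (normal_density (m / s\<^sup>2) (1 / s) z) \<partial>lborel)"
    by (rule nn_integral_cmult) simp
  also have "(\<integral>\<^sup>+z. ennreal (normal_density (m / s\<^sup>2) (1 / s) z) \<partial>lborel) = 1"
    using s(1) by (subst nn_integral_eq_integral) auto
  finally show ?thesis using s by (simp add: s_def)
qed

section \<open>Concentration and moments of a single innovation\<close>

context innovations
begin

lemma integrable_mu_iff:
  fixes f :: "real^'r \<Rightarrow> 'b::{banach, second_countable_topology}"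
  assumes "f \<in> borel_measurable borel"
  shows "integrable mu f \<longleftrightarrow> integrable M (\<lambda>\<omega>. f (U 1 \<omega>))"
  unfolding mu_def using assms U_measurable[of 1] by (intro integrable_distr_eq) auto

lemma integral_mu_eq:
  fixes f :: "real^'r \<Rightarrow> 'b::{banach, second_countable_topology}"
  assumes "f \<in> borel_measurable borel" "1 \<le> k"
  shows "(\<integral>\<omega>. f (U k \<omega>) \<partial>M) = (\<integral>u. f u \<partial>mu)"
proof -
  have "(\<integral>\<omega>. f (U k \<omega>) \<partial>M) = (\<integral>u. f u \<partial>distr M borel (U k))"
    using assms U_measurable[of k] by (intro integral_distr[symmetric]) auto
  then show ?thesis using distr_U_mu[OF assms(2)] by simp
qed

text \<open>Passing to \<open>g / L\<close> reduces to the assumed \<open>1\<close>-Lipschitz case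
  with parameter \<open>l * L\<close>. Negative \<open>l\<close> is reached through
  \<open>- g / L\<close>, and \<open>L = 0\<close> stands apart because \<open>g\<close> is then
  constant and cannot be rescaled.\<close>

lemma concentration_mu:
  fixes g :: "real^'r \<Rightarrow> real"
  assumes g: "L-lipschitz_on UNIV g"
  shows "integrable mu g"
    and "(\<integral>\<^sup>+u. ennreal (exp (l * g u)) \<partial>mu) \<le> ennreal (exp (l * (\<integral>u. g u \<partial>mu) + l\<^sup>2 * L\<^sup>2 / 2))"
proof -
  have one: "integrable mu g \<and>
      (\<integral>\<^sup>+u. ennreal (exp (l * g u)) \<partial>mu) \<le> ennreal (exp (l * (\<integral>u. g u \<partial>mu) + l\<^sup>2 / 2))"
    if g: "1-lipschitz_on UNIV g" and l: "0 < l" for g and l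
  proof -
    have [measurable]: "g \<in> borel_measurable borel"
      using lipschitz_on_continuous_on[OF g] by (rule borel_measurable_continuous_onI)
    have *: "integrable M (\<lambda>\<omega>. g (U 1 \<omega>))" "integrable M (\<lambda>\<omega>. exp (l * g (U 1 \<omega>)))"
      "(\<integral>\<omega>. exp (l * g (U 1 \<omega>)) \<partial>M) \<le> exp (l * (\<integral>\<omega>. g (U 1 \<omega>) \<partial>M) + l\<^sup>2 / 2)"
      using concentration g l by (auto simp: gaussian_concentration_def)
    have "integrable mu (\<lambda>u. exp (l * g u))" using * by (subst integrable_mu_iff) auto
    then have "(\<integral>\<^sup>+u. ennreal (exp (l * g u)) \<partial>mu) = ennreal (\<integral>u. exp (l * g u) \<partial>mu)"
      by (rule nn_integral_eq_integral) auto
    then show ?thesis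
      using * integral_mu_eq[of g 1] integral_mu_eq[of "\<lambda>u. exp (l * g u)" 1]
      by (auto simp: integrable_mu_iff ennreal_leI)
  qed
  have "integrable mu g \<and>
      (\<integral>\<^sup>+u. ennreal (exp (l * g u)) \<partial>mu) \<le> ennreal (exp (l * (\<integral>u. g u \<partial>mu) + l\<^sup>2 * L\<^sup>2 / 2))"
  proof (cases "L = 0")
    case True
    then have "g u = g 0" for u using lipschitz_onD[OF g, of u 0] by simp
    then have "g = (\<lambda>u. g 0)" by auto
    then obtain c where "g = (\<lambda>u. c)" by blast
    then show ?thesis using True mu.emeasure_space_1 mu.prob_space by simp
  next
    case False
    then have L: "0 < L" using lipschitz_on_nonneg[OF g] by simp
    have "1-lipschitz_on UNIV (\<lambda>u. g u / L)" "1-lipschitz_on UNIV (\<lambda>u. - g u / L)"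
      using lipschitz_onD[OF g] L
      by (auto intro!: lipschitz_onI simp: dist_real_def field_simps abs_minus_commute
          simp flip: diff_divide_distrib)
    note o1 = one[OF this(1)] and o2 = one[OF this(2)]
    have int: "integrable mu g"
      using o1[of 1] L integrable_mult_right[of L mu "\<lambda>u. g u / L"] by simp
    consider "l = 0" | "0 < l" | "l < 0" by linarith
    then show ?thesis
    proof cases
      case 1 then show ?thesis using int mu.emeasure_space_1 by simp
    next
      case 2
      then show ?thesis using o1[of "l * L"] L int by (simp add: power_mult_distrib)
    next
      case 3
      then show ?thesis using o2[of "- l * L"] L int
        by (simp add: power_mult_distrib mult_neg_pos)
    qed
  qed
  then show "integrable mu g"
    "(\<integral>\<^sup>+u. ennreal (exp (l * g u)) \<partial>mu) \<le> ennreal (exp (l * (\<integral>u. g u \<partial>mu) + l\<^sup>2 * L\<^sup>2 / 2))"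
    by auto
qed

text \<open>The norm is \<open>1\<close>-Lipschitz, so \<open>exp (norm u)\<close> is integrable by
  concentration, and it dominates every polynomial.\<close>

lemma integrable_polynomial_growth:
  fixes f :: "real^'r \<Rightarrow> real"
  assumes f: "f \<in> borel_measurable borel" and le: "\<And>u. \<bar>f u\<bar> \<le> C * (1 + norm u) ^ k"
  shows "integrable mu f"
proof -
  have lip: "1-lipschitz_on UNIV (\<lambda>u::real^'r. norm u)"
    by (rule lipschitz_onI) (auto simp: dist_real_def dist_norm norm_triangle_ineq3)
  have e: "integrable mu (\<lambda>u. exp (1 + norm u))"
  proof -
    have "(\<integral>\<^sup>+u. ennreal (exp (1 * norm u)) \<partial>mu) < \<infinity>"
      using concentration_mu(2)[OF lip, of 1] by (auto simp: order_le_less_trans)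
    then have "integrable mu (\<lambda>u. exp (norm u))"
      by (intro integrableI_nonneg) auto
    then show ?thesis by (simp add: exp_add)
  qed
  have "integrable mu (\<lambda>u. C * real k ^ k * exp (1 + norm u))" using e by simp
  then show ?thesis
  proof (rule Bochner_Integration.integrable_bound)
    have C: "0 \<le> C" using le[of 0] by simp
    show "AE u :: real^'r in mu. norm (f u) \<le> norm (C * real k ^ k * exp (1 + norm u))"
    proof (rule AE_I2)
      fix u :: "real^'r"
      have "C * (1 + norm u) ^ k \<le> C * (real k ^ k * exp (1 + norm u))"
        by (intro mult_left_mono C power_le_exp) auto
      then show "norm (f u) \<le> norm (C * real k ^ k * exp (1 + norm u))"
        using le[of u] C by (simp add: abs_mult)
    qed
  qed (use f in simp)
qed

text \<open>Linearises the square by \<open>exp (a s\<^sup>2) = E exp (sqrt (2 a) s Z)\<close> with a standard normal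
  variable \<open>Z\<close>, so that the concentration inequality applies inside.\<close>

lemma nn_integral_exp_square_le:
  fixes g :: "real^'r \<Rightarrow> real"
  assumes g: "L-lipschitz_on UNIV g" and a: "0 \<le> a" "2 * a * L\<^sup>2 \<le> 1 / 2"
  shows "(\<integral>\<^sup>+u. ennreal (exp (a * (g u)\<^sup>2)) \<partial>mu)
    \<le> ennreal (exp (a * (1 + 4 * a * L\<^sup>2) * (\<integral>u. g u \<partial>mu)\<^sup>2 + 2 * a * L\<^sup>2))"
proof -
  have [measurable]: "g \<in> borel_measurable borel"
    using lipschitz_on_continuous_on[OF g] by (rule borel_measurable_continuous_onI)
  let ?m = "\<integral>u. g u \<partial>mu" and ?c = "a * L\<^sup>2" and ?r = "sqrt (2 * a)"
  have c: "0 \<le> ?c" "?c \<le> 1 / 4" using a by auto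
  interpret P: pair_sigma_finite mu lborel
    by (simp add: pair_sigma_finite_def mu.sigma_finite_measure sigma_finite_lborel)
  have "(\<integral>\<^sup>+u. ennreal (exp (a * (g u)\<^sup>2)) \<partial>mu)
      = (\<integral>\<^sup>+u. \<integral>\<^sup>+z. ennreal (exp (?r * g u * z) * std_normal_density z) \<partial>lborel \<partial>mu)"
    using nn_integral_gaussian[of 0 "?r * g u" for u] a
    by (simp add: power_mult_distrib)
  also have "\<dots> = (\<integral>\<^sup>+z. \<integral>\<^sup>+u. ennreal (exp (?r * g u * z) * std_normal_density z) \<partial>mu \<partial>lborel)"
    by (rule P.Fubini[symmetric, of "\<lambda>(u, z). ennreal (exp (?r * g u * z) * std_normal_density z)", simplified]) measurable
  also have "\<dots> \<le> (\<integral>\<^sup>+z. ennreal (exp (?r * ?m * z + ?c * z\<^sup>2) * std_normal_density z) \<partial>lborel)"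
  proof (rule nn_integral_mono)
    fix z
    have "(\<integral>\<^sup>+u. ennreal (exp (?r * g u * z) * std_normal_density z) \<partial>mu)
       = ennreal (std_normal_density z) * (\<integral>\<^sup>+u. ennreal (exp ((?r * z) * g u)) \<partial>mu)"
      by (subst nn_integral_cmult[symmetric]) (auto simp: ennreal_mult mult_ac)
    also have "\<dots> \<le> ennreal (std_normal_density z) * ennreal (exp ((?r * z) * ?m + (?r * z)\<^sup>2 * L\<^sup>2 / 2))"
      by (intro mult_left_mono concentration_mu(2)[OF g]) simp
    also have "\<dots> = ennreal (exp (?r * ?m * z + ?c * z\<^sup>2) * std_normal_density z)"
      using a by (simp add: ennreal_mult[symmetric] power_mult_distrib mult_ac)
    finally show "(\<integral>\<^sup>+u. ennreal (exp (?r * g u * z) * std_normal_density z) \<partial>mu)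
       \<le> ennreal (exp (?r * ?m * z + ?c * z\<^sup>2) * std_normal_density z)" .
  qed
  also have "\<dots> = ennreal (exp ((?r * ?m)\<^sup>2 / (2 * (1 - 2 * ?c))) / sqrt (1 - 2 * ?c))"
    using c by (intro nn_integral_gaussian) auto
  also have "\<dots> \<le> ennreal (exp (a * (1 + 4 * a * L\<^sup>2) * ?m\<^sup>2 + 2 * a * L\<^sup>2))"
  proof (rule ennreal_leI)
    let ?d = "1 - 2 * ?c"
    have d: "1 / 2 \<le> ?d" using c by simp
    \<comment> \<open>Here the threshold on \<open>a\<close> enters:
      \<open>(1 + 4 * x) * (1 - 2 * x) \<ge> 1\<close> holds for
      \<open>0 \<le> x \<le> 1/4\<close>.\<close>
    have i: "1 / ?d \<le> 1 + 4 * ?c"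
    proof -
      have "?c * ?c \<le> ?c * (1/4)" using c by (intro mult_left_mono) auto
      then have "1 \<le> (1 + 4 * ?c) * ?d" by (simp add: algebra_simps)
      then show ?thesis using d by (simp add: divide_le_eq)
    qed
    have "(?r * ?m)\<^sup>2 / (2 * ?d) = a * ?m\<^sup>2 * (1 / ?d)"
    proof -
      have "(?r * ?m)\<^sup>2 = 2 * (a * ?m\<^sup>2)" using a by (simp add: power_mult_distrib)
      moreover have "2 * x / (2 * y) = x * (1 / y)" for x y :: real by simp
      ultimately show ?thesis by (simp only:)
    qed
    also have "\<dots> \<le> a * ?m\<^sup>2 * (1 + 4 * ?c)" using a i by (intro mult_left_mono) auto
    finally have 1: "(?r * ?m)\<^sup>2 / (2 * ?d) \<le> a * (1 + 4 * a * L\<^sup>2) * ?m\<^sup>2" by (simp add: algebra_simps)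
    have "1 / sqrt ?d = sqrt (1 / ?d)" by (simp add: real_sqrt_divide)
    also have "\<dots> \<le> sqrt (1 + 4 * ?c)" using i by simp
    also have "\<dots> \<le> sqrt (exp (4 * ?c))" using exp_ge_add_one_self[of "4 * ?c"] by simp
    also have "\<dots> = exp (2 * ?c)" by (rule real_sqrt_unique) (auto simp flip: exp_of_nat_mult)
    finally have 2: "1 / sqrt ?d \<le> exp (2 * ?c)" .
    have "exp ((?r * ?m)\<^sup>2 / (2 * ?d)) * (1 / sqrt ?d) \<le> exp (a * (1 + 4 * a * L\<^sup>2) * ?m\<^sup>2) * exp (2 * ?c)"
      using 1 2 d by (intro mult_mono) auto
    then show "exp ((?r * ?m)\<^sup>2 / (2 * ?d)) / sqrt ?d \<le> exp (a * (1 + 4 * a * L\<^sup>2) * ?m\<^sup>2 + 2 * a * L\<^sup>2)"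
      by (simp add: exp_add mult_ac)
  qed
  finally show ?thesis .
qed

lemma moments:
  shows "has_bochner_integral mu (\<lambda>u. u $ i) 0"
    and "has_bochner_integral mu (\<lambda>u. u $ i * u $ j) (if i = j then 1 else 0)"
    and "has_bochner_integral mu (\<lambda>u. u $ i * u $ j * u $ k) 0"
proof -
  have 1: "has_bochner_integral M (U 1) 0"
    "has_bochner_integral M (\<lambda>\<omega>. U 1 \<omega> $ i * U 1 \<omega> $ j) (if i = j then 1 else 0)"
    "has_bochner_integral M (\<lambda>\<omega>. U 1 \<omega> $ i * U 1 \<omega> $ j * U 1 \<omega> $ k) 0"
    using concentration unfolding gaussian_concentration_def by blast+
  have 2: "has_bochner_integral M (\<lambda>\<omega>. U 1 \<omega> $ i) 0"
    using has_bochner_integral_bounded_linear[OF bounded_linear_vec_nth 1(1), of i] by simp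
  have m: "(\<lambda>u::real^'r. u $ i) \<in> borel_measurable borel" for i
    by (intro borel_measurable_continuous_onI continuous_intros)
  note [measurable] = m
  show "has_bochner_integral mu (\<lambda>u. u $ i) 0"
    using 2 integral_mu_eq[of "\<lambda>u. u $ i" 1] by (simp add: has_bochner_integral_iff integrable_mu_iff)
  show "has_bochner_integral mu (\<lambda>u. u $ i * u $ j) (if i = j then 1 else 0)"
    using 1(2) integral_mu_eq[of "\<lambda>u. u $ i * u $ j" 1] unfolding has_bochner_integral_iff
    by (subst integrable_mu_iff) auto
  show "has_bochner_integral mu (\<lambda>u. u $ i * u $ j * u $ k) 0"
    using 1(3) integral_mu_eq[of "\<lambda>u. u $ i * u $ j * u $ k" 1] unfolding has_bochner_integral_iff
    by (subst integrable_mu_iff) auto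
qed

lemma linear_moment: "has_bochner_integral mu (\<lambda>u. p \<bullet> u) 0"
proof -
  have "has_bochner_integral mu (\<lambda>u. \<Sum>i\<in>UNIV. p $ i * u $ i) (\<Sum>i\<in>UNIV. p $ i * 0)"
    by (intro has_bochner_integral_sum has_bochner_integral_mult_right moments)
  then show ?thesis by (simp add: inner_vec_def)
qed

lemma quadratic_moment: "has_bochner_integral mu (\<lambda>u. (p \<bullet> u) * (q \<bullet> u)) (p \<bullet> q)"
proof -
  have "has_bochner_integral mu (\<lambda>u. \<Sum>i\<in>UNIV. \<Sum>j\<in>UNIV. (p $ i * q $ j) * (u $ i * u $ j))
     (\<Sum>i\<in>UNIV. \<Sum>j\<in>UNIV. (p $ i * q $ j) * (if i = j then 1 else 0))"
    by (intro has_bochner_integral_sum has_bochner_integral_mult_right moments)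
  moreover have "(\<Sum>i\<in>UNIV. \<Sum>j\<in>UNIV. (p $ i * q $ j) * (if i = j then 1 else 0)) = p \<bullet> q"
    by (simp add: inner_vec_def if_distrib cong: if_cong)
  ultimately show ?thesis by (simp add: inner_vec_def sum_product mult_ac)
qed

lemma cubic_moment: "has_bochner_integral mu (\<lambda>u. (p \<bullet> u) * (q \<bullet> u) * (s \<bullet> u)) 0"
proof -
  have "has_bochner_integral mu (\<lambda>u. \<Sum>i\<in>UNIV. \<Sum>j\<in>UNIV. \<Sum>k\<in>UNIV. (p $ i * q $ j * s $ k) * (u $ i * u $ j * u $ k))
     (\<Sum>i\<in>UNIV. \<Sum>j\<in>UNIV. \<Sum>k\<in>UNIV. (p $ i * q $ j * s $ k) * 0)"
    by (intro has_bochner_integral_sum has_bochner_integral_mult_right moments)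
  moreover have "(p \<bullet> u) * (q \<bullet> u) * (s \<bullet> u)
      = (\<Sum>i\<in>UNIV. \<Sum>j\<in>UNIV. \<Sum>k\<in>UNIV. (p $ i * q $ j * s $ k) * (u $ i * u $ j * u $ k))" for u
    unfolding mult.assoc inner_vec_def inner_real_def
    unfolding sum_product
    unfolding sum_distrib_left
    by (intro sum.cong refl) (simp only: mult_ac)
  ultimately show ?thesis by simp
qed

end

section \<open>The scheme and its Lyapunov function\<close>

lemma continuous_on_mult_vec [continuous_intros]:
  fixes A :: "'a::topological_space \<Rightarrow> real^'m^'n"
  assumes "continuous_on S A" "continuous_on S v"
  shows "continuous_on S (\<lambda>z. A z *v v z)"
  unfolding matrix_vector_mult_def by (intro continuous_intros assms)

lemma abs_quadratic_form_le_op_norm: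
  fixes A :: "real^'n^'n"
  shows "\<bar>h \<bullet> (A *v h)\<bar> \<le> op_norm A * (norm h)\<^sup>2"
proof -
  have "\<bar>h \<bullet> (A *v h)\<bar> \<le> norm h * norm (A *v h)" by (rule Cauchy_Schwarz_ineq2)
  also have "\<dots> \<le> norm h * (op_norm A * norm h)"
    by (intro mult_left_mono norm_mult_vec_le) auto
  finally show ?thesis by (simp add: power2_eq_square mult_ac)
qed

text \<open>The identity covariance of the innovations turns the second-order Taylor term into the
  trace appearing in the generator.\<close>

lemma (in innovations) trace_moment:
  fixes S :: "real^'r^'n"
  shows "has_bochner_integral mu (\<lambda>u. (S *v u) \<bullet> (A *v (S *v u))) (trace (A ** (S ** transpose S)))"
proof -
  have "has_bochner_integral mu (\<lambda>u. \<Sum>i\<in>UNIV. \<Sum>j\<in>UNIV. A $ i $ j * ((S $ i \<bullet> u) * (S $ j \<bullet> u)))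
     (\<Sum>i\<in>UNIV. \<Sum>j\<in>UNIV. A $ i $ j * (S $ i \<bullet> S $ j))"
    by (intro has_bochner_integral_sum has_bochner_integral_mult_right quadratic_moment)
  moreover have "(\<Sum>i\<in>UNIV. \<Sum>j\<in>UNIV. A $ i $ j * (S $ i \<bullet> S $ j)) = trace (A ** (S ** transpose S))"
    by (simp add: trace_def matrix_matrix_mult_def transpose_def inner_vec_def mult_ac)
  ultimately show ?thesis
    by (simp add: inner_mult_vec_eq_sum matrix_vector_mul_component mult.assoc)
qed

lemma (in innovations) norm_square_moment:
  "has_bochner_integral mu (\<lambda>u. (norm u)\<^sup>2) (real CARD('r))"
proof -
  have "has_bochner_integral mu (\<lambda>u. \<Sum>i\<in>UNIV. u $ i * u $ i) (\<Sum>i\<in>(UNIV::'r set). if i = i then 1 else 0)"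
    by (intro has_bochner_integral_sum moments)
  then show ?thesis by (simp add: power2_norm_eq_inner inner_vec_def)
qed

locale euler_scheme = innovations M X0 U
  for M :: "'w measure" and X0 :: "'w \<Rightarrow> real^'d" and U :: "nat \<Rightarrow> 'w \<Rightarrow> real^'r" +
  fixes b :: "real^'d \<Rightarrow> real^'d" and \<sigma> :: "real^'d \<Rightarrow> real^'r^'d" and \<gamma> :: "nat \<Rightarrow> real"
    and s\<^sub>1 :: real
  assumes b_cont: "continuous_on UNIV b" and \<sigma>_cont: "continuous_on UNIV \<sigma>"
    and \<gamma>_pos: "\<And>k. 1 \<le> k \<Longrightarrow> 0 < \<gamma> k" and \<gamma>_le: "\<And>k. 1 \<le> k \<Longrightarrow> \<gamma> k \<le> \<gamma> 1"
    and s1_pos: "0 < s\<^sub>1" and \<sigma>_le: "\<And>x. op_norm (\<sigma> x) \<le> s\<^sub>1"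
begin

definition noiseless :: "nat \<Rightarrow> real^'d \<Rightarrow> real^'d" where
  "noiseless k x = x + \<gamma> k *\<^sub>R b x"

definition jump :: "nat \<Rightarrow> real^'d \<Rightarrow> real^'r \<Rightarrow> real^'d" where
  "jump k x u = sqrt (\<gamma> k) *\<^sub>R (\<sigma> x *v u)"

definition step :: "nat \<Rightarrow> real^'d \<Rightarrow> real^'r \<Rightarrow> real^'d" where
  "step k x u = noiseless k x + jump k x u"

abbreviation X :: "nat \<Rightarrow> 'w \<Rightarrow> real^'d" where
  "X \<equiv> scheme b \<sigma> \<gamma> X0 U"

lemma X_Suc: "X (Suc n) \<omega> = step (Suc n) (X n \<omega>) (U (Suc n) \<omega>)"
  by (simp add: step_def noiseless_def jump_def)

lemma continuous_on_noiseless [continuous_intros]: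
  "continuous_on S f \<Longrightarrow> continuous_on S (\<lambda>z. noiseless k (f z))"
  unfolding noiseless_def
  by (intro continuous_intros continuous_on_compose2[OF b_cont]) auto

lemma continuous_on_jump [continuous_intros]:
  "continuous_on S f \<Longrightarrow> continuous_on S g \<Longrightarrow> continuous_on S (\<lambda>z. jump k (f z) (g z))"
  unfolding jump_def
  by (intro continuous_intros continuous_on_compose2[OF \<sigma>_cont]) auto

lemma continuous_on_step [continuous_intros]:
  "continuous_on S f \<Longrightarrow> continuous_on S g \<Longrightarrow> continuous_on S (\<lambda>z. step k (f z) (g z))"
  unfolding step_def by (intro continuous_intros)

lemma measurable_step [measurable]: "(\<lambda>p. step k (fst p) (snd p)) \<in> borel_measurable (borel \<Otimes>\<^sub>M borel)"
  unfolding borel_prod by (intro borel_measurable_continuous_onI continuous_intros)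

lemma X_history: "m \<le> n \<Longrightarrow> X m \<in> borel_measurable (history n)"
proof (induction m)
  case 0 then show ?case using X0_history[of n] by simp
next
  case (Suc m)
  then have [measurable]: "X m \<in> borel_measurable (history n)" "U (Suc m) \<in> borel_measurable (history n)"
    using U_history by auto
  have "(\<lambda>\<omega>. step (Suc m) (fst (X m \<omega>, U (Suc m) \<omega>)) (snd (X m \<omega>, U (Suc m) \<omega>))) \<in> borel_measurable (history n)"
    by (rule measurable_compose[OF _ measurable_step]) measurable
  then show ?case by (simp add: X_Suc[abs_def])
qed

lemma X_measurable: "X n \<in> borel_measurable M"
  using X_history[of n n] by (intro history_measurable) auto

lemma norm_jump_le: "1 \<le> k \<Longrightarrow> norm (jump k x u) \<le> sqrt (\<gamma> k) * op_norm (\<sigma> x) * norm u"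
  using \<gamma>_pos[of k] norm_mult_vec_le[of "\<sigma> x" u] by (simp add: jump_def mult.assoc mult_left_mono)

lemma step_lipschitz:
  assumes f: "\<And>x y. \<bar>f x - f y\<bar> \<le> L * norm (x - y)" and L: "0 \<le> L" and k: "1 \<le> k"
  shows "(L * (sqrt (\<gamma> k) * op_norm (\<sigma> x)))-lipschitz_on UNIV (\<lambda>u. f (step k x u))"
proof (rule lipschitz_onI)
  fix u v
  have "dist (f (step k x u)) (f (step k x v)) \<le> L * norm (step k x u - step k x v)"
    using f by (simp add: dist_real_def)
  also have "step k x u - step k x v = jump k x (u - v)"
    by (simp add: step_def jump_def matrix_vector_mult_diff_distrib scaleR_diff_right)
  also have "L * norm (jump k x (u - v)) \<le> L * (sqrt (\<gamma> k) * op_norm (\<sigma> x) * norm (u - v))"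
    by (intro mult_left_mono norm_jump_le L k)
  finally show "dist (f (step k x u)) (f (step k x v)) \<le> L * (sqrt (\<gamma> k) * op_norm (\<sigma> x)) * dist u v"
    by (simp add: dist_norm mult.assoc)
qed (use L k \<gamma>_pos[of k] op_norm_nonneg[of "\<sigma> x"] in auto)

end

locale lyapunov_scheme = euler_scheme M X0 U b \<sigma> \<gamma> s\<^sub>1
  for M :: "'w measure" and X0 :: "'w \<Rightarrow> real^'d" and U :: "nat \<Rightarrow> 'w \<Rightarrow> real^'r"
    and b \<sigma> \<gamma> s\<^sub>1 +
  fixes V :: "real^'d \<Rightarrow> real" and v CV \<alpha> \<beta>V H :: real
  assumes lyap: "lyapunov b \<sigma> V v CV \<alpha> \<beta>V"
    and H: "0 < H" "\<And>x. op_norm (hess V x) \<le> H"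
    and small_steps: "\<And>k. 1 \<le> k \<Longrightarrow> \<gamma> k * (CV * H) \<le> \<alpha> / 2"
    and X0_exp: "\<exists>l>0. integrable M (\<lambda>\<omega>. exp (l * (norm (X0 \<omega>))\<^sup>2))"
begin

lemma v_pos: "0 < v" and V_ge: "v \<le> V x" and V_Ck: "Ck 2 V" and CV_pos: "0 < CV"
  and grad_b_le: "(norm (grad V x))\<^sup>2 + (norm (b x))\<^sup>2 \<le> CV * V x"
  and \<alpha>_pos: "0 < \<alpha>" and \<beta>V_nonneg: "0 \<le> \<beta>V"
  and drift: "generator b \<sigma> V x \<le> - \<alpha> * V x + \<beta>V"
  using lyap unfolding lyapunov_def by blast+

lemma V_pos: "0 < V x" using v_pos V_ge[of x] by linarith

lemma V_cont: "continuous_on UNIV V"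
  using Ck_continuous[OF V_Ck, of "[]"] by simp

text \<open>\<open>|grad V|\<^sup>2 \<le> CV * V\<close> bounds the gradient of
  \<open>sqrt V\<close> by \<open>sqrt CV / 2\<close>. Hence \<open>V\<close> is the square of a
  Lipschitz function, which is how Gaussian concentration reaches its exponential moments.\<close>

lemma sqrt_V_lipschitz: "\<bar>sqrt (V x) - sqrt (V y)\<bar> \<le> sqrt CV / 2 * norm (x - y)"
proof -
  have "norm (sqrt (V (y + 1 *\<^sub>R (x - y))) - sqrt (V (y + 0 *\<^sub>R (x - y)))) \<le> sqrt CV / 2 * norm (x - y) * norm (1 - 0 :: real)"
  proof (rule field_differentiable_bound[where S = UNIV])
    fix t :: real
    let ?z = "y + t *\<^sub>R (x - y)"
    show "((\<lambda>t. sqrt (V (y + t *\<^sub>R (x - y)))) has_field_derivative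
       (grad V ?z \<bullet> (x - y) / (2 * sqrt (V ?z)))) (at t within UNIV)"
      using DERIV_chain2[where f = sqrt and g = "\<lambda>t. V (y + t *\<^sub>R (x - y))" and x = t,
          OF DERIV_real_sqrt Ck_line1[OF V_Ck]] V_pos[of ?z]
      by (simp add: field_simps)
    have "\<bar>grad V ?z \<bullet> (x - y)\<bar> \<le> norm (grad V ?z) * norm (x - y)" by (rule Cauchy_Schwarz_ineq2)
    also have "norm (grad V ?z) \<le> sqrt (CV * V ?z)"
      using grad_b_le[of ?z] zero_le_power2[of "norm (b ?z)"] by (intro real_le_rsqrt) linarith
    finally have "\<bar>grad V ?z \<bullet> (x - y)\<bar> \<le> sqrt (CV * V ?z) * norm (x - y)"
      by (simp add: mult_right_mono)
    also have "\<dots> = sqrt CV / 2 * norm (x - y) * (2 * sqrt (V ?z))" by (simp add: real_sqrt_mult)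
    finally have "\<bar>grad V ?z \<bullet> (x - y)\<bar> / (2 * sqrt (V ?z)) \<le> sqrt CV / 2 * norm (x - y)"
      using V_pos[of ?z] by (subst pos_divide_le_eq) auto
    then show "norm (grad V ?z \<bullet> (x - y) / (2 * sqrt (V ?z))) \<le> sqrt CV / 2 * norm (x - y)"
      using V_pos[of ?z] by simp
  qed auto
  then show ?thesis by simp
qed

text \<open>Comparison of \<open>sqrt V\<close> with its value at the origin gives quadratic growth,
  so that an exponential moment of \<open>|X0|\<^sup>2\<close> controls one of
  \<open>V (X0)\<close>.\<close>

lemma V_le_quadratic: "V x \<le> 2 * V 0 + CV / 2 * (norm x)\<^sup>2"
proof -
  have "sqrt (V x) \<le> sqrt (V 0) + sqrt CV / 2 * norm x"
    using sqrt_V_lipschitz[of x 0] unfolding diff_zero by linarith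
  then have "(sqrt (V x))\<^sup>2 \<le> (sqrt (V 0) + sqrt CV / 2 * norm x)\<^sup>2"
    using V_pos[of x] by (intro power_mono) auto
  also have "\<dots> \<le> 2 * (sqrt (V 0))\<^sup>2 + 2 * (sqrt CV / 2 * norm x)\<^sup>2"
    using sum_squares_ge_zero[of "sqrt (V 0) - sqrt CV / 2 * norm x" 0]
    by (simp add: power2_eq_square algebra_simps)
  finally show ?thesis using V_pos[of x] V_pos[of 0] CV_pos
    by (simp add: power_mult_distrib power_divide)
qed

lemma V_add_le: "V (x + h) \<le> V x + grad V x \<bullet> h + H / 2 * (norm h)\<^sup>2"
proof -
  have 1: "((\<lambda>t. (1 - t) * (H * (norm h)\<^sup>2)) has_integral 1/2 * (H * (norm h)\<^sup>2)) {0..1}"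
  proof -
    have "((\<lambda>t. (1 - t) * (H * (norm h)\<^sup>2)) has_integral
       (\<lambda>t. (t - t^2/2) * (H * (norm h)\<^sup>2)) 1 - (\<lambda>t. (t - t^2/2) * (H * (norm h)\<^sup>2)) 0) {0..1}"
      by (rule fundamental_theorem_of_calculus)
        (auto simp flip: has_real_derivative_iff_has_vector_derivative
           intro!: derivative_eq_intros)
    then show ?thesis by simp
  qed
  have "V (x + h) - V x - grad V x \<bullet> h \<le> 1/2 * (H * (norm h)\<^sup>2)"
  proof (rule has_integral_le[OF taylor2[OF V_Ck] 1])
    fix t :: real assume t: "t \<in> {0..1}"
    have "h \<bullet> (hess V (x + t *\<^sub>R h) *v h) \<le> H * (norm h)\<^sup>2"
      using abs_quadratic_form_le_op_norm[of h "hess V (x + t *\<^sub>R h)"]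
        mult_right_mono[OF H(2)[of "x + t *\<^sub>R h"], of "(norm h)\<^sup>2"] by simp
    then show "(1 - t) * (h \<bullet> (hess V (x + t *\<^sub>R h) *v h)) \<le> (1 - t) * (H * (norm h)\<^sup>2)"
      using t by (intro mult_left_mono) auto
  qed simp
  then show ?thesis by simp
qed

lemma measurable_V_step: "(\<lambda>u. V (step k x u)) \<in> borel_measurable borel"
  by (intro borel_measurable_continuous_onI continuous_on_compose2[OF V_cont] continuous_intros) auto

lemma sqrt_V_step:
  assumes k: "1 \<le> k"
  shows "(sqrt CV / 2 * (sqrt (\<gamma> k) * op_norm (\<sigma> x)))-lipschitz_on UNIV (\<lambda>u. sqrt (V (step k x u)))"
  using CV_pos by (intro step_lipschitz[OF sqrt_V_lipschitz _ k]) auto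

lemma integrable_V_step:
  assumes k: "1 \<le> k"
  shows "integrable mu (\<lambda>u. V (step k x u))"
proof -
  define C where "C = 2 * V 0 + CV / 2 * (norm (noiseless k x) + sqrt (\<gamma> k) * s\<^sub>1)\<^sup>2"
  show ?thesis
  proof (rule integrable_polynomial_growth[OF measurable_V_step, where C = C and k = 2])
    fix u :: "real^'r"
    have "norm (step k x u) \<le> norm (noiseless k x) + sqrt (\<gamma> k) * op_norm (\<sigma> x) * norm u"
      unfolding step_def using norm_jump_le[OF k, of x u] norm_triangle_ineq[of "noiseless k x" "jump k x u"] by linarith
    also have "\<dots> \<le> norm (noiseless k x) + sqrt (\<gamma> k) * s\<^sub>1 * norm u"
      using \<sigma>_le[of x] \<gamma>_pos[OF k] by (intro add_left_mono mult_right_mono mult_left_mono) auto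
    also have "\<dots> \<le> (norm (noiseless k x) + sqrt (\<gamma> k) * s\<^sub>1) * (1 + norm u)"
      using s1_pos \<gamma>_pos[OF k] by (simp add: algebra_simps)
    finally have "(norm (step k x u))\<^sup>2 \<le> ((norm (noiseless k x) + sqrt (\<gamma> k) * s\<^sub>1) * (1 + norm u))\<^sup>2"
      by (intro power_mono) auto
    then have "CV / 2 * (norm (step k x u))\<^sup>2 \<le> CV / 2 * (norm (noiseless k x) + sqrt (\<gamma> k) * s\<^sub>1)\<^sup>2 * (1 + norm u)\<^sup>2"
      using CV_pos by (simp add: power_mult_distrib mult.assoc)
    moreover have "2 * V 0 * 1 \<le> 2 * V 0 * (1 + norm u)\<^sup>2"
      using V_pos[of 0] by (intro mult_left_mono) (auto intro: one_le_power)
    ultimately show "\<bar>V (step k x u)\<bar> \<le> C * (1 + norm u)\<^sup>2"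
      using V_le_quadratic[of "step k x u"] V_pos[of "step k x u"]
      by (simp add: C_def distrib_right)
  qed
qed

definition drift_const :: real where "drift_const = \<beta>V + H * s\<^sub>1\<^sup>2 * real CARD('r)"

lemma drift_const_nonneg: "0 \<le> drift_const"
  using \<beta>V_nonneg H(1) by (simp add: drift_const_def)

text \<open>After a second-order expansion the terms linear in the innovation have mean zero. The
  squared drift costs \<open>H / 2 * \<gamma>\<^sup>2 * CV * V\<close>, at most
  \<open>\<alpha> / 4 * \<gamma> * V\<close> by \<open>small_steps\<close>; this lowers the rate
  \<alpha> to \<open>3/4 * \<alpha>\<close>.\<close>

lemma integral_V_step_le:
  assumes k: "1 \<le> k"
  shows "(\<integral>u. V (step k x u) \<partial>mu) \<le> (1 - 3/4 * \<alpha> * \<gamma> k) * V x + drift_const * \<gamma> k"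
proof -
  let ?g = "\<gamma> k" and ?r = "real CARD('r)"
  let ?B = "\<lambda>u. V x + ?g * (grad V x \<bullet> b x) + sqrt ?g * (((grad V x) v* \<sigma> x) \<bullet> u)
     + H / 2 * (?g\<^sup>2 * (norm (b x))\<^sup>2 + 2 * ?g * sqrt ?g * ((b x v* \<sigma> x) \<bullet> u) + ?g * s\<^sub>1\<^sup>2 * (norm u)\<^sup>2)"
  have g: "0 < ?g" by (rule \<gamma>_pos[OF k])
  have le: "V (step k x u) \<le> ?B u" for u
  proof -
    have "V (step k x u) = V (x + (?g *\<^sub>R b x + jump k x u))"
      by (simp add: step_def noiseless_def add.assoc)
    also have "\<dots> \<le> V x + grad V x \<bullet> (?g *\<^sub>R b x + jump k x u) + H / 2 * (norm (?g *\<^sub>R b x + jump k x u))\<^sup>2"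
      by (rule V_add_le)
    also have "grad V x \<bullet> (?g *\<^sub>R b x + jump k x u) = ?g * (grad V x \<bullet> b x) + sqrt ?g * (((grad V x) v* \<sigma> x) \<bullet> u)"
      by (simp add: jump_def inner_add_right dot_lmul_matrix)
    also have "(norm (?g *\<^sub>R b x + jump k x u))\<^sup>2
       = ?g\<^sup>2 * (norm (b x))\<^sup>2 + 2 * ?g * sqrt ?g * ((b x v* \<sigma> x) \<bullet> u) + (norm (jump k x u))\<^sup>2"
    proof -
      have "(norm (p + q))\<^sup>2 = (norm p)\<^sup>2 + 2 * (p \<bullet> q) + (norm q)\<^sup>2" for p q :: "real^'d"
        unfolding power2_norm_eq_inner by (simp add: inner_add_left inner_add_right inner_commute)
      from this[of "?g *\<^sub>R b x" "jump k x u"] show ?thesis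
        by (simp add: jump_def dot_lmul_matrix power_mult_distrib)
    qed
    also have "(norm (jump k x u))\<^sup>2 \<le> ?g * s\<^sub>1\<^sup>2 * (norm u)\<^sup>2"
    proof -
      have "norm (jump k x u) \<le> sqrt ?g * s\<^sub>1 * norm u"
        using norm_jump_le[OF k, of x u] \<sigma>_le[of x] g
        by (meson mult_left_mono mult_right_mono norm_ge_zero order_trans real_sqrt_ge_zero less_imp_le)
      then have "(norm (jump k x u))\<^sup>2 \<le> (sqrt ?g * s\<^sub>1 * norm u)\<^sup>2" by (intro power_mono) auto
      then show ?thesis using g by (simp add: power_mult_distrib)
    qed
    finally show ?thesis using H(1) by (simp add: add.assoc)
  qed
  have "has_bochner_integral mu ?B (V x + ?g * (grad V x \<bullet> b x) + sqrt ?g * 0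
     + H / 2 * (?g\<^sup>2 * (norm (b x))\<^sup>2 + 2 * ?g * sqrt ?g * 0 + ?g * s\<^sub>1\<^sup>2 * ?r))"
    using mu.prob_space
    by (intro has_bochner_integral_add has_bochner_integral_mult_right linear_moment norm_square_moment)
      (auto simp: has_bochner_integral_iff)
  then have B: "integrable mu ?B" "integral\<^sup>L mu ?B = V x + ?g * (grad V x \<bullet> b x)
     + H / 2 * (?g\<^sup>2 * (norm (b x))\<^sup>2 + ?g * s\<^sub>1\<^sup>2 * ?r)"
    by (auto simp: has_bochner_integral_iff)
  have "(\<integral>u. V (step k x u) \<partial>mu) \<le> integral\<^sup>L mu ?B"
    by (intro integral_mono integrable_V_step k B le)
  \<comment> \<open>The Lyapunov drift condition bounds the sum of this scalar product and half a
    trace. Isolating the scalar product takes a lower bound for the trace, obtained by writing it as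
    the mean of the Hessian form at \<open>\<sigma> x *v u\<close>.\<close>
  moreover have "grad V x \<bullet> b x \<le> - \<alpha> * V x + \<beta>V + 1/2 * (H * s\<^sub>1\<^sup>2 * ?r)"
  proof -
    have "- trace (hess V x ** (\<sigma> x ** transpose (\<sigma> x))) \<le> H * s\<^sub>1\<^sup>2 * ?r"
    proof -
      have "has_bochner_integral mu (\<lambda>u. H * s\<^sub>1\<^sup>2 * (norm u)\<^sup>2 + (\<sigma> x *v u) \<bullet> (hess V x *v (\<sigma> x *v u)))
         (H * s\<^sub>1\<^sup>2 * ?r + trace (hess V x ** (\<sigma> x ** transpose (\<sigma> x))))"
        by (intro has_bochner_integral_add has_bochner_integral_mult_right norm_square_moment trace_moment)
      moreover have "0 \<le> H * s\<^sub>1\<^sup>2 * (norm u)\<^sup>2 + (\<sigma> x *v u) \<bullet> (hess V x *v (\<sigma> x *v u))" for u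
      proof -
        have "norm (\<sigma> x *v u) \<le> s\<^sub>1 * norm u"
          using norm_mult_vec_le[of "\<sigma> x" u] mult_right_mono[OF \<sigma>_le[of x], of "norm u"] by simp
        then have "(norm (\<sigma> x *v u))\<^sup>2 \<le> (s\<^sub>1 * norm u)\<^sup>2" by (intro power_mono) auto
        then have "H * (norm (\<sigma> x *v u))\<^sup>2 \<le> H * s\<^sub>1\<^sup>2 * (norm u)\<^sup>2"
          using H(1) by (simp add: power_mult_distrib mult.assoc)
        then show ?thesis
          using abs_quadratic_form_le_op_norm[of "\<sigma> x *v u" "hess V x"]
            mult_right_mono[OF H(2)[of x], of "(norm (\<sigma> x *v u))\<^sup>2"] by simp
      qed
      ultimately have "0 \<le> H * s\<^sub>1\<^sup>2 * ?r + trace (hess V x ** (\<sigma> x ** transpose (\<sigma> x)))"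
        by (auto dest!: has_bochner_integral_integral_eq[symmetric] intro: integral_nonneg)
      then show ?thesis by simp
    qed
    then show ?thesis
      using drift[of x] by (simp add: generator_def diffusion_matrix_def trace_mul_sym[of "hess V x"] inner_commute)
  qed
  then have "?g * (grad V x \<bullet> b x) \<le> ?g * (- \<alpha> * V x + \<beta>V + 1/2 * (H * s\<^sub>1\<^sup>2 * ?r))"
    using g by (intro mult_left_mono) auto
  moreover have "H / 2 * (?g\<^sup>2 * (norm (b x))\<^sup>2) \<le> \<alpha> / 4 * ?g * V x"
  proof -
    have "H / 2 * (?g\<^sup>2 * (norm (b x))\<^sup>2) \<le> H / 2 * (?g\<^sup>2 * (CV * V x))"
    proof (intro mult_left_mono)
      show "(norm (b x))\<^sup>2 \<le> CV * V x" using grad_b_le[of x] zero_le_power2[of "norm (grad V x)"] by linarith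
    qed (use H(1) in auto)
    also have "\<dots> = (?g * (CV * H)) * (?g * V x / 2)" by (simp add: power2_eq_square)
    also have "\<dots> \<le> \<alpha> / 2 * (?g * V x / 2)"
      using small_steps[OF k] g V_pos[of x] by (intro mult_right_mono) auto
    finally show ?thesis by simp
  qed
  ultimately show ?thesis
    unfolding B(2) drift_const_def by (simp add: algebra_simps)
qed


text \<open>The bound for \<open>exp\<close> of a square, applied to \<open>sqrt V\<close> after the
  step, involves the squared mean of \<open>sqrt V\<close>, which is at most the mean of
  \<open>V\<close>. With \<open>L\<close> the Lipschitz constant in the innovation, the correction
  factor \<open>1 + 4 * a * L\<^sup>2 \<le> 1 + \<alpha> / 4 * \<gamma>\<close> uses up part of the
  contraction \<open>1 - 3/4 * \<alpha> * \<gamma>\<close> and leaves the rate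
  \<open>\<alpha> / 2\<close>.\<close>

lemma lyapunov_step:
  obtains c r C where "0 < c" "0 < r" "0 \<le> C" "\<And>k. 1 \<le> k \<Longrightarrow> r * \<gamma> k \<le> 1"
    "\<And>a k x. 0 \<le> a \<Longrightarrow> a \<le> c \<Longrightarrow> 1 \<le> k \<Longrightarrow>
       (\<integral>\<^sup>+u. ennreal (exp (a * V (step k x u))) \<partial>mu) \<le> ennreal (exp (a * (1 - r * \<gamma> k) * V x + C * a * \<gamma> k))"
proof -
  define q where "q = s\<^sub>1\<^sup>2 * CV"
  \<comment> \<open>With \<open>q = s\<^sub>1\<^sup>2 * CV\<close> the Lipschitz constant satisfies
    \<open>4 * L\<^sup>2 \<le> \<gamma> k * q\<close>. The first entry of the minimum secures the
    threshold of the exponential square bound, the second the correction factor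
    \<open>1 + \<alpha> / 4 * \<gamma> k\<close>.\<close>
  define c where "c = min (1 / (\<gamma> 1 * q)) (\<alpha> / (4 * q))"
  \<comment> \<open>The cap \<open>1 / \<gamma> 1\<close> keeps the contraction factor
    \<open>1 - r * \<gamma> k\<close> nonnegative.\<close>
  define r where "r = min (\<alpha> / 2) (1 / \<gamma> 1)"
  define C where "C = (1 + \<alpha> * \<gamma> 1) * drift_const + q / 2"
  have q: "0 < q" using s1_pos CV_pos by (simp add: q_def)
  have g1: "0 < \<gamma> 1" using \<gamma>_pos by simp
  show ?thesis
  proof (rule that[of c r C])
    show "0 < c" "0 < r" using q g1 \<alpha>_pos by (auto simp: c_def r_def)
    show "0 \<le> C" using q g1 \<alpha>_pos drift_const_nonneg by (simp add: C_def)
    show "r * \<gamma> k \<le> 1" if "1 \<le> k" for k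
    proof -
      have "r * \<gamma> k \<le> 1 / \<gamma> 1 * \<gamma> 1"
        using \<gamma>_le[OF that] \<gamma>_pos[OF that] g1 by (intro mult_mono) (auto simp: r_def)
      then show ?thesis using g1 by simp
    qed
    fix a k x assume a: "0 \<le> a" "a \<le> c" and k: "1 \<le> (k::nat)"
    let ?g = "\<gamma> k" and ?m = "\<integral>u. sqrt (V (step k x u)) \<partial>mu"
    let ?L = "sqrt CV / 2 * (sqrt ?g * op_norm (\<sigma> x))"
    have g: "0 < ?g" "?g \<le> \<gamma> 1" using \<gamma>_pos[OF k] \<gamma>_le[OF k] by auto
    have L: "4 * ?L\<^sup>2 \<le> ?g * q"
    proof -
      have "4 * ?L\<^sup>2 = CV * ?g * (op_norm (\<sigma> x))\<^sup>2"
        using CV_pos g by (simp add: power_mult_distrib power_divide)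
      also have "\<dots> \<le> CV * ?g * s\<^sub>1\<^sup>2"
        using CV_pos g \<sigma>_le op_norm_nonneg by (intro mult_left_mono power_mono) auto
      finally show ?thesis by (simp add: q_def mult_ac)
    qed
    have aq: "a * q \<le> \<alpha> / 4" "a * q * \<gamma> 1 \<le> 1"
      using a q g1 by (auto simp: c_def field_simps)
    have aL: "4 * a * ?L\<^sup>2 \<le> \<alpha> / 4 * ?g" "4 * a * ?L\<^sup>2 \<le> a * ?g * q" "2 * a * ?L\<^sup>2 \<le> 1 / 2"
    proof -
      show 1: "4 * a * ?L\<^sup>2 \<le> a * ?g * q" using mult_left_mono[OF L a(1)] by (simp add: mult_ac)
      have "a * ?g * q \<le> a * q * \<gamma> 1" using g a q by (simp add: mult_ac mult_left_mono)
      then show "2 * a * ?L\<^sup>2 \<le> 1 / 2" using 1 aq by linarith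
      show "4 * a * ?L\<^sup>2 \<le> \<alpha> / 4 * ?g" 
      proof -
        have "a * ?g * q \<le> \<alpha> / 4 * ?g" using mult_right_mono[OF aq(1), of ?g] g by (simp add: mult_ac)
        with 1 show ?thesis by (rule order_trans)
      qed
    qed
    have m: "?m\<^sup>2 \<le> (1 - 3/4 * \<alpha> * ?g) * V x + drift_const * ?g"
    proof -
      let ?f = "\<lambda>u. sqrt (V (step k x u))"
      have i: "integrable mu ?f" by (rule concentration_mu(1)[OF sqrt_V_step[OF k]])
      have sq: "(?f u)\<^sup>2 = V (step k x u)" for u using V_pos[of "step k x u"] by simp
      have i2: "integrable mu (\<lambda>u. (?f u)\<^sup>2)" using integrable_V_step[OF k] by (simp only: sq)
      have "0 \<le> mu.variance ?f" by (rule mu.variance_positive)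
      then have "?m\<^sup>2 \<le> (\<integral>u. (?f u)\<^sup>2 \<partial>mu)" using mu.variance_eq[OF i i2] by linarith
      then show ?thesis using integral_V_step_le[OF k, of x] unfolding sq by linarith
    qed
    have "(1 + 4 * a * ?L\<^sup>2) * ?m\<^sup>2 \<le> (1 + \<alpha> / 4 * ?g) * ((1 - 3/4 * \<alpha> * ?g) * V x + drift_const * ?g)"
      using aL(1) m a g \<alpha>_pos by (intro mult_mono) auto
    also have "\<dots> = (1 - \<alpha> / 2 * ?g - 3/16 * (\<alpha> * ?g)\<^sup>2) * V x + (1 + \<alpha> / 4 * ?g) * drift_const * ?g"
      by (simp add: power2_eq_square algebra_simps)
    also have "\<dots> \<le> (1 - r * ?g) * V x + (1 + \<alpha> * \<gamma> 1) * drift_const * ?g"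
    proof (intro add_mono mult_right_mono)
      have "r * ?g \<le> \<alpha> / 2 * ?g" using g by (intro mult_right_mono) (auto simp: r_def)
      then show "1 - \<alpha> / 2 * ?g - 3/16 * (\<alpha> * ?g)\<^sup>2 \<le> 1 - r * ?g"
        using zero_le_power2[of "\<alpha> * ?g"] by linarith
      show "\<alpha> / 4 * ?g \<le> \<alpha> * \<gamma> 1" using g \<alpha>_pos by (intro mult_mono) auto
    qed (use V_pos[of x] drift_const_nonneg g in auto)
    finally have "a * ((1 + 4 * a * ?L\<^sup>2) * ?m\<^sup>2) \<le> a * ((1 - r * ?g) * V x + (1 + \<alpha> * \<gamma> 1) * drift_const * ?g)"
      using a by (intro mult_left_mono)
    moreover have "2 * a * ?L\<^sup>2 \<le> q / 2 * a * ?g" using aL(2) by (simp add: mult_ac)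
    ultimately have E: "a * (1 + 4 * a * ?L\<^sup>2) * ?m\<^sup>2 + 2 * a * ?L\<^sup>2 \<le> a * (1 - r * ?g) * V x + C * a * ?g"
      by (simp add: C_def algebra_simps)
    have "(\<integral>\<^sup>+u. ennreal (exp (a * V (step k x u))) \<partial>mu)
       = (\<integral>\<^sup>+u. ennreal (exp (a * (sqrt (V (step k x u)))\<^sup>2)) \<partial>mu)"
      using V_pos by (simp add: less_imp_le)
    also have "\<dots> \<le> ennreal (exp (a * (1 + 4 * a * ?L\<^sup>2) * ?m\<^sup>2 + 2 * a * ?L\<^sup>2))"
      by (rule nn_integral_exp_square_le[OF sqrt_V_step[OF k] a(1) aL(3)])
    also have "\<dots> \<le> ennreal (exp (a * (1 - r * ?g) * V x + C * a * ?g))"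
      using E by (intro ennreal_leI) simp
    finally show "(\<integral>\<^sup>+u. ennreal (exp (a * V (step k x u))) \<partial>mu)
       \<le> ennreal (exp (a * (1 - r * \<gamma> k) * V x + C * a * \<gamma> k))" .
  qed
qed

lemma nn_integral_exp_V_X0:
  obtains c K where "0 < c" "0 \<le> K"
    "\<And>a. a \<le> c \<Longrightarrow> (\<integral>\<^sup>+\<omega>. ennreal (exp (a * V (X0 \<omega>))) \<partial>M) \<le> ennreal (exp K)"
proof -
  obtain l where l: "0 < l" "integrable M (\<lambda>\<omega>. exp (l * (norm (X0 \<omega>))\<^sup>2))" using X0_exp by blast
  define c where "c = 2 * l / CV"
  have c: "0 < c" "c * (CV / 2) = l" using l CV_pos by (auto simp: c_def)
  define I where "I = (\<integral>\<omega>. exp (c * (2 * V 0) + l * (norm (X0 \<omega>))\<^sup>2) \<partial>M)"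
  have int: "integrable M (\<lambda>\<omega>. exp (c * (2 * V 0) + l * (norm (X0 \<omega>))\<^sup>2))"
    using l(2) by (simp add: exp_add)
  have "(\<integral>\<^sup>+\<omega>. ennreal (exp (a * V (X0 \<omega>))) \<partial>M) \<le> ennreal (exp I)" if "a \<le> c" for a
  proof -
    have "(\<integral>\<^sup>+\<omega>. ennreal (exp (a * V (X0 \<omega>))) \<partial>M)
        \<le> (\<integral>\<^sup>+\<omega>. ennreal (exp (c * (2 * V 0) + l * (norm (X0 \<omega>))\<^sup>2)) \<partial>M)"
    proof (intro nn_integral_mono ennreal_leI)
      fix \<omega>
      have "a * V (X0 \<omega>) \<le> c * V (X0 \<omega>)" using that V_pos[of "X0 \<omega>"] by (intro mult_right_mono) auto
      also have "\<dots> \<le> c * (2 * V 0 + CV / 2 * (norm (X0 \<omega>))\<^sup>2)"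
        using c(1) V_le_quadratic[of "X0 \<omega>"] by (intro mult_left_mono) auto
      also have "\<dots> = c * (2 * V 0) + l * (norm (X0 \<omega>))\<^sup>2"
        using c(2) by (simp add: distrib_left flip: mult.assoc)
      finally show "exp (a * V (X0 \<omega>)) \<le> exp (c * (2 * V 0) + l * (norm (X0 \<omega>))\<^sup>2)" by simp
    qed
    also have "\<dots> = ennreal I" unfolding I_def by (intro nn_integral_eq_integral int) auto
    also have "\<dots> \<le> ennreal (exp I)" using exp_ge_add_one_self[of I] by (intro ennreal_leI) linarith
    finally show ?thesis .
  qed
  moreover have "0 \<le> I" by (simp add: I_def)
  ultimately show ?thesis using c(1) that by blast
qed

text \<open>Induction on \<open>n\<close> works for every coefficient of \<open>V (X n)\<close> up to a fixed threshold: one step contracts the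
  coefficient by \<open>1 - r \<gamma>\<close>, which makes room for the next weight.\<close>

lemma weighted_exp_moment:
  obtains c K where "0 < c" "0 \<le> K"
    "\<And>n w. (\<And>k. 1 \<le> k \<Longrightarrow> k \<le> n \<Longrightarrow> 0 \<le> w k \<and> w k \<le> c * \<gamma> k) \<Longrightarrow>
      (\<integral>\<^sup>+\<omega>. ennreal (exp (c * V (X n \<omega>) + c * V (X0 \<omega>) + (\<Sum>k=1..n. w k * V (X (k - 1) \<omega>)))) \<partial>M)
      \<le> ennreal (exp (K * (1 + (\<Sum>k=1..n. w k))))"
proof -
  obtain c1 r C where S: "0 < c1" "0 < r" "0 \<le> C" "\<And>k. 1 \<le> k \<Longrightarrow> r * \<gamma> k \<le> 1"
    "\<And>a k x. 0 \<le> a \<Longrightarrow> a \<le> c1 \<Longrightarrow> 1 \<le> k \<Longrightarrow>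
       (\<integral>\<^sup>+u. ennreal (exp (a * V (step k x u))) \<partial>mu) \<le> ennreal (exp (a * (1 - r * \<gamma> k) * V x + C * a * \<gamma> k))"
    using lyapunov_step by blast
  obtain c0 K0 where Z: "0 < c0" "0 \<le> K0"
    "\<And>a. a \<le> c0 \<Longrightarrow> (\<integral>\<^sup>+\<omega>. ennreal (exp (a * V (X0 \<omega>))) \<partial>M) \<le> ennreal (exp K0)"
    using nn_integral_exp_V_X0 by blast
  \<comment> \<open>Half of \<open>c0\<close>, because at time \<open>0\<close> the coefficient of
    \<open>V (X0)\<close> is \<open>a + c2 \<le> 2 * c2\<close>.\<close>
  define c2 where "c2 = min c1 (c0 / 2)"
  have c2: "0 < c2" "c2 \<le> c1" "2 * c2 \<le> c0" using S Z by (auto simp: c2_def)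
  have [measurable]: "V \<in> borel_measurable borel" by (rule borel_measurable_continuous_onI[OF V_cont])
  have main: "(\<integral>\<^sup>+\<omega>. ennreal (exp (a * V (X n \<omega>) + c2 * V (X0 \<omega>) + (\<Sum>k=1..n. w k * V (X (k - 1) \<omega>)))) \<partial>M)
      \<le> ennreal (exp (C / r * (a + (\<Sum>k=1..n. w k)) + K0))"
    if "0 \<le> a" "a \<le> c2" "\<And>k. 1 \<le> k \<Longrightarrow> k \<le> n \<Longrightarrow> 0 \<le> w k \<and> w k \<le> c2 * r * \<gamma> k" for a n w
    using that
  proof (induction n arbitrary: a)
    case 0
    have "(\<integral>\<^sup>+\<omega>. ennreal (exp ((a + c2) * V (X0 \<omega>))) \<partial>M) \<le> ennreal (exp K0)"
      using 0 c2 by (intro Z(3)) auto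
    also have "\<dots> \<le> ennreal (exp (C / r * a + K0))" using 0 S by (intro ennreal_leI) simp
    finally show ?case by (simp add: distrib_right)
  next
    case (Suc n)
    let ?g = "\<gamma> (Suc n)" and ?w = "w (Suc n)"
    \<comment> \<open>Coefficient of \<open>V (X n)\<close> once the last step is integrated out.
      The contraction leaves room \<open>c2 * r * \<gamma>\<close> for the weight
      \<open>w (Suc n)\<close>, so the coefficient stays below \<open>c2\<close>.\<close>
    let ?a' = "a * (1 - r * ?g) + ?w"
    let ?A = "\<lambda>\<omega>. c2 * V (X0 \<omega>) + (\<Sum>k=1..n. w k * V (X (k - 1) \<omega>)) + ?w * V (X n \<omega>)"
    have rg: "0 \<le> 1 - r * ?g" using S(4)[of "Suc n"] by simp
    have a': "0 \<le> ?a'" "?a' \<le> c2"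
    proof -
      show "0 \<le> ?a'" using rg Suc.prems(1) Suc.prems(3)[of "Suc n"] by auto
      have "?a' \<le> c2 * (1 - r * ?g) + c2 * r * ?g"
        using rg Suc.prems(2) Suc.prems(3)[of "Suc n"] by (intro add_mono mult_right_mono) auto
      then show "?a' \<le> c2" by (simp add: algebra_simps)
    qed
    have [measurable]: "X n \<in> borel_measurable (history n)" "X0 \<in> borel_measurable (history n)"
      by (simp_all add: X_history X0_history)
    have [measurable]: "X (k - 1) \<in> borel_measurable (history n)" if "k \<in> {1..n}" for k
      using that by (intro X_history) auto
    have m: "?A \<in> borel_measurable (history n)" by measurable
    have st: "case_prod (\<lambda>x u. a * V (step (Suc n) x u)) \<in> borel_measurable (borel \<Otimes>\<^sub>M borel)"
      unfolding case_prod_unfold by measurable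
    have "(\<integral>\<^sup>+\<omega>. ennreal (exp (a * V (X (Suc n) \<omega>) + c2 * V (X0 \<omega>) + (\<Sum>k=1..Suc n. w k * V (X (k - 1) \<omega>)))) \<partial>M)
       = (\<integral>\<^sup>+\<omega>. ennreal (exp (?A \<omega> + a * V (step (Suc n) (X n \<omega>) (U (Suc n) \<omega>)))) \<partial>M)"
      by (simp only: X_Suc) (simp add: add_ac)
    also have "\<dots> \<le> (\<integral>\<^sup>+\<omega>. ennreal (exp (?A \<omega> + (a * (1 - r * ?g) * V (X n \<omega>) + C * a * ?g))) \<partial>M)"
      using Suc.prems c2 by (intro nn_integral_exp_history_le m st S(5) X_history) auto
    also have "\<dots> = (\<integral>\<^sup>+\<omega>. ennreal (exp (C * a * ?g)) *
        ennreal (exp (?a' * V (X n \<omega>) + c2 * V (X0 \<omega>) + (\<Sum>k=1..n. w k * V (X (k - 1) \<omega>)))) \<partial>M)"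
      by (intro nn_integral_cong) (simp add: exp_add[symmetric] ennreal_mult[symmetric] algebra_simps)
    also have "\<dots> = ennreal (exp (C * a * ?g)) *
        (\<integral>\<^sup>+\<omega>. ennreal (exp (?a' * V (X n \<omega>) + c2 * V (X0 \<omega>) + (\<Sum>k=1..n. w k * V (X (k - 1) \<omega>)))) \<partial>M)"
    proof (rule nn_integral_cmult)
      have "(\<lambda>\<omega>. ennreal (exp (?a' * V (X n \<omega>) + c2 * V (X0 \<omega>) + (\<Sum>k=1..n. w k * V (X (k - 1) \<omega>))))) \<in> borel_measurable (history n)"
        by measurable
      then show "(\<lambda>\<omega>. ennreal (exp (?a' * V (X n \<omega>) + c2 * V (X0 \<omega>) + (\<Sum>k=1..n. w k * V (X (k - 1) \<omega>))))) \<in> borel_measurable M"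
        by (rule history_measurable)
    qed
    also have "\<dots> \<le> ennreal (exp (C * a * ?g)) * ennreal (exp (C / r * (?a' + (\<Sum>k=1..n. w k)) + K0))"
      using Suc.prems by (intro mult_left_mono Suc.IH a') auto
    also have "\<dots> = ennreal (exp (C * a * ?g + (C / r * (?a' + (\<Sum>k=1..n. w k)) + K0)))"
      by (simp add: exp_add ennreal_mult)
    \<comment> \<open>The factor \<open>C / r\<close> is tailored to this identity: the loss
      \<open>C * a * \<gamma>\<close> of one step is \<open>C / r\<close> times the amount
      \<open>a * r * \<gamma>\<close> by which the coefficient shrinks.\<close>
    also have "C * a * ?g + (C / r * (?a' + (\<Sum>k=1..n. w k)) + K0) = C / r * (a + (\<Sum>k=1..Suc n. w k)) + K0"
      using S(2) by (simp add: field_simps)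
    finally show ?case .
  qed
  define c where "c = min c2 (c2 * r)"
  define K where "K = C / r * (c2 + 1) + K0"
  have cc: "0 < c" "c \<le> c2" "c \<le> c2 * r" using c2 S by (auto simp: c_def)
  have K: "0 \<le> K" "C / r * c2 + K0 \<le> K" "C / r \<le> K" using S Z c2 by (auto simp: K_def distrib_left)
  show ?thesis
  proof (rule that[OF cc(1) K(1)])
    fix n w assume w: "\<And>k. 1 \<le> k \<Longrightarrow> k \<le> n \<Longrightarrow> 0 \<le> w k \<and> w k \<le> c * \<gamma> k"
    have w': "0 \<le> w k \<and> w k \<le> c2 * r * \<gamma> k" if "1 \<le> k" "k \<le> n" for k
      using w[OF that] order_trans[OF _ mult_right_mono[OF cc(3), of "\<gamma> k"]] \<gamma>_pos[OF that(1)] by auto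
    let ?W = "\<Sum>k=1..n. w k"
    have W: "0 \<le> ?W" using w by (intro sum_nonneg) auto
    have "(\<integral>\<^sup>+\<omega>. ennreal (exp (c * V (X n \<omega>) + c * V (X0 \<omega>) + (\<Sum>k=1..n. w k * V (X (k - 1) \<omega>)))) \<partial>M)
       \<le> (\<integral>\<^sup>+\<omega>. ennreal (exp (c2 * V (X n \<omega>) + c2 * V (X0 \<omega>) + (\<Sum>k=1..n. w k * V (X (k - 1) \<omega>)))) \<partial>M)"
    proof (intro nn_integral_mono ennreal_leI)
      fix \<omega>
      have "c * V z \<le> c2 * V z" for z using cc V_pos[of z] by (intro mult_right_mono) auto
      from this[of "X n \<omega>"] this[of "X0 \<omega>"]
      show "exp (c * V (X n \<omega>) + c * V (X0 \<omega>) + (\<Sum>k=1..n. w k * V (X (k - 1) \<omega>)))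
         \<le> exp (c2 * V (X n \<omega>) + c2 * V (X0 \<omega>) + (\<Sum>k=1..n. w k * V (X (k - 1) \<omega>)))" by simp
    qed
    also have "\<dots> \<le> ennreal (exp (C / r * (c2 + ?W) + K0))"
      using w' c2 by (intro main) auto
    also have "\<dots> \<le> ennreal (exp (K * (1 + ?W)))"
      using K mult_right_mono[OF K(3) W] by (intro ennreal_leI) (simp add: distrib_left)
    finally show "(\<integral>\<^sup>+\<omega>. ennreal (exp (c * V (X n \<omega>) + c * V (X0 \<omega>) + (\<Sum>k=1..n. w k * V (X (k - 1) \<omega>)))) \<partial>M)
      \<le> ennreal (exp (K * (1 + ?W)))" .
  qed
qed

end

section \<open>Exponential martingale bounds\<close>

text \<open>Hoelder's inequality in logarithmic form: normalise both exponentials to mean at most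
  \<open>1\<close> and apply convexity of \<open>exp\<close> pointwise. It separates a martingale
  from a remainder that depends on it.\<close>

lemma (in prob_space) nn_integral_exp_convex:
  assumes [measurable]: "A \<in> borel_measurable M" "B \<in> borel_measurable M"
    and t: "0 \<le> t" "t \<le> 1"
    and A: "(\<integral>\<^sup>+\<omega>. ennreal (exp (A \<omega>)) \<partial>M) \<le> ennreal (exp \<alpha>)"
    and B: "(\<integral>\<^sup>+\<omega>. ennreal (exp (B \<omega>)) \<partial>M) \<le> ennreal (exp \<beta>)"
  shows "(\<integral>\<^sup>+\<omega>. ennreal (exp (t * A \<omega> + (1 - t) * B \<omega>)) \<partial>M) \<le> ennreal (exp (t * \<alpha> + (1 - t) * \<beta>))"
proof -
  have normalised: "(\<integral>\<^sup>+\<omega>. ennreal (exp (A \<omega> - \<alpha>)) \<partial>M) \<le> 1"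
    if [measurable]: "A \<in> borel_measurable M" and A: "(\<integral>\<^sup>+\<omega>. ennreal (exp (A \<omega>)) \<partial>M) \<le> ennreal (exp \<alpha>)" for A \<alpha>
  proof -
    have "(\<integral>\<^sup>+\<omega>. ennreal (exp (A \<omega> - \<alpha>)) \<partial>M) = (\<integral>\<^sup>+\<omega>. ennreal (exp (- \<alpha>)) * ennreal (exp (A \<omega>)) \<partial>M)"
      by (simp flip: ennreal_mult exp_add)
    also have "\<dots> = ennreal (exp (- \<alpha>)) * (\<integral>\<^sup>+\<omega>. ennreal (exp (A \<omega>)) \<partial>M)"
      by (rule nn_integral_cmult) measurable
    also have "\<dots> \<le> ennreal (exp (- \<alpha>)) * ennreal (exp \<alpha>)" by (intro mult_left_mono A) simp
    also have "\<dots> = 1" by (simp flip: ennreal_mult exp_add)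
    finally show ?thesis .
  qed
  have "(\<integral>\<^sup>+\<omega>. ennreal (exp (t * A \<omega> + (1 - t) * B \<omega>)) \<partial>M)
     \<le> (\<integral>\<^sup>+\<omega>. ennreal (exp (t * \<alpha> + (1 - t) * \<beta>)) *
        (ennreal t * ennreal (exp (A \<omega> - \<alpha>)) + ennreal (1 - t) * ennreal (exp (B \<omega> - \<beta>))) \<partial>M)"
  proof (rule nn_integral_mono)
    fix \<omega>
    have "exp ((1 - t) *\<^sub>R (B \<omega> - \<beta>) + t *\<^sub>R (A \<omega> - \<alpha>)) \<le> (1 - t) * exp (B \<omega> - \<beta>) + t * exp (A \<omega> - \<alpha>)"
      using t by (intro convex_onD[OF exp_convex]) auto
    then have "exp (t * \<alpha> + (1 - t) * \<beta>) * exp (t * (A \<omega> - \<alpha>) + (1 - t) * (B \<omega> - \<beta>))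
      \<le> exp (t * \<alpha> + (1 - t) * \<beta>) * (t * exp (A \<omega> - \<alpha>) + (1 - t) * exp (B \<omega> - \<beta>))"
      by (intro mult_left_mono) (auto simp: add_ac)
    moreover have "exp (t * \<alpha> + (1 - t) * \<beta>) * exp (t * (A \<omega> - \<alpha>) + (1 - t) * (B \<omega> - \<beta>)) = exp (t * A \<omega> + (1 - t) * B \<omega>)"
      by (simp add: algebra_simps flip: exp_add)
    ultimately show "ennreal (exp (t * A \<omega> + (1 - t) * B \<omega>)) \<le> ennreal (exp (t * \<alpha> + (1 - t) * \<beta>)) *
        (ennreal t * ennreal (exp (A \<omega> - \<alpha>)) + ennreal (1 - t) * ennreal (exp (B \<omega> - \<beta>)))"
      using t by (simp flip: ennreal_mult ennreal_plus)
  qed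
  also have "\<dots> = ennreal (exp (t * \<alpha> + (1 - t) * \<beta>)) *
     (ennreal t * (\<integral>\<^sup>+\<omega>. ennreal (exp (A \<omega> - \<alpha>)) \<partial>M) + ennreal (1 - t) * (\<integral>\<^sup>+\<omega>. ennreal (exp (B \<omega> - \<beta>)) \<partial>M))"
    by (simp add: nn_integral_cmult nn_integral_add)
  also have "\<dots> \<le> ennreal (exp (t * \<alpha> + (1 - t) * \<beta>)) * (ennreal t * 1 + ennreal (1 - t) * 1)"
    by (intro mult_left_mono add_mono normalised A B assms(1,2)) auto
  also have "\<dots> = ennreal (exp (t * \<alpha> + (1 - t) * \<beta>))"
    using t by (simp flip: ennreal_plus)
  finally show ?thesis .
qed

lemma (in prob_space) nn_integral_exp_scale:
  assumes [measurable]: "A \<in> borel_measurable M"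
    and t: "0 \<le> t" "t \<le> 1"
    and A: "(\<integral>\<^sup>+\<omega>. ennreal (exp (A \<omega>)) \<partial>M) \<le> ennreal (exp \<alpha>)"
  shows "(\<integral>\<^sup>+\<omega>. ennreal (exp (t * A \<omega>)) \<partial>M) \<le> ennreal (exp (t * \<alpha>))"
  using nn_integral_exp_convex[of A "\<lambda>_. 0" t \<alpha> 0] assms emeasure_space_1 by simp

lemma (in prob_space) chernoff:
  assumes [measurable]: "Z \<in> borel_measurable M"
    and le: "(\<integral>\<^sup>+\<omega>. ennreal (exp (Z \<omega>)) \<partial>M) \<le> ennreal (exp \<alpha>)"
  shows "prob {\<omega>\<in>space M. z \<le> Z \<omega>} \<le> exp (\<alpha> - z)"
proof -
  have "emeasure M {\<omega>\<in>space M. z \<le> Z \<omega>} = (\<integral>\<^sup>+\<omega>. indicator {\<omega>\<in>space M. z \<le> Z \<omega>} \<omega> \<partial>M)"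
    by (subst nn_integral_indicator) measurable
  also have "\<dots> \<le> (\<integral>\<^sup>+\<omega>. ennreal (exp (- z)) * ennreal (exp (Z \<omega>)) \<partial>M)"
    by (intro nn_integral_mono) (auto simp: indicator_def simp flip: ennreal_mult exp_add)
  also have "\<dots> = ennreal (exp (- z)) * (\<integral>\<^sup>+\<omega>. ennreal (exp (Z \<omega>)) \<partial>M)"
    by (rule nn_integral_cmult) measurable
  also have "\<dots> \<le> ennreal (exp (- z)) * ennreal (exp \<alpha>)" by (intro mult_left_mono le) simp
  also have "\<dots> = ennreal (exp (\<alpha> - z))" by (simp flip: ennreal_mult exp_add)
  finally show ?thesis by (simp add: emeasure_eq_measure)
qed

context euler_scheme
begin

definition transition :: "nat \<Rightarrow> (real^'d \<Rightarrow> real) \<Rightarrow> real^'d \<Rightarrow> real" where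
  "transition k f x = (\<integral>u. f (step k x u) \<partial>mu)"

definition mart :: "(real^'d \<Rightarrow> real) \<Rightarrow> nat \<Rightarrow> 'w \<Rightarrow> real" where
  "mart f n \<omega> = (\<Sum>k=1..n. f (X k \<omega>) - transition k f (X (k - 1) \<omega>))"

lemma lipschitz_measurable:
  fixes f :: "real^'n \<Rightarrow> real"
  assumes "\<And>x y. \<bar>f x - f y\<bar> \<le> L * norm (x - y)" "0 \<le> L"
  shows "f \<in> borel_measurable borel"
  using lipschitz_on_continuous_on[OF lipschitz_onI[of UNIV f L]] assms
  by (intro borel_measurable_continuous_onI) (auto simp: dist_real_def dist_norm)

lemma measurable_transition:
  assumes [measurable]: "f \<in> borel_measurable borel"
  shows "transition k f \<in> borel_measurable borel"
  unfolding transition_def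
  by (rule mu.borel_measurable_lebesgue_integral) (simp add: case_prod_unfold)

lemma transition_linear:
  assumes "integrable mu (\<lambda>u. f (step k x u))" "integrable mu (\<lambda>u. g (step k x u))"
  shows "transition k (\<lambda>y. c * f y + d * g y) x = c * transition k f x + d * transition k g x"
  using assms by (simp add: transition_def)

lemma integrable_step:
  assumes f: "\<And>x y. \<bar>f x - f y\<bar> \<le> L * norm (x - y)" "0 \<le> L" "1 \<le> k"
  shows "integrable mu (\<lambda>u. f (step k x u))"
  by (rule concentration_mu(1)[OF step_lipschitz[OF f]])

lemma mart_linear:
  assumes f: "\<And>x y. \<bar>f x - f y\<bar> \<le> L * norm (x - y)" "0 \<le> L"
    and g: "\<And>x y. \<bar>g x - g y\<bar> \<le> L' * norm (x - y)" "0 \<le> L'"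
  shows "mart (\<lambda>y. c * f y + d * g y) n \<omega> = c * mart f n \<omega> + d * mart g n \<omega>"
proof -
  have "transition k (\<lambda>y. c * f y + d * g y) x = c * transition k f x + d * transition k g x" if "1 \<le> k" for k x
    using that integrable_step[OF f] integrable_step[OF g] by (intro transition_linear) auto
  then show ?thesis
    by (simp add: mart_def sum_distrib_left sum.distrib[symmetric] algebra_simps cong: sum.cong_simp)
qed

lemma telescope:
  "f (X n \<omega>) - f (X 0 \<omega>) = mart f n \<omega> + (\<Sum>k=1..n. transition k f (X (k - 1) \<omega>) - f (X (k - 1) \<omega>))"
  by (induction n) (simp_all add: mart_def)

lemma sum_X_history:
  fixes g :: "nat \<Rightarrow> real^'d \<Rightarrow> real"
  assumes "\<And>k. 1 \<le> k \<Longrightarrow> g k \<in> borel_measurable borel"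
  shows "(\<lambda>\<omega>. \<Sum>k=1..n. g k (X (k - 1) \<omega>)) \<in> borel_measurable (history n)"
  using assms by (intro borel_measurable_sum measurable_compose[OF X_history]) auto

lemma mart_history:
  assumes f: "f \<in> borel_measurable borel"
  shows "mart f n \<in> borel_measurable (history n)"
  unfolding mart_def[abs_def]
  by (intro borel_measurable_sum borel_measurable_diff measurable_compose[OF X_history]
      f measurable_transition[OF f]) auto

text \<open>Given the past, the increment is Lipschitz in the fresh innovation and centred, so its
  exponential moment is at most \<open>exp (L\<^sup>2 * \<gamma> * |\<sigma>|\<^sup>2 / 2)\<close>;
  subtracting that exponent makes a supermartingale. The larger \<open>S\<close> takes the place of
  the operator norm because the Poisson equation is available for
  \<open>N (\<sigma>)\<^sup>2\<close>.\<close>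

lemma mart_exp:
  assumes f: "\<And>x y. \<bar>f x - f y\<bar> \<le> L * norm (x - y)" "0 \<le> L"
    and [measurable]: "S \<in> borel_measurable borel" and S: "\<And>x. op_norm (\<sigma> x) \<le> S x"
  shows "(\<integral>\<^sup>+\<omega>. ennreal (exp (mart f n \<omega> - L\<^sup>2 / 2 * (\<Sum>k=1..n. \<gamma> k * (S (X (k - 1) \<omega>))\<^sup>2))) \<partial>M) \<le> ennreal (exp 0)"
proof (induction n)
  case 0
  then show ?case by (simp add: mart_def emeasure_space_1)
next
  case (Suc n)
  note [measurable] = lipschitz_measurable[OF f] measurable_transition[OF lipschitz_measurable[OF f]]
  let ?A = "\<lambda>\<omega>. mart f n \<omega> - L\<^sup>2 / 2 * (\<Sum>k=1..n. \<gamma> k * (S (X (k - 1) \<omega>))\<^sup>2)"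
  let ?h = "\<lambda>x u. f (step (Suc n) x u) - transition (Suc n) f x - L\<^sup>2 / 2 * \<gamma> (Suc n) * (S x)\<^sup>2"
  have A: "?A \<in> borel_measurable (history n)"
    using mart_history[of f n] sum_X_history[of "\<lambda>k x. \<gamma> k * (S x)\<^sup>2" n] by measurable
  have "(\<integral>\<^sup>+u. ennreal (exp (?h x u)) \<partial>mu) \<le> ennreal (exp 0)" for x
  proof -
    let ?c = "- transition (Suc n) f x - L\<^sup>2 / 2 * \<gamma> (Suc n) * (S x)\<^sup>2"
    let ?L = "L * (sqrt (\<gamma> (Suc n)) * op_norm (\<sigma> x))"
    have [measurable]: "(\<lambda>u. f (step (Suc n) x u)) \<in> borel_measurable borel"
      using integrable_step[OF f, of "Suc n" x] by (auto dest: borel_measurable_integrable)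
    have L: "?L\<^sup>2 \<le> L\<^sup>2 * \<gamma> (Suc n) * (S x)\<^sup>2"
    proof -
      have "(op_norm (\<sigma> x))\<^sup>2 \<le> (S x)\<^sup>2" using S op_norm_nonneg by (intro power_mono) auto
      then show ?thesis using \<gamma>_pos[of "Suc n"]
        by (simp add: power_mult_distrib mult_left_mono mult.assoc)
    qed
    have "(\<integral>\<^sup>+u. ennreal (exp (?h x u)) \<partial>mu) = (\<integral>\<^sup>+u. ennreal (exp ?c) * ennreal (exp (1 * f (step (Suc n) x u))) \<partial>mu)"
      by (simp add: algebra_simps flip: ennreal_mult exp_add)
    also have "\<dots> = ennreal (exp ?c) * (\<integral>\<^sup>+u. ennreal (exp (1 * f (step (Suc n) x u))) \<partial>mu)"
      by (rule nn_integral_cmult) measurable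
    also have "\<dots> \<le> ennreal (exp ?c) * ennreal (exp (1 * (\<integral>u. f (step (Suc n) x u) \<partial>mu) + 1\<^sup>2 * ?L\<^sup>2 / 2))"
      by (intro mult_left_mono concentration_mu(2) step_lipschitz f) auto
    also have "\<dots> = ennreal (exp (?c + (1 * (\<integral>u. f (step (Suc n) x u) \<partial>mu) + 1\<^sup>2 * ?L\<^sup>2 / 2)))"
      by (simp flip: ennreal_mult exp_add)
    also have "\<dots> \<le> ennreal (exp 0)" using L by (intro ennreal_leI) (simp add: transition_def)
    finally show ?thesis .
  qed
  then have "(\<integral>\<^sup>+\<omega>. ennreal (exp (?A \<omega> + ?h (X n \<omega>) (U (Suc n) \<omega>))) \<partial>M) \<le> (\<integral>\<^sup>+\<omega>. ennreal (exp (?A \<omega> + 0)) \<partial>M)"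
    by (intro nn_integral_exp_history_le A X_history) (auto simp: case_prod_unfold)
  also have "\<dots> \<le> ennreal (exp 0)" using Suc.IH by simp
  also have "(\<integral>\<^sup>+\<omega>. ennreal (exp (?A \<omega> + ?h (X n \<omega>) (U (Suc n) \<omega>))) \<partial>M)
    = (\<integral>\<^sup>+\<omega>. ennreal (exp (mart f (Suc n) \<omega> - L\<^sup>2 / 2 * (\<Sum>k=1..Suc n. \<gamma> k * (S (X (k - 1) \<omega>))\<^sup>2))) \<partial>M)"
    by (intro nn_integral_cong arg_cong[where f = ennreal] arg_cong[where f = exp])
      (simp add: mart_def X_Suc algebra_simps del: scheme.simps(2))
  finally show ?case .
qed

end

lemma young_sqrt:
  fixes a c v :: real
  assumes "0 < c" "0 \<le> v" shows "a * sqrt v \<le> a\<^sup>2 / (4 * c) + c * v"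
proof -
  have "0 \<le> (a / 2 - c * sqrt v)\<^sup>2" by simp
  then have "c * (a * sqrt v) \<le> a\<^sup>2 / 4 + c * c * v" using assms
    by (simp add: power2_eq_square algebra_simps)
  then have "a * sqrt v \<le> (a\<^sup>2 / 4 + c * c * v) / c" using assms by (simp add: field_simps)
  also have "\<dots> = a\<^sup>2 / (4 * c) + c * v" using assms by (simp add: field_simps)
  finally show ?thesis .
qed

section \<open>Exponential moments of the remainders\<close>

context lyapunov_scheme
begin

text \<open>\<open>remainder f l\<close> dominates the difference between \<open>\<Sum> (transition k f - f - l k) (X (k - 1))\<close> and
  the martingale \<open>- mart f\<close>.\<close>

definition remainder :: "(real^'d \<Rightarrow> real) \<Rightarrow> (nat \<Rightarrow> real^'d \<Rightarrow> real) \<Rightarrow> nat \<Rightarrow> 'w \<Rightarrow> real" where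
  "remainder f l n \<omega> = \<bar>f (X n \<omega>)\<bar> + \<bar>f (X 0 \<omega>)\<bar> + (\<Sum>k=1..n. \<bar>l k (X (k - 1) \<omega>)\<bar>)"

lemma remainder_measurable:
  assumes "f \<in> borel_measurable borel" "\<And>k. 1 \<le> k \<Longrightarrow> l k \<in> borel_measurable borel"
  shows "remainder f l n \<in> borel_measurable M"
  unfolding remainder_def[abs_def] using assms
  by (intro borel_measurable_add borel_measurable_sum borel_measurable_abs measurable_compose[OF X_measurable]) auto

lemma Gam_pos: "1 \<le> n \<Longrightarrow> \<gamma> 1 \<le> Gam \<gamma> n"
  unfolding Gam_def using \<gamma>_pos by (intro member_le_sum) (auto simp: less_imp_le)

lemma Gam_nonneg: "0 \<le> Gam \<gamma> n"
  unfolding Gam_def using \<gamma>_pos by (intro sum_nonneg) (auto simp: less_imp_le)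

text \<open>Young's inequality shifts a large \<open>a\<close> away from \<open>V\<close>: the
  coefficient of \<open>V\<close> stays at the threshold \<open>c\<close> of
  \<open>weighted_exp_moment\<close>, at the price of a term of order
  \<open>a\<^sup>2 * \<Gamma>\<close>. That price has the order of the Gaussian exponent itself, so
  the bound suits only crude estimates.\<close>

lemma remainder_exp_all:
  assumes f: "\<And>x. \<bar>f x\<bar> \<le> C * sqrt (V x)" and C: "0 \<le> C"
    and l: "\<And>k x. 1 \<le> k \<Longrightarrow> \<bar>l k x\<bar> \<le> C * \<gamma> k * sqrt (V x)"
  obtains K where "0 \<le> K" "\<And>a n. 0 \<le> a \<Longrightarrow>
    (\<integral>\<^sup>+\<omega>. ennreal (exp (a * remainder f l n \<omega>)) \<partial>M) \<le> ennreal (exp (K * (1 + a\<^sup>2) * (1 + Gam \<gamma> n)))"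
proof -
  obtain c K where W: "0 < c" "0 \<le> K"
    "\<And>n w. (\<And>k. 1 \<le> k \<Longrightarrow> k \<le> n \<Longrightarrow> 0 \<le> w k \<and> w k \<le> c * \<gamma> k) \<Longrightarrow>
      (\<integral>\<^sup>+\<omega>. ennreal (exp (c * V (X n \<omega>) + c * V (X0 \<omega>) + (\<Sum>k=1..n. w k * V (X (k - 1) \<omega>)))) \<partial>M)
      \<le> ennreal (exp (K * (1 + (\<Sum>k=1..n. w k))))"
    using weighted_exp_moment by blast
  define D where "D = C\<^sup>2 / (4 * c)"
  have D: "0 \<le> D" using W by (simp add: D_def)
  show ?thesis
  proof (rule that[of "2 * D + K * (1 + c)"])
    show "0 \<le> 2 * D + K * (1 + c)" using D W by simp
    fix a :: real and n assume a: "0 \<le> a"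
    have y: "a * C * sqrt (V x) \<le> D * a\<^sup>2 + c * V x" for x
      using young_sqrt[OF W(1), of "V x" "a * C"] V_pos[of x] by (simp add: D_def power_mult_distrib mult.commute)
    have f': "a * \<bar>f x\<bar> \<le> D * a\<^sup>2 + c * V x" for x
      using y[of x] mult_left_mono[OF f[of x] a] by (simp add: mult.assoc)
    have l': "a * \<bar>l k x\<bar> \<le> D * a\<^sup>2 * \<gamma> k + c * \<gamma> k * V x" if "1 \<le> k" for k x
    proof -
      have "a * \<bar>l k x\<bar> \<le> a * (C * \<gamma> k * sqrt (V x))" by (intro mult_left_mono l that a)
      also have "\<dots> = \<gamma> k * (a * C * sqrt (V x))" by simp
      also have "\<dots> \<le> \<gamma> k * (D * a\<^sup>2 + c * V x)" using \<gamma>_pos[OF that] y by (intro mult_left_mono) auto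
      finally show ?thesis by (simp add: algebra_simps)
    qed
    have "(\<integral>\<^sup>+\<omega>. ennreal (exp (a * remainder f l n \<omega>)) \<partial>M)
       \<le> (\<integral>\<^sup>+\<omega>. ennreal (exp (D * a\<^sup>2 * (2 + Gam \<gamma> n))) *
           ennreal (exp (c * V (X n \<omega>) + c * V (X0 \<omega>) + (\<Sum>k=1..n. c * \<gamma> k * V (X (k - 1) \<omega>)))) \<partial>M)"
    proof (rule nn_integral_mono)
      fix \<omega>
      have "a * remainder f l n \<omega> = a * \<bar>f (X n \<omega>)\<bar> + a * \<bar>f (X 0 \<omega>)\<bar> + (\<Sum>k=1..n. a * \<bar>l k (X (k - 1) \<omega>)\<bar>)"
        by (simp add: remainder_def distrib_left sum_distrib_left)
      also have "\<dots> \<le> (D * a\<^sup>2 + c * V (X n \<omega>)) + (D * a\<^sup>2 + c * V (X 0 \<omega>))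
          + (\<Sum>k=1..n. D * a\<^sup>2 * \<gamma> k + c * \<gamma> k * V (X (k - 1) \<omega>))"
        by (intro add_mono f' sum_mono l') auto
      also have "\<dots> = D * a\<^sup>2 * (2 + Gam \<gamma> n) + (c * V (X n \<omega>) + c * V (X0 \<omega>) + (\<Sum>k=1..n. c * \<gamma> k * V (X (k - 1) \<omega>)))"
        by (simp add: Gam_def sum.distrib sum_distrib_left algebra_simps)
      finally show "ennreal (exp (a * remainder f l n \<omega>)) \<le> ennreal (exp (D * a\<^sup>2 * (2 + Gam \<gamma> n))) *
           ennreal (exp (c * V (X n \<omega>) + c * V (X0 \<omega>) + (\<Sum>k=1..n. c * \<gamma> k * V (X (k - 1) \<omega>))))"
        by (simp flip: ennreal_mult exp_add)
    qed
    also have "\<dots> = ennreal (exp (D * a\<^sup>2 * (2 + Gam \<gamma> n))) *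
       (\<integral>\<^sup>+\<omega>. ennreal (exp (c * V (X n \<omega>) + c * V (X0 \<omega>) + (\<Sum>k=1..n. c * \<gamma> k * V (X (k - 1) \<omega>)))) \<partial>M)"
      using X_measurable X0_measurable V_cont
      by (intro nn_integral_cmult measurable_compose[OF _ measurable_ennreal] borel_measurable_exp
          borel_measurable_add borel_measurable_sum borel_measurable_times borel_measurable_const
          measurable_compose[OF X_measurable borel_measurable_continuous_onI[OF V_cont]]
          measurable_compose[OF X0_measurable borel_measurable_continuous_onI[OF V_cont]]
          measurable_compose[OF _ borel_measurable_exp])
    also have "\<dots> \<le> ennreal (exp (D * a\<^sup>2 * (2 + Gam \<gamma> n))) * ennreal (exp (K * (1 + (\<Sum>k=1..n. c * \<gamma> k))))"
      using W \<gamma>_pos by (intro mult_left_mono W(3)) (auto simp: less_imp_le)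
    also have "\<dots> = ennreal (exp (D * a\<^sup>2 * (2 + Gam \<gamma> n) + K * (1 + c * Gam \<gamma> n)))"
      by (simp add: Gam_def sum_distrib_left flip: ennreal_mult exp_add)
    also have "\<dots> \<le> ennreal (exp ((2 * D + K * (1 + c)) * (1 + a\<^sup>2) * (1 + Gam \<gamma> n)))"
    proof (intro ennreal_leI, simp only: exp_le_cancel_iff)
      let ?G = "Gam \<gamma> n"
      have "D * a\<^sup>2 * (2 + ?G) \<le> 2 * D * (1 + a\<^sup>2) * (1 + ?G)"
        using D Gam_nonneg[of n] mult_nonneg_nonneg[OF D zero_le_power2[of a]]
          mult_nonneg_nonneg[OF mult_nonneg_nonneg[OF D zero_le_power2[of a]] Gam_nonneg[of n]]
          mult_nonneg_nonneg[OF D Gam_nonneg[of n]]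
        by (simp add: algebra_simps)
      moreover have "K * (1 + c * ?G) \<le> K * (1 + c) * (1 + a\<^sup>2) * (1 + ?G)"
      proof -
        have "1 + c * ?G \<le> (1 + c) * (1 + ?G)" using W Gam_nonneg[of n] by (simp add: algebra_simps)
        also have "\<dots> \<le> (1 + c) * (1 + ?G) * (1 + a\<^sup>2)"
          using mult_left_mono[of 1 "1 + a\<^sup>2" "(1 + c) * (1 + ?G)"] W(1) Gam_nonneg[of n] by simp
        finally show ?thesis using W(2) by (simp add: mult_left_mono mult_ac)
      qed
      ultimately show "D * a\<^sup>2 * (2 + ?G) + K * (1 + c * ?G) \<le> (2 * D + K * (1 + c)) * (1 + a\<^sup>2) * (1 + ?G)"
        by (simp add: distrib_right)
    qed
    finally show "(\<integral>\<^sup>+\<omega>. ennreal (exp (a * remainder f l n \<omega>)) \<partial>M)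
      \<le> ennreal (exp ((2 * D + K * (1 + c)) * (1 + a\<^sup>2) * (1 + Gam \<gamma> n)))" .
  qed
qed


text \<open>The bound is linear in \<open>a\<close>, so it vanishes as \<open>a\<close> tends to \<open>0\<close>: it is proved at \<open>a1\<close> and
  transferred to smaller \<open>a\<close> by convexity.\<close>

lemma remainder_exp_bounded:
  assumes f: "\<And>x. \<bar>f x\<bar> \<le> C * sqrt (V x)" and C: "0 \<le> C"
    and l: "\<And>k x. 1 \<le> k \<Longrightarrow> \<bar>l k x\<bar> \<le> C * \<gamma> k * sqrt (V x)"
    and e: "\<And>k x. 1 \<le> k \<Longrightarrow> \<bar>l k x\<bar> \<le> C * e k * V x" "\<And>k. 1 \<le> k \<Longrightarrow> 0 \<le> e k"
      "(\<lambda>k. e k / \<gamma> k) \<longlonglongrightarrow> 0"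
    and [measurable]: "f \<in> borel_measurable borel" "\<And>k. 1 \<le> k \<Longrightarrow> l k \<in> borel_measurable borel"
    and a1: "0 < a1"
  obtains K where "0 \<le> K" "\<And>a n. 0 \<le> a \<Longrightarrow> a \<le> a1 \<Longrightarrow>
    (\<integral>\<^sup>+\<omega>. ennreal (exp (a * remainder f l n \<omega>)) \<partial>M) \<le> ennreal (exp (a * (K * (1 + (\<Sum>k=1..n. e k)))))"
proof -
  obtain c K where W: "0 < c" "0 \<le> K"
    "\<And>n w. (\<And>k. 1 \<le> k \<Longrightarrow> k \<le> n \<Longrightarrow> 0 \<le> w k \<and> w k \<le> c * \<gamma> k) \<Longrightarrow>
      (\<integral>\<^sup>+\<omega>. ennreal (exp (c * V (X n \<omega>) + c * V (X0 \<omega>) + (\<Sum>k=1..n. w k * V (X (k - 1) \<omega>)))) \<partial>M)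
      \<le> ennreal (exp (K * (1 + (\<Sum>k=1..n. w k))))"
    using weighted_exp_moment by blast
  define D where "D = (a1 * C)\<^sup>2 / (4 * c)"
  have D: "0 \<le> D" using W by (simp add: D_def)
  have "\<forall>\<^sub>F k in sequentially. e k / \<gamma> k < c / (a1 * C + 1)"
    using e(3) W(1) a1 C by (intro order_tendstoD(2)[OF e(3)]) (auto intro!: divide_pos_pos add_nonneg_pos)
  then obtain k0 where k0: "\<And>k. k0 \<le> k \<Longrightarrow> e k / \<gamma> k < c / (a1 * C + 1)"
    by (auto simp: eventually_sequentially)
  \<comment> \<open>The coefficient \<open>a1 * C * e k\<close> is known to be below the threshold
    \<open>c * \<gamma> k\<close> only for \<open>k > k0\<close>. The finitely many earlier terms
    are bounded through \<open>sqrt V\<close> and Young's inequality, at the price of the constant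
    \<open>E\<close>.\<close>
  define w where "w k = (if k \<le> k0 then c * \<gamma> k else a1 * C * e k)" for k
  have w: "0 \<le> w k \<and> w k \<le> c * \<gamma> k" if "1 \<le> k" for k
  proof (cases "k \<le> k0")
    case True then show ?thesis using W \<gamma>_pos[OF that] by (simp add: w_def)
  next
    case False
    have "a1 * C * e k \<le> (a1 * C + 1) * e k" using e(2)[OF that] by (simp add: distrib_right)
    also have "\<dots> \<le> (a1 * C + 1) * (c / (a1 * C + 1) * \<gamma> k)"
      using k0[of k] False \<gamma>_pos[OF that] a1 C
      by (intro mult_left_mono) (auto simp: pos_divide_less_eq)
    also have "\<dots> = c * \<gamma> k"
    proof -
      have "0 < a1 * C + 1" using a1 C by (intro add_nonneg_pos) auto
      then show ?thesis by (simp add: field_simps)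
    qed
    finally show ?thesis using False a1 C e(2)[OF that] by (simp add: w_def)
  qed
  have y: "a1 * C * sqrt (V x) \<le> D + c * V x" for x
    using young_sqrt[OF W(1), of "V x" "a1 * C"] V_pos[of x] by (simp add: D_def)
  have f': "a1 * \<bar>f x\<bar> \<le> D + c * V x" for x
    using order_trans[OF mult_left_mono[OF f[of x], of a1] y[of x, unfolded mult.assoc]] a1 by simp
  define E where "E = (\<Sum>k=1..k0. D * \<gamma> k)"
  have E: "0 \<le> E" using D \<gamma>_pos by (auto simp: E_def less_imp_le intro!: sum_nonneg)
  have l': "a1 * \<bar>l k x\<bar> \<le> (if k \<le> k0 then D * \<gamma> k else 0) + w k * V x" if "1 \<le> k" for k x
  proof (cases "k \<le> k0")
    case True
    have "a1 * \<bar>l k x\<bar> \<le> a1 * (C * \<gamma> k * sqrt (V x))" using a1 by (intro mult_left_mono l that) auto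
    also have "\<dots> = \<gamma> k * (a1 * C * sqrt (V x))" by simp
    also have "\<dots> \<le> \<gamma> k * (D + c * V x)" using \<gamma>_pos[OF that] y by (intro mult_left_mono) auto
    finally show ?thesis using True by (simp add: w_def algebra_simps)
  next
    case False
    then show ?thesis using mult_left_mono[OF e(1)[OF that, of x], of a1] a1 by (simp add: w_def mult.assoc)
  qed
  have sums: "(\<Sum>k=1..n. if k \<le> k0 then g k else 0) \<le> (\<Sum>k=1..k0. g k)"
    if "\<And>k. 1 \<le> k \<Longrightarrow> 0 \<le> g k" for n and g :: "nat \<Rightarrow> real"
  proof -
    have "(\<Sum>k=1..n. if k \<le> k0 then g k else 0) = (\<Sum>k\<in>{1..n} \<inter> {k. k \<le> k0}. g k)"
      by (simp add: sum.If_cases)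
    also have "\<dots> \<le> (\<Sum>k=1..k0. g k)" using that by (intro sum_mono2) auto
    finally show ?thesis .
  qed
  \<comment> \<open>Dividing by \<open>a1\<close> puts the bound at \<open>a1\<close> into the form
    \<open>a1 * (K' * ...)\<close>, which convexity scales down linearly.\<close>
  define K' where "K' = (2 * D + E + K * (1 + (\<Sum>k=1..k0. c * \<gamma> k)) + K * a1 * C) / a1"
  have G0: "0 \<le> (\<Sum>k=1..k0. c * \<gamma> k)" using \<gamma>_pos W by (auto intro!: sum_nonneg simp: less_imp_le)
  show ?thesis
  proof (rule that[of K'])
    show K': "0 \<le> K'" using D E W a1 C G0 by (simp add: K'_def)
    fix a :: real and n assume a: "0 \<le> a" "a \<le> a1"
    have m: "remainder f l n \<in> borel_measurable M" by (intro remainder_measurable) auto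
    have "(\<integral>\<^sup>+\<omega>. ennreal (exp (a1 * remainder f l n \<omega>)) \<partial>M)
       \<le> (\<integral>\<^sup>+\<omega>. ennreal (exp (2 * D + E)) *
           ennreal (exp (c * V (X n \<omega>) + c * V (X0 \<omega>) + (\<Sum>k=1..n. w k * V (X (k - 1) \<omega>)))) \<partial>M)"
    proof (rule nn_integral_mono)
      fix \<omega>
      have "a1 * remainder f l n \<omega> = a1 * \<bar>f (X n \<omega>)\<bar> + a1 * \<bar>f (X 0 \<omega>)\<bar> + (\<Sum>k=1..n. a1 * \<bar>l k (X (k - 1) \<omega>)\<bar>)"
        by (simp add: remainder_def distrib_left sum_distrib_left)
      also have "\<dots> \<le> (D + c * V (X n \<omega>)) + (D + c * V (X 0 \<omega>))
          + (\<Sum>k=1..n. (if k \<le> k0 then D * \<gamma> k else 0) + w k * V (X (k - 1) \<omega>))"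
        by (intro add_mono f' sum_mono l') auto
      also have "\<dots> = 2 * D + (\<Sum>k=1..n. if k \<le> k0 then D * \<gamma> k else 0)
          + (c * V (X n \<omega>) + c * V (X0 \<omega>) + (\<Sum>k=1..n. w k * V (X (k - 1) \<omega>)))"
        by (simp add: sum.distrib)
      also have "\<dots> \<le> 2 * D + E + (c * V (X n \<omega>) + c * V (X0 \<omega>) + (\<Sum>k=1..n. w k * V (X (k - 1) \<omega>)))"
        unfolding E_def using D \<gamma>_pos by (intro add_mono sums) (auto simp: less_imp_le)
      finally show "ennreal (exp (a1 * remainder f l n \<omega>)) \<le> ennreal (exp (2 * D + E)) *
           ennreal (exp (c * V (X n \<omega>) + c * V (X0 \<omega>) + (\<Sum>k=1..n. w k * V (X (k - 1) \<omega>))))"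
        by (simp flip: ennreal_mult exp_add)
    qed
    also have "\<dots> = ennreal (exp (2 * D + E)) *
       (\<integral>\<^sup>+\<omega>. ennreal (exp (c * V (X n \<omega>) + c * V (X0 \<omega>) + (\<Sum>k=1..n. w k * V (X (k - 1) \<omega>)))) \<partial>M)"
      using X_measurable X0_measurable V_cont
      by (intro nn_integral_cmult measurable_compose[OF _ measurable_ennreal] borel_measurable_exp
          borel_measurable_add borel_measurable_sum borel_measurable_times borel_measurable_const
          measurable_compose[OF X_measurable borel_measurable_continuous_onI[OF V_cont]]
          measurable_compose[OF X0_measurable borel_measurable_continuous_onI[OF V_cont]]
          measurable_compose[OF _ borel_measurable_exp])
    also have "\<dots> \<le> ennreal (exp (2 * D + E)) * ennreal (exp (K * (1 + (\<Sum>k=1..n. w k))))"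
      using w by (intro mult_left_mono W(3)) auto
    also have "\<dots> = ennreal (exp (2 * D + E + K * (1 + (\<Sum>k=1..n. w k))))"
      by (simp flip: ennreal_mult exp_add)
    also have "\<dots> \<le> ennreal (exp (a1 * (K' * (1 + (\<Sum>k=1..n. e k)))))"
    proof (intro ennreal_leI, simp only: exp_le_cancel_iff)
      let ?e = "\<Sum>k=1..n. e k"
      have e0: "0 \<le> ?e" using e(2) by (intro sum_nonneg) auto
      have "(\<Sum>k=1..n. w k) \<le> (\<Sum>k=1..n. (if k \<le> k0 then c * \<gamma> k else 0) + a1 * C * e k)"
        using a1 C e(2) by (intro sum_mono) (auto simp: w_def)
      also have "\<dots> = (\<Sum>k=1..n. if k \<le> k0 then c * \<gamma> k else 0) + a1 * C * ?e"
        by (simp add: sum.distrib sum_distrib_left)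
      also have "\<dots> \<le> (\<Sum>k=1..k0. c * \<gamma> k) + a1 * C * ?e"
        using W \<gamma>_pos by (intro add_right_mono sums) (auto simp: less_imp_le)
      finally have "K * (1 + (\<Sum>k=1..n. w k)) \<le> K * (1 + (\<Sum>k=1..k0. c * \<gamma> k)) + K * a1 * C * ?e"
        using mult_left_mono[of _ _ K] W(2) by (fastforce simp: distrib_left mult.assoc)
      moreover have "2 * D + E + (K * (1 + (\<Sum>k=1..k0. c * \<gamma> k)) + K * a1 * C * ?e)
         \<le> (2 * D + E + K * (1 + (\<Sum>k=1..k0. c * \<gamma> k)) + K * a1 * C) * (1 + ?e)"
      proof -
        have "0 \<le> (2 * D + E + K * (1 + (\<Sum>k=1..k0. c * \<gamma> k))) * ?e" "0 \<le> K * a1 * C"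
          using D E W a1 C G0 e0 by auto
        then show ?thesis by (simp add: distrib_left distrib_right)
      qed
      moreover have "a1 * (K' * (1 + ?e)) = (2 * D + E + K * (1 + (\<Sum>k=1..k0. c * \<gamma> k)) + K * a1 * C) * (1 + ?e)"
        using a1 by (simp add: K'_def)
      ultimately show "2 * D + E + K * (1 + (\<Sum>k=1..n. w k)) \<le> a1 * (K' * (1 + ?e))" by linarith
    qed
    finally have le: "(\<integral>\<^sup>+\<omega>. ennreal (exp (a1 * remainder f l n \<omega>)) \<partial>M)
        \<le> ennreal (exp (a1 * (K' * (1 + (\<Sum>k=1..n. e k)))))" .
    have "(\<integral>\<^sup>+\<omega>. ennreal (exp (a / a1 * (a1 * remainder f l n \<omega>))) \<partial>M)
        \<le> ennreal (exp (a / a1 * (a1 * (K' * (1 + (\<Sum>k=1..n. e k))))))"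
      using a a1 by (intro nn_integral_exp_scale[OF _ _ _ le] borel_measurable_times m borel_measurable_const)
        (auto simp: divide_le_eq_1)
    then show "(\<integral>\<^sup>+\<omega>. ennreal (exp (a * remainder f l n \<omega>)) \<partial>M) \<le> ennreal (exp (a * (K' * (1 + (\<Sum>k=1..n. e k)))))"
      using a1 by simp
  qed
qed

end

section \<open>Deviations from a Poisson equation\<close>

text \<open>Separates the probabilistic estimate from the Taylor analysis. The part \<open>s\<close>
  of the compensator of \<phi> is what is to be estimated: the generator term, alone or with the
  bias. Each remainder carries two bounds: the one by \<open>\<gamma> * sqrt V\<close> serves the
  finitely many early terms and the crude estimate, the one by \<open>e * V\<close> with
  \<open>e = o(\<gamma>)\<close> the sharp constants. Only the sum of \<open>e\<close> is squared in
  the growth conditions, because the remainder of \<phi> is weighted by \<open>a\<close>, that of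
  \<psi> by the quadratic \<open>q\<close>.\<close>

locale deviation = lyapunov_scheme M X0 U b \<sigma> \<gamma> s\<^sub>1 V v CV \<alpha> \<beta>V H
  for M :: "'w measure" and X0 :: "'w \<Rightarrow> real^'d" and U :: "nat \<Rightarrow> 'w \<Rightarrow> real^'r"
    and b \<sigma> \<gamma> s\<^sub>1 V v CV \<alpha> \<beta>V H +
  fixes \<phi> \<psi> S :: "real^'d \<Rightarrow> real" and s l l' :: "nat \<Rightarrow> real^'d \<Rightarrow> real"
    and L L' m S\<^sub>1 C :: real and e e' :: "nat \<Rightarrow> real"
  assumes \<phi>_lip: "\<And>x y. \<bar>\<phi> x - \<phi> y\<bar> \<le> L * norm (x - y)" and L_pos: "0 < L"
    and \<psi>_lip: "\<And>x y. \<bar>\<psi> x - \<psi> y\<bar> \<le> L' * norm (x - y)" and L'_pos: "0 < L'"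
    and S_measurable [measurable]: "S \<in> borel_measurable borel"
    and S_ge: "\<And>x. op_norm (\<sigma> x) \<le> S x" and S_le: "\<And>x. S x \<le> S\<^sub>1"
    and S1_pos: "0 < S\<^sub>1" and m_pos: "0 < m"
    and \<phi>_dec: "\<And>k x. 1 \<le> k \<Longrightarrow> transition k \<phi> x - \<phi> x = s k x + l k x"
    and \<psi>_dec: "\<And>k x. 1 \<le> k \<Longrightarrow> transition k \<psi> x - \<psi> x = \<gamma> k * ((S x)\<^sup>2 - m) + l' k x"
    and C_nonneg: "0 \<le> C"
    and \<phi>_le: "\<And>x. \<bar>\<phi> x\<bar> \<le> C * sqrt (V x)" and \<psi>_le: "\<And>x. \<bar>\<psi> x\<bar> \<le> C * sqrt (V x)"
    and l_le: "\<And>k x. 1 \<le> k \<Longrightarrow> \<bar>l k x\<bar> \<le> C * \<gamma> k * sqrt (V x)"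
    and l_le_e: "\<And>k x. 1 \<le> k \<Longrightarrow> \<bar>l k x\<bar> \<le> C * e k * V x"
    and l'_le: "\<And>k x. 1 \<le> k \<Longrightarrow> \<bar>l' k x\<bar> \<le> C * \<gamma> k * sqrt (V x)"
    and l'_le_e: "\<And>k x. 1 \<le> k \<Longrightarrow> \<bar>l' k x\<bar> \<le> C * e' k * V x"
    and e_nonneg: "\<And>k. 1 \<le> k \<Longrightarrow> 0 \<le> e k" and e'_nonneg: "\<And>k. 1 \<le> k \<Longrightarrow> 0 \<le> e' k"
    and e_small: "(\<lambda>k. e k / \<gamma> k) \<longlonglongrightarrow> 0" and e'_small: "(\<lambda>k. e' k / \<gamma> k) \<longlonglongrightarrow> 0"
    and l_measurable: "\<And>k. 1 \<le> k \<Longrightarrow> l k \<in> borel_measurable borel"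
    and l'_measurable: "\<And>k. 1 \<le> k \<Longrightarrow> l' k \<in> borel_measurable borel"
    and s_measurable: "\<And>k. 1 \<le> k \<Longrightarrow> s k \<in> borel_measurable borel"
    and Gam_top: "filterlim (Gam \<gamma>) at_top sequentially"
    and e_sum: "(\<lambda>n. (1 + (\<Sum>k=1..n. e k))\<^sup>2 / Gam \<gamma> n) \<longlonglongrightarrow> 0"
    and e'_sum: "(\<lambda>n. (1 + (\<Sum>k=1..n. e' k)) / Gam \<gamma> n) \<longlonglongrightarrow> 0"
begin

definition Z :: "nat \<Rightarrow> 'w \<Rightarrow> real" where "Z n \<omega> = (\<Sum>k=1..n. s k (X (k - 1) \<omega>))"

abbreviation R :: "nat \<Rightarrow> 'w \<Rightarrow> real" where "R \<equiv> remainder \<phi> l"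
abbreviation R' :: "nat \<Rightarrow> 'w \<Rightarrow> real" where "R' \<equiv> remainder \<psi> l'"

lemma \<phi>_measurable [measurable]: "\<phi> \<in> borel_measurable borel"
  using lipschitz_measurable[OF \<phi>_lip] L_pos by simp

lemma \<psi>_measurable [measurable]: "\<psi> \<in> borel_measurable borel"
  using lipschitz_measurable[OF \<psi>_lip] L'_pos by simp

lemma Z_measurable [measurable]: "Z n \<in> borel_measurable M"
  unfolding Z_def[abs_def] by (intro history_measurable[OF sum_X_history] s_measurable)

lemma R_measurable [measurable]: "R n \<in> borel_measurable M"
  by (intro remainder_measurable l_measurable) auto

lemma R'_measurable [measurable]: "R' n \<in> borel_measurable M"
  by (intro remainder_measurable l'_measurable) auto

lemma mart_measurable [measurable]: "f \<in> borel_measurable borel \<Longrightarrow> mart f n \<in> borel_measurable M"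
  by (intro history_measurable[OF mart_history])

lemma Z_le: "\<bar>Z n \<omega> + mart \<phi> n \<omega>\<bar> \<le> R n \<omega>"
proof -
  have "(\<Sum>k=1..n. transition k \<phi> (X (k - 1) \<omega>) - \<phi> (X (k - 1) \<omega>)) = Z n \<omega> + (\<Sum>k=1..n. l k (X (k - 1) \<omega>))"
    unfolding Z_def sum.distrib[symmetric] by (intro sum.cong refl \<phi>_dec) auto
  then have "Z n \<omega> + mart \<phi> n \<omega> = \<phi> (X n \<omega>) - \<phi> (X 0 \<omega>) - (\<Sum>k=1..n. l k (X (k - 1) \<omega>))"
    using telescope[of \<phi> n \<omega>] by simp
  moreover have "\<bar>\<Sum>k=1..n. l k (X (k - 1) \<omega>)\<bar> \<le> (\<Sum>k=1..n. \<bar>l k (X (k - 1) \<omega>)\<bar>)" by (rule sum_abs)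
  ultimately show ?thesis unfolding remainder_def by linarith
qed

lemma sum_S_le: "(\<Sum>k=1..n. \<gamma> k * (S (X (k - 1) \<omega>))\<^sup>2) \<le> m * Gam \<gamma> n - mart \<psi> n \<omega> + R' n \<omega>"
proof -
  have "(\<Sum>k=1..n. transition k \<psi> (X (k - 1) \<omega>) - \<psi> (X (k - 1) \<omega>))
     = (\<Sum>k=1..n. \<gamma> k * (S (X (k - 1) \<omega>))\<^sup>2) - m * Gam \<gamma> n + (\<Sum>k=1..n. l' k (X (k - 1) \<omega>))"
  proof -
    have "(\<Sum>k=1..n. transition k \<psi> (X (k - 1) \<omega>) - \<psi> (X (k - 1) \<omega>))
       = (\<Sum>k=1..n. \<gamma> k * ((S (X (k - 1) \<omega>))\<^sup>2 - m) + l' k (X (k - 1) \<omega>))"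
      by (intro sum.cong refl \<psi>_dec) auto
    then show ?thesis
      by (simp add: Gam_def sum.distrib sum_distrib_left right_diff_distrib sum_subtractf mult.commute[of m])
  qed
  then have "(\<Sum>k=1..n. \<gamma> k * (S (X (k - 1) \<omega>))\<^sup>2)
     = m * Gam \<gamma> n - mart \<psi> n \<omega> + (\<psi> (X n \<omega>) - \<psi> (X 0 \<omega>) - (\<Sum>k=1..n. l' k (X (k - 1) \<omega>)))"
    using telescope[of \<psi> n \<omega>] by simp
  moreover have "\<bar>\<Sum>k=1..n. l' k (X (k - 1) \<omega>)\<bar> \<le> (\<Sum>k=1..n. \<bar>l' k (X (k - 1) \<omega>)\<bar>)" by (rule sum_abs)
  ultimately show ?thesis unfolding remainder_def by linarith
qed

lemma sum_S_measurable: "(\<lambda>\<omega>. \<Sum>k=1..n. \<gamma> k * (S (X (k - 1) \<omega>))\<^sup>2) \<in> borel_measurable M"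
  by (intro history_measurable[OF sum_X_history[of "\<lambda>k x. \<gamma> k * (S x)\<^sup>2"]]) measurable

lemma sum_S_le_const: "(\<Sum>k=1..n. \<gamma> k * (S (X (k - 1) \<omega>))\<^sup>2) \<le> S\<^sub>1\<^sup>2 * Gam \<gamma> n"
proof -
  have "0 \<le> S x" for x using S_ge[of x] op_norm_nonneg[of "\<sigma> x"] by linarith
  then have "(S x)\<^sup>2 \<le> S\<^sub>1\<^sup>2" for x using S_le by (intro power_mono) auto
  then have "(\<Sum>k=1..n. \<gamma> k * (S (X (k - 1) \<omega>))\<^sup>2) \<le> (\<Sum>k=1..n. \<gamma> k * S\<^sub>1\<^sup>2)"
    using \<gamma>_pos by (intro sum_mono mult_left_mono) (auto simp: less_imp_le)
  then show ?thesis by (simp add: Gam_def sum_distrib_left mult.commute)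
qed

text \<open>Weights \<open>1/2\<close> suffice here since the value of the constant does not matter:
  the bracket is replaced by \<open>S\<^sub>1\<^sup>2 * \<Gamma>\<close>, and
  \<open>remainder_exp_all\<close> holds for every \<open>a\<close>.\<close>

lemma laplace_crude:
  obtains K where "0 < K" "\<And>a n. 1 \<le> n \<Longrightarrow>
    (\<integral>\<^sup>+\<omega>. ennreal (exp (a * Z n \<omega>)) \<partial>M) \<le> ennreal (exp (K * (1 + a\<^sup>2) * Gam \<gamma> n))"
proof -
  obtain K where K: "0 \<le> K" "\<And>a n. 0 \<le> a \<Longrightarrow>
    (\<integral>\<^sup>+\<omega>. ennreal (exp (a * R n \<omega>)) \<partial>M) \<le> ennreal (exp (K * (1 + a\<^sup>2) * (1 + Gam \<gamma> n)))"
    using remainder_exp_all[OF \<phi>_le C_nonneg l_le] by blast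
  have g1: "0 < \<gamma> 1" using \<gamma>_pos by simp
  define K' where "K' = L\<^sup>2 * S\<^sub>1\<^sup>2 + 2 * K * (1 / \<gamma> 1 + 1)"
  show ?thesis
  proof (rule that[of K'])
    show "0 < K'" using L_pos S1_pos K(1) g1 by (auto simp: K'_def intro!: add_pos_nonneg)
    fix a :: real and n :: nat assume n: "1 \<le> n"
    let ?G = "Gam \<gamma> n"
    \<comment> \<open>The factor \<open>2\<close> undoes the weight \<open>1/2\<close> of the
      convexity bound; the vanishing multiple of \<psi> puts the function into the shape of
      \<open>mart_linear\<close>.\<close>
    let ?f = "\<lambda>x. (- 2 * a) * \<phi> x + 0 * \<psi> x"
    let ?A = "\<lambda>\<omega>. mart ?f n \<omega> - (2 * \<bar>a\<bar> * L)\<^sup>2 / 2 * (\<Sum>k=1..n. \<gamma> k * (S (X (k - 1) \<omega>))\<^sup>2)"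
    have Am [measurable]: "?A \<in> borel_measurable M"
      by (intro borel_measurable_diff borel_measurable_times borel_measurable_const mart_measurable sum_S_measurable)
        measurable
    have f: "\<bar>?f x - ?f y\<bar> \<le> (2 * \<bar>a\<bar> * L) * norm (x - y)" for x y
    proof -
      have "?f x - ?f y = (- 2 * a) * (\<phi> x - \<phi> y)" by (simp add: algebra_simps)
      also have "\<bar>\<dots>\<bar> = 2 * \<bar>a\<bar> * \<bar>\<phi> x - \<phi> y\<bar>" by (simp add: abs_mult)
      also have "\<dots> \<le> 2 * \<bar>a\<bar> * (L * norm (x - y))" by (intro mult_left_mono \<phi>_lip) auto
      finally show ?thesis by simp
    qed
    have A: "(\<integral>\<^sup>+\<omega>. ennreal (exp (?A \<omega>)) \<partial>M) \<le> ennreal (exp 0)"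
      using L_pos by (intro mart_exp[OF f] S_ge) auto
    have "(\<integral>\<^sup>+\<omega>. ennreal (exp (a * Z n \<omega>)) \<partial>M)
       \<le> (\<integral>\<^sup>+\<omega>. ennreal (exp (L\<^sup>2 * S\<^sub>1\<^sup>2 * a\<^sup>2 * ?G)) * ennreal (exp (1/2 * ?A \<omega> + (1 - 1/2) * ((2 * \<bar>a\<bar>) * R n \<omega>))) \<partial>M)"
    proof (rule nn_integral_mono)
      fix \<omega>
      have "a * Z n \<omega> = - a * mart \<phi> n \<omega> + a * (Z n \<omega> + mart \<phi> n \<omega>)" by (simp add: algebra_simps)
      also have "a * (Z n \<omega> + mart \<phi> n \<omega>) \<le> \<bar>a\<bar> * R n \<omega>"
      proof -
        have "a * (Z n \<omega> + mart \<phi> n \<omega>) \<le> \<bar>a\<bar> * \<bar>Z n \<omega> + mart \<phi> n \<omega>\<bar>"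
          using abs_ge_self[of "a * (Z n \<omega> + mart \<phi> n \<omega>)"] by (simp only: abs_mult)
        also have "\<dots> \<le> \<bar>a\<bar> * R n \<omega>" by (intro mult_left_mono Z_le) auto
        finally show ?thesis .
      qed
      also have "- a * mart \<phi> n \<omega> = 1/2 * mart ?f n \<omega>"
        using mart_linear[OF \<phi>_lip _ \<psi>_lip, of "- 2 * a" 0 n \<omega>] L_pos L'_pos by simp
      also have "1/2 * mart ?f n \<omega> = 1/2 * ?A \<omega> + L\<^sup>2 * a\<^sup>2 * (\<Sum>k=1..n. \<gamma> k * (S (X (k - 1) \<omega>))\<^sup>2)"
        by (simp add: power_mult_distrib field_simps)
      also have "L\<^sup>2 * a\<^sup>2 * (\<Sum>k=1..n. \<gamma> k * (S (X (k - 1) \<omega>))\<^sup>2) \<le> L\<^sup>2 * a\<^sup>2 * (S\<^sub>1\<^sup>2 * ?G)"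
        by (intro mult_left_mono sum_S_le_const) auto
      finally have "a * Z n \<omega> \<le> L\<^sup>2 * S\<^sub>1\<^sup>2 * a\<^sup>2 * ?G + (1/2 * ?A \<omega> + (1 - 1/2) * ((2 * \<bar>a\<bar>) * R n \<omega>))"
        by (simp add: mult_ac)
      then show "ennreal (exp (a * Z n \<omega>)) \<le> ennreal (exp (L\<^sup>2 * S\<^sub>1\<^sup>2 * a\<^sup>2 * ?G)) * ennreal (exp (1/2 * ?A \<omega> + (1 - 1/2) * ((2 * \<bar>a\<bar>) * R n \<omega>)))"
        by (simp flip: ennreal_mult exp_add)
    qed
    also have "\<dots> = ennreal (exp (L\<^sup>2 * S\<^sub>1\<^sup>2 * a\<^sup>2 * ?G)) * (\<integral>\<^sup>+\<omega>. ennreal (exp (1/2 * ?A \<omega> + (1 - 1/2) * ((2 * \<bar>a\<bar>) * R n \<omega>))) \<partial>M)"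
      by (rule nn_integral_cmult) (intro measurable_compose[OF _ measurable_ennreal]
        measurable_compose[OF _ borel_measurable_exp] borel_measurable_add borel_measurable_times
        borel_measurable_const Am R_measurable)
    also have "\<dots> \<le> ennreal (exp (L\<^sup>2 * S\<^sub>1\<^sup>2 * a\<^sup>2 * ?G)) * ennreal (exp (1/2 * 0 + (1 - 1/2) * (K * (1 + (2 * \<bar>a\<bar>)\<^sup>2) * (1 + ?G))))"
      by (intro mult_left_mono nn_integral_exp_convex A Am K(2)) auto
    also have "\<dots> = ennreal (exp (L\<^sup>2 * S\<^sub>1\<^sup>2 * a\<^sup>2 * ?G + 1/2 * (K * (1 + 4 * a\<^sup>2) * (1 + ?G))))"
      by (simp add: power_mult_distrib flip: ennreal_mult exp_add)
    also have "\<dots> \<le> ennreal (exp (K' * (1 + a\<^sup>2) * ?G))"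
    proof (intro ennreal_leI, simp only: exp_le_cancel_iff)
      have G: "0 < ?G" using Gam_pos[OF n] g1 by linarith
      have "1 + ?G \<le> (1 / \<gamma> 1 + 1) * ?G" using Gam_pos[OF n] g1 by (simp add: field_simps)
      then have h1: "K * (1 + 4 * a\<^sup>2) * (1 + ?G) \<le> K * (4 * (1 + a\<^sup>2)) * ((1 / \<gamma> 1 + 1) * ?G)"
        using K(1) G by (intro mult_mono mult_nonneg_nonneg) auto
      have h2: "L\<^sup>2 * S\<^sub>1\<^sup>2 * a\<^sup>2 * ?G \<le> L\<^sup>2 * S\<^sub>1\<^sup>2 * (1 + a\<^sup>2) * ?G"
        using G by (intro mult_right_mono mult_left_mono) auto
      have eq: "K' * (1 + a\<^sup>2) * ?G = L\<^sup>2 * S\<^sub>1\<^sup>2 * (1 + a\<^sup>2) * ?G + 1/2 * (K * (4 * (1 + a\<^sup>2)) * ((1 / \<gamma> 1 + 1) * ?G))"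
        unfolding K'_def by algebra
      show "L\<^sup>2 * S\<^sub>1\<^sup>2 * a\<^sup>2 * ?G + 1/2 * (K * (1 + 4 * a\<^sup>2) * (1 + ?G)) \<le> K' * (1 + a\<^sup>2) * ?G"
        unfolding eq by (intro add_mono h2 mult_left_mono[OF h1]) simp
    qed
    finally show "(\<integral>\<^sup>+\<omega>. ennreal (exp (a * Z n \<omega>)) \<partial>M) \<le> ennreal (exp (K' * (1 + a\<^sup>2) * Gam \<gamma> n))" .
  qed
qed


text \<open>The martingale part receives the weight \<open>1 - \<epsilon>\<close> and the remainders
  the weight \<epsilon>, so they are needed at the parameters \<open>2 * q / \<epsilon>\<close> and
  \<open>2 * |a| / \<epsilon>\<close>. These stay bounded only for bounded \<open>a\<close> and
  \<open>q\<close>, whence \<Lambda> and a constant \<open>K\<close> depending on it and on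
  \<epsilon>.\<close>

lemma laplace_sharp:
  assumes \<epsilon>: "0 < \<epsilon>" "\<epsilon> < 1" and \<Lambda>: "0 < \<Lambda>"
  obtains K where "0 \<le> K" "\<And>a p q n. \<bar>a\<bar> \<le> \<Lambda> \<Longrightarrow> 1 < p \<Longrightarrow> q = p * a\<^sup>2 * L\<^sup>2 / 2 \<Longrightarrow> q \<le> \<Lambda> \<Longrightarrow>
    (\<integral>\<^sup>+\<omega>. ennreal (exp ((1 - \<epsilon>) * a * Z n \<omega>)) \<partial>M)
    \<le> ennreal (exp ((1 - \<epsilon>) * (q * m + p / (p - 1) * q\<^sup>2 * L'\<^sup>2 * S\<^sub>1\<^sup>2 / 2) * Gam \<gamma> n
        + K * (q * (1 + (\<Sum>k=1..n. e' k)) + \<bar>a\<bar> * (1 + (\<Sum>k=1..n. e k)))))"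
proof -
  have a1: "0 < 2 * \<Lambda> / \<epsilon>" using \<epsilon> \<Lambda> by simp
  obtain K1 where K1: "0 \<le> K1" "\<And>a n. 0 \<le> a \<Longrightarrow> a \<le> 2 * \<Lambda> / \<epsilon> \<Longrightarrow>
    (\<integral>\<^sup>+\<omega>. ennreal (exp (a * R n \<omega>)) \<partial>M) \<le> ennreal (exp (a * (K1 * (1 + (\<Sum>k=1..n. e k)))))"
    using remainder_exp_bounded[OF \<phi>_le C_nonneg l_le l_le_e e_nonneg e_small \<phi>_measurable l_measurable a1] by blast
  obtain K2 where K2: "0 \<le> K2" "\<And>a n. 0 \<le> a \<Longrightarrow> a \<le> 2 * \<Lambda> / \<epsilon> \<Longrightarrow>
    (\<integral>\<^sup>+\<omega>. ennreal (exp (a * R' n \<omega>)) \<partial>M) \<le> ennreal (exp (a * (K2 * (1 + (\<Sum>k=1..n. e' k)))))"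
    using remainder_exp_bounded[OF \<psi>_le C_nonneg l'_le l'_le_e e'_nonneg e'_small \<psi>_measurable l'_measurable a1] by blast
  show ?thesis
  proof (rule that[of "max K1 K2"])
    show "0 \<le> max K1 K2" using K1 by simp
    fix a p q :: real and n
    assume a: "\<bar>a\<bar> \<le> \<Lambda>" and p: "1 < p" and q: "q = p * a\<^sup>2 * L\<^sup>2 / 2" "q \<le> \<Lambda>"
    let ?G = "Gam \<gamma> n" and ?E = "1 + (\<Sum>k=1..n. e k)" and ?E' = "1 + (\<Sum>k=1..n. e' k)"
    let ?c = "q * m + p / (p - 1) * q\<^sup>2 * L'\<^sup>2 * S\<^sub>1\<^sup>2 / 2"
    let ?f = "\<lambda>x. (- a) * \<phi> x + (- q) * \<psi> x"
    let ?L = "\<bar>a\<bar> * L + q * L'"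
    let ?T = "\<lambda>\<omega>. \<Sum>k=1..n. \<gamma> k * (S (X (k - 1) \<omega>))\<^sup>2"
    let ?A = "\<lambda>\<omega>. mart ?f n \<omega> - ?L\<^sup>2 / 2 * ?T \<omega>"
    \<comment> \<open>Chosen so that \<open>\<epsilon> * ?Y = q * R' + |a| * R\<close>.\<close>
    let ?Y = "\<lambda>\<omega>. 1/2 * ((2 * q / \<epsilon>) * R' n \<omega>) + (1 - 1/2) * ((2 * \<bar>a\<bar> / \<epsilon>) * R n \<omega>)"
    have q0: "0 \<le> q" unfolding q(1) using p by (intro divide_nonneg_pos mult_nonneg_nonneg) auto
    have E: "1 \<le> ?E" "1 \<le> ?E'" using e_nonneg e'_nonneg by (auto intro!: sum_nonneg)
    have Am [measurable]: "?A \<in> borel_measurable M"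
      by (intro borel_measurable_diff borel_measurable_times borel_measurable_const mart_measurable sum_S_measurable)
        measurable
    have Ym [measurable]: "?Y \<in> borel_measurable M" by measurable
    have f: "\<bar>?f x - ?f y\<bar> \<le> ?L * norm (x - y)" for x y
    proof -
      have "?f x - ?f y = (- a) * (\<phi> x - \<phi> y) + (- q) * (\<psi> x - \<psi> y)" by (simp add: algebra_simps)
      also have "\<bar>\<dots>\<bar> \<le> \<bar>a\<bar> * \<bar>\<phi> x - \<phi> y\<bar> + q * \<bar>\<psi> x - \<psi> y\<bar>"
        using abs_triangle_ineq[of "(- a) * (\<phi> x - \<phi> y)" "(- q) * (\<psi> x - \<psi> y)"] q0 by (simp add: abs_mult)
      also have "\<dots> \<le> \<bar>a\<bar> * (L * norm (x - y)) + q * (L' * norm (x - y))"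
        using q0 by (intro add_mono mult_left_mono \<phi>_lip \<psi>_lip) auto
      finally show ?thesis by (simp add: algebra_simps)
    qed
    have A: "(\<integral>\<^sup>+\<omega>. ennreal (exp (?A \<omega>)) \<partial>M) \<le> ennreal (exp 0)"
      using L_pos L'_pos q0 by (intro mart_exp[OF f] S_ge) auto
    have Y: "(\<integral>\<^sup>+\<omega>. ennreal (exp (?Y \<omega>)) \<partial>M)
       \<le> ennreal (exp (1/2 * ((2 * q / \<epsilon>) * (K2 * ?E')) + (1 - 1/2) * ((2 * \<bar>a\<bar> / \<epsilon>) * (K1 * ?E))))"
      using a q q0 \<epsilon> by (intro nn_integral_exp_convex K1(2) K2(2) borel_measurable_times borel_measurable_const
          R_measurable R'_measurable) (auto intro!: divide_right_mono)
    \<comment> \<open>The inequality \<open>(x + y)\<^sup>2 \<le> p * x\<^sup>2 + p / (p - 1) *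
      y\<^sup>2\<close> is taken so that the part from \<phi> gives the bracket the coefficient
      \<open>p * a\<^sup>2 * L\<^sup>2 / 2 = q\<close>, the very multiple of \<psi> subtracted in
      \<open>?f\<close>.\<close>
    have quad: "?L\<^sup>2 \<le> 2 * q + p / (p - 1) * q\<^sup>2 * L'\<^sup>2"
    proof -
      have *: "(x + y)\<^sup>2 \<le> p * x\<^sup>2 + p / (p - 1) * y\<^sup>2" for x y :: real
      proof -
        have "0 \<le> ((p - 1) * x - y)\<^sup>2 / (p - 1)" using p by simp
        also have "\<dots> = p * x\<^sup>2 + p / (p - 1) * y\<^sup>2 - (x + y)\<^sup>2"
          using p by (simp add: field_simps power2_eq_square)
        finally show ?thesis by simp
      qed
      have "2 * q = p * (\<bar>a\<bar> * L)\<^sup>2" using q(1) by (simp add: power_mult_distrib)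
      moreover have "p / (p - 1) * q\<^sup>2 * L'\<^sup>2 = p / (p - 1) * (q * L')\<^sup>2" by (simp add: power_mult_distrib)
      ultimately show ?thesis using *[of "\<bar>a\<bar> * L" "q * L'"] by linarith
    qed
    have bound: "(1 - \<epsilon>) * a * Z n \<omega> \<le> (1 - \<epsilon>) * ?c * ?G + ((1 - \<epsilon>) * ?A \<omega> + (1 - (1 - \<epsilon>)) * ?Y \<omega>)" for \<omega>
    proof -
      have R0: "0 \<le> R n \<omega>" "0 \<le> R' n \<omega>" by (auto simp: remainder_def intro!: add_nonneg_nonneg sum_nonneg)
      have T0: "0 \<le> ?T \<omega>" using \<gamma>_pos by (intro sum_nonneg mult_nonneg_nonneg) (auto simp: less_imp_le)
      have "?L\<^sup>2 / 2 * ?T \<omega> \<le> q * ?T \<omega> + p / (p - 1) * q\<^sup>2 * L'\<^sup>2 / 2 * ?T \<omega>"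
        using divide_right_mono[OF mult_right_mono[OF quad T0], of 2] by (simp add: distrib_right add_divide_distrib)
      \<comment> \<open>Only the leading bracket goes through the Poisson equation. The one of order
        \<open>q\<^sup>2\<close> is bounded by means of \<open>S\<^sub>1\<close>, since replacing it
        too would produce a further, uncancelled multiple of the martingale of \<psi>.\<close>
      also have "\<dots> \<le> q * (m * ?G - mart \<psi> n \<omega> + R' n \<omega>) + p / (p - 1) * q\<^sup>2 * L'\<^sup>2 / 2 * (S\<^sub>1\<^sup>2 * ?G)"
        using p q0 by (intro add_mono mult_left_mono sum_S_le sum_S_le_const) auto
      finally have 1: "?L\<^sup>2 / 2 * ?T \<omega> \<le> ?c * ?G - q * mart \<psi> n \<omega> + q * R' n \<omega>"
        by (simp add: algebra_simps)
      have 2: "mart ?f n \<omega> = - a * mart \<phi> n \<omega> - q * mart \<psi> n \<omega>"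
        using mart_linear[OF \<phi>_lip _ \<psi>_lip, of "- a" "- q" n \<omega>] L_pos L'_pos by simp
      have "a * (Z n \<omega> + mart \<phi> n \<omega>) \<le> \<bar>a\<bar> * \<bar>Z n \<omega> + mart \<phi> n \<omega>\<bar>"
        using abs_ge_self[of "a * (Z n \<omega> + mart \<phi> n \<omega>)"] by (simp only: abs_mult)
      also have "\<dots> \<le> \<bar>a\<bar> * R n \<omega>" by (intro mult_left_mono Z_le) auto
      finally have "a * Z n \<omega> \<le> ?A \<omega> + ?c * ?G + (q * R' n \<omega> + \<bar>a\<bar> * R n \<omega>)"
        using 1 2 by (simp add: algebra_simps)
      then have "(1 - \<epsilon>) * (a * Z n \<omega>) \<le> (1 - \<epsilon>) * (?A \<omega> + ?c * ?G + (q * R' n \<omega> + \<bar>a\<bar> * R n \<omega>))"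
        using \<epsilon> by (intro mult_left_mono) auto
      also have "\<dots> \<le> (1 - \<epsilon>) * (?A \<omega> + ?c * ?G) + (q * R' n \<omega> + \<bar>a\<bar> * R n \<omega>)"
      proof -
        have "0 \<le> \<epsilon> * (q * R' n \<omega> + \<bar>a\<bar> * R n \<omega>)" using R0 q0 \<epsilon> by simp
        then show ?thesis by (simp add: distrib_left left_diff_distrib)
      qed
      also have "q * R' n \<omega> + \<bar>a\<bar> * R n \<omega> = (1 - (1 - \<epsilon>)) * ?Y \<omega>"
        using \<epsilon> by (simp add: distrib_left)
      finally have le: "(1 - \<epsilon>) * (a * Z n \<omega>) \<le> (1 - \<epsilon>) * (?A \<omega> + ?c * ?G) + (1 - (1 - \<epsilon>)) * ?Y \<omega>" .
      have "d * (a' * z) \<le> d * (x + c * g) + y \<Longrightarrow> d * a' * z \<le> d * c * g + (d * x + y)" for d a' z x c g y :: real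
        by (simp add: algebra_simps)
      from this[OF le] show ?thesis .
    qed
    have "(\<integral>\<^sup>+\<omega>. ennreal (exp ((1 - \<epsilon>) * a * Z n \<omega>)) \<partial>M)
       \<le> (\<integral>\<^sup>+\<omega>. ennreal (exp ((1 - \<epsilon>) * ?c * ?G)) * ennreal (exp ((1 - \<epsilon>) * ?A \<omega> + (1 - (1 - \<epsilon>)) * ?Y \<omega>)) \<partial>M)"
      unfolding ennreal_mult[symmetric, OF exp_ge_zero exp_ge_zero] exp_add[symmetric]
      by (intro nn_integral_mono ennreal_leI iffD2[OF exp_le_cancel_iff] bound)
    also have "\<dots> = ennreal (exp ((1 - \<epsilon>) * ?c * ?G)) * (\<integral>\<^sup>+\<omega>. ennreal (exp ((1 - \<epsilon>) * ?A \<omega> + (1 - (1 - \<epsilon>)) * ?Y \<omega>)) \<partial>M)"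
      by (rule nn_integral_cmult) (intro measurable_compose[OF _ measurable_ennreal]
        measurable_compose[OF _ borel_measurable_exp] borel_measurable_add borel_measurable_times
        borel_measurable_const Am R_measurable R'_measurable)
    also have "\<dots> \<le> ennreal (exp ((1 - \<epsilon>) * ?c * ?G)) * ennreal (exp ((1 - \<epsilon>) * 0 +
         (1 - (1 - \<epsilon>)) * (1/2 * ((2 * q / \<epsilon>) * (K2 * ?E')) + (1 - 1/2) * ((2 * \<bar>a\<bar> / \<epsilon>) * (K1 * ?E)))))"
      using \<epsilon> by (intro mult_left_mono nn_integral_exp_convex[OF Am Ym _ _ A Y]) auto
    also have "\<dots> = ennreal (exp ((1 - \<epsilon>) * ?c * ?G + (q * (K2 * ?E') + \<bar>a\<bar> * (K1 * ?E))))"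
      using \<epsilon> unfolding ennreal_mult[symmetric, OF exp_ge_zero exp_ge_zero] exp_add[symmetric]
      by (simp add: distrib_left)
    also have "\<dots> \<le> ennreal (exp ((1 - \<epsilon>) * ?c * ?G + max K1 K2 * (q * ?E' + \<bar>a\<bar> * ?E)))"
    proof (intro ennreal_leI iffD2[OF exp_le_cancel_iff] add_left_mono)
      have "q * (K2 * ?E') \<le> q * (max K1 K2 * ?E')" "\<bar>a\<bar> * (K1 * ?E) \<le> \<bar>a\<bar> * (max K1 K2 * ?E)"
        using q0 E by (auto intro!: mult_left_mono mult_right_mono)
      moreover have "max K1 K2 * (q * ?E' + \<bar>a\<bar> * ?E) = q * (max K1 K2 * ?E') + \<bar>a\<bar> * (max K1 K2 * ?E)"
        by (simp only: distrib_left[of "max K1 K2"] mult.left_commute[of "max K1 K2"])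
      ultimately show "q * (K2 * ?E') + \<bar>a\<bar> * (K1 * ?E) \<le> max K1 K2 * (q * ?E' + \<bar>a\<bar> * ?E)"
        by (simp only: add_mono)
    qed
    finally show "(\<integral>\<^sup>+\<omega>. ennreal (exp ((1 - \<epsilon>) * a * Z n \<omega>)) \<partial>M)
      \<le> ennreal (exp ((1 - \<epsilon>) * ?c * ?G + max K1 K2 * (q * ?E' + \<bar>a\<bar> * ?E)))" .
  qed
qed

lemma two_sided_tail:
  assumes t: "0 < t"
    and B: "\<And>a. \<bar>a\<bar> = t \<Longrightarrow> (\<integral>\<^sup>+\<omega>. ennreal (exp (a * Z n \<omega>)) \<partial>M) \<le> ennreal (exp B)"
  shows "prob {\<omega>\<in>space M. z \<le> \<bar>Z n \<omega>\<bar>} \<le> 2 * exp (B - t * z)"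
proof -
  have "prob {\<omega>\<in>space M. t * z \<le> a * Z n \<omega>} \<le> exp (B - t * z)" if "\<bar>a\<bar> = t" for a
    by (intro chernoff B that) measurable
  note tails = this[of t] this[of "- t"]
  have "{\<omega>\<in>space M. z \<le> \<bar>Z n \<omega>\<bar>} \<subseteq> {\<omega>\<in>space M. t * z \<le> t * Z n \<omega>} \<union> {\<omega>\<in>space M. t * z \<le> (- t) * Z n \<omega>}"
  proof
    fix \<omega> assume "\<omega> \<in> {\<omega>\<in>space M. z \<le> \<bar>Z n \<omega>\<bar>}"
    then have w: "\<omega> \<in> space M" "z \<le> Z n \<omega> \<or> z \<le> - Z n \<omega>" by auto
    then have "t * z \<le> t * Z n \<omega> \<or> t * z \<le> t * (- Z n \<omega>)"
      using t mult_left_mono[of z "Z n \<omega>" t] mult_left_mono[of z "- Z n \<omega>" t] by linarith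
    then show "\<omega> \<in> {\<omega>\<in>space M. t * z \<le> t * Z n \<omega>} \<union> {\<omega>\<in>space M. t * z \<le> (- t) * Z n \<omega>}" using w by auto
  qed
  then have "prob {\<omega>\<in>space M. z \<le> \<bar>Z n \<omega>\<bar>}
     \<le> prob ({\<omega>\<in>space M. t * z \<le> t * Z n \<omega>} \<union> {\<omega>\<in>space M. t * z \<le> (- t) * Z n \<omega>})"
    by (intro finite_measure_mono) measurable
  also have "\<dots> \<le> prob {\<omega>\<in>space M. t * z \<le> t * Z n \<omega>} + prob {\<omega>\<in>space M. t * z \<le> (- t) * Z n \<omega>}"
    by (intro measure_Un_le) measurable
  finally show ?thesis using tails t by simp
qed

end

section \<open>Optimising the Chernoff bound\<close>

text \<open>With \<open>z = c ^ 3 * \<Gamma> / a\<^sup>2\<close>, \<open>rate1\<close> and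
  \<open>rate2\<close> are the two branches of \<Phi> divided by \<open>a\<^sup>2\<close>; the
  remaining dependence on \<open>n\<close> and \<open>a\<close> is carried by \<open>z\<close>
  alone.\<close>

definition rate1 :: "real \<Rightarrow> real" where "rate1 z = 1 - 2 / (1 + sqrt (1 + 4 * z))"

definition rate2 :: "real \<Rightarrow> real" where
  "rate2 z = z powr (1/3) * max (1 - 2/3 * z powr (1/3)) 0"

lemma rate1_mono: "0 \<le> z \<Longrightarrow> z \<le> z' \<Longrightarrow> rate1 z \<le> rate1 z'"
  unfolding rate1_def by (intro diff_left_mono divide_left_mono) (auto intro!: mult_pos_pos add_pos_nonneg)

lemma rate1_pos: "0 < z \<Longrightarrow> 0 < rate1 z"
  unfolding rate1_def by (simp add: add_pos_pos divide_less_eq)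

text \<open>This bound and \<open>rate2_le\<close> show that the rates vanish as \<open>z\<close>
  tends to \<open>0\<close>, that is for large deviations, where a Gaussian exponent of order
  \<open>y\<^sup>2\<close> therefore wins.\<close>

lemma rate1_le: "0 \<le> z \<Longrightarrow> rate1 z \<le> z"
proof -
  assume z: "0 \<le> z"
  \<comment> \<open>With this \<open>r\<close> the rate is \<open>(r - 1) / (r + 1)\<close> and
    \<open>z = (r\<^sup>2 - 1) / 4\<close>.\<close>
  define r where "r = sqrt (1 + 4 * z)"
  have r: "1 \<le> r" "z = (r - 1) * (r + 1) / 4"
    using z by (auto simp: r_def algebra_simps simp flip: power2_eq_square)
  have "rate1 z = (r - 1) / (r + 1)" using r(1) unfolding rate1_def r_def[symmetric]
    by (simp add: field_simps)
  also have "\<dots> \<le> (r - 1) * (r + 1) / 4"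
  proof -
    have "4 * 1 \<le> (r + 1) * (r + 1)" using mult_mono[of 2 "r + 1" 2 "r + 1"] r(1) by simp
    then have "(r - 1) * 4 \<le> (r - 1) * ((r + 1) * (r + 1))" using r(1) by (intro mult_left_mono) auto
    then show ?thesis using r(1) by (simp add: field_simps)
  qed
  finally show ?thesis unfolding r(2)[symmetric] .
qed

lemma rate2_le: "rate2 z \<le> z powr (1/3)"
  unfolding rate2_def by (rule mult_left_le) auto

text \<open>The constraint \<open>q = p a\<^sup>2 L\<^sup>2 / 2\<close> and the objective are those of \<open>laplace_sharp\<close>, with \<open>D = L'\<^sup>2 S\<^sub>1\<^sup>2\<close>.\<close>

lemma rate1_attained:
  fixes y m L D :: real
  assumes "0 < y" "0 < m" "0 < L" "0 < D"
  defines "c \<equiv> L\<^sup>2 * m ^ 3 / D"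
  obtains a p q where "0 < a" "a \<le> y / (m * L\<^sup>2)" "1 < p" "q = p * a\<^sup>2 * L\<^sup>2 / 2" "q \<le> y\<^sup>2 / (m\<^sup>2 * L\<^sup>2)"
    "a * y - (q * m + p / (p - 1) * q\<^sup>2 * D / 2) = y\<^sup>2 / (2 * m * L\<^sup>2) * rate1 (c / y\<^sup>2)"
proof -
  define r where "r = sqrt (1 + 4 * (c / y\<^sup>2))"
  have c: "0 < c" using assms by simp
  have r: "1 < r" using c assms(1) by (simp add: r_def)
  have "r\<^sup>2 = 1 + 4 * (c / y\<^sup>2)" using c by (simp add: r_def)
  then have "4 * (L\<^sup>2 * m ^ 3) = (r\<^sup>2 - 1) * y\<^sup>2 * D" using assms(1,4) by (simp add: c_def field_simps)
  moreover have "r\<^sup>2 - 1 = (r - 1) * (r + 1)" by (simp add: power2_eq_square algebra_simps)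
  moreover have "0 < (r - 1) * (r + 1)" using r by simp
  \<comment> \<open>\<open>D\<close> is eliminated in favour of \<open>r\<close>, so that the
    objective becomes rational in \<open>r\<close>, with \<open>y\<close>, \<open>m\<close> and
    \<open>L\<close> in a common factor.\<close>
  ultimately have D: "D = 4 * (L\<^sup>2 * m ^ 3) / ((r - 1) * (r + 1) * y\<^sup>2)" using assms(1) by (simp add: field_simps)
  define p where "p = r / (r - 1)"
  \<comment> \<open>Since \<open>(r - 1) / r = 1 / p\<close>, this is
    \<open>y / (p * m * L\<^sup>2)\<close>, the maximiser of the quadratic part
    \<open>a * y - q * m\<close> for the given \<open>p\<close>.\<close>
  define a where "a = y / (m * L\<^sup>2) * ((r - 1) / r)"
  define q where "q = y\<^sup>2 / (2 * m\<^sup>2 * L\<^sup>2) * ((r - 1) / r)"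
  have p: "1 < p" "p / (p - 1) = r" using r by (auto simp: p_def field_simps)
  have r': "(r - 1) / r \<le> 1" "0 < (r - 1) / r" using r by auto
  show ?thesis
  proof (rule that[of a p q])
    show "0 < a" unfolding a_def using assms(1-3) r by (intro mult_pos_pos divide_pos_pos) auto
    show "a \<le> y / (m * L\<^sup>2)" unfolding a_def using assms r' by (intro mult_left_le) auto
    show "1 < p" by fact
    have "y\<^sup>2 / (2 * m\<^sup>2 * L\<^sup>2) * (t / r) = r / t * (y / (m * L\<^sup>2) * (t / r))\<^sup>2 * L\<^sup>2 / 2" if "0 < t" for t
      using r assms(2,3) that by (simp add: field_simps power2_eq_square)
    from this[of "r - 1"] show "q = p * a\<^sup>2 * L\<^sup>2 / 2" using r by (simp add: q_def p_def a_def)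
    have "q \<le> y\<^sup>2 / (2 * m\<^sup>2 * L\<^sup>2)" unfolding q_def using r' by (intro mult_left_le) auto
    also have "\<dots> \<le> y\<^sup>2 / (m\<^sup>2 * L\<^sup>2)" using assms by (intro divide_left_mono) auto
    finally show "q \<le> y\<^sup>2 / (m\<^sup>2 * L\<^sup>2)" .
    have q2: "r * q\<^sup>2 * D / 2 = y\<^sup>2 / (2 * m * L\<^sup>2) * ((r - 1) / (r * (r + 1)))"
    proof -
      have "r * ((y\<^sup>2 / (2 * m\<^sup>2 * L\<^sup>2) * (t / r))\<^sup>2 * (4 * (L\<^sup>2 * m ^ 3) / (t * x * y\<^sup>2))) / 2
          = y\<^sup>2 / (2 * m * L\<^sup>2) * (t / (r * x))" if "0 < t" "0 < x" for t x
        using r assms(1,2,3) that by (simp add: field_simps power2_eq_square power3_eq_cube)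
      from this[of "r - 1" "r + 1"] have "r * (q\<^sup>2 * D) / 2 = y\<^sup>2 / (2 * m * L\<^sup>2) * ((r - 1) / (r * (r + 1)))"
        using r by (simp add: D q_def)
      then show ?thesis by (simp only: mult.assoc)
    qed
    have "q * m = y\<^sup>2 / (2 * m * L\<^sup>2) * ((r - 1) / r)"
      using assms(2) by (simp add: q_def power2_eq_square)
    moreover have "a * y = y\<^sup>2 / (2 * m * L\<^sup>2) * (2 * ((r - 1) / r))"
    proof -
      have "y / (m * L\<^sup>2) * t * y = y\<^sup>2 / (2 * m * L\<^sup>2) * (2 * t)" for t
        by (simp add: power2_eq_square)
      then show ?thesis unfolding a_def .
    qed
    ultimately have "a * y - (q * m + p / (p - 1) * q\<^sup>2 * D / 2)
       = y\<^sup>2 / (2 * m * L\<^sup>2) * (2 * ((r - 1) / r) - (r - 1) / r - (r - 1) / (r * (r + 1)))"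
      unfolding p(2) q2 by (simp only: right_diff_distrib diff_diff_eq distrib_left)
    also have "2 * ((r - 1) / r) - (r - 1) / r - (r - 1) / (r * (r + 1)) = rate1 (c / y\<^sup>2)"
    proof -
      have "r \<noteq> 0" "1 + r \<noteq> 0" "r + r * r \<noteq> 0" using r by (auto simp: add_pos_pos less_imp_neq[symmetric])
      then show ?thesis unfolding rate1_def r_def[symmetric] by (simp add: field_simps)
    qed
    finally show "a * y - (q * m + p / (p - 1) * q\<^sup>2 * D / 2) = y\<^sup>2 / (2 * m * L\<^sup>2) * rate1 (c / y\<^sup>2)" .
  qed
qed

text \<open>The choice \<open>p = 3/2\<close> minimises \<open>p ^ 3 / (p - 1)\<close>, to which the
  term quartic in \<open>a\<close> is proportional, and \<open>a\<close> maximises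
  \<open>a * y\<close> minus that quartic term. With \<open>w = (c / y\<^sup>2) powr (1/3)\<close>
  the terms are \<open>2/3 * w\<close>, \<open>w\<^sup>2 / 3\<close> and \<open>w / 6\<close> in
  units of \<open>y\<^sup>2 / (m * L\<^sup>2)\<close>. Positivity of the rate gives
  \<open>2/3 * w < 1\<close>, hence the bounds on \<open>a\<close> and \<open>q\<close>.\<close>

lemma rate2_attained:
  fixes y m L D :: real
  assumes "0 < y" "0 < m" "0 < L" "0 < D"
  defines "c \<equiv> L\<^sup>2 * m ^ 3 / D"
  assumes pos: "0 < rate2 (c / y\<^sup>2)"
  obtains a p q where "0 < a" "a \<le> y / (m * L\<^sup>2)" "1 < p" "q = p * a\<^sup>2 * L\<^sup>2 / 2" "q \<le> y\<^sup>2 / (m\<^sup>2 * L\<^sup>2)"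
    "a * y - (q * m + p / (p - 1) * q\<^sup>2 * D / 2) = y\<^sup>2 / (2 * m * L\<^sup>2) * rate2 (c / y\<^sup>2)"
proof -
  define w where "w = (c / y\<^sup>2) powr (1/3)"
  have c: "0 < c" using assms by simp
  have w: "0 < w" using c assms(1) by (simp add: w_def)
  have rate: "rate2 (c / y\<^sup>2) = w * max (1 - 2/3 * w) 0" by (simp add: rate2_def w_def)
  then have w1: "2/3 * w < 1" using pos w by (auto simp: max_def zero_less_mult_iff split: if_splits)
  have "w ^ 3 = w powr 3" using w by simp
  also have "\<dots> = c / y\<^sup>2" using c assms(1) unfolding w_def powr_powr by simp
  finally have "w ^ 3 = c / y\<^sup>2" .
  then have "L\<^sup>2 * m ^ 3 = w ^ 3 * y\<^sup>2 * D" using assms(1,4) by (simp add: c_def field_simps)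
  then have D: "D = L\<^sup>2 * m ^ 3 / (w ^ 3 * y\<^sup>2)" using assms(1) w by (simp add: field_simps)
  define a where "a = y / (m * L\<^sup>2) * (2/3 * w)"
  define q where "q = y\<^sup>2 / (m\<^sup>2 * L\<^sup>2) * (w\<^sup>2 / 3)"
  show ?thesis
  proof (rule that[of a "3/2" q])
    show "0 < a" using assms w by (simp add: a_def)
    show "a \<le> y / (m * L\<^sup>2)" unfolding a_def using assms w1 w by (intro mult_left_le) auto
    show "q = 3/2 * a\<^sup>2 * L\<^sup>2 / 2" using assms(2,3)
      by (simp add: q_def a_def field_simps power2_eq_square)
    have "w\<^sup>2 / 3 \<le> 1"
    proof -
      have "w * w \<le> (3/2) * (3/2)" using w w1 by (intro mult_mono) auto
      then show ?thesis by (simp add: power2_eq_square)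
    qed
    then show "q \<le> y\<^sup>2 / (m\<^sup>2 * L\<^sup>2)" unfolding q_def by (intro mult_left_le) auto
    have q2: "q\<^sup>2 * D = y\<^sup>2 / (m * L\<^sup>2) * (w / 9)"
      unfolding D q_def using w assms(1,2,3) by (simp add: field_simps power2_eq_square power3_eq_cube)
    have "q * m = y\<^sup>2 / (m * L\<^sup>2) * (w\<^sup>2 / 3)"
      using assms(2) by (simp add: q_def power2_eq_square)
    moreover have "a * y = y\<^sup>2 / (m * L\<^sup>2) * (2/3 * w)"
      using assms(2) by (simp add: a_def power2_eq_square)
    moreover have "3/2 / (3/2 - 1) * q\<^sup>2 * D / 2 = y\<^sup>2 / (m * L\<^sup>2) * (w / 6)"
    proof -
      have "3/2 / (3/2 - 1) * q\<^sup>2 * D / 2 = 3/2 * (q\<^sup>2 * D)" by simp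
      also have "\<dots> = y\<^sup>2 / (m * L\<^sup>2) * (w / 6)" unfolding q2 by (simp add: mult_ac)
      finally show ?thesis .
    qed
    ultimately have "a * y - (q * m + 3/2 / (3/2 - 1) * q\<^sup>2 * D / 2)
       = y\<^sup>2 / (m * L\<^sup>2) * (2/3 * w - w\<^sup>2 / 3 - w / 6)"
      by (simp only: right_diff_distrib diff_diff_eq distrib_left)
    also have "\<dots> = y\<^sup>2 / (2 * m * L\<^sup>2) * rate2 (c / y\<^sup>2)"
    proof -
      have "x * (2/3 * w - w\<^sup>2 / 3 - w / 6) = x / 2 * (w * (1 - 2/3 * w))" for x
        by (simp add: algebra_simps power2_eq_square)
      from this[of "y\<^sup>2 / (m * L\<^sup>2)"] show ?thesis unfolding rate using w1 by (simp add: max_def mult_ac)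
    qed
    finally show "a * y - (q * m + 3/2 / (3/2 - 1) * q\<^sup>2 * D / 2) = y\<^sup>2 / (2 * m * L\<^sup>2) * rate2 (c / y\<^sup>2)" .
  qed auto
qed

section \<open>Tail bounds for moderate and large deviations\<close>

context deviation
begin

text \<open>The cube of \<open>bar_c\<close> for the constant sequence \<open>1\<close>, once
  \<open>L\<close>, \<open>L'\<close>, \<open>m\<close> and \<open>S\<^sub>1\<close> are the
  Lipschitz constants, the mean and the supremum of the theorem.\<close>

definition scale :: real where "scale = L\<^sup>2 * m ^ 3 / (L'\<^sup>2 * S\<^sub>1\<^sup>2)"

text \<open>The exponent of the theorem per unit of \<Gamma> at the level
  \<open>y = a / sqrt \<Gamma>\<close>, with \<open>L\<close> in place of the gradient norm.\<close>

definition rate :: "real \<Rightarrow> real" where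
  "rate y = y\<^sup>2 / (2 * m * L\<^sup>2) * max (rate1 (scale / y\<^sup>2)) (rate2 (scale / y\<^sup>2))"

lemma scale_pos: "0 < scale"
  using L_pos L'_pos m_pos S1_pos by (simp add: scale_def)

text \<open>At the parameter \<open>y / (2 * K)\<close> the crude bound has exponent
  \<open>K - y\<^sup>2 / (4 * K)\<close> per unit of \<Gamma>. Since \<open>rate y\<close> is
  \<open>o(y\<^sup>2)\<close>, both \<open>K\<close> and \<open>rate y\<close> are at most
  \<open>y\<^sup>2 / (8 * K)\<close> once \<open>y\<close> is large.\<close>

lemma tail_large:
  obtains Y where "0 < Y" "\<And>y n. 0 < y \<Longrightarrow> Y \<le> y\<^sup>2 \<Longrightarrow> 1 \<le> n \<Longrightarrow>
    prob {\<omega>\<in>space M. y * Gam \<gamma> n \<le> \<bar>Z n \<omega>\<bar>} \<le> 2 * exp (- rate y * Gam \<gamma> n)"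
proof -
  obtain K where K: "0 < K" "\<And>a n. 1 \<le> n \<Longrightarrow>
    (\<integral>\<^sup>+\<omega>. ennreal (exp (a * Z n \<omega>)) \<partial>M) \<le> ennreal (exp (K * (1 + a\<^sup>2) * Gam \<gamma> n))"
    using laplace_crude by blast
  define d where "d = m * L\<^sup>2 / (4 * K)"
  have d: "0 < d" using K m_pos L_pos by (simp add: d_def)
  \<comment> \<open>The three summands force, in this order,
    \<open>K \<le> y\<^sup>2 / (8 * K)\<close>, smallness of \<open>rate1\<close> and smallness of
    \<open>rate2\<close>.\<close>
  define Y where "Y = 8 * K\<^sup>2 + 4 * K * scale / (m * L\<^sup>2) + scale / d ^ 3"
  have Y: "8 * K\<^sup>2 \<le> Y" "4 * K * scale / (m * L\<^sup>2) \<le> Y" "scale / d ^ 3 \<le> Y" "0 < Y"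
    using K d scale_pos m_pos L_pos by (auto simp: Y_def add_pos_pos intro!: add_nonneg_nonneg)
  show ?thesis
  proof (rule that[OF Y(4)])
    fix y :: real and n :: nat assume y: "0 < y" "Y \<le> y\<^sup>2" and n: "1 \<le> n"
    let ?t = "y / (2 * K)" and ?G = "Gam \<gamma> n"
    have "prob {\<omega>\<in>space M. y * ?G \<le> \<bar>Z n \<omega>\<bar>} \<le> 2 * exp (K * (1 + ?t\<^sup>2) * ?G - ?t * (y * ?G))"
    proof (rule two_sided_tail)
      show "0 < ?t" using y K by simp
      fix a assume "\<bar>a\<bar> = ?t"
      then have "a\<^sup>2 = ?t\<^sup>2" by (metis power2_abs)
      then show "(\<integral>\<^sup>+\<omega>. ennreal (exp (a * Z n \<omega>)) \<partial>M) \<le> ennreal (exp (K * (1 + ?t\<^sup>2) * ?G))"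
        using K(2)[OF n, of a] by simp
    qed
    also have "K * (1 + ?t\<^sup>2) * ?G - ?t * (y * ?G) = (K - y\<^sup>2 / (4 * K)) * ?G"
      using K(1) by (simp add: field_simps power2_eq_square)
    also have "2 * exp ((K - y\<^sup>2 / (4 * K)) * ?G) \<le> 2 * exp (- rate y * ?G)"
    proof -
      have "K \<le> y\<^sup>2 / (8 * K)" using y(2) Y(1) K(1) by (simp add: field_simps power2_eq_square)
      moreover have "rate y \<le> y\<^sup>2 / (8 * K)"
      proof -
        have "rate1 (scale / y\<^sup>2) \<le> m * L\<^sup>2 / (4 * K)"
        proof -
          have "rate1 (scale / y\<^sup>2) \<le> scale / y\<^sup>2" using scale_pos y(1) by (intro rate1_le) auto
          also have "\<dots> \<le> m * L\<^sup>2 / (4 * K)"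
            
          proof -
            have "scale * (4 * K) \<le> (m * L\<^sup>2) * y\<^sup>2"
              using order_trans[OF Y(2) y(2)] K(1) m_pos L_pos by (simp add: pos_divide_le_eq mult_ac)
            then show ?thesis using y(1) K(1) by (simp add: pos_divide_le_eq pos_le_divide_eq)
          qed
          finally show ?thesis .
        qed
        moreover have "rate2 (scale / y\<^sup>2) \<le> m * L\<^sup>2 / (4 * K)"
        proof -
          have "scale / y\<^sup>2 \<le> d ^ 3" using order_trans[OF Y(3) y(2)] y(1) d by (simp add: field_simps)
          then have "(scale / y\<^sup>2) powr (1/3) \<le> (d ^ 3) powr (1/3)"
            using scale_pos by (intro powr_mono2) auto
          also have "(d ^ 3) powr (1/3) = (d powr 3) powr (1/3)" using d by simp
          also have "\<dots> = d" using d unfolding powr_powr by simp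
          finally show ?thesis using rate2_le[of "scale / y\<^sup>2"] by (simp add: d_def)
        qed
        ultimately have "rate y \<le> y\<^sup>2 / (2 * m * L\<^sup>2) * (m * L\<^sup>2 / (4 * K))"
          unfolding rate_def using m_pos by (intro mult_left_mono) auto
        also have "\<dots> = y\<^sup>2 / (8 * K)" using m_pos L_pos by simp
        finally show ?thesis .
      qed
      ultimately have "K - y\<^sup>2 / (4 * K) \<le> - rate y" by (simp add: field_simps)
      then show ?thesis using mult_right_mono[OF _ Gam_nonneg[of n], of "K - y\<^sup>2 / (4 * K)" "- rate y"]
        by (simp only: exp_le_cancel_iff mult_le_cancel_left_pos zero_less_numeral)
    qed
    finally show "prob {\<omega>\<in>space M. y * ?G \<le> \<bar>Z n \<omega>\<bar>} \<le> 2 * exp (- rate y * ?G)" .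
  qed
qed

text \<open>For \<open>y\<^sup>2 \<le> Y\<close> the parameters stay below a fixed \<Lambda>, and
  monotonicity of \<open>rate1\<close> gives \<open>rate y \<ge> k * y\<^sup>2\<close>, so errors up
  to \<open>\<epsilon> * k * y\<^sup>2 * \<Gamma>\<close> are affordable. The factor
  \<open>1 - 2 * \<epsilon>\<close> collects one \<epsilon> from the convexity weight and one from
  the remainders.\<close>

lemma tail_moderate:
  assumes \<epsilon>: "0 < \<epsilon>" "\<epsilon> < 1/2" and Y: "0 < Y"
  shows "\<forall>\<^sub>F n in sequentially. \<forall>y. 0 < y \<and> y\<^sup>2 \<le> Y \<longrightarrow>
    prob {\<omega>\<in>space M. y * Gam \<gamma> n \<le> \<bar>Z n \<omega>\<bar>} \<le> 2 * exp \<epsilon> * exp (- (1 - 2 * \<epsilon>) * rate y * Gam \<gamma> n)"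
proof -
  define k where "k = rate1 (scale / Y) / (2 * m * L\<^sup>2)"
  have k: "0 < k" using rate1_pos[of "scale / Y"] scale_pos Y m_pos L_pos by (simp add: k_def)
  define A where "A = 1 / (m * L\<^sup>2)"
  define A' where "A' = 1 / (m\<^sup>2 * L\<^sup>2)"
  have A: "0 < A" "0 < A'" using m_pos L_pos by (auto simp: A_def A'_def)
  define \<Lambda> where "\<Lambda> = max (A * sqrt Y) (A' * Y)"
  have \<Lambda>: "0 < \<Lambda>" "A * sqrt Y \<le> \<Lambda>" "A' * Y \<le> \<Lambda>" using A Y by (auto simp: \<Lambda>_def less_max_iff_disj)
  have \<epsilon>1: "\<epsilon> < 1" using \<epsilon> by simp
  obtain K where K: "0 \<le> K" "\<And>a p q n. \<bar>a\<bar> \<le> \<Lambda> \<Longrightarrow> 1 < p \<Longrightarrow> q = p * a\<^sup>2 * L\<^sup>2 / 2 \<Longrightarrow> q \<le> \<Lambda> \<Longrightarrow>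
    (\<integral>\<^sup>+\<omega>. ennreal (exp ((1 - \<epsilon>) * a * Z n \<omega>)) \<partial>M)
    \<le> ennreal (exp ((1 - \<epsilon>) * (q * m + p / (p - 1) * q\<^sup>2 * L'\<^sup>2 * S\<^sub>1\<^sup>2 / 2) * Gam \<gamma> n
        + K * (q * (1 + (\<Sum>k=1..n. e' k)) + \<bar>a\<bar> * (1 + (\<Sum>k=1..n. e k)))))"
    using laplace_sharp[OF \<epsilon>(1) \<epsilon>1 \<Lambda>(1)] by blast
  have "(\<lambda>n. K * A' * ((1 + (\<Sum>k=1..n. e' k)) / Gam \<gamma> n) + (K * A)\<^sup>2 / (4 * \<epsilon>) * ((1 + (\<Sum>k=1..n. e k))\<^sup>2 / Gam \<gamma> n))
      \<longlonglongrightarrow> K * A' * 0 + (K * A)\<^sup>2 / (4 * \<epsilon>) * 0"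
    by (intro tendsto_intros e_sum e'_sum)
  then have "\<forall>\<^sub>F n in sequentially. K * A' * ((1 + (\<Sum>k=1..n. e' k)) / Gam \<gamma> n)
      + (K * A)\<^sup>2 / (4 * \<epsilon>) * ((1 + (\<Sum>k=1..n. e k))\<^sup>2 / Gam \<gamma> n) < \<epsilon> * k"
    using \<epsilon> k by (intro order_tendstoD(2)) auto
  moreover have "\<forall>\<^sub>F n in sequentially. 1 \<le> n" by (rule eventually_ge_at_top)
  ultimately show ?thesis
  proof eventually_elim
    case (elim n)
    let ?G = "Gam \<gamma> n" and ?E = "1 + (\<Sum>k=1..n. e k)" and ?E' = "1 + (\<Sum>k=1..n. e' k)"
    have G: "0 < ?G" using Gam_pos[OF elim(2)] \<gamma>_pos[of 1] by simp
    have E: "0 \<le> ?E" "0 \<le> ?E'" using e_nonneg e'_nonneg by (auto intro!: add_nonneg_nonneg sum_nonneg)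
    have small: "K * A' * ?E' + (K * A)\<^sup>2 / (4 * \<epsilon>) * ?E\<^sup>2 \<le> \<epsilon> * k * ?G"
      using mult_right_mono[OF less_imp_le[OF elim(1)], of ?G] G by (simp add: distrib_right)
    \<comment> \<open>The Chernoff argument common to both branches: it accepts any admissible
      \<open>a\<close>, \<open>p\<close>, \<open>q\<close> whose value \<open>J\<close> is at least
      \<open>k * y\<^sup>2\<close>.\<close>
    have one: "prob {\<omega>\<in>space M. y * ?G \<le> \<bar>Z n \<omega>\<bar>} \<le> 2 * exp \<epsilon> * exp (- (1 - 2 * \<epsilon>) * J * ?G)"
      if y: "0 < y" "y\<^sup>2 \<le> Y" and a: "0 < a" "a \<le> y / (m * L\<^sup>2)" and p: "1 < p"
        and q: "q = p * a\<^sup>2 * L\<^sup>2 / 2" "q \<le> y\<^sup>2 / (m\<^sup>2 * L\<^sup>2)"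
        and J: "a * y - (q * m + p / (p - 1) * q\<^sup>2 * (L'\<^sup>2 * S\<^sub>1\<^sup>2) / 2) = J" "k * y\<^sup>2 \<le> J" for y a p q J
    proof -
      have y': "y \<le> sqrt Y" using y by (simp add: real_le_rsqrt)
      have a': "a \<le> A * y" "a \<le> \<Lambda>"
        using a(2) order_trans[OF mult_left_mono[OF y', of A] \<Lambda>(2)] A by (auto simp: A_def)
      have q': "q \<le> A' * y\<^sup>2" "q \<le> \<Lambda>"
        using q(2) order_trans[OF mult_left_mono[OF y(2), of A'] \<Lambda>(3)] A by (auto simp: A'_def)
      let ?B = "(1 - \<epsilon>) * (q * m + p / (p - 1) * q\<^sup>2 * L'\<^sup>2 * S\<^sub>1\<^sup>2 / 2) * ?G + K * (q * ?E' + a * ?E)"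
      have "prob {\<omega>\<in>space M. y * ?G \<le> \<bar>Z n \<omega>\<bar>} \<le> 2 * exp (?B - (1 - \<epsilon>) * a * (y * ?G))"
      proof (rule two_sided_tail)
        show "0 < (1 - \<epsilon>) * a" using \<epsilon> a by simp
        fix x assume x: "\<bar>x\<bar> = (1 - \<epsilon>) * a"
        define z where "z = x / (1 - \<epsilon>)"
        have z: "x = (1 - \<epsilon>) * z" "\<bar>z\<bar> = a" using x \<epsilon> by (auto simp: z_def abs_divide)
        then have "z\<^sup>2 = a\<^sup>2" by (metis power2_abs)
        then have "q = p * z\<^sup>2 * L\<^sup>2 / 2" using q(1) by simp
        from K(2)[OF _ p this q'(2), of n] z a'
        show "(\<integral>\<^sup>+\<omega>. ennreal (exp (x * Z n \<omega>)) \<partial>M) \<le> ennreal (exp ?B)" by simp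
      qed
      also have "?B - (1 - \<epsilon>) * a * (y * ?G) = - (1 - \<epsilon>) * J * ?G + K * (q * ?E' + a * ?E)"
      proof -
        have "(1 - \<epsilon>) * c * ?G + x - (1 - \<epsilon>) * a * (y * ?G) = - (1 - \<epsilon>) * (a * y - c) * ?G + x" for c x
          by (simp add: algebra_simps)
        then show ?thesis unfolding J(1)[symmetric] by (simp only: mult.assoc)
      qed
      also have "2 * exp (- (1 - \<epsilon>) * J * ?G + K * (q * ?E' + a * ?E)) \<le> 2 * exp (\<epsilon> + - (1 - 2 * \<epsilon>) * J * ?G)"
      proof -
        have "K * (q * ?E') \<le> K * (A' * y\<^sup>2 * ?E')" using K(1) E q' by (intro mult_left_mono mult_right_mono) auto
        moreover have "K * (a * ?E) \<le> K * (A * y * ?E)" using K(1) E a' by (intro mult_left_mono mult_right_mono) auto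
        \<comment> \<open>This cost is linear in \<open>y\<close>, hence not dominated by
          \<open>y\<^sup>2\<close> near \<open>0\<close>. The inequality
          \<open>x \<le> \<epsilon> + x\<^sup>2 / (4 * \<epsilon>)\<close> sends a constant to the
          prefactor and leaves a square that the exponent absorbs.\<close>
        moreover have "K * (A * y * ?E) \<le> \<epsilon> + (K * A)\<^sup>2 / (4 * \<epsilon>) * ?E\<^sup>2 * y\<^sup>2"
        proof -
          have "x \<le> \<epsilon> + x\<^sup>2 / (4 * \<epsilon>)" for x
          proof -
            have "0 \<le> (x - 2 * \<epsilon>)\<^sup>2" by simp
            then have "x * (4 * \<epsilon>) \<le> (\<epsilon> + x\<^sup>2 / (4 * \<epsilon>)) * (4 * \<epsilon>)"
              using \<epsilon>(1) by (simp add: power2_eq_square algebra_simps)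
            then show ?thesis using \<epsilon>(1) by simp
          qed
          from this[of "K * (A * y * ?E)"] show ?thesis by (simp add: power_mult_distrib mult_ac)
        qed
        moreover have "K * A' * ?E' * y\<^sup>2 + (K * A)\<^sup>2 / (4 * \<epsilon>) * ?E\<^sup>2 * y\<^sup>2 \<le> \<epsilon> * k * ?G * y\<^sup>2"
          using mult_right_mono[OF small, of "y\<^sup>2"] by (simp add: distrib_right)
        moreover have "\<epsilon> * k * ?G * y\<^sup>2 \<le> \<epsilon> * J * ?G"
        proof -
          have "\<epsilon> * ?G * (k * y\<^sup>2) \<le> \<epsilon> * ?G * J" using J(2) \<epsilon> G by (intro mult_left_mono) auto
          then show ?thesis by (simp only: mult_ac)
        qed
        moreover have "K * (A' * y\<^sup>2 * ?E') = K * A' * ?E' * y\<^sup>2" by (simp only: mult_ac)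
        ultimately have "K * (q * ?E') + K * (a * ?E) \<le> \<epsilon> + \<epsilon> * J * ?G" by linarith
        moreover have "- (1 - \<epsilon>) * J * ?G + \<epsilon> * J * ?G = - (1 - 2 * \<epsilon>) * J * ?G" by (simp add: algebra_simps)
        ultimately show ?thesis by (simp add: distrib_left)
      qed
      finally show ?thesis by (simp add: exp_add)
    qed
    show ?case
    proof (intro allI impI)
      fix y assume y: "0 < y \<and> y\<^sup>2 \<le> Y"
      let ?r1 = "y\<^sup>2 / (2 * m * L\<^sup>2) * rate1 (scale / y\<^sup>2)" and ?r2 = "y\<^sup>2 / (2 * m * L\<^sup>2) * rate2 (scale / y\<^sup>2)"
      have D: "0 < L'\<^sup>2 * S\<^sub>1\<^sup>2" using L'_pos S1_pos by simp
      have k1: "k * y\<^sup>2 \<le> ?r1"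
      proof -
        have "rate1 (scale / Y) \<le> rate1 (scale / y\<^sup>2)"
          using y Y scale_pos by (intro rate1_mono divide_left_mono) auto
        then have "y\<^sup>2 / (2 * m * L\<^sup>2) * rate1 (scale / Y) \<le> ?r1" using m_pos by (intro mult_left_mono) auto
        then show ?thesis by (simp add: k_def mult.commute)
      qed
      have "0 < k * y\<^sup>2" using k y by simp
      show "prob {\<omega>\<in>space M. y * ?G \<le> \<bar>Z n \<omega>\<bar>} \<le> 2 * exp \<epsilon> * exp (- (1 - 2 * \<epsilon>) * rate y * ?G)"
      proof (cases "?r1 \<le> ?r2")
        case True
        then have r2: "k * y\<^sup>2 \<le> ?r2" "0 < ?r2" using k1 \<open>0 < k * y\<^sup>2\<close> by linarith+
        have pos: "0 < y\<^sup>2 / (2 * m * L\<^sup>2)" using y m_pos L_pos by simp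
        have "0 < rate2 (scale / y\<^sup>2)" using r2(2) zero_less_mult_pos[OF _ pos] by blast
        moreover have "rate y = ?r2"
          using True pos unfolding rate_def max_mult_distrib_left by (simp add: max_def)
        ultimately obtain a p q where "0 < a" "a \<le> y / (m * L\<^sup>2)" "1 < p" "q = p * a\<^sup>2 * L\<^sup>2 / 2"
            "q \<le> y\<^sup>2 / (m\<^sup>2 * L\<^sup>2)" "a * y - (q * m + p / (p - 1) * q\<^sup>2 * (L'\<^sup>2 * S\<^sub>1\<^sup>2) / 2) = rate y"
          using rate2_attained[OF conjunct1[OF y] m_pos L_pos D, folded scale_def] by metis
        then show ?thesis using y \<open>k * y\<^sup>2 \<le> ?r2\<close> \<open>rate y = ?r2\<close> by (intro one[of y a p q]) auto
      next
        case False
        moreover have "0 < y\<^sup>2 / (2 * m * L\<^sup>2)" using y m_pos L_pos by simp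
        ultimately have "rate y = ?r1" unfolding rate_def max_mult_distrib_left by (simp add: max_def)
        then obtain a p q where "0 < a" "a \<le> y / (m * L\<^sup>2)" "1 < p" "q = p * a\<^sup>2 * L\<^sup>2 / 2"
            "q \<le> y\<^sup>2 / (m\<^sup>2 * L\<^sup>2)" "a * y - (q * m + p / (p - 1) * q\<^sup>2 * (L'\<^sup>2 * S\<^sub>1\<^sup>2) / 2) = rate y"
          using rate1_attained[OF conjunct1[OF y] m_pos L_pos D, folded scale_def] by metis
        then show ?thesis using y k1 \<open>rate y = ?r1\<close> by (intro one[of y a p q]) auto
      qed
    qed
  qed
qed

lemma deviation_bound:
  assumes \<epsilon>: "0 < \<epsilon>" "\<epsilon> < 1/2"
  shows "\<forall>\<^sub>F n in sequentially. \<forall>y>0.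
    prob {\<omega>\<in>space M. y * Gam \<gamma> n \<le> \<bar>Z n \<omega>\<bar>} \<le> 2 * exp \<epsilon> * exp (- (1 - 2 * \<epsilon>) * rate y * Gam \<gamma> n)"
proof -
  obtain Y where Y: "0 < Y" "\<And>y n. 0 < y \<Longrightarrow> Y \<le> y\<^sup>2 \<Longrightarrow> 1 \<le> n \<Longrightarrow>
    prob {\<omega>\<in>space M. y * Gam \<gamma> n \<le> \<bar>Z n \<omega>\<bar>} \<le> 2 * exp (- rate y * Gam \<gamma> n)"
    using tail_large by blast
  have "\<forall>\<^sub>F n in sequentially. 1 \<le> n" by (rule eventually_ge_at_top)
  with tail_moderate[OF \<epsilon> Y(1)] show ?thesis
  proof eventually_elim
    case (elim n)
    show ?case
    proof (intro allI impI)
      fix y :: real assume y: "0 < y"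
      show "prob {\<omega>\<in>space M. y * Gam \<gamma> n \<le> \<bar>Z n \<omega>\<bar>} \<le> 2 * exp \<epsilon> * exp (- (1 - 2 * \<epsilon>) * rate y * Gam \<gamma> n)"
      proof (cases "y\<^sup>2 \<le> Y")
        case True then show ?thesis using elim y by blast
      next
        case False
        have "0 \<le> rate1 (scale / y\<^sup>2)" using rate1_pos[of "scale / y\<^sup>2"] scale_pos y by simp
        then have "0 \<le> rate y" using m_pos by (simp add: rate_def le_max_iff_disj)
        then have "0 \<le> 2 * \<epsilon> * (rate y * Gam \<gamma> n)" using \<epsilon> Gam_nonneg by (intro mult_nonneg_nonneg) auto
        then have "- rate y * Gam \<gamma> n \<le> \<epsilon> + - (1 - 2 * \<epsilon>) * rate y * Gam \<gamma> n"
          using \<epsilon> by (simp add: algebra_simps)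
        then have "exp (- rate y * Gam \<gamma> n) \<le> exp \<epsilon> * exp (- (1 - 2 * \<epsilon>) * rate y * Gam \<gamma> n)"
          by (simp flip: exp_add)
        then show ?thesis using Y(2)[OF y, of n] False elim by simp
      qed
    qed
  qed
qed

end

section \<open>Taylor remainders and the bias\<close>

text \<open>A non-integrable \<open>f\<close> has integral \<open>0\<close> by convention, a case
  covered by \<open>0 \<le> B\<close>.\<close>

lemma abs_integral_unit_le:
  fixes f :: "real \<Rightarrow> real"
  assumes "\<And>t. 0 \<le> t \<Longrightarrow> t \<le> 1 \<Longrightarrow> \<bar>f t\<bar> \<le> B" "0 \<le> B"
  shows "\<bar>integral {0..1} f\<bar> \<le> B"
proof (cases "f integrable_on {0..1}")
  case True
  then have "(f has_integral integral {0..1} f) (cbox 0 1)" by (simp add: integrable_integral)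
  from has_integral_bound[OF assms(2) this] assms(1) show ?thesis by simp
qed (use assms(2) in \<open>simp add: not_integrable_integral\<close>)

lemma third_deriv_scale: "third_deriv f x (c *\<^sub>R h) = c *\<^sub>R third_deriv f x h"
  by (simp add: third_deriv_def vec_eq_iff sum_distrib_left mult_ac)

lemma third_form_scale:
  "(c *\<^sub>R h) \<bullet> (third_deriv f x (c *\<^sub>R h) *v (c *\<^sub>R h)) = c ^ 3 * (h \<bullet> (third_deriv f x h *v h))"
  by (simp add: third_deriv_scale matrix_vector_mult_scaleR scaleR_matrix_vector_assoc[symmetric] power3_eq_cube)

lemma continuous_on_third_form:
  fixes f :: "real^'n \<Rightarrow> real"
  assumes "Ck k f" "3 \<le> k" "continuous_on S g" "continuous_on S h"
  shows "continuous_on S (\<lambda>z. h z \<bullet> (third_deriv f (g z) (h z) *v h z))"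
proof -
  have *: "continuous_on S (\<lambda>z. partial i (partial j (partial l f)) (g z))" for i j l
    using continuous_on_compose2[OF Ck_continuous[OF assms(1), of "[i,j,l]"] assms(3)] assms(2) by simp
  show ?thesis unfolding inner_mult_vec_eq_sum third_deriv_def vec_lambda_beta
    by (intro continuous_intros * assms(4))
qed

text \<open>The expectation stands inside the integrals over \<open>t\<close> and \<open>u\<close>
  in the bias term and outside them in the averaged Taylor formula. The swap passes from the gauge
  integral to the Lebesgue integral on the unit interval and uses Fubini with a polynomial
  majorant.\<close>

lemma (in innovations) integral_swap:
  fixes f :: "real \<Rightarrow> real^'r \<Rightarrow> real"
  assumes f: "continuous_on UNIV (\<lambda>p. f (fst p) (snd p))"
    and le: "\<And>t u. 0 \<le> t \<Longrightarrow> t \<le> 1 \<Longrightarrow> \<bar>f t u\<bar> \<le> C * (1 + norm u) ^ k"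
  shows "integral {0..1} (\<lambda>t. \<integral>u. f t u \<partial>mu) = (\<integral>u. integral {0..1} (\<lambda>t. f t u) \<partial>mu)"
proof -
  interpret P: pair_sigma_finite lborel mu
    by (simp add: pair_sigma_finite_def mu.sigma_finite_measure sigma_finite_lborel)
  let ?F = "\<lambda>p. indicator {0..1} (fst p) *\<^sub>R f (fst p) (snd p)"
  have fm: "(\<lambda>p. f (fst p) (snd p)) \<in> borel_measurable (borel \<Otimes>\<^sub>M borel)"
    unfolding borel_prod by (rule borel_measurable_continuous_onI[OF f])
  then have [measurable]: "(\<lambda>p. f (fst p) (snd p)) \<in> borel_measurable (lborel \<Otimes>\<^sub>M mu)"
    using measurable_cong_sets[OF sets_pair_measure_cong[OF sets_lborel sets_mu] refl] by blast
  have fu: "f t \<in> borel_measurable borel" for t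
    using measurable_compose[OF _ fm, of "\<lambda>u. (t, u)" borel] by simp
  have B: "integrable mu (\<lambda>u. C * (1 + norm u) ^ k)"
  proof (rule integrable_polynomial_growth)
    show "\<bar>C * (1 + norm u) ^ k\<bar> \<le> \<bar>C\<bar> * (1 + norm u) ^ k" for u :: "real^'r"
      by (simp add: abs_mult)
  qed measurable
  have ft: "integrable mu (f t)" if "0 \<le> t" "t \<le> 1" for t
    using le[OF that] by (intro integrable_polynomial_growth[OF fu]) auto
  have int: "integrable (lborel \<Otimes>\<^sub>M mu) ?F"
  proof (rule P.Fubini_integrable)
    show "?F \<in> borel_measurable (lborel \<Otimes>\<^sub>M mu)" by measurable
    show "AE t in lborel. integrable mu (\<lambda>u. ?F (t, u))"
      using ft by (intro AE_I2) (auto simp: indicator_def)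
    show "integrable lborel (\<lambda>t. \<integral>u. norm (?F (t, u)) \<partial>mu)"
    proof (rule Bochner_Integration.integrable_bound)
      show "integrable lborel (\<lambda>t. indicator {0..1::real} t * (\<integral>u. C * (1 + norm u) ^ k \<partial>mu))" by simp
      show "(\<lambda>t. \<integral>u. norm (?F (t, u)) \<partial>mu) \<in> borel_measurable lborel" by measurable
      show "AE t in lborel. norm (\<integral>u. norm (?F (t, u)) \<partial>mu) \<le> norm (indicator {0..1} t * (\<integral>u. C * (1 + norm u) ^ k \<partial>mu))"
      proof (rule AE_I2)
        fix t :: real
        show "norm (\<integral>u. norm (?F (t, u)) \<partial>mu) \<le> norm (indicator {0..1} t * (\<integral>u. C * (1 + norm u) ^ k \<partial>mu))"
        proof (cases "t \<in> {0..1}")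
          case True
          then have "(\<integral>u. \<bar>f t u\<bar> \<partial>mu) \<le> (\<integral>u. C * (1 + norm u) ^ k \<partial>mu)"
            using ft[of t] le[of t] by (intro integral_mono B) auto
          then show ?thesis using True by simp
        qed simp
      qed
    qed
  qed
  have "integral {0..1} (\<lambda>t. \<integral>u. f t u \<partial>mu) = (LINT t:{0..1}|lborel. \<integral>u. f t u \<partial>mu)"
  proof (rule set_borel_integral_eq_integral(2)[symmetric])
    show "set_integrable lborel {0..1} (\<lambda>t. \<integral>u. f t u \<partial>mu)"
      using P.integrable_fst'[OF int] by (simp add: set_integrable_def)
  qed
  also have "\<dots> = (\<integral>t. (\<integral>u. ?F (t, u) \<partial>mu) \<partial>lborel)"
    by (simp add: set_lebesgue_integral_def)
  also have "\<dots> = (\<integral>u. (\<integral>t. ?F (t, u) \<partial>lborel) \<partial>mu)"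
    using P.Fubini_integral[of "\<lambda>t u. ?F (t, u)"] int by (simp add: case_prod_unfold)
  also have "\<dots> = (\<integral>u. integral {0..1} (\<lambda>t. f t u) \<partial>mu)"
  proof (rule Bochner_Integration.integral_cong)
    fix u
    have "continuous_on {0..1} (\<lambda>t. f t u)"
      using continuous_on_compose2[OF f, of "{0..1}" "\<lambda>t. (t, u)"] by (simp add: continuous_intros)
    then have "set_integrable lborel {0..1} (\<lambda>t. f t u)" by (rule borel_integrable_atLeastAtMost')
    from set_borel_integral_eq_integral(2)[OF this]
    show "(\<integral>t. ?F (t, u) \<partial>lborel) = integral {0..1} (\<lambda>t. f t u)"
      by (simp add: set_lebesgue_integral_def)
  qed simp
  finally show ?thesis .
qed

context euler_scheme
begin

text \<open>This and the next two functions are the Taylor errors of one step: the drift move, the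
  shift of the Hessian along it, and the third-order effect of the noise. Their sums divided by
  \<open>sqrt \<Gamma>\<close> are the three parts of the bias for \<open>\<beta> = 1\<close>;
  \<open>skew_rem\<close> alone gives the bias for \<open>\<beta> < 1\<close>.\<close>

definition drift_rem :: "(real^'d \<Rightarrow> real) \<Rightarrow> nat \<Rightarrow> real^'d \<Rightarrow> real" where
  "drift_rem f k x = f (noiseless k x) - f x - \<gamma> k * (grad f x \<bullet> b x)"

definition hess_rem :: "(real^'d \<Rightarrow> real) \<Rightarrow> nat \<Rightarrow> real^'d \<Rightarrow> real" where
  "hess_rem f k x = \<gamma> k / 2 * trace ((hess f (noiseless k x) - hess f x) ** diffusion_matrix \<sigma> x)"

definition skew_rem :: "(real^'d \<Rightarrow> real) \<Rightarrow> nat \<Rightarrow> real^'d \<Rightarrow> real" where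
  "skew_rem f k x = transition k f x - f (noiseless k x)
     - \<gamma> k / 2 * trace (hess f (noiseless k x) ** diffusion_matrix \<sigma> x)"

lemma transition_decomposition:
  "transition k f x - f x = \<gamma> k * generator b \<sigma> f x + (drift_rem f k x + hess_rem f k x + skew_rem f k x)"
proof -
  have "trace ((A - B) ** D) = trace (A ** D) - trace (B ** D)" for A B D :: "real^'d^'d"
    by (simp add: trace_def matrix_matrix_mult_def sum_subtractf left_diff_distrib)
  note tr = this[of "hess f (noiseless k x)" "hess f x" "diffusion_matrix \<sigma> x"]
  show ?thesis
    unfolding drift_rem_def hess_rem_def tr skew_rem_def generator_def trace_mul_sym[of "diffusion_matrix \<sigma> x"]
    by (simp add: inner_commute algebra_simps)
qed

lemma continuous_on_diffusion_trace:
  assumes "continuous_on UNIV A"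
  shows "continuous_on UNIV (\<lambda>x. trace (A x ** diffusion_matrix \<sigma> x))"
  unfolding trace_def matrix_matrix_mult_def diffusion_matrix_def transpose_def vec_lambda_beta
  by (intro continuous_intros assms \<sigma>_cont)

lemma rem_measurable:
  fixes f :: "real^'d \<Rightarrow> real"
  assumes f: "Ck 3 f"
  shows "drift_rem f k \<in> borel_measurable borel" "hess_rem f k \<in> borel_measurable borel"
    "skew_rem f k \<in> borel_measurable borel"
proof -
  have fc: "continuous_on UNIV f" using Ck_continuous[OF f, of "[]"] by simp
  have gc: "continuous_on UNIV (grad f)" by (rule continuous_on_grad[OF f]) simp
  have hc: "continuous_on UNIV (hess f)" by (rule continuous_on_hess[OF f]) simp
  have nc: "continuous_on UNIV (noiseless k)" by (intro continuous_intros)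
  have fn: "continuous_on UNIV (\<lambda>x. f (noiseless k x))" by (rule continuous_on_compose2[OF fc nc]) simp
  have hn: "continuous_on UNIV (\<lambda>x. hess f (noiseless k x))" by (rule continuous_on_compose2[OF hc nc]) simp
  show "drift_rem f k \<in> borel_measurable borel" unfolding drift_rem_def[abs_def]
    by (intro borel_measurable_continuous_onI continuous_intros fn fc gc b_cont)
  show "hess_rem f k \<in> borel_measurable borel" unfolding hess_rem_def[abs_def]
    by (intro borel_measurable_continuous_onI continuous_intros continuous_on_diffusion_trace hn hc)
  have "(\<lambda>x. f (noiseless k x)) \<in> borel_measurable borel" by (rule borel_measurable_continuous_onI[OF fn])
  moreover have "(\<lambda>x. trace (hess f (noiseless k x) ** diffusion_matrix \<sigma> x)) \<in> borel_measurable borel"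
    by (intro borel_measurable_continuous_onI continuous_on_diffusion_trace hn)
  moreover have "transition k f \<in> borel_measurable borel"
    by (rule measurable_transition[OF borel_measurable_continuous_onI[OF fc]])
  ultimately show "skew_rem f k \<in> borel_measurable borel" unfolding skew_rem_def[abs_def] by measurable
qed

lemma norm_\<sigma>_mult_le: "norm (\<sigma> x *v u) \<le> s\<^sub>1 * norm u"
  using norm_mult_vec_le[of "\<sigma> x" u] mult_right_mono[OF \<sigma>_le[of x], of "norm u"] by simp

text \<open>The trace is the mean of the quadratic form at \<open>\<sigma> x *v u\<close>, so a
  bound on the form suffices.\<close>

lemma abs_trace_diffusion_le:
  assumes "\<And>h. \<bar>h \<bullet> (A *v h)\<bar> \<le> B * (norm h)\<^sup>2" "0 \<le> B"
  shows "\<bar>trace (A ** diffusion_matrix \<sigma> x)\<bar> \<le> B * s\<^sub>1\<^sup>2 * real CARD('r)"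
proof -
  have *: "\<bar>(\<sigma> x *v u) \<bullet> (A *v (\<sigma> x *v u))\<bar> \<le> B * s\<^sub>1\<^sup>2 * (norm u)\<^sup>2" for u
  proof -
    have "(norm (\<sigma> x *v u))\<^sup>2 \<le> (s\<^sub>1 * norm u)\<^sup>2" using norm_\<sigma>_mult_le by (intro power_mono) auto
    then show ?thesis using order_trans[OF assms(1) mult_left_mono[OF _ assms(2)]]
      by (simp add: power_mult_distrib mult.assoc)
  qed
  have t: "has_bochner_integral mu (\<lambda>u. (\<sigma> x *v u) \<bullet> (A *v (\<sigma> x *v u))) (trace (A ** diffusion_matrix \<sigma> x))"
    unfolding diffusion_matrix_def by (rule trace_moment)
  have n: "has_bochner_integral mu (\<lambda>u. B * s\<^sub>1\<^sup>2 * (norm u)\<^sup>2) (B * s\<^sub>1\<^sup>2 * real CARD('r))"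
    by (intro has_bochner_integral_mult_right norm_square_moment)
  have "\<bar>\<integral>u. (\<sigma> x *v u) \<bullet> (A *v (\<sigma> x *v u)) \<partial>mu\<bar> \<le> (\<integral>u. B * s\<^sub>1\<^sup>2 * (norm u)\<^sup>2 \<partial>mu)"
  proof (rule order_trans[OF integral_abs_bound], rule integral_mono)
    show "integrable mu (\<lambda>u. \<bar>(\<sigma> x *v u) \<bullet> (A *v (\<sigma> x *v u))\<bar>)" "integrable mu (\<lambda>u. B * s\<^sub>1\<^sup>2 * (norm u)\<^sup>2)"
      using t n by (auto simp only: has_bochner_integral_iff intro: integrable_abs)
  qed (rule *)
  then show ?thesis
    unfolding has_bochner_integral_integral_eq[OF t] has_bochner_integral_integral_eq[OF n] .
qed

lemma drift_rem_eq:
  fixes f :: "real^'d \<Rightarrow> real"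
  assumes "Ck 3 f"
  shows "drift_rem f k x = (\<gamma> k)\<^sup>2 * integral {0..1} (\<lambda>t. (1 - t) *
     trace (hess f (x + (t * \<gamma> k) *\<^sub>R b x) ** outer (b x) (b x)))"
proof -
  have "drift_rem f k x = integral {0..1} (\<lambda>t. (1 - t) * ((\<gamma> k *\<^sub>R b x) \<bullet> (hess f (x + t *\<^sub>R (\<gamma> k *\<^sub>R b x)) *v (\<gamma> k *\<^sub>R b x))))"
    using integral_unique[OF taylor2[OF assms, of "\<gamma> k *\<^sub>R b x" x]] by (simp add: drift_rem_def noiseless_def)
  also have "\<dots> = integral {0..1} (\<lambda>t. (\<gamma> k)\<^sup>2 * ((1 - t) * trace (hess f (x + (t * \<gamma> k) *\<^sub>R b x) ** outer (b x) (b x))))"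
    by (simp add: trace_mult_outer matrix_vector_mult_scaleR power2_eq_square mult_ac)
  finally show ?thesis by simp
qed

lemma bias_Lambda_eq:
  fixes f :: "real^'d \<Rightarrow> real"
  assumes f: "Ck 3 f" and k: "1 \<le> k"
  shows "bias_Lambda M b \<sigma> \<gamma> U f k t v x = (\<integral>u. (\<sigma> x *v u) \<bullet>
    (third_deriv f (noiseless k x + (v * t * sqrt (\<gamma> k)) *\<^sub>R (\<sigma> x *v u)) (\<sigma> x *v u) *v (\<sigma> x *v u)) \<partial>mu)"
proof -
  have "(\<lambda>u. (\<sigma> x *v u) \<bullet> (third_deriv f (noiseless k x + (v * t * sqrt (\<gamma> k)) *\<^sub>R (\<sigma> x *v u))
      (\<sigma> x *v u) *v (\<sigma> x *v u))) \<in> borel_measurable borel"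
    by (intro borel_measurable_continuous_onI continuous_on_third_form[OF f] continuous_intros) auto
  from integral_mu_eq[OF this k] show ?thesis
    by (simp add: bias_Lambda_def trace_mult_outer noiseless_def)
qed

lemma third_form_moment:
  fixes S :: "real^'r^'d"
  shows "has_bochner_integral mu (\<lambda>u. (S *v u) \<bullet> (third_deriv f y (S *v u) *v (S *v u))) 0"
proof -
  have "has_bochner_integral mu (\<lambda>u. \<Sum>i\<in>UNIV. \<Sum>j\<in>UNIV. \<Sum>l\<in>UNIV.
      partial i (partial j (partial l f)) y * ((S $ l \<bullet> u) * (S $ i \<bullet> u) * (S $ j \<bullet> u)))
     (\<Sum>i\<in>(UNIV::'d set). \<Sum>j\<in>(UNIV::'d set). \<Sum>l\<in>(UNIV::'d set). partial i (partial j (partial l f)) y * 0)"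
    by (intro has_bochner_integral_sum has_bochner_integral_mult_right cubic_moment)
  then show ?thesis
    by (simp add: inner_mult_vec_eq_sum third_deriv_def sum_distrib_right matrix_vector_mul_component mult.assoc)
qed

text \<open>The second bound rests on the vanishing third moments of the innovation: the cubic form
  with the third derivative frozen at the noiseless point has mean zero, so only a Hoelder increment
  over a distance of order \<open>sqrt (\<gamma> k)\<close> remains, which yields
  \<open>\<gamma> k powr (\<beta> / 2)\<close>.\<close>

lemma abs_bias_Lambda_le:
  fixes f :: "real^'d \<Rightarrow> real"
  assumes f: "Ck_hoelder 3 \<beta> f" and \<beta>: "0 < \<beta>" "\<beta> \<le> 1"
  obtains C where "0 \<le> C" "\<And>k t v x. 1 \<le> k \<Longrightarrow> \<bar>bias_Lambda M b \<sigma> \<gamma> U f k t v x\<bar> \<le> C"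
    "\<And>k t v x. 1 \<le> k \<Longrightarrow> \<bar>v * t\<bar> \<le> 1 \<Longrightarrow> \<bar>bias_Lambda M b \<sigma> \<gamma> U f k t v x\<bar> \<le> C * \<gamma> k powr (\<beta> / 2)"
proof -
  note Ck = Ck_hoelderD(1)[OF f]
  obtain B where B: "0 \<le> B" "\<And>x h. \<bar>h \<bullet> (third_deriv f x h *v h)\<bar> \<le> B * norm h ^ 3"
    using Ck_hoelder_third_bounded[OF f] by blast
  obtain B' where B': "0 \<le> B'" "\<And>x y h. \<bar>h \<bullet> (third_deriv f x h *v h) - h \<bullet> (third_deriv f y h *v h)\<bar>
       \<le> B' * norm (x - y) powr \<beta> * norm h ^ 3"
    using Ck_hoelder_third_hoelder[OF f] by blast
  \<comment> \<open>The exponent \<open>4\<close> is \<open>3\<close> for the cubic form plus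
    \<open>1\<close> for the Hoelder factor, because \<open>x powr \<beta> \<le> 1 + x\<close> when
    \<open>\<beta> \<le> 1\<close>.\<close>
  define I where "I = (\<integral>u. (1 + norm (u::real^'r)) ^ 4 \<partial>mu)"
  have I: "integrable mu (\<lambda>u::real^'r. (1 + norm u) ^ 4)"
    by (rule integrable_polynomial_growth[where C = 1 and k = 4]) auto
  have I0: "0 \<le> I" unfolding I_def by (rule Bochner_Integration.integral_nonneg) auto
  define C where "C = (B + B') * (1 + s\<^sub>1) ^ 4 * I"
  have C: "0 \<le> C" using B B' I0 s1_pos by (simp add: C_def)
  have cub: "norm (\<sigma> x *v u) ^ 3 \<le> (1 + s\<^sub>1) ^ 3 * (1 + norm u) ^ 3" for x u
  proof -
    have "norm (\<sigma> x *v u) \<le> (1 + s\<^sub>1) * (1 + norm u)"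
      using norm_\<sigma>_mult_le[of x u] s1_pos norm_ge_zero[of u] by (simp add: algebra_simps del: norm_ge_zero)
    then have "norm (\<sigma> x *v u) ^ 3 \<le> ((1 + s\<^sub>1) * (1 + norm u)) ^ 3" by (intro power_mono) auto
    then show ?thesis by (simp add: power_mult_distrib)
  qed
  have int: "\<bar>\<integral>u. g u \<partial>mu\<bar> \<le> c * (1 + s\<^sub>1) ^ 4 * I"
    if "\<And>u. \<bar>g u\<bar> \<le> c * (1 + s\<^sub>1) ^ 4 * (1 + norm u) ^ 4" "0 \<le> c" for g :: "real^'r \<Rightarrow> real" and c
  proof (cases "integrable mu g")
    case True
    have "\<bar>\<integral>u. g u \<partial>mu\<bar> \<le> (\<integral>u. c * (1 + s\<^sub>1) ^ 4 * (1 + norm u) ^ 4 \<partial>mu)"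
    proof (rule order_trans[OF integral_abs_bound], rule integral_mono)
      show "integrable mu (\<lambda>u. c * (1 + s\<^sub>1) ^ 4 * (1 + norm u) ^ 4)"
        by (intro integrable_mult_right) (rule I)
    qed (use True that in auto)
    then show ?thesis by (simp add: I_def)
  qed (use that(2) s1_pos I0 in \<open>simp add: not_integrable_integral_eq\<close>)
  show ?thesis
  proof (rule that[OF C])
    fix k :: nat and t v :: real and x assume k: "1 \<le> k"
    let ?T = "\<lambda>u. (\<sigma> x *v u) \<bullet> (third_deriv f (noiseless k x + (v * t * sqrt (\<gamma> k)) *\<^sub>R (\<sigma> x *v u)) (\<sigma> x *v u) *v (\<sigma> x *v u))"
    have T: "\<bar>?T u\<bar> \<le> B * (1 + s\<^sub>1) ^ 4 * (1 + norm u) ^ 4" for u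
    proof -
      have "\<bar>?T u\<bar> \<le> B * ((1 + s\<^sub>1) ^ 3 * (1 + norm u) ^ 3)"
        by (rule order_trans[OF B(2) mult_left_mono[OF cub B(1)]])
      also have "\<dots> \<le> B * ((1 + s\<^sub>1) ^ 4 * (1 + norm u) ^ 4)"
        using s1_pos by (intro mult_left_mono[OF _ B(1)] mult_mono power_increasing) auto
      finally show ?thesis by (simp add: mult.assoc)
    qed
    have "\<bar>bias_Lambda M b \<sigma> \<gamma> U f k t v x\<bar> \<le> B * (1 + s\<^sub>1) ^ 4 * I"
      unfolding bias_Lambda_eq[OF Ck k] by (rule int[OF T B(1)])
    also have "\<dots> \<le> C" unfolding C_def using B B' s1_pos I0 by (intro mult_right_mono) auto
    finally show "\<bar>bias_Lambda M b \<sigma> \<gamma> U f k t v x\<bar> \<le> C" .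
    assume tv: "\<bar>v * t\<bar> \<le> 1"
    let ?g = "\<gamma> k powr (\<beta> / 2)"
    let ?W = "\<lambda>u. (\<sigma> x *v u) \<bullet> (third_deriv f (noiseless k x) (\<sigma> x *v u) *v (\<sigma> x *v u))"
    have g: "0 < \<gamma> k" by (rule \<gamma>_pos[OF k])
    have diff: "\<bar>?T u - ?W u\<bar> \<le> (B' * ?g) * (1 + s\<^sub>1) ^ 4 * (1 + norm u) ^ 4" for u
    proof -
      let ?s = "norm (\<sigma> x *v u)"
      have "norm ((noiseless k x + (v * t * sqrt (\<gamma> k)) *\<^sub>R (\<sigma> x *v u)) - noiseless k x) powr \<beta>
         = (\<bar>v * t\<bar> * (sqrt (\<gamma> k) * ?s)) powr \<beta>" using g by (simp add: abs_mult mult.assoc)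
      also have "\<dots> \<le> (1 * (sqrt (\<gamma> k) * ?s)) powr \<beta>"
        using tv g \<beta> by (intro powr_mono2 mult_right_mono) auto
      also have "\<dots> = ?g * ?s powr \<beta>"
        using g by (simp add: powr_mult powr_powr powr_half_sqrt[symmetric])
      also have "\<dots> \<le> ?g * ((1 + s\<^sub>1) * (1 + norm u))"
      proof (intro mult_left_mono)
        have "?s powr \<beta> \<le> (1 + ?s) powr \<beta>" using \<beta> by (intro powr_mono2) auto
        also have "\<dots> \<le> (1 + ?s) powr 1" using \<beta> by (intro powr_mono) auto
        also have "(1 + ?s) powr 1 = 1 + ?s" by (simp add: add_nonneg_nonneg)
        also have "\<dots> \<le> (1 + s\<^sub>1) * (1 + norm u)"
          using norm_\<sigma>_mult_le[of x u] s1_pos norm_ge_zero[of u] by (simp add: algebra_simps del: norm_ge_zero)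
        finally show "?s powr \<beta> \<le> (1 + s\<^sub>1) * (1 + norm u)" .
      qed simp
      finally have p: "norm ((noiseless k x + (v * t * sqrt (\<gamma> k)) *\<^sub>R (\<sigma> x *v u)) - noiseless k x) powr \<beta>
         \<le> ?g * ((1 + s\<^sub>1) * (1 + norm u))" .
      have "\<bar>?T u - ?W u\<bar> \<le> B' * (?g * ((1 + s\<^sub>1) * (1 + norm u))) * ((1 + s\<^sub>1) ^ 3 * (1 + norm u) ^ 3)"
        using s1_pos by (intro order_trans[OF B'(2)] mult_mono mult_left_mono p cub B'(1) mult_nonneg_nonneg) auto
      also have "\<dots> = (B' * ?g) * (1 + s\<^sub>1) ^ 4 * (1 + norm u) ^ 4"
        by (simp add: power4_eq_xxxx power3_eq_cube)
      finally show ?thesis .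
    qed
    have "integrable mu ?T"
    proof (rule integrable_polynomial_growth[OF _ T])
      show "?T \<in> borel_measurable borel"
        by (intro borel_measurable_continuous_onI continuous_on_third_form[OF Ck] continuous_intros) auto
    qed
    then have "(\<integral>u. ?T u \<partial>mu) = (\<integral>u. ?T u - ?W u \<partial>mu)"
      using third_form_moment[of "\<sigma> x" f "noiseless k x"] by (simp add: has_bochner_integral_iff)
    then have "\<bar>bias_Lambda M b \<sigma> \<gamma> U f k t v x\<bar> \<le> (B' * ?g) * (1 + s\<^sub>1) ^ 4 * I"
      unfolding bias_Lambda_eq[OF Ck k] using int[OF diff] B' by simp
    also have "\<dots> = (B' * (1 + s\<^sub>1) ^ 4 * I) * ?g" by simp
    also have "\<dots> \<le> C * ?g" unfolding C_def using B B' s1_pos I0 by (intro mult_right_mono) auto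
    finally show "\<bar>bias_Lambda M b \<sigma> \<gamma> U f k t v x\<bar> \<le> C * ?g" .
  qed
qed

text \<open>Third-order Taylor expansion in the noise around the noiseless point. The linear term
  has mean zero, the quadratic one is the trace subtracted in \<open>skew_rem\<close>, and cubic
  homogeneity in \<open>sqrt (\<gamma> k)\<close> produces the power \<open>3/2\<close>.\<close>

lemma skew_rem_eq:
  fixes f :: "real^'d \<Rightarrow> real"
  assumes f: "Ck_hoelder 3 \<beta> f" and k: "1 \<le> k"
  shows "skew_rem f k x = \<gamma> k powr (3/2) *
     integral {0..1} (\<lambda>t. (1 - t) * t * integral {0..1} (\<lambda>u. bias_Lambda M b \<sigma> \<gamma> U f k t u x))"
proof -
  note Ck = Ck_hoelderD(1)[OF f]
  obtain B where B: "0 \<le> B" "\<And>x h. \<bar>h \<bullet> (third_deriv f x h *v h)\<bar> \<le> B * norm h ^ 3"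
    using Ck_hoelder_third_bounded[OF f] by blast
  have g: "0 < \<gamma> k" by (rule \<gamma>_pos[OF k])
  have fc: "continuous_on UNIV f" using Ck_continuous[OF Ck, of "[]"] by simp
  let ?y = "noiseless k x"
  define T where "T = (\<lambda>t v u. (\<sigma> x *v u) \<bullet> (third_deriv f (?y + (v * t * sqrt (\<gamma> k)) *\<^sub>R (\<sigma> x *v u)) (\<sigma> x *v u) *v (\<sigma> x *v u)))"
  have T_cont: "continuous_on S (\<lambda>z. T (t z) (v z) (u z))"
    if "continuous_on S t" "continuous_on S v" "continuous_on S u" for S :: "'b::topological_space set" and t v u
    unfolding T_def using that by (intro continuous_on_third_form[OF Ck] continuous_intros) auto
  have T_le: "\<bar>T t v u\<bar> \<le> B * s\<^sub>1 ^ 3 * (1 + norm u) ^ 3" for t v u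
  proof -
    have "\<bar>T t v u\<bar> \<le> B * norm (\<sigma> x *v u) ^ 3" unfolding T_def by (rule B(2))
    also have "\<dots> \<le> B * (s\<^sub>1 * (1 + norm u)) ^ 3"
      using norm_\<sigma>_mult_le[of x u] s1_pos by (intro mult_left_mono power_mono B(1)) (auto simp: algebra_simps)
    finally show ?thesis by (simp add: power_mult_distrib mult.assoc)
  qed
  have Lam: "bias_Lambda M b \<sigma> \<gamma> U f k t v x = (\<integral>u. T t v u \<partial>mu)" for t v
    unfolding T_def by (rule bias_Lambda_eq[OF Ck k])
  have inner: "integral {0..1} (\<lambda>v. bias_Lambda M b \<sigma> \<gamma> U f k t v x) = (\<integral>u. integral {0..1} (\<lambda>v. T t v u) \<partial>mu)" for t
    unfolding Lam by (rule integral_swap[OF _ T_le]) (intro T_cont continuous_intros)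
  have Ic: "continuous_on UNIV (\<lambda>p. integral {0..1} (\<lambda>v. T (fst p) v (snd p)))"
  proof -
    have "continuous_on (UNIV \<times> cbox 0 1) (\<lambda>(p, v). T (fst p) v (snd p))"
      unfolding case_prod_unfold by (intro T_cont continuous_intros)
    from integral_continuous_on_param[OF this] show ?thesis by simp
  qed
  have "integral {0..1} (\<lambda>t. (1 - t) * t * integral {0..1} (\<lambda>v. bias_Lambda M b \<sigma> \<gamma> U f k t v x))
     = integral {0..1} (\<lambda>t. \<integral>u. (1 - t) * t * integral {0..1} (\<lambda>v. T t v u) \<partial>mu)"
    unfolding inner by simp
  also have "\<dots> = (\<integral>u. integral {0..1} (\<lambda>t. (1 - t) * t * integral {0..1} (\<lambda>v. T t v u)) \<partial>mu)"
  proof (rule integral_swap)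
    show "continuous_on UNIV (\<lambda>p. (1 - fst p) * fst p * integral {0..1} (\<lambda>v. T (fst p) v (snd p)))"
      by (intro continuous_intros Ic)
    fix t :: real and u assume t: "0 \<le> t" "t \<le> 1"
    have 1: "\<bar>(1 - t) * t\<bar> \<le> 1" using t by (simp add: abs_mult mult_le_one)
    have 2: "\<bar>integral {0..1} (\<lambda>v. T t v u)\<bar> \<le> B * s\<^sub>1 ^ 3 * (1 + norm u) ^ 3"
      using B(1) s1_pos by (intro abs_integral_unit_le T_le) auto
    show "\<bar>(1 - t) * t * integral {0..1} (\<lambda>v. T t v u)\<bar> \<le> B * s\<^sub>1 ^ 3 * (1 + norm u) ^ 3"
      unfolding abs_mult[of "(1 - t) * t"] using mult_mono[OF 1 2] by simp
  qed
  finally have dbl: "integral {0..1} (\<lambda>t. (1 - t) * t * integral {0..1} (\<lambda>v. bias_Lambda M b \<sigma> \<gamma> U f k t v x))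
     = (\<integral>u. integral {0..1} (\<lambda>t. (1 - t) * t * integral {0..1} (\<lambda>v. T t v u)) \<partial>mu)" .
  have sq3: "sqrt (\<gamma> k) ^ 3 = \<gamma> k powr (3/2)"
  proof -
    have "sqrt (\<gamma> k) ^ 3 = (\<gamma> k powr (1/2)) powr 3" using g by (simp add: powr_half_sqrt)
    also have "\<dots> = \<gamma> k powr (3/2)" unfolding powr_powr by simp
    finally show ?thesis .
  qed
  have pt: "f (step k x u) = f ?y + sqrt (\<gamma> k) * ((grad f ?y v* \<sigma> x) \<bullet> u)
      + \<gamma> k / 2 * ((\<sigma> x *v u) \<bullet> (hess f ?y *v (\<sigma> x *v u)))
      + \<gamma> k powr (3/2) * integral {0..1} (\<lambda>t. (1 - t) * t * integral {0..1} (\<lambda>v. T t v u))" for u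
  proof -
    have "f (?y + jump k x u) - f ?y - grad f ?y \<bullet> jump k x u - 1/2 * (jump k x u \<bullet> (hess f ?y *v jump k x u))
       = integral {0..1} (\<lambda>t. (1 - t) * t * integral {0..1} (\<lambda>v. jump k x u \<bullet> (third_deriv f (?y + (v * t) *\<^sub>R jump k x u) (jump k x u) *v jump k x u)))"
      by (rule taylor3[OF Ck]) simp
    also have "\<dots> = integral {0..1} (\<lambda>t. \<gamma> k powr (3/2) * ((1 - t) * t * integral {0..1} (\<lambda>v. T t v u)))"
      unfolding jump_def third_form_scale sq3 T_def by (simp add: mult_ac)
    also have "\<dots> = \<gamma> k powr (3/2) * integral {0..1} (\<lambda>t. (1 - t) * t * integral {0..1} (\<lambda>v. T t v u))" by simp
    finally have "f (?y + jump k x u) = f ?y + grad f ?y \<bullet> jump k x u + 1/2 * (jump k x u \<bullet> (hess f ?y *v jump k x u))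
      + \<gamma> k powr (3/2) * integral {0..1} (\<lambda>t. (1 - t) * t * integral {0..1} (\<lambda>v. T t v u))" by simp
    moreover have "jump k x u \<bullet> (hess f ?y *v jump k x u) = \<gamma> k * ((\<sigma> x *v u) \<bullet> (hess f ?y *v (\<sigma> x *v u)))"
      using g by (simp add: jump_def matrix_vector_mult_scaleR flip: mult.assoc)
    ultimately show ?thesis
      by (simp add: step_def) (simp add: jump_def dot_lmul_matrix)
  qed
  let ?I = "\<lambda>u. integral {0..1} (\<lambda>t. (1 - t) * t * integral {0..1} (\<lambda>v. T t v u))"
  have I_int: "integrable mu ?I"
  proof (rule integrable_polynomial_growth)
    have "continuous_on (UNIV \<times> cbox 0 1) (\<lambda>(u, t). (1 - t) * t * integral {0..1} (\<lambda>v. T t v u))"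
      unfolding case_prod_unfold
      by (intro continuous_intros continuous_on_compose2[OF Ic, of _ "\<lambda>p. (snd p, fst p)", simplified])
    from integral_continuous_on_param[OF this]
    show "?I \<in> borel_measurable borel" by (intro borel_measurable_continuous_onI) simp
    fix u
    show "\<bar>?I u\<bar> \<le> B * s\<^sub>1 ^ 3 * (1 + norm u) ^ 3"
    proof (rule abs_integral_unit_le)
      fix t :: real assume t: "0 \<le> t" "t \<le> 1"
      have 1: "\<bar>(1 - t) * t\<bar> \<le> 1" using t by (simp add: abs_mult mult_le_one)
      have 2: "\<bar>integral {0..1} (\<lambda>v. T t v u)\<bar> \<le> B * s\<^sub>1 ^ 3 * (1 + norm u) ^ 3"
        using B(1) s1_pos by (intro abs_integral_unit_le T_le) auto
      show "\<bar>(1 - t) * t * integral {0..1} (\<lambda>v. T t v u)\<bar> \<le> B * s\<^sub>1 ^ 3 * (1 + norm u) ^ 3"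
        unfolding abs_mult[of "(1 - t) * t"] using mult_mono[OF 1 2] by simp
    qed (use B(1) s1_pos in auto)
  qed
  have "has_bochner_integral mu (\<lambda>u. f ?y + sqrt (\<gamma> k) * ((grad f ?y v* \<sigma> x) \<bullet> u)
      + \<gamma> k / 2 * ((\<sigma> x *v u) \<bullet> (hess f ?y *v (\<sigma> x *v u))) + \<gamma> k powr (3/2) * ?I u)
     (f ?y + sqrt (\<gamma> k) * 0 + \<gamma> k / 2 * trace (hess f ?y ** (\<sigma> x ** transpose (\<sigma> x)))
       + \<gamma> k powr (3/2) * integral\<^sup>L mu ?I)"
    using mu.prob_space I_int
    by (intro has_bochner_integral_add has_bochner_integral_mult_right linear_moment trace_moment)
      (auto simp: has_bochner_integral_iff)
  then have "transition k f x = f ?y + \<gamma> k / 2 * trace (hess f ?y ** diffusion_matrix \<sigma> x) + \<gamma> k powr (3/2) * integral\<^sup>L mu ?I"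
    unfolding transition_def pt[symmetric] diffusion_matrix_def by (simp add: has_bochner_integral_iff)
  then show ?thesis unfolding skew_rem_def dbl by simp
qed

end

section \<open>Remainder bounds in terms of the Lyapunov function\<close>

context lyapunov_scheme
begin

lemma norm_b_le: "norm (b x) \<le> sqrt CV * sqrt (V x)"
  using grad_b_le[of x] zero_le_power2[of "norm (grad V x)"] unfolding real_sqrt_mult[symmetric]
  by (intro real_le_rsqrt) linarith

text \<open>Converts constants into multiples of \<open>sqrt V\<close> or \<open>V\<close>, the
  quantities whose weighted exponential moments are controlled.\<close>

lemma one_le_V:
  shows "1 \<le> 1 / sqrt v * sqrt (V x)" "sqrt (V x) \<le> 1 / sqrt v * V x" "1 \<le> 1 / v * V x"
proof -
  have s: "sqrt v \<le> sqrt (V x)" "0 < sqrt v" using V_ge v_pos by auto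
  show "1 \<le> 1 / sqrt v * sqrt (V x)" using s by (simp add: pos_le_divide_eq)
  have "sqrt v * sqrt (V x) \<le> sqrt (V x) * sqrt (V x)" using s by (intro mult_right_mono) auto
  then show "sqrt (V x) \<le> 1 / sqrt v * V x" using s V_pos[of x] by (simp add: pos_le_divide_eq mult.commute)
  show "1 \<le> 1 / v * V x" using V_ge[of x] v_pos by (simp add: pos_le_divide_eq)
qed

text \<open>The two bounds use different orders of smoothness: the gradient with
  \<open>|b| \<le> sqrt (CV * V)\<close> for the first, the Hessian with
  \<open>|b|\<^sup>2 \<le> CV * V\<close> for the second, which gains a factor
  \<open>\<gamma> k\<close>.\<close>

lemma drift_rem_le:
  fixes f :: "real^'d \<Rightarrow> real"
  assumes f: "Ck_hoelder 3 \<beta> f"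
  obtains C where "0 \<le> C" "\<And>k x. 1 \<le> k \<Longrightarrow> \<bar>drift_rem f k x\<bar> \<le> C * \<gamma> k * sqrt (V x)"
    "\<And>k x. 1 \<le> k \<Longrightarrow> \<bar>drift_rem f k x\<bar> \<le> C * (\<gamma> k)\<^sup>2 * V x"
proof -
  note Ck = Ck_hoelderD(1)[OF f]
  obtain G where G: "0 \<le> G" "\<And>x. norm (grad f x) \<le> G" using Ck_hoelder_grad_bounded[OF f] by blast
  obtain B where B: "0 \<le> B" "\<And>x h. \<bar>h \<bullet> (hess f x *v h)\<bar> \<le> B * (norm h)\<^sup>2"
    using Ck_hoelder_hess_bounded[OF f] by blast
  define C where "C = 2 * G * sqrt CV + B * CV"
  show ?thesis
  proof (rule that[of C])
    show "0 \<le> C" using G B CV_pos by (simp add: C_def)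
    fix k :: nat and x assume k: "1 \<le> k"
    have g: "0 < \<gamma> k" by (rule \<gamma>_pos[OF k])
    have "\<bar>f (noiseless k x) - f x\<bar> \<le> G * norm (noiseless k x - x)"
      using Ck_differentiable[OF Ck, of "[]"] G(2) by (intro lipschitz_of_bounded_grad) auto
    moreover have "norm (noiseless k x - x) = \<gamma> k * norm (b x)" using g by (simp add: noiseless_def)
    moreover have "\<bar>\<gamma> k * (grad f x \<bullet> b x)\<bar> \<le> \<gamma> k * (G * norm (b x))"
    proof -
      have "\<bar>grad f x \<bullet> b x\<bar> \<le> norm (grad f x) * norm (b x)" by (rule Cauchy_Schwarz_ineq2)
      also have "\<dots> \<le> G * norm (b x)" using G by (intro mult_right_mono) auto
      finally show ?thesis using g by (simp add: abs_mult)
    qed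
    ultimately have "\<bar>drift_rem f k x\<bar> \<le> 2 * G * \<gamma> k * norm (b x)"
      using abs_triangle_ineq4[of "f (noiseless k x) - f x" "\<gamma> k * (grad f x \<bullet> b x)"]
      by (simp add: drift_rem_def mult_ac)
    also have "\<dots> \<le> 2 * G * \<gamma> k * (sqrt CV * sqrt (V x))" using G g by (intro mult_left_mono norm_b_le) auto
    also have "\<dots> \<le> C * \<gamma> k * sqrt (V x)"
    proof -
      have "0 \<le> B * CV * (\<gamma> k * sqrt (V x))" using B CV_pos g V_pos[of x] by simp
      then show ?thesis by (simp add: C_def algebra_simps)
    qed
    finally show "\<bar>drift_rem f k x\<bar> \<le> C * \<gamma> k * sqrt (V x)" .
    have "\<bar>integral {0..1} (\<lambda>t. (1 - t) * trace (hess f (x + (t * \<gamma> k) *\<^sub>R b x) ** outer (b x) (b x)))\<bar> \<le> B * (norm (b x))\<^sup>2"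
    proof (rule abs_integral_unit_le)
      fix t :: real assume t: "0 \<le> t" "t \<le> 1"
      have "\<bar>1 - t\<bar> * \<bar>b x \<bullet> (hess f (x + (t * \<gamma> k) *\<^sub>R b x) *v b x)\<bar> \<le> 1 * (B * (norm (b x))\<^sup>2)"
        using t by (intro mult_mono B(2)) auto
      then show "\<bar>(1 - t) * trace (hess f (x + (t * \<gamma> k) *\<^sub>R b x) ** outer (b x) (b x))\<bar> \<le> B * (norm (b x))\<^sup>2"
        by (simp add: trace_mult_outer abs_mult)
    qed (use B(1) in simp)
    then have "\<bar>drift_rem f k x\<bar> \<le> (\<gamma> k)\<^sup>2 * (B * (norm (b x))\<^sup>2)"
      unfolding drift_rem_eq[OF Ck] abs_mult by (simp add: mult_left_mono)
    also have "(norm (b x))\<^sup>2 \<le> CV * V x" using grad_b_le[of x] zero_le_power2[of "norm (grad V x)"] by linarith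
    finally have "\<bar>drift_rem f k x\<bar> \<le> (\<gamma> k)\<^sup>2 * (B * (CV * V x))" using B(1) by (auto simp: mult_left_mono)
    also have "\<dots> \<le> C * (\<gamma> k)\<^sup>2 * V x"
    proof -
      have "0 \<le> 2 * G * sqrt CV * ((\<gamma> k)\<^sup>2 * V x)" using G CV_pos V_pos[of x] by simp
      then show ?thesis by (simp add: C_def algebra_simps)
    qed
    finally show "\<bar>drift_rem f k x\<bar> \<le> C * (\<gamma> k)\<^sup>2 * V x" .
  qed
qed

lemma hess_rem_le:
  fixes f :: "real^'d \<Rightarrow> real"
  assumes f: "Ck_hoelder 3 \<beta> f"
  obtains C where "0 \<le> C" "\<And>k x. 1 \<le> k \<Longrightarrow> \<bar>hess_rem f k x\<bar> \<le> C * \<gamma> k * sqrt (V x)"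
    "\<And>k x. 1 \<le> k \<Longrightarrow> \<bar>hess_rem f k x\<bar> \<le> C * (\<gamma> k)\<^sup>2 * V x"
proof -
  obtain B where B: "0 \<le> B" "\<And>x h. \<bar>h \<bullet> (hess f x *v h)\<bar> \<le> B * (norm h)\<^sup>2"
    using Ck_hoelder_hess_bounded[OF f] by blast
  obtain B' where B': "0 \<le> B'"
    "\<And>x y h. \<bar>h \<bullet> ((hess f x - hess f y) *v h)\<bar> \<le> B' * norm (x - y) * (norm h)\<^sup>2"
    using Ck_hoelder_hess_lipschitz[OF f] by blast
  let ?r = "real CARD('r)"
  define c where "c = s\<^sub>1\<^sup>2 * ?r / sqrt v"
  have c: "0 \<le> c" using v_pos by (simp add: c_def)
  define C where "C = B * c + B' * sqrt CV * c / 2"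
  show ?thesis
  proof (rule that[of C])
    show "0 \<le> C" using B B' CV_pos c by (simp add: C_def)
    fix k :: nat and x assume k: "1 \<le> k"
    have g: "0 < \<gamma> k" by (rule \<gamma>_pos[OF k])
    let ?A = "hess f (noiseless k x) - hess f x"
    have "\<bar>h \<bullet> (?A *v h)\<bar> \<le> (2 * B) * (norm h)\<^sup>2" for h
      using B(2)[of h "noiseless k x"] B(2)[of h x]
      by (simp add: matrix_vector_mult_diff_rdistrib inner_diff_right)
    then have "\<bar>trace (?A ** diffusion_matrix \<sigma> x)\<bar> \<le> 2 * B * s\<^sub>1\<^sup>2 * ?r"
      using B(1) by (intro abs_trace_diffusion_le) auto
    then have "\<bar>hess_rem f k x\<bar> \<le> \<gamma> k * (B * s\<^sub>1\<^sup>2 * ?r) * 1"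
      using g by (simp add: hess_rem_def abs_mult)
    also have "\<dots> \<le> \<gamma> k * (B * s\<^sub>1\<^sup>2 * ?r) * (1 / sqrt v * sqrt (V x))"
      using g B by (intro mult_left_mono one_le_V) auto
    also have "\<dots> = B * c * (\<gamma> k * sqrt (V x))" by (simp add: c_def)
    also have "\<dots> \<le> C * (\<gamma> k * sqrt (V x))"
      using g V_pos[of x] B' CV_pos c by (intro mult_right_mono) (auto simp: C_def)
    finally show "\<bar>hess_rem f k x\<bar> \<le> C * \<gamma> k * sqrt (V x)" by (simp add: mult.assoc)
    have "\<bar>trace (?A ** diffusion_matrix \<sigma> x)\<bar> \<le> B' * norm (noiseless k x - x) * s\<^sub>1\<^sup>2 * ?r"
      using B' by (intro abs_trace_diffusion_le) auto
    also have "norm (noiseless k x - x) = \<gamma> k * norm (b x)" using g by (simp add: noiseless_def)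
    finally have "\<bar>hess_rem f k x\<bar> \<le> \<gamma> k / 2 * (B' * (\<gamma> k * norm (b x)) * s\<^sub>1\<^sup>2 * ?r)"
      using g by (simp add: hess_rem_def abs_mult)
    also have "\<dots> = (\<gamma> k)\<^sup>2 * (B' * s\<^sub>1\<^sup>2 * ?r / 2) * norm (b x)" by (simp add: power2_eq_square)
    also have "\<dots> \<le> (\<gamma> k)\<^sup>2 * (B' * s\<^sub>1\<^sup>2 * ?r / 2) * (sqrt CV * (1 / sqrt v * V x))"
      using B' CV_pos by (intro mult_left_mono order_trans[OF norm_b_le] one_le_V) auto
    also have "\<dots> = B' * sqrt CV * c / 2 * ((\<gamma> k)\<^sup>2 * V x)" by (simp add: c_def mult_ac)
    also have "\<dots> \<le> C * ((\<gamma> k)\<^sup>2 * V x)"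
      using V_pos[of x] B c by (intro mult_right_mono) (auto simp: C_def)
    finally show "\<bar>hess_rem f k x\<bar> \<le> C * (\<gamma> k)\<^sup>2 * V x" by (simp add: mult.assoc)
  qed
qed

lemma skew_rem_le:
  fixes f :: "real^'d \<Rightarrow> real"
  assumes f: "Ck_hoelder 3 \<beta> f" and \<beta>: "0 < \<beta>" "\<beta> \<le> 1"
  obtains C where "0 \<le> C" "\<And>k x. 1 \<le> k \<Longrightarrow> \<bar>skew_rem f k x\<bar> \<le> C * \<gamma> k * sqrt (V x)"
    "\<And>k x. 1 \<le> k \<Longrightarrow> \<bar>skew_rem f k x\<bar> \<le> C * \<gamma> k powr ((3 + \<beta>) / 2) * V x"
proof -
  obtain L where L: "0 \<le> L" "\<And>k t v x. 1 \<le> k \<Longrightarrow> \<bar>bias_Lambda M b \<sigma> \<gamma> U f k t v x\<bar> \<le> L"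
    "\<And>k t v x. 1 \<le> k \<Longrightarrow> \<bar>v * t\<bar> \<le> 1 \<Longrightarrow> \<bar>bias_Lambda M b \<sigma> \<gamma> U f k t v x\<bar> \<le> L * \<gamma> k powr (\<beta> / 2)"
    using abs_bias_Lambda_le[OF f \<beta>] by blast
  have dbl: "\<bar>integral {0..1} (\<lambda>t. (1 - t) * t * integral {0..1} (\<lambda>u. bias_Lambda M b \<sigma> \<gamma> U f k t u x))\<bar> \<le> D"
    if "\<And>t u. 0 \<le> t \<Longrightarrow> t \<le> 1 \<Longrightarrow> 0 \<le> u \<Longrightarrow> u \<le> 1 \<Longrightarrow> \<bar>bias_Lambda M b \<sigma> \<gamma> U f k t u x\<bar> \<le> D" "0 \<le> D" for k x D
  proof (rule abs_integral_unit_le)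
    fix t :: real assume t: "0 \<le> t" "t \<le> 1"
    have 1: "\<bar>(1 - t) * t\<bar> \<le> 1" using t by (simp add: abs_mult mult_le_one)
    have 2: "\<bar>integral {0..1} (\<lambda>u. bias_Lambda M b \<sigma> \<gamma> U f k t u x)\<bar> \<le> D"
      using t that by (intro abs_integral_unit_le) auto
    show "\<bar>(1 - t) * t * integral {0..1} (\<lambda>u. bias_Lambda M b \<sigma> \<gamma> U f k t u x)\<bar> \<le> D"
      unfolding abs_mult[of "(1 - t) * t"] using mult_mono[OF 1 2] by simp
  qed (rule that(2))
  define C where "C = L * sqrt (\<gamma> 1) / sqrt v + L / v"
  show ?thesis
  proof (rule that[of C])
    show "0 \<le> C" using L v_pos \<gamma>_pos[of 1] by (simp add: C_def)
    fix k :: nat and x assume k: "1 \<le> k"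
    have g: "0 < \<gamma> k" by (rule \<gamma>_pos[OF k])
    have "\<bar>skew_rem f k x\<bar> \<le> \<gamma> k powr (3/2) * L"
      unfolding skew_rem_eq[OF f k] abs_mult using L k by (simp add: mult_left_mono dbl)
    also have "\<gamma> k powr (3/2) = \<gamma> k * sqrt (\<gamma> k)"
    proof -
      have "\<gamma> k powr (3/2) = \<gamma> k powr (1 + 1/2)" by simp
      then show ?thesis using g unfolding powr_add by (simp add: powr_half_sqrt)
    qed
    also have "\<gamma> k * sqrt (\<gamma> k) * L \<le> \<gamma> k * sqrt (\<gamma> 1) * L * 1"
      using g \<gamma>_le[OF k] L by (simp add: mult_left_mono mult_right_mono)
    also have "\<dots> \<le> \<gamma> k * sqrt (\<gamma> 1) * L * (1 / sqrt v * sqrt (V x))"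
      using g \<gamma>_pos[of 1] L by (intro mult_left_mono one_le_V) auto
    also have "\<dots> = L * sqrt (\<gamma> 1) / sqrt v * (\<gamma> k * sqrt (V x))" by simp
    also have "\<dots> \<le> C * (\<gamma> k * sqrt (V x))"
      using g V_pos[of x] L v_pos by (intro mult_right_mono) (auto simp: C_def)
    finally show "\<bar>skew_rem f k x\<bar> \<le> C * \<gamma> k * sqrt (V x)" by (simp add: mult.assoc)
    have "\<bar>skew_rem f k x\<bar> \<le> \<gamma> k powr (3/2) * (L * \<gamma> k powr (\<beta> / 2))"
      unfolding skew_rem_eq[OF f k] abs_mult using L k
      by (auto intro!: mult_left_mono dbl L(3) simp: abs_mult mult_le_one)
    also have "\<dots> = L * \<gamma> k powr ((3 + \<beta>) / 2) * 1"
      by (simp add: add_divide_distrib powr_add)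
    also have "\<dots> \<le> L * \<gamma> k powr ((3 + \<beta>) / 2) * (1 / v * V x)"
      using L by (intro mult_left_mono one_le_V) auto
    also have "\<dots> = L / v * (\<gamma> k powr ((3 + \<beta>) / 2) * V x)" by simp
    also have "\<dots> \<le> C * (\<gamma> k powr ((3 + \<beta>) / 2) * V x)"
      using V_pos[of x] L v_pos \<gamma>_pos[of 1] by (intro mult_right_mono) (auto simp: C_def)
    finally show "\<bar>skew_rem f k x\<bar> \<le> C * \<gamma> k powr ((3 + \<beta>) / 2) * V x" by (simp add: mult.assoc)
  qed
qed

end

section \<open>Negligible remainders and the main theorem\<close>

text \<open>Let \<open>I n\<close> be the largest \<open>i \<le> n\<close> for which
  \<open>Q (1 / (i + 2))\<close> holds from \<open>n\<close> onwards. The admissible sets grow with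
  \<open>n\<close>, so \<open>I\<close> is monotone, and each \<open>i\<close> is eventually
  admissible, so \<open>I\<close> tends to infinity; \<open>top\<close> makes \<open>i = 0\<close>
  always admissible.\<close>

lemma diagonal_sequence:
  fixes Q :: "real \<Rightarrow> nat \<Rightarrow> bool"
  assumes top: "\<And>n. Q (1/2) n" and ev: "\<And>\<epsilon>. 0 < \<epsilon> \<Longrightarrow> \<epsilon> < 1/2 \<Longrightarrow> \<forall>\<^sub>F n in sequentially. Q \<epsilon> n"
  obtains \<delta> where "\<And>n. 0 < \<delta> n" "\<And>n. \<delta> n \<le> 1/2" "antimono \<delta>" "\<delta> \<longlonglongrightarrow> 0" "\<And>n. Q (\<delta> n) n"
proof -
  define G where "G n = {i. i \<le> n \<and> (\<forall>m\<ge>n. Q (1 / (real i + 2)) m)}" for n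
  have fin: "finite (G n)" for n unfolding G_def by (rule finite_subset[of _ "{..n}"]) auto
  have zero: "0 \<in> G n" for n using top by (simp add: G_def)
  define I where "I n = Max (G n)" for n
  have I_in: "I n \<in> G n" for n unfolding I_def using fin zero by (intro Max_in) auto
  have I_mono: "I m \<le> I n" if "m \<le> n" for m n
  proof -
    have "G m \<subseteq> G n" using that by (auto simp: G_def)
    then show ?thesis unfolding I_def using fin zero by (intro Max_mono) auto
  qed
  have I_top: "\<forall>\<^sub>F n in sequentially. i \<le> I n" for i
  proof -
    have "\<forall>\<^sub>F n in sequentially. Q (1 / (real i + 2)) n"
    proof (cases "i = 0")
      case False then show ?thesis by (intro ev) (auto simp: field_simps)
    qed (use top in simp)
    then obtain n0 where n0: "\<And>n. n0 \<le> n \<Longrightarrow> Q (1 / (real i + 2)) n" by (auto simp: eventually_sequentially)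
    have "i \<le> I n" if "max n0 i \<le> n" for n
    proof -
      have "i \<in> G n" using that n0 by (auto simp: G_def)
      then show ?thesis unfolding I_def using fin by (intro Max_ge) auto
    qed
    then show ?thesis by (rule eventually_sequentiallyI)
  qed
  show ?thesis
  proof (rule that[of "\<lambda>n. 1 / (real (I n) + 2)"])
    show "antimono (\<lambda>n. 1 / (real (I n) + 2))"
      using I_mono by (auto intro!: antimonoI divide_left_mono)
    have "filterlim I at_top sequentially" using I_top by (simp add: filterlim_at_top)
    from filterlim_compose[OF filterlim_real_sequentially this]
    have "filterlim (\<lambda>n. real (I n) + 2) at_top sequentially"
      by (rule filterlim_at_top_mono) simp
    then show "(\<lambda>n. 1 / (real (I n) + 2)) \<longlonglongrightarrow> 0"
      by (intro real_tendsto_divide_at_top[OF tendsto_const])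
    show "Q (1 / (real (I n) + 2)) n" for n using I_in[of n] by (simp add: G_def)
  qed (auto simp: field_simps)
qed

text \<open>Toeplitz averaging: the quotients \<open>e k / \<gamma> k\<close> tend to zero and are
  averaged with weights \<gamma> of divergent sum.\<close>

lemma weighted_sum_small:
  fixes e \<gamma> :: "nat \<Rightarrow> real"
  assumes \<gamma>: "\<And>k. 1 \<le> k \<Longrightarrow> 0 < \<gamma> k" and e: "\<And>k. 1 \<le> k \<Longrightarrow> 0 \<le> e k"
    and small: "(\<lambda>k. e k / \<gamma> k) \<longlonglongrightarrow> 0" and top: "filterlim (Gam \<gamma>) at_top sequentially"
  shows "(\<lambda>n. (1 + (\<Sum>k=1..n. e k)) / Gam \<gamma> n) \<longlonglongrightarrow> 0"
proof (rule LIMSEQ_I)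
  fix d :: real assume d: "0 < d"
  have "\<forall>\<^sub>F k in sequentially. e k / \<gamma> k < d / 2" using d by (intro order_tendstoD(2)[OF small]) auto
  then obtain k0 where k0: "\<And>k. k0 \<le> k \<Longrightarrow> e k / \<gamma> k < d / 2" by (auto simp: eventually_sequentially)
  define A where "A = 1 + (\<Sum>k=1..k0. e k)"
  have "\<forall>\<^sub>F n in sequentially. 2 * A / d < Gam \<gamma> n" using top by (simp add: filterlim_at_top_dense)
  moreover have "\<forall>\<^sub>F n in sequentially. 0 < Gam \<gamma> n" using top by (simp add: filterlim_at_top_dense)
  ultimately have "\<forall>\<^sub>F n in sequentially. norm ((1 + (\<Sum>k=1..n. e k)) / Gam \<gamma> n - 0) < d"
  proof eventually_elim
    case (elim n)
    have "(\<Sum>k=1..n. e k) \<le> (\<Sum>k=1..n. (if k \<le> k0 then e k else 0) + d / 2 * \<gamma> k)"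
    proof (rule sum_mono)
      fix k assume k: "k \<in> {1..n}"
      then have "0 < \<gamma> k" using \<gamma> by auto
      then show "e k \<le> (if k \<le> k0 then e k else 0) + d / 2 * \<gamma> k"
        using d k0[of k] by (auto simp: pos_divide_less_eq)
    qed
    also have "\<dots> = (\<Sum>k\<in>{1..n} \<inter> {k. k \<le> k0}. e k) + d / 2 * Gam \<gamma> n"
      by (simp add: sum.distrib sum.If_cases Gam_def sum_distrib_left)
    also have "(\<Sum>k\<in>{1..n} \<inter> {k. k \<le> k0}. e k) \<le> (\<Sum>k=1..k0. e k)"
      using e by (intro sum_mono2) auto
    finally have "1 + (\<Sum>k=1..n. e k) \<le> A + d / 2 * Gam \<gamma> n" by (simp add: A_def)
    also have "\<dots> < d * Gam \<gamma> n" using elim d by (simp add: field_simps)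
    finally have "(1 + (\<Sum>k=1..n. e k)) / Gam \<gamma> n < d" using elim by (simp add: field_simps)
    moreover have "0 \<le> 1 + (\<Sum>k=1..n. e k)" using e by (intro add_nonneg_nonneg sum_nonneg) auto
    ultimately show ?case using elim by simp
  qed
  then show "\<exists>no. \<forall>n\<ge>no. norm ((1 + (\<Sum>k=1..n. e k)) / Gam \<gamma> n - 0) < d"
    by (simp add: eventually_sequentially)
qed

text \<open>Cauchy--Schwarz against the weights \<open>\<gamma>\<close>, applied only to the tail of the sum so that the
  constant is the arbitrarily small tail of \<open>\<Sum> e\<^sup>2 / \<gamma>\<close>.\<close>

lemma square_sum_small:
  fixes e \<gamma> :: "nat \<Rightarrow> real"
  assumes \<gamma>: "\<And>k. 1 \<le> k \<Longrightarrow> 0 < \<gamma> k" and e: "\<And>k. 1 \<le> k \<Longrightarrow> 0 \<le> e k"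
    and summ: "summable (\<lambda>k. (e k)\<^sup>2 / \<gamma> k)" and top: "filterlim (Gam \<gamma>) at_top sequentially"
  shows "(\<lambda>n. (1 + (\<Sum>k=1..n. e k))\<^sup>2 / Gam \<gamma> n) \<longlonglongrightarrow> 0"
proof (rule LIMSEQ_I)
  fix d :: real assume d: "0 < d"
  obtain N where N: "\<And>m n. N \<le> m \<Longrightarrow> norm (\<Sum>k=m..<n. (e k)\<^sup>2 / \<gamma> k) < d / 4"
    using summ d unfolding summable_Cauchy by (metis divide_pos_pos zero_less_numeral)
  define A where "A = 1 + (\<Sum>k=1..N. e k)"
  have A: "1 \<le> A" unfolding A_def using e by (auto intro!: sum_nonneg)
  have "\<forall>\<^sub>F n in sequentially. 4 * A\<^sup>2 / d < Gam \<gamma> n" using top by (simp add: filterlim_at_top_dense)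
  moreover have "\<forall>\<^sub>F n in sequentially. 0 < Gam \<gamma> n" using top by (simp add: filterlim_at_top_dense)
  ultimately have "\<forall>\<^sub>F n in sequentially. norm ((1 + (\<Sum>k=1..n. e k))\<^sup>2 / Gam \<gamma> n - 0) < d"
  proof eventually_elim
    case (elim n)
    let ?B = "\<Sum>k=Suc N..n. e k"
    have B0: "0 \<le> ?B" using e by (intro sum_nonneg) auto
    have "?B\<^sup>2 = (\<Sum>k=Suc N..n. sqrt (\<gamma> k) * (e k / sqrt (\<gamma> k)))\<^sup>2"
    proof -
      have "sqrt (\<gamma> k) * (e k / sqrt (\<gamma> k)) = e k" if "k \<in> {Suc N..n}" for k
        using \<gamma>[of k] that by simp
      then have "?B = (\<Sum>k=Suc N..n. sqrt (\<gamma> k) * (e k / sqrt (\<gamma> k)))"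
        by (intro sum.cong refl) (rule sym)
      then show ?thesis by (rule arg_cong)
    qed
    also have "\<dots> \<le> (\<Sum>k=Suc N..n. (sqrt (\<gamma> k))\<^sup>2) * (\<Sum>k=Suc N..n. (e k / sqrt (\<gamma> k))\<^sup>2)"
      by (rule Cauchy_Schwarz_ineq_sum)
    also have "(\<Sum>k=Suc N..n. (sqrt (\<gamma> k))\<^sup>2) = (\<Sum>k=Suc N..n. \<gamma> k)"
      using \<gamma> by (intro sum.cong) (auto simp: less_imp_le)
    also have "(\<Sum>k=Suc N..n. (e k / sqrt (\<gamma> k))\<^sup>2) = (\<Sum>k=Suc N..n. (e k)\<^sup>2 / \<gamma> k)"
      using \<gamma> by (intro sum.cong) (auto simp: power_divide less_imp_le)
    also have "(\<Sum>k=Suc N..n. \<gamma> k) * (\<Sum>k=Suc N..n. (e k)\<^sup>2 / \<gamma> k) \<le> Gam \<gamma> n * (d / 4)"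
    proof (rule mult_mono)
      show "(\<Sum>k=Suc N..n. \<gamma> k) \<le> Gam \<gamma> n"
        unfolding Gam_def using \<gamma> by (intro sum_mono2) (auto simp: less_imp_le)
      show "(\<Sum>k=Suc N..n. (e k)\<^sup>2 / \<gamma> k) \<le> d / 4"
        using N[of "Suc N" "Suc n"] by (simp add: atLeastLessThanSuc_atLeastAtMost)
    qed (use elim \<gamma> in \<open>auto intro!: sum_nonneg divide_nonneg_pos\<close>)
    finally have B: "?B\<^sup>2 \<le> Gam \<gamma> n * (d / 4)" .
    have "1 + (\<Sum>k=1..n. e k) \<le> A + ?B"
    proof -
      have "(\<Sum>k=1..n. e k) \<le> (\<Sum>k\<in>{1..N} \<union> {Suc N..n}. e k)"
        using e by (intro sum_mono2) auto
      also have "\<dots> = (\<Sum>k=1..N. e k) + ?B" by (rule sum.union_disjoint) auto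
      finally show ?thesis by (simp add: A_def)
    qed
    moreover have "0 \<le> 1 + (\<Sum>k=1..n. e k)" using e by (intro add_nonneg_nonneg sum_nonneg) auto
    ultimately have "(1 + (\<Sum>k=1..n. e k))\<^sup>2 \<le> (A + ?B)\<^sup>2" by (intro power_mono)
    also have "\<dots> \<le> 2 * A\<^sup>2 + 2 * ?B\<^sup>2"
      using zero_le_power2[of "A - ?B"] by (simp add: power2_eq_square algebra_simps)
    also have "\<dots> < d * Gam \<gamma> n"
    proof -
      have "4 * A\<^sup>2 < Gam \<gamma> n * d" using elim d by (simp add: pos_divide_less_eq)
      then show ?thesis using B by (simp add: mult.commute)
    qed
    finally have "(1 + (\<Sum>k=1..n. e k))\<^sup>2 / Gam \<gamma> n < d" using elim by (simp add: pos_divide_less_eq)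
    then show ?case using elim by simp
  qed
  then show "\<exists>no. \<forall>n\<ge>no. norm ((1 + (\<Sum>k=1..n. e k))\<^sup>2 / Gam \<gamma> n - 0) < d"
    by (simp add: eventually_sequentially)
qed

lemma summable_powr_asymp:
  fixes \<gamma> :: "nat \<Rightarrow> real"
  assumes \<gamma>: "\<And>k. 1 \<le> k \<Longrightarrow> 0 < \<gamma> k" and as: "asymp_seq \<gamma> (\<lambda>k. real k powr (- \<theta>))"
    and p: "0 < p" "1 < \<theta> * p"
  shows "summable (\<lambda>k. \<gamma> k powr p)"
proof -
  obtain n0 C where C: "C \<ge> 1" "\<And>n. n0 \<le> n \<Longrightarrow> \<gamma> n \<le> C * real n powr (- \<theta>)"
    using as by (auto simp: asymp_seq_def)
  show ?thesis
  proof (rule summable_comparison_test_ev)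
    show "summable (\<lambda>k. C powr p * real k powr (- \<theta> * p))"
      using p by (intro summable_mult) (simp add: summable_real_powr_iff)
    have "norm (\<gamma> k powr p) \<le> C powr p * real k powr (- \<theta> * p)" if "max n0 1 \<le> k" for k
    proof -
      have "\<gamma> k powr p \<le> (C * real k powr (- \<theta>)) powr p"
        using \<gamma>[of k] C(2)[of k] p that by (intro powr_mono2) auto
      then show ?thesis using C(1) by (simp add: powr_mult powr_powr)
    qed
    then show "\<forall>\<^sub>F k in sequentially. norm (\<gamma> k powr p) \<le> C powr p * real k powr (- \<theta> * p)"
      by (rule eventually_sequentiallyI)
  qed
qed

lemma Phi_eq_rate:
  assumes "0 < a" "0 < Gam \<gamma> n" "0 < c n"
  defines "z \<equiv> c n ^ 3 * Gam \<gamma> n / a\<^sup>2"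
  shows "Phi \<gamma> c n a = a\<^sup>2 * max (rate1 z) (rate2 z)"
proof -
  let ?G = "Gam \<gamma> n"
  have z: "z powr (1/3) = c n * (?G / a\<^sup>2) powr (1/3)"
  proof -
    have "(c n ^ 3) powr (1/3) = (c n powr 3) powr (1/3)" using assms by simp
    also have "\<dots> = c n" using assms(3) unfolding powr_powr by simp
    finally have "(c n ^ 3) powr (1/3) = c n" .
    moreover have "z powr (1/3) = (c n ^ 3) powr (1/3) * (?G / a\<^sup>2) powr (1/3)"
      using assms(1-3) unfolding z_def by (subst powr_mult[symmetric]) auto
    ultimately show ?thesis by simp
  qed
  have "a powr (4/3) * ?G powr (1/3) = a\<^sup>2 * (?G / a\<^sup>2) powr (1/3)"
  proof -
    have "(?G / a\<^sup>2) powr (1/3) = ?G powr (1/3) / (a powr 2) powr (1/3)"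
      using assms(1,2) by (simp add: powr_divide)
    also have "\<dots> = ?G powr (1/3) / a powr (2/3)" unfolding powr_powr by simp
    finally have root: "(?G / a\<^sup>2) powr (1/3) = ?G powr (1/3) / a powr (2/3)" .
    have "a\<^sup>2 = a powr (4/3) * a powr (2/3)"
      using assms(1) by (simp flip: powr_add)
    then have "a\<^sup>2 / a powr (2/3) = a powr (4/3)" using assms(1) by simp
    then show ?thesis unfolding root by (simp add: mult.commute flip: times_divide_eq_left)
  qed
  then have 2: "a powr (4/3) * ?G powr (1/3) * c n * max (1 - 2/3 * c n * (?G / a\<^sup>2) powr (1/3)) 0 = a\<^sup>2 * rate2 z"
    unfolding rate2_def z by (simp add: mult_ac)
  have 1: "a\<^sup>2 * (1 - 2 / (1 + sqrt (1 + 4 * c n ^ 3 * ?G / a\<^sup>2))) = a\<^sup>2 * rate1 z"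
    by (simp add: rate1_def z_def mult.assoc)
  show ?thesis unfolding Phi_def 1 2 by (simp add: max_mult_distrib_left)
qed

text \<open>Substitutes \<open>y = a / sqrt \<Gamma>\<close> and then lets \<epsilon> depend on
  \<open>n\<close>. Replacing \<open>L\<close> by a larger \<open>G\<close> only weakens the bound,
  since \<Phi> is nonnegative.\<close>

lemma (in deviation) deviation_sequences:
  fixes T :: "nat \<Rightarrow> 'w \<Rightarrow> real"
  assumes G: "L \<le> G" and c: "0 < c" "c ^ 3 = scale"
    and T: "\<And>n \<omega>. 1 \<le> n \<Longrightarrow> T n \<omega> = Z n \<omega> / sqrt (Gam \<gamma> n)"
  obtains \<delta> where "\<And>n. 0 < \<delta> n" "\<And>n. \<delta> n \<le> 1/2" "antimono \<delta>" "\<delta> \<longlonglongrightarrow> 0"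
    "\<And>n a. 1 \<le> n \<Longrightarrow> 0 < a \<Longrightarrow> prob {\<omega>\<in>space M. \<bar>T n \<omega>\<bar> \<ge> a}
       \<le> 2 * exp (\<delta> n) * exp (- ((1 - 2 * \<delta> n) / (2 * m * G\<^sup>2) * Phi \<gamma> (\<lambda>_. c) n a))"
proof -
  define Q where "Q \<epsilon> n \<longleftrightarrow> (1 \<le> n \<longrightarrow> (\<forall>a>0. prob {\<omega>\<in>space M. \<bar>T n \<omega>\<bar> \<ge> a}
       \<le> 2 * exp \<epsilon> * exp (- ((1 - 2 * \<epsilon>) / (2 * m * G\<^sup>2) * Phi \<gamma> (\<lambda>_. c) n a))))" for \<epsilon> n
  \<comment> \<open>At \<open>\<epsilon> = 1/2\<close> the exponent vanishes and
    \<open>2 * exp (1/2)\<close> exceeds \<open>1\<close>, so the bound is trivial; this starts the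
    diagonal sequence.\<close>
  have top: "Q (1/2) n" for n
  proof -
    have "prob {\<omega>\<in>space M. \<bar>T n \<omega>\<bar> \<ge> a} \<le> 2 * exp (1/2)" for a
      using exp_ge_add_one_self[of "1/2"] prob_le_1[of "{\<omega>\<in>space M. \<bar>T n \<omega>\<bar> \<ge> a}"] by linarith
    then show ?thesis by (simp add: Q_def)
  qed
  have ev: "\<forall>\<^sub>F n in sequentially. Q \<epsilon> n" if \<epsilon>: "0 < \<epsilon>" "\<epsilon> < 1/2" for \<epsilon>
    using deviation_bound[OF \<epsilon>]
  proof eventually_elim
    case (elim n)
    show ?case unfolding Q_def
    proof (intro impI allI)
      fix a :: real assume n: "1 \<le> n" and a: "0 < a"
      let ?G = "Gam \<gamma> n"
      have Gp: "0 < ?G" using Gam_pos[OF n] \<gamma>_pos[of 1] by simp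
      define y where "y = a / sqrt ?G"
      have y: "0 < y" "y\<^sup>2 = a\<^sup>2 / ?G" "y * ?G = a * sqrt ?G"
        using a Gp by (auto simp: y_def power_divide real_div_sqrt field_simps)
      have event: "{\<omega>\<in>space M. \<bar>T n \<omega>\<bar> \<ge> a} = {\<omega>\<in>space M. y * ?G \<le> \<bar>Z n \<omega>\<bar>}"
        using Gp unfolding T[OF n] y(3) by (auto simp: abs_divide pos_le_divide_eq)
      have 1: "prob {\<omega>\<in>space M. y * ?G \<le> \<bar>Z n \<omega>\<bar>} \<le> 2 * exp \<epsilon> * exp (- (1 - 2 * \<epsilon>) * rate y * ?G)"
        using elim y(1) by blast
      have "(1 - 2 * \<epsilon>) / (2 * m * G\<^sup>2) * Phi \<gamma> (\<lambda>_. c) n a \<le> (1 - 2 * \<epsilon>) * rate y * ?G"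
      proof -
        let ?z = "c ^ 3 * ?G / a\<^sup>2"
        have z: "scale / y\<^sup>2 = ?z" using Gp a by (simp add: y(2) c(2))
        have Phi: "Phi \<gamma> (\<lambda>_. c) n a = a\<^sup>2 * max (rate1 ?z) (rate2 ?z)"
          using a Gp c(1) by (rule Phi_eq_rate)
        have "0 < ?z" using a Gp c(1) by simp
        then have "0 \<le> max (rate1 ?z) (rate2 ?z)" using rate1_pos[of ?z] by (simp add: le_max_iff_disj)
        then have P0: "0 \<le> Phi \<gamma> (\<lambda>_. c) n a" unfolding Phi by (intro mult_nonneg_nonneg) auto
        have "(1 - 2 * \<epsilon>) / (2 * m * G\<^sup>2) \<le> (1 - 2 * \<epsilon>) / (2 * m * L\<^sup>2)"
          using \<epsilon> m_pos L_pos G by (intro divide_left_mono mult_left_mono power_mono mult_pos_pos) auto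
        then have "(1 - 2 * \<epsilon>) / (2 * m * G\<^sup>2) * Phi \<gamma> (\<lambda>_. c) n a \<le> (1 - 2 * \<epsilon>) / (2 * m * L\<^sup>2) * Phi \<gamma> (\<lambda>_. c) n a"
          using P0 by (rule mult_right_mono)
        also have "\<dots> = (1 - 2 * \<epsilon>) * rate y * ?G"
          unfolding rate_def z Phi using Gp by (simp add: y(2))
        finally show ?thesis .
      qed
      then have "- (1 - 2 * \<epsilon>) * rate y * ?G \<le> - ((1 - 2 * \<epsilon>) / (2 * m * G\<^sup>2) * Phi \<gamma> (\<lambda>_. c) n a)"
        by (simp only: mult_minus_left neg_le_iff_le)
      then have "exp (- (1 - 2 * \<epsilon>) * rate y * ?G) \<le> exp (- ((1 - 2 * \<epsilon>) / (2 * m * G\<^sup>2) * Phi \<gamma> (\<lambda>_. c) n a))"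
        by (simp only: exp_le_cancel_iff)
      then have 2: "2 * exp \<epsilon> * exp (- (1 - 2 * \<epsilon>) * rate y * ?G)
         \<le> 2 * exp \<epsilon> * exp (- ((1 - 2 * \<epsilon>) / (2 * m * G\<^sup>2) * Phi \<gamma> (\<lambda>_. c) n a))" by (intro mult_left_mono) auto
      show "prob {\<omega>\<in>space M. \<bar>T n \<omega>\<bar> \<ge> a}
         \<le> 2 * exp \<epsilon> * exp (- ((1 - 2 * \<epsilon>) / (2 * m * G\<^sup>2) * Phi \<gamma> (\<lambda>_. c) n a))"
        unfolding event using 1 2 by (rule order_trans)
    qed
  qed
  obtain \<delta> where d: "\<And>n. 0 < \<delta> n" "\<And>n. \<delta> n \<le> 1/2" "antimono \<delta>" "\<delta> \<longlonglongrightarrow> 0" "\<And>n. Q (\<delta> n) n"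
    using diagonal_sequence[of Q, OF top ev] by blast
  show ?thesis by (rule that[OF d(1-4)]) (use d(5) in \<open>auto simp: Q_def\<close>)
qed

lemma (in euler_scheme) step_rate:
  assumes "\<gamma> \<longlonglongrightarrow> 0" "0 < \<beta>"
  shows "(\<lambda>k. ((\<gamma> k)\<^sup>2 + \<gamma> k powr ((3 + \<beta>) / 2)) / \<gamma> k) \<longlonglongrightarrow> 0"
proof (rule Lim_transform_eventually)
  have ev: "\<forall>\<^sub>F k in sequentially. 0 < \<gamma> k" using \<gamma>_pos by (intro eventually_sequentiallyI[of 1])
  have "(\<lambda>k. \<gamma> k powr ((1 + \<beta>) / 2)) \<longlonglongrightarrow> 0"
    using assms ev by (intro tendsto_zero_powrI[OF assms(1) tendsto_const]) (auto elim: eventually_mono)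
  from tendsto_add[OF assms(1) this] show "(\<lambda>k. \<gamma> k + \<gamma> k powr ((1 + \<beta>) / 2)) \<longlonglongrightarrow> 0" by simp
  show "\<forall>\<^sub>F k in sequentially. \<gamma> k + \<gamma> k powr ((1 + \<beta>) / 2) = ((\<gamma> k)\<^sup>2 + \<gamma> k powr ((3 + \<beta>) / 2)) / \<gamma> k"
    using ev
  proof eventually_elim
    case (elim k)
    have "\<gamma> k powr ((3 + \<beta>) / 2) = \<gamma> k powr (1 + (1 + \<beta>) / 2)" by (simp add: field_simps)
    also have "\<dots> = \<gamma> k * \<gamma> k powr ((1 + \<beta>) / 2)" using elim unfolding powr_add by simp
    finally show ?case using elim by (simp add: add_divide_distrib power2_eq_square)
  qed
qed

lemma (in lyapunov_scheme) drift_hess_rem_le: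
  fixes f :: "real^'d \<Rightarrow> real"
  assumes f: "Ck_hoelder 3 \<beta> f"
  obtains C where "0 \<le> C" "\<And>k x. 1 \<le> k \<Longrightarrow> \<bar>drift_rem f k x + hess_rem f k x\<bar> \<le> C * \<gamma> k * sqrt (V x)"
    "\<And>k x. 1 \<le> k \<Longrightarrow> \<bar>drift_rem f k x + hess_rem f k x\<bar> \<le> C * (\<gamma> k)\<^sup>2 * V x"
proof -
  obtain C1 where C1: "0 \<le> C1" "\<And>k x. 1 \<le> k \<Longrightarrow> \<bar>drift_rem f k x\<bar> \<le> C1 * \<gamma> k * sqrt (V x)"
    "\<And>k x. 1 \<le> k \<Longrightarrow> \<bar>drift_rem f k x\<bar> \<le> C1 * (\<gamma> k)\<^sup>2 * V x" using drift_rem_le[OF f] by blast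
  obtain C2 where C2: "0 \<le> C2" "\<And>k x. 1 \<le> k \<Longrightarrow> \<bar>hess_rem f k x\<bar> \<le> C2 * \<gamma> k * sqrt (V x)"
    "\<And>k x. 1 \<le> k \<Longrightarrow> \<bar>hess_rem f k x\<bar> \<le> C2 * (\<gamma> k)\<^sup>2 * V x" using hess_rem_le[OF f] by blast
  show ?thesis
  proof (rule that[of "C1 + C2"])
    show "0 \<le> C1 + C2" using C1(1) C2(1) by simp
    fix k :: nat and x assume k: "1 \<le> k"
    have "\<bar>drift_rem f k x + hess_rem f k x\<bar> \<le> \<bar>drift_rem f k x\<bar> + \<bar>hess_rem f k x\<bar>" by (rule abs_triangle_ineq)
    then show "\<bar>drift_rem f k x + hess_rem f k x\<bar> \<le> (C1 + C2) * \<gamma> k * sqrt (V x)"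
      "\<bar>drift_rem f k x + hess_rem f k x\<bar> \<le> (C1 + C2) * (\<gamma> k)\<^sup>2 * V x"
      using C1(2,3)[OF k, of x] C2(2,3)[OF k, of x] unfolding distrib_right by linarith+
  qed
qed

lemma (in lyapunov_scheme) total_rem_le:
  fixes f :: "real^'d \<Rightarrow> real"
  assumes f: "Ck_hoelder 3 \<beta> f" and \<beta>: "0 < \<beta>" "\<beta> \<le> 1"
  obtains C where "0 \<le> C"
    "\<And>k x. 1 \<le> k \<Longrightarrow> \<bar>drift_rem f k x + hess_rem f k x + skew_rem f k x\<bar> \<le> C * \<gamma> k * sqrt (V x)"
    "\<And>k x. 1 \<le> k \<Longrightarrow> \<bar>drift_rem f k x + hess_rem f k x + skew_rem f k x\<bar>
      \<le> C * ((\<gamma> k)\<^sup>2 + \<gamma> k powr ((3 + \<beta>) / 2)) * V x"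
proof -
  obtain C1 where C1: "0 \<le> C1" "\<And>k x. 1 \<le> k \<Longrightarrow> \<bar>drift_rem f k x + hess_rem f k x\<bar> \<le> C1 * \<gamma> k * sqrt (V x)"
    "\<And>k x. 1 \<le> k \<Longrightarrow> \<bar>drift_rem f k x + hess_rem f k x\<bar> \<le> C1 * (\<gamma> k)\<^sup>2 * V x" using drift_hess_rem_le[OF f] by blast
  obtain C2 where C2: "0 \<le> C2" "\<And>k x. 1 \<le> k \<Longrightarrow> \<bar>skew_rem f k x\<bar> \<le> C2 * \<gamma> k * sqrt (V x)"
    "\<And>k x. 1 \<le> k \<Longrightarrow> \<bar>skew_rem f k x\<bar> \<le> C2 * \<gamma> k powr ((3 + \<beta>) / 2) * V x" using skew_rem_le[OF f \<beta>] by blast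
  show ?thesis
  proof (rule that[of "C1 + C2"])
    show "0 \<le> C1 + C2" using C1(1) C2(1) by simp
    fix k :: nat and x assume k: "1 \<le> k"
    have tri: "\<bar>drift_rem f k x + hess_rem f k x + skew_rem f k x\<bar> \<le> \<bar>drift_rem f k x + hess_rem f k x\<bar> + \<bar>skew_rem f k x\<bar>"
      by (rule abs_triangle_ineq)
    then show "\<bar>drift_rem f k x + hess_rem f k x + skew_rem f k x\<bar> \<le> (C1 + C2) * \<gamma> k * sqrt (V x)"
      using C1(2)[OF k, of x] C2(2)[OF k, of x] unfolding distrib_right by linarith
    have "0 \<le> C1 * \<gamma> k powr ((3 + \<beta>) / 2) * V x" "0 \<le> C2 * (\<gamma> k)\<^sup>2 * V x"
      using C1(1) C2(1) V_pos[of x] by (simp_all add: less_imp_le)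
    then show "\<bar>drift_rem f k x + hess_rem f k x + skew_rem f k x\<bar>
      \<le> (C1 + C2) * ((\<gamma> k)\<^sup>2 + \<gamma> k powr ((3 + \<beta>) / 2)) * V x"
      using tri C1(3)[OF k, of x] C2(3)[OF k, of x] unfolding distrib_right distrib_left by linarith
  qed
qed

text \<open>The argument common to (a) and to both cases of (b), which differ only in which Taylor
  errors are counted in \<open>s\<close> and which in \<open>l\<close>.\<close>

lemma (in lyapunov_scheme) deviation_estimate:
  fixes \<phi> \<psi> :: "real^'d \<Rightarrow> real" and N :: "real^'r^'d \<Rightarrow> real" and s l :: "nat \<Rightarrow> real^'d \<Rightarrow> real"
    and e :: "nat \<Rightarrow> real" and T :: "nat \<Rightarrow> 'w \<Rightarrow> real"
  assumes \<beta>: "0 < \<beta>" "\<beta> \<le> 1"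
    and \<phi>: "Ck_hoelder 3 \<beta> \<phi>" "\<exists>L. L-lipschitz_on UNIV \<phi>" "0 < C\<phi>" "\<forall>x. \<bar>\<phi> x\<bar> \<le> C\<phi> * (1 + sqrt (V x))"
    and \<psi>: "Ck_hoelder 3 \<beta> \<psi>" "\<exists>L. L-lipschitz_on UNIV \<psi>" "0 < C\<psi>" "\<forall>x. \<bar>\<psi> x\<bar> \<le> C\<psi> * (1 + sqrt (V x))"
    and N: "matrix_norm N" "\<forall>A. op_norm A \<le> N A" and m: "0 \<le> m"
    and poisson: "\<forall>x. generator b \<sigma> \<psi> x = (N (\<sigma> x))\<^sup>2 - m"
    and \<gamma>_0: "\<gamma> \<longlonglongrightarrow> 0" and Gam_top: "filterlim (Gam \<gamma>) at_top sequentially"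
    and dec: "\<And>k x. 1 \<le> k \<Longrightarrow> transition k \<phi> x - \<phi> x = s k x + l k x"
    and l_measurable: "\<And>k. 1 \<le> k \<Longrightarrow> l k \<in> borel_measurable borel"
    and Cl: "0 \<le> Cl" "\<And>k x. 1 \<le> k \<Longrightarrow> \<bar>l k x\<bar> \<le> Cl * \<gamma> k * sqrt (V x)"
      "\<And>k x. 1 \<le> k \<Longrightarrow> \<bar>l k x\<bar> \<le> Cl * e k * V x"
    and e: "\<And>k. 1 \<le> k \<Longrightarrow> 0 \<le> e k" "(\<lambda>k. e k / \<gamma> k) \<longlonglongrightarrow> 0"
      "(\<lambda>n. (1 + (\<Sum>k=1..n. e k))\<^sup>2 / Gam \<gamma> n) \<longlonglongrightarrow> 0"
    and T: "\<And>n \<omega>. 1 \<le> n \<Longrightarrow> T n \<omega> = (\<Sum>k=1..n. s k (X (k - 1) \<omega>)) / sqrt (Gam \<gamma> n)"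
  shows "\<exists>ct Ct cc :: nat \<Rightarrow> real.
        (\<forall>n\<ge>1. ct n \<le> 1 \<and> 1 \<le> Ct n \<and> 0 < cc n) \<and>
        mono_on {1..} ct \<and> antimono_on {1..} Ct \<and> antimono_on {1..} cc \<and>
        ct \<longlonglongrightarrow> 1 \<and> Ct \<longlonglongrightarrow> 1 \<and> cc \<longlonglongrightarrow> 1 \<and>
        (\<forall>n\<ge>1. \<forall>a>0. prob {\<omega> \<in> space M. \<bar>T n \<omega>\<bar> \<ge> a}
          \<le> 2 * Ct n * exp (- (ct n / (2 * m * (SUP x. norm (grad \<phi> x))\<^sup>2)
                              * Phi \<gamma> (bar_c \<phi> \<psi> m (SUP x. N (\<sigma> x)) cc) n a)))"
    (is "\<exists>ct Ct cc. ?P ct Ct cc")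
proof -
  let ?G = "SUP x. norm (grad \<phi> x)" and ?S = "SUP x. N (\<sigma> x)"
  let ?L = "lip_const \<phi>" and ?L' = "lip_const \<psi>"
  let ?c = "(?L / ?L') powr (2/3) * m * ?S powr (- (2/3))"
  have bar_c: "bar_c \<phi> \<psi> m ?S (\<lambda>_. 1) = (\<lambda>_. ?c)"
    by (simp add: fun_eq_iff bar_c_def)
  have lip\<phi>: "0 \<le> ?L" "\<And>x y. \<bar>\<phi> x - \<phi> y\<bar> \<le> ?L * norm (x - y)"
  proof -
    obtain L where L: "L-lipschitz_on UNIV \<phi>" using \<phi>(2) by blast
    show "0 \<le> ?L" "\<And>x y. \<bar>\<phi> x - \<phi> y\<bar> \<le> ?L * norm (x - y)" by (rule lip_const_bound[OF L])+
  qed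
  have lip\<psi>: "0 \<le> ?L'" "\<And>x y. \<bar>\<psi> x - \<psi> y\<bar> \<le> ?L' * norm (x - y)"
  proof -
    obtain L where L: "L-lipschitz_on UNIV \<psi>" using \<psi>(2) by blast
    show "0 \<le> ?L'" "\<And>x y. \<bar>\<psi> x - \<psi> y\<bar> \<le> ?L' * norm (x - y)" by (rule lip_const_bound[OF L])+
  qed
  have N_bdd: "bdd_above (range (\<lambda>x. N (\<sigma> x)))"
  proof -
    obtain D where D: "0 \<le> D" "\<And>A. N A \<le> D * norm A" using matrix_norm_le_norm[OF N(1)] by blast
    have "N (\<sigma> x) \<le> D * (real CARD('r) * real CARD('d) * s\<^sub>1)" for x
    proof -
      have "norm (\<sigma> x) \<le> real CARD('r) * real CARD('d) * op_norm (\<sigma> x)" by (rule norm_matrix_le_op_norm)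
      also have "\<dots> \<le> real CARD('r) * real CARD('d) * s\<^sub>1" using \<sigma>_le by (intro mult_left_mono) auto
      finally show ?thesis by (intro order_trans[OF D(2)] mult_left_mono D(1))
    qed
    then show ?thesis by (rule bdd_aboveI2)
  qed
  have N_le: "N (\<sigma> x) \<le> ?S" for x using N_bdd by (rule cSUP_upper[OF UNIV_I])
  have S0: "0 \<le> ?S" 
  proof -
    have "0 \<le> N (\<sigma> 0)" using N(1) by (simp add: matrix_norm_def)
    then show ?thesis using N_le[of 0] by (rule order_trans)
  qed
  show ?thesis
  \<comment> \<open>Degenerate values: division by zero yields \<open>0\<close>, and so does
    \<open>0 powr x\<close>. Hence either the factor in front of \<Phi> vanishes, or the constant
    \<open>?c\<close> and with it \<Phi>; the right-hand side is then \<open>2\<close> for constant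
    sequences \<open>1\<close>.\<close>
  proof (cases "m = 0 \<or> ?G = 0 \<or> ?L = 0 \<or> ?L' = 0 \<or> ?S = 0")
    case True
    have exponent: "1 / (2 * m * ?G\<^sup>2) * Phi \<gamma> (\<lambda>_. ?c) n a = 0" for n a
    proof (cases "m = 0 \<or> ?G = 0")
      case False
      then have zero: "?c = 0" using True by auto
      have "Phi \<gamma> (\<lambda>_. 0) n a = 0" by (simp add: Phi_def)
      then show ?thesis unfolding zero by simp
    qed auto
    have trivial: "prob A \<le> 2 * 1 * exp (- (1 / (2 * m * ?G\<^sup>2) * Phi \<gamma> (bar_c \<phi> \<psi> m ?S (\<lambda>_. 1)) n a))" for A n a
      unfolding bar_c exponent by (rule order_trans[OF prob_le_1]) simp
    have "?P (\<lambda>_. 1) (\<lambda>_. 1) (\<lambda>_. 1)"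
      by (intro conjI allI impI trivial tendsto_const monotone_onI order_refl zero_less_one)
    then show ?thesis
      by (intro exI[where x = "\<lambda>_. 1 :: real"])
  next
    case False
    then have pos: "0 < m" "0 < ?L" "0 < ?L'" "0 < ?S" using m lip\<phi> lip\<psi> S0 by auto
    obtain B where B: "0 \<le> B" "\<And>x. norm (grad \<phi> x) \<le> B" using Ck_hoelder_grad_bounded[OF \<phi>(1)] by blast
    have LG: "?L \<le> ?G"
    proof (rule lip_const_le, rule lipschitz_of_bounded_grad)
      show "\<phi> differentiable at x" for x using Ck_differentiable[OF Ck_hoelderD(1)[OF \<phi>(1)], of "[]"] by simp
      show "norm (grad \<phi> x) \<le> ?G" for x by (rule cSUP_upper[OF UNIV_I bdd_aboveI2[OF B(2)]])
    qed
    define l' where "l' k x = drift_rem \<psi> k x + hess_rem \<psi> k x + skew_rem \<psi> k x" for k x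
    define e' where "e' k = (\<gamma> k)\<^sup>2 + \<gamma> k powr ((3 + \<beta>) / 2)" for k
    obtain C1 where C1: "0 \<le> C1" "\<And>k x. 1 \<le> k \<Longrightarrow> \<bar>l' k x\<bar> \<le> C1 * \<gamma> k * sqrt (V x)"
      "\<And>k x. 1 \<le> k \<Longrightarrow> \<bar>l' k x\<bar> \<le> C1 * e' k * V x"
      using total_rem_le[OF \<psi>(1) \<beta>] unfolding l'_def e'_def by blast
    have le_C: "y \<le> C * z" if "y \<le> c * z" "c \<le> C" "0 \<le> z" for y c C z :: real
      using that by (meson mult_right_mono order_trans)
    \<comment> \<open>Folds \<open>1 + sqrt (V x)\<close> into a multiple of
      \<open>sqrt (V x)\<close>, by means of \<open>V x \<ge> v\<close>.\<close>
    define q where "q = 1 / sqrt v + 1"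
    have q: "0 \<le> q" using v_pos by (simp add: q_def)
    have growth: "c * (1 + sqrt (V x)) \<le> c * q * sqrt (V x)" if "0 \<le> c" for c x
    proof -
      have "1 + sqrt (V x) \<le> q * sqrt (V x)" using one_le_V(1)[of x] by (simp add: q_def distrib_right)
      then show ?thesis using that by (simp add: mult.assoc mult_left_mono)
    qed
    define C where "C = Cl + C\<phi> * q + C\<psi> * q + C1"
    have C: "0 \<le> C" "Cl \<le> C" "C\<phi> * q \<le> C" "C\<psi> * q \<le> C" "C1 \<le> C"
      using Cl(1) C1(1) \<phi>(3) \<psi>(3) q by (auto simp: C_def)
    have e': "0 \<le> e' k" for k by (simp add: e'_def)
    have e'_small: "(\<lambda>k. e' k / \<gamma> k) \<longlonglongrightarrow> 0"
      unfolding e'_def using \<gamma>_0 \<beta>(1) by (rule step_rate)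
    interpret D: deviation M X0 U b \<sigma> \<gamma> s\<^sub>1 V v CV \<alpha> \<beta>V H \<phi> \<psi> "\<lambda>x. N (\<sigma> x)" s l l' ?L ?L' m ?S C e e'
    proof
      show "(\<lambda>x. N (\<sigma> x)) \<in> borel_measurable borel"
        by (intro borel_measurable_continuous_onI continuous_on_compose2[OF matrix_norm_continuous[OF N(1)] \<sigma>_cont]) auto
      show "op_norm (\<sigma> x) \<le> N (\<sigma> x)" for x using N(2) by blast
      show "transition k \<psi> x - \<psi> x = \<gamma> k * ((N (\<sigma> x))\<^sup>2 - m) + l' k x" if "1 \<le> k" for k x
        using transition_decomposition[of k \<psi> x] poisson by (simp add: l'_def)
      show "\<bar>\<phi> x\<bar> \<le> C * sqrt (V x)" for x
        using \<phi>(3,4) C(3) V_pos[of x] by (intro le_C[OF order_trans[OF _ growth]]) auto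
      show "\<bar>\<psi> x\<bar> \<le> C * sqrt (V x)" for x
        using \<psi>(3,4) C(4) V_pos[of x] by (intro le_C[OF order_trans[OF _ growth]]) auto
      fix k :: nat and x assume k: "1 \<le> k"
      have g: "0 < \<gamma> k" by (rule \<gamma>_pos[OF k])
      show "\<bar>l k x\<bar> \<le> C * \<gamma> k * sqrt (V x)"
        using le_C[of "\<bar>l k x\<bar>" Cl "\<gamma> k * sqrt (V x)" C] Cl(2)[OF k, of x] C(2) g V_pos[of x] by (simp add: mult.assoc)
      show "\<bar>l k x\<bar> \<le> C * e k * V x"
        using le_C[of "\<bar>l k x\<bar>" Cl "e k * V x" C] Cl(3)[OF k, of x] C(2) e(1)[OF k] V_pos[of x] by (simp add: mult.assoc less_imp_le)
      show "\<bar>l' k x\<bar> \<le> C * \<gamma> k * sqrt (V x)"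
        using le_C[of "\<bar>l' k x\<bar>" C1 "\<gamma> k * sqrt (V x)" C] C1(2)[OF k, of x] C(5) g V_pos[of x] by (simp add: mult.assoc)
      show "\<bar>l' k x\<bar> \<le> C * e' k * V x"
        using le_C[of "\<bar>l' k x\<bar>" C1 "e' k * V x" C] C1(3)[OF k, of x] C(5) e'[of k] V_pos[of x] by (simp add: mult.assoc less_imp_le)
    next
      fix k :: nat assume k: "1 \<le> k"
      note rm = rem_measurable[OF Ck_hoelderD(1)[OF \<psi>(1)]]
      have "(\<lambda>x. drift_rem \<psi> k x + hess_rem \<psi> k x + skew_rem \<psi> k x) \<in> borel_measurable borel"
        by (intro borel_measurable_add rm)
      then show "l' k \<in> borel_measurable borel" by (simp add: l'_def[abs_def])
      have [measurable]: "\<phi> \<in> borel_measurable borel" by (rule lipschitz_measurable[OF lip\<phi>(2) lip\<phi>(1)])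
      have [measurable]: "l k \<in> borel_measurable borel" by (rule l_measurable[OF k])
      have [measurable]: "transition k \<phi> \<in> borel_measurable borel" by (rule measurable_transition) measurable
      have "(\<lambda>x. transition k \<phi> x - \<phi> x - l k x) \<in> borel_measurable borel" by measurable
      then show "s k \<in> borel_measurable borel" using dec[OF k] by simp
    next
      show "(\<lambda>n. (1 + (\<Sum>k=1..n. e' k)) / Gam \<gamma> n) \<longlonglongrightarrow> 0"
        by (rule weighted_sum_small[OF \<gamma>_pos e' e'_small Gam_top])
    qed (assumption | rule lip\<phi>(2) lip\<psi>(2) pos N_le dec C(1) l_measurable e e' e'_small Gam_top)+
    have c: "0 < ?c" using pos by simp
    have c3: "?c ^ 3 = D.scale"
    proof -
      have cube: "(x powr y) ^ 3 = x powr (3 * y)" if "0 < x" for x y :: real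
      proof -
        have "(x powr y) ^ 3 = (x powr y) powr 3" using that by simp
        then show ?thesis unfolding powr_powr by (simp add: mult.commute)
      qed
      have "((?L / ?L') powr (2/3)) ^ 3 = (?L / ?L')\<^sup>2" using pos by (subst cube) auto
      moreover have "(?S powr (- (2/3))) ^ 3 = 1 / ?S\<^sup>2" using pos by (subst cube) (auto simp: powr_minus_divide)
      ultimately show ?thesis
        by (simp add: D.scale_def power_mult_distrib power_divide)
    qed
    have TZ: "T n \<omega> = D.Z n \<omega> / sqrt (Gam \<gamma> n)" if "1 \<le> n" for n \<omega>
      using T[OF that] by (simp add: D.Z_def)
    obtain \<delta> where d: "\<And>n. 0 < \<delta> n" "\<And>n. \<delta> n \<le> 1/2" "antimono \<delta>" "\<delta> \<longlonglongrightarrow> 0"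
      "\<And>n a. 1 \<le> n \<Longrightarrow> 0 < a \<Longrightarrow> prob {\<omega>\<in>space M. \<bar>T n \<omega>\<bar> \<ge> a}
       \<le> 2 * exp (\<delta> n) * exp (- ((1 - 2 * \<delta> n) / (2 * m * ?G\<^sup>2) * Phi \<gamma> (\<lambda>_. ?c) n a))"
      using D.deviation_sequences[OF LG c c3 TZ] by blast
    \<comment> \<open>All loss is carried by \<open>ct\<close> and \<open>Ct\<close>, so the
      constant sequence \<open>1\<close> can serve as \<open>cc\<close>: it is nonincreasing with
      limit \<open>1\<close>.\<close>
    have "?P (\<lambda>n. 1 - 2 * \<delta> n) (\<lambda>n. exp (\<delta> n)) (\<lambda>_. 1)"
    proof (intro conjI allI impI)
      show "mono_on {1..} (\<lambda>n. 1 - 2 * \<delta> n)" "antimono_on {1..} (\<lambda>n. exp (\<delta> n))" "antimono_on {1..} (\<lambda>_. 1::real)"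
        using antimonoD[OF d(3)] by (auto intro!: monotone_onI)
      show "(\<lambda>n. 1 - 2 * \<delta> n) \<longlonglongrightarrow> 1" "(\<lambda>n. exp (\<delta> n)) \<longlonglongrightarrow> 1"
        using tendsto_diff[OF tendsto_const tendsto_mult[OF tendsto_const d(4)], of 1 2] tendsto_exp[OF d(4)] by auto
      fix n :: nat
      show "1 - 2 * \<delta> n \<le> 1" "1 \<le> exp (\<delta> n)" "0 < (1::real)"
        using d(1)[of n] by auto
    next
      fix n :: nat and a :: real assume "1 \<le> n" "0 < a"
      then show "prob {\<omega> \<in> space M. \<bar>T n \<omega>\<bar> \<ge> a} \<le> 2 * exp (\<delta> n) *
         exp (- ((1 - 2 * \<delta> n) / (2 * m * ?G\<^sup>2) * Phi \<gamma> (bar_c \<phi> \<psi> m ?S (\<lambda>_. 1)) n a))"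
        unfolding bar_c by (rule d(5))
    qed simp
    then show ?thesis
      by (rule exI[where x = "\<lambda>n. 1 - 2 * \<delta> n", OF exI[where x = "\<lambda>n. exp (\<delta> n)", OF exI[where x = "\<lambda>_. 1"]]])
  qed
qed

text \<open>With \<open>e = \<gamma>\<^sup>2\<close> the series in \<open>square_sum_small\<close>
  has terms \<open>\<gamma> k ^ 3\<close>, of order \<open>k powr (- 3 * \<theta>)\<close>.\<close>

lemma square_sum_small_sq:
  fixes \<gamma> :: "nat \<Rightarrow> real"
  assumes \<gamma>: "\<And>k. 1 \<le> k \<Longrightarrow> 0 < \<gamma> k" and as: "asymp_seq \<gamma> (\<lambda>k. real k powr (- \<theta>))"
    and top: "filterlim (Gam \<gamma>) at_top sequentially" and \<theta>: "1 < \<theta> * 3"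
  shows "(\<lambda>n. (1 + (\<Sum>k=1..n. (\<gamma> k)\<^sup>2))\<^sup>2 / Gam \<gamma> n) \<longlonglongrightarrow> 0"
proof (rule square_sum_small[OF \<gamma> _ _ top])
  have summ: "summable (\<lambda>k. \<gamma> k powr 3)" using \<theta> by (intro summable_powr_asymp[OF \<gamma> as]) simp_all
  have "((\<gamma> k)\<^sup>2)\<^sup>2 / \<gamma> k = \<gamma> k powr 3" if "1 \<le> k" for k
  proof -
    have "(x\<^sup>2)\<^sup>2 / x = x ^ 3" if "0 < x" for x :: real
      using that by (simp add: power2_eq_square power3_eq_cube)
    then show ?thesis using \<gamma>[OF that] by simp
  qed
  then have "\<forall>\<^sub>F k in sequentially. ((\<gamma> k)\<^sup>2)\<^sup>2 / \<gamma> k = \<gamma> k powr 3"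
    by (rule eventually_sequentiallyI)
  with summ show "summable (\<lambda>k. ((\<gamma> k)\<^sup>2)\<^sup>2 / \<gamma> k)"
    by (rule iffD2[OF summable_cong, rotated])
qed simp_all

text \<open>For \<open>e = \<gamma>\<^sup>2 + \<gamma> powr ((3 + \<beta>) / 2)\<close> the quotient
  \<open>e\<^sup>2 / \<gamma>\<close> is at most twice
  \<open>\<gamma> ^ 3 + \<gamma> powr (2 + \<beta>)\<close>. The second power decides, because
  \<open>\<beta> \<le> 1\<close>, and gives the condition
  \<open>\<theta> * (2 + \<beta>) > 1\<close>.\<close>

lemma square_sum_small_sq_powr:
  fixes \<gamma> :: "nat \<Rightarrow> real"
  assumes \<gamma>: "\<And>k. 1 \<le> k \<Longrightarrow> 0 < \<gamma> k" and as: "asymp_seq \<gamma> (\<lambda>k. real k powr (- \<theta>))"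
    and top: "filterlim (Gam \<gamma>) at_top sequentially"
    and \<beta>: "0 < \<beta>" "\<beta> \<le> 1" and \<theta>: "0 < \<theta>" "1 < \<theta> * (2 + \<beta>)"
  shows "(\<lambda>n. (1 + (\<Sum>k=1..n. (\<gamma> k)\<^sup>2 + \<gamma> k powr ((3 + \<beta>) / 2)))\<^sup>2 / Gam \<gamma> n) \<longlonglongrightarrow> 0"
proof (rule square_sum_small[OF \<gamma> _ _ top])
  have "\<theta> * (2 + \<beta>) \<le> \<theta> * 3" using \<beta> \<theta> by (intro mult_left_mono) auto
  then have "1 < \<theta> * 3" using \<theta>(2) by linarith
  then have "summable (\<lambda>k. 2 * \<gamma> k powr 3 + 2 * \<gamma> k powr (2 + \<beta>))"
    using \<beta> \<theta> by (intro summable_add summable_mult summable_powr_asymp[OF \<gamma> as]) simp_all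
  moreover have "norm (((\<gamma> k)\<^sup>2 + \<gamma> k powr ((3 + \<beta>) / 2))\<^sup>2 / \<gamma> k) \<le> 2 * \<gamma> k powr 3 + 2 * \<gamma> k powr (2 + \<beta>)"
    if "1 \<le> k" for k
  proof -
    have g: "0 < \<gamma> k" using \<gamma>[OF that] .
    have "(x + y)\<^sup>2 \<le> 2 * x\<^sup>2 + 2 * y\<^sup>2" for x y :: real
      using zero_le_power2[of "x - y"] by (simp add: power2_eq_square algebra_simps)
    from divide_right_mono[OF this, of "\<gamma> k" "(\<gamma> k)\<^sup>2" "\<gamma> k powr ((3 + \<beta>) / 2)"]
    have "((\<gamma> k)\<^sup>2 + \<gamma> k powr ((3 + \<beta>) / 2))\<^sup>2 / \<gamma> k
        \<le> 2 * (((\<gamma> k)\<^sup>2)\<^sup>2 / \<gamma> k) + 2 * ((\<gamma> k powr ((3 + \<beta>) / 2))\<^sup>2 / \<gamma> k)"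
      using g by (simp add: add_divide_distrib)
    moreover have "((\<gamma> k)\<^sup>2)\<^sup>2 / \<gamma> k = \<gamma> k powr 3"
    proof -
      have "(x\<^sup>2)\<^sup>2 / x = x ^ 3" if "0 < x" for x :: real
        using that by (simp add: power2_eq_square power3_eq_cube)
      then show ?thesis using g by simp
    qed
    moreover have "(\<gamma> k powr ((3 + \<beta>) / 2))\<^sup>2 / \<gamma> k = \<gamma> k powr (2 + \<beta>)"
    proof -
      have "(\<gamma> k powr ((3 + \<beta>) / 2))\<^sup>2 = \<gamma> k powr (1 + (2 + \<beta>))"
        unfolding power2_eq_square powr_add[symmetric] by (rule arg_cong) (simp add: field_simps)
      also have "\<dots> = \<gamma> k * \<gamma> k powr (2 + \<beta>)" using g unfolding powr_add[of _ 1] by simp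
      finally show ?thesis using g by simp
    qed
    ultimately show ?thesis using g by simp
  qed
  then have "\<forall>\<^sub>F k in sequentially. norm (((\<gamma> k)\<^sup>2 + \<gamma> k powr ((3 + \<beta>) / 2))\<^sup>2 / \<gamma> k) \<le> 2 * \<gamma> k powr 3 + 2 * \<gamma> k powr (2 + \<beta>)"
    by (rule eventually_sequentiallyI)
  ultimately show "summable (\<lambda>k. ((\<gamma> k)\<^sup>2 + \<gamma> k powr ((3 + \<beta>) / 2))\<^sup>2 / \<gamma> k)"
    by (rule summable_comparison_test_ev[rotated])
qed simp_all

theorem theorem8:
  fixes b :: "real^'d \<Rightarrow> real^'d" and \<sigma> :: "real^'d \<Rightarrow> real^'r^'d"
    and M :: "'w measure" and X0 :: "'w \<Rightarrow> real^'d" and U :: "nat \<Rightarrow> 'w \<Rightarrow> real^'r"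
    and X :: "nat \<Rightarrow> 'w \<Rightarrow> real^'d"
    and \<gamma> :: "nat \<Rightarrow> real" and \<nu> :: "(real^'d) measure"
    and V :: "real^'d \<Rightarrow> real" and v CV \<alpha>V \<beta>V K cbar \<kappa> :: real
    and \<beta> \<theta> C\<phi> C\<psi> :: real and \<phi> \<psi> :: "real^'d \<Rightarrow> real"
    and N :: "real^'r^'d \<Rightarrow> real" and \<nu>\<sigma> \<sigma>sup :: real
  assumes lipschitz: "\<exists>L. L-lipschitz_on UNIV b" "\<exists>L. L-lipschitz_on UNIV \<sigma>"
    and prob: "prob_space M"
    and X0: "X0 \<in> borel_measurable M" "integrable M (\<lambda>\<omega>. (norm (X0 \<omega>))\<^sup>2)"
    and iid: "prob_space.indep_vars M (\<lambda>_. borel) U {1..}"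
      "\<forall>n\<ge>1. distr M borel (U n) = distr M borel (U 1)"
    and steps: "\<forall>k\<ge>1. 0 < \<gamma> k" "antimono_on {1..} \<gamma>" "\<gamma> \<longlonglongrightarrow> 0"
      "filterlim (Gam \<gamma>) at_top sequentially"
    and X_def: "X = scheme b \<sigma> \<gamma> X0 U"
    and C1: "\<exists>l0>0. \<forall>l<l0. integrable M (\<lambda>\<omega>. exp (l * (norm (X0 \<omega>))\<^sup>2))"
    and GC: "gaussian_concentration M X0 U"
    and C2: "\<forall>x. (op_norm (\<sigma> x))\<^sup>2 \<le> \<kappa>"
    and LV: "lyapunov b \<sigma> V v CV \<alpha>V \<beta>V"
    and cbar: "\<forall>x. K \<le> norm x \<longrightarrow> \<bar>V x\<bar> \<le> cbar * (norm x)\<^sup>2"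
    and unique_inv: "invariant_distribution b \<sigma> \<nu>" "\<forall>\<mu>. invariant_distribution b \<sigma> \<mu> \<longrightarrow> \<mu> = \<nu>"
    and S: "\<forall>k\<ge>1. \<gamma> k \<le> 1/2 * min (1 / sqrt (CV * cbar)) (\<alpha>V / (CV * (SUP x. op_norm (hess V x))))"
    and \<beta>: "0 < \<beta>" "\<beta> \<le> 1"
    and \<phi>: "Ck_hoelder 3 \<beta> \<phi>" "\<exists>L. L-lipschitz_on UNIV \<phi>"
      "0 < C\<phi>" "\<forall>x. \<bar>\<phi> x\<bar> \<le> C\<phi> * (1 + sqrt (V x))"
    and \<theta>: "asymp_seq \<gamma> (\<lambda>k. real k powr (- \<theta>))"
    and N: "matrix_norm N" "\<forall>A. op_norm A \<le> N A"
    and \<nu>\<sigma>_def: "\<nu>\<sigma> = (\<integral>x. (N (\<sigma> x))\<^sup>2 \<partial>\<nu>)"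
    and \<sigma>sup_def: "\<sigma>sup = (SUP x. N (\<sigma> x))"
    and poisson: "\<forall>x. generator b \<sigma> \<psi> x = (N (\<sigma> x))\<^sup>2 - \<nu>\<sigma>"
    and \<psi>: "Ck_hoelder 3 \<beta> \<psi>" "\<exists>L. L-lipschitz_on UNIV \<psi>"
      "0 < C\<psi>" "\<forall>x. \<bar>\<psi> x\<bar> \<le> C\<psi> * (1 + sqrt (V x))"
  shows "(1 / (2 + \<beta>) < \<theta> \<and> \<theta> \<le> 1 \<longrightarrow>
      (\<exists>ct Ct cc :: nat \<Rightarrow> real.
        (\<forall>n\<ge>1. ct n \<le> 1 \<and> 1 \<le> Ct n \<and> 0 < cc n) \<and>
        mono_on {1..} ct \<and> antimono_on {1..} Ct \<and> antimono_on {1..} cc \<and>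
        ct \<longlonglongrightarrow> 1 \<and> Ct \<longlonglongrightarrow> 1 \<and> cc \<longlonglongrightarrow> 1 \<and>
        (\<forall>n\<ge>1. \<forall>a>0.
          measure M {\<omega> \<in> space M. \<bar>sqrt (Gam \<gamma> n) * emp_measure \<gamma> X n (generator b \<sigma> \<phi>) \<omega>\<bar> \<ge> a}
          \<le> 2 * Ct n * exp (- (ct n / (2 * \<nu>\<sigma> * (SUP x. norm (grad \<phi> x))\<^sup>2)
                              * Phi \<gamma> (bar_c \<phi> \<psi> \<nu>\<sigma> \<sigma>sup cc) n a))))) \<and>
    (\<theta> = 1 / (2 + \<beta>) \<longrightarrow>
      (\<exists>ct Ct cc :: nat \<Rightarrow> real.
        (\<forall>n\<ge>1. ct n \<le> 1 \<and> 1 \<le> Ct n \<and> 0 < cc n) \<and>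
        mono_on {1..} ct \<and> antimono_on {1..} Ct \<and> antimono_on {1..} cc \<and>
        ct \<longlonglongrightarrow> 1 \<and> Ct \<longlonglongrightarrow> 1 \<and> cc \<longlonglongrightarrow> 1 \<and>
        (\<forall>n\<ge>1. \<forall>a>0.
          measure M {\<omega> \<in> space M. \<bar>sqrt (Gam \<gamma> n) * emp_measure \<gamma> X n (generator b \<sigma> \<phi>) \<omega>
                                     + bias M b \<sigma> \<gamma> U \<phi> X \<beta> n \<omega>\<bar> \<ge> a}
          \<le> 2 * Ct n * exp (- (ct n / (2 * \<nu>\<sigma> * (SUP x. norm (grad \<phi> x))\<^sup>2)
                              * Phi \<gamma> (bar_c \<phi> \<psi> \<nu>\<sigma> \<sigma>sup cc) n a)))))"
proof -
  interpret prob_space M by (rule prob)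
  define H where "H = (SUP x. op_norm (hess V x))"
  \<comment> \<open>The summand \<open>1\<close> keeps the bound on \<sigma> positive when
    \<open>\<kappa> = 0\<close>.\<close>
  define s\<^sub>1 where "s\<^sub>1 = sqrt \<kappa> + 1"
  have \<kappa>: "0 \<le> \<kappa>" by (rule order_trans[OF zero_le_power2 spec[OF C2, of 0]])
  have H_bdd: "bdd_above (range (\<lambda>x. op_norm (hess V x)))" and CV: "0 < CV" and \<alpha>V: "0 < \<alpha>V"
    using LV by (auto simp only: lyapunov_def)
  have step_le: "\<gamma> k \<le> 1/2 * (\<alpha>V / (CV * H))" if "1 \<le> k" for k
  proof -
    have "\<gamma> k \<le> 1/2 * min (1 / sqrt (CV * cbar)) (\<alpha>V / (CV * H))" using S that unfolding H_def by blast
    also have "\<dots> \<le> 1/2 * (\<alpha>V / (CV * H))" by (intro mult_left_mono) auto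
    finally show ?thesis .
  qed
  \<comment> \<open>Positivity of \<open>\<gamma> 1\<close> makes the quotient positive. This also
    excludes \<open>H = 0\<close>, since division by zero would yield \<open>0\<close>.\<close>
  have "0 < \<alpha>V / (CV * H)" 
  proof -
    have "0 < \<gamma> 1" using steps(1) by simp
    then have "0 < 1/2 * (\<alpha>V / (CV * H))" using step_le[of 1] by linarith
    then show ?thesis by linarith
  qed
  then have H: "0 < H" using CV \<alpha>V by (simp add: zero_less_divide_iff zero_less_mult_iff)
  interpret E: lyapunov_scheme M X0 U b \<sigma> \<gamma> s\<^sub>1 V v CV \<alpha>V \<beta>V H
  proof
    show "X0 \<in> borel_measurable M" by (rule X0(1))
    show "indep_vars (\<lambda>_. borel) U {1..}" by (rule iid(1))
    show "distr M borel (U n) = distr M borel (U 1)" if "1 \<le> n" for n using iid(2) that by blast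
    show "gaussian_concentration M X0 U" by (rule GC)
    show "continuous_on UNIV b" "continuous_on UNIV \<sigma>"
      using lipschitz lipschitz_on_continuous_on by blast+
    show "0 < \<gamma> k" if "1 \<le> k" for k using steps(1) that by blast
    show "\<gamma> k \<le> \<gamma> 1" if "1 \<le> k" for k using monotone_onD[OF steps(2), of 1 k] that by simp
    show "0 < s\<^sub>1" using \<kappa> by (simp add: s\<^sub>1_def add_nonneg_pos)
    show "op_norm (\<sigma> x) \<le> s\<^sub>1" for x
    proof -
      have "op_norm (\<sigma> x) \<le> sqrt \<kappa>" using C2 by (intro real_le_rsqrt) blast
      then show ?thesis by (simp add: s\<^sub>1_def)
    qed
    show "lyapunov b \<sigma> V v CV \<alpha>V \<beta>V" by (rule LV)
    show "0 < H" by (rule H)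
    show "op_norm (hess V x) \<le> H" for x unfolding H_def by (rule cSUP_upper[OF UNIV_I H_bdd])
    show "\<gamma> k * (CV * H) \<le> \<alpha>V / 2" if "1 \<le> k" for k
    proof -
      have "\<gamma> k * (CV * H) \<le> 1/2 * (\<alpha>V / (CV * H)) * (CV * H)"
        using CV H by (intro mult_right_mono step_le that) auto
      then show ?thesis using CV H by simp
    qed
    obtain l0 where l0: "0 < l0" "\<And>l. l < l0 \<Longrightarrow> integrable M (\<lambda>\<omega>. exp (l * (norm (X0 \<omega>))\<^sup>2))" using C1 by blast
    show "\<exists>l>0. integrable M (\<lambda>\<omega>. exp (l * (norm (X0 \<omega>))\<^sup>2))"
    proof (intro exI conjI)
      show "0 < l0 / 2" using l0(1) by simp
      show "integrable M (\<lambda>\<omega>. exp (l0 / 2 * (norm (X0 \<omega>))\<^sup>2))" using l0(1) by (intro l0(2)) simp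
    qed
  qed
  have m: "0 \<le> \<nu>\<sigma>" by (simp add: \<nu>\<sigma>_def)
  note estimate = E.deviation_estimate[OF \<beta> \<phi> \<psi> N m poisson steps(3,4), folded \<sigma>sup_def]
  have Gam: "0 < Gam \<gamma> n" if "1 \<le> n" for n
    using E.Gam_pos[OF that] E.\<gamma>_pos[of 1] by simp
  have scaled: "sqrt (Gam \<gamma> n) * emp_measure \<gamma> X n f \<omega> = (\<Sum>k=1..n. \<gamma> k * f (X (k - 1) \<omega>)) / sqrt (Gam \<gamma> n)"
    if "1 \<le> n" for n f \<omega>
  proof -
    have "r * (1 / (r * r) * x) = x / r" if "0 < r" for r x :: real using that by simp
    from this[of "sqrt (Gam \<gamma> n)"] show ?thesis using Gam[OF that] by (simp add: emp_measure_def)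
  qed
  note rem_meas = E.rem_measurable[OF Ck_hoelderD(1)[OF \<phi>(1)]]
  have bias_E: "bias_E M b \<sigma> \<gamma> U \<phi> X n \<omega> = (\<Sum>k=1..n. E.skew_rem \<phi> k (X (k - 1) \<omega>)) / sqrt (Gam \<gamma> n)" for n \<omega>
  proof -
    have "(\<Sum>k=1..n. \<gamma> k powr (3/2) * integral {0..1} (\<lambda>t. (1 - t) * t *
         integral {0..1} (\<lambda>u. bias_Lambda M b \<sigma> \<gamma> U \<phi> k t u (X (k - 1) \<omega>)))) = (\<Sum>k=1..n. E.skew_rem \<phi> k (X (k - 1) \<omega>))"
      by (intro sum.cong refl E.skew_rem_eq[OF \<phi>(1), symmetric]) simp
    then show ?thesis by (simp add: bias_E_def)
  qed
  show ?thesis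
  proof (intro conjI impI, elim conjE)
    assume \<theta>': "1 / (2 + \<beta>) < \<theta>" "\<theta> \<le> 1"
    have t: "0 < \<theta>" "1 < \<theta> * (2 + \<beta>)"
    proof -
      show "0 < \<theta>" using \<theta>'(1) \<beta> by (intro less_trans[OF _ \<theta>'(1)]) simp
      show "1 < \<theta> * (2 + \<beta>)" using \<theta>'(1) \<beta> by (simp add: pos_divide_less_eq)
    qed
    obtain C where C: "0 \<le> C"
      "\<And>k x. 1 \<le> k \<Longrightarrow> \<bar>E.drift_rem \<phi> k x + E.hess_rem \<phi> k x + E.skew_rem \<phi> k x\<bar> \<le> C * \<gamma> k * sqrt (V x)"
      "\<And>k x. 1 \<le> k \<Longrightarrow> \<bar>E.drift_rem \<phi> k x + E.hess_rem \<phi> k x + E.skew_rem \<phi> k x\<bar>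
        \<le> C * ((\<gamma> k)\<^sup>2 + \<gamma> k powr ((3 + \<beta>) / 2)) * V x"
      using E.total_rem_le[OF \<phi>(1) \<beta>] by blast
    show "\<exists>ct Ct cc :: nat \<Rightarrow> real.
        (\<forall>n\<ge>1. ct n \<le> 1 \<and> 1 \<le> Ct n \<and> 0 < cc n) \<and>
        mono_on {1..} ct \<and> antimono_on {1..} Ct \<and> antimono_on {1..} cc \<and>
        ct \<longlonglongrightarrow> 1 \<and> Ct \<longlonglongrightarrow> 1 \<and> cc \<longlonglongrightarrow> 1 \<and>
        (\<forall>n\<ge>1. \<forall>a>0.
          measure M {\<omega> \<in> space M. \<bar>sqrt (Gam \<gamma> n) * emp_measure \<gamma> X n (generator b \<sigma> \<phi>) \<omega>\<bar> \<ge> a}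
          \<le> 2 * Ct n * exp (- (ct n / (2 * \<nu>\<sigma> * (SUP x. norm (grad \<phi> x))\<^sup>2)
                              * Phi \<gamma> (bar_c \<phi> \<psi> \<nu>\<sigma> \<sigma>sup cc) n a)))"
    \<comment> \<open>All three Taylor errors are negligible in this range of \<theta>, so
      \<open>s\<close> is the generator term alone.\<close>
    proof (rule estimate[where T = "\<lambda>n \<omega>. sqrt (Gam \<gamma> n) * emp_measure \<gamma> X n (generator b \<sigma> \<phi>) \<omega>"
          and s = "\<lambda>k x. \<gamma> k * generator b \<sigma> \<phi> x"
          and l = "\<lambda>k x. E.drift_rem \<phi> k x + E.hess_rem \<phi> k x + E.skew_rem \<phi> k x"
          and e = "\<lambda>k. (\<gamma> k)\<^sup>2 + \<gamma> k powr ((3 + \<beta>) / 2)" and Cl = C])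
      fix k :: nat and x assume k: "1 \<le> k"
      show "E.transition k \<phi> x - \<phi> x = \<gamma> k * generator b \<sigma> \<phi> x + (E.drift_rem \<phi> k x + E.hess_rem \<phi> k x + E.skew_rem \<phi> k x)"
        by (rule E.transition_decomposition)
    next
      show "(\<lambda>x. E.drift_rem \<phi> k x + E.hess_rem \<phi> k x + E.skew_rem \<phi> k x) \<in> borel_measurable borel" for k
        by (intro borel_measurable_add rem_meas)
      show "(\<lambda>k. ((\<gamma> k)\<^sup>2 + \<gamma> k powr ((3 + \<beta>) / 2)) / \<gamma> k) \<longlonglongrightarrow> 0"
        by (rule E.step_rate[OF steps(3) \<beta>(1)])
      show "(\<lambda>n. (1 + (\<Sum>k=1..n. (\<gamma> k)\<^sup>2 + \<gamma> k powr ((3 + \<beta>) / 2)))\<^sup>2 / Gam \<gamma> n) \<longlonglongrightarrow> 0"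
        by (rule square_sum_small_sq_powr[OF E.\<gamma>_pos \<theta> steps(4) \<beta> t])
      show "sqrt (Gam \<gamma> n) * emp_measure \<gamma> X n (generator b \<sigma> \<phi>) \<omega>
         = (\<Sum>k=1..n. \<gamma> k * generator b \<sigma> \<phi> (scheme b \<sigma> \<gamma> X0 U (k - 1) \<omega>)) / sqrt (Gam \<gamma> n)" if "1 \<le> n" for n \<omega>
        using scaled[OF that, of "generator b \<sigma> \<phi>" \<omega>] unfolding X_def .
    qed (use C in auto)
  next
    assume \<theta>': "\<theta> = 1 / (2 + \<beta>)"
    let ?Q = "\<lambda>T. \<exists>ct Ct cc :: nat \<Rightarrow> real.
        (\<forall>n\<ge>1. ct n \<le> 1 \<and> 1 \<le> Ct n \<and> 0 < cc n) \<and>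
        mono_on {1..} ct \<and> antimono_on {1..} Ct \<and> antimono_on {1..} cc \<and>
        ct \<longlonglongrightarrow> 1 \<and> Ct \<longlonglongrightarrow> 1 \<and> cc \<longlonglongrightarrow> 1 \<and>
        (\<forall>n\<ge>1. \<forall>a>0.
          measure M {\<omega> \<in> space M. \<bar>T n \<omega>\<bar> \<ge> a}
          \<le> 2 * Ct n * exp (- (ct n / (2 * \<nu>\<sigma> * (SUP x. norm (grad \<phi> x))\<^sup>2)
                              * Phi \<gamma> (bar_c \<phi> \<psi> \<nu>\<sigma> \<sigma>sup cc) n a)))"
    let ?T = "\<lambda>n \<omega>. sqrt (Gam \<gamma> n) * emp_measure \<gamma> X n (generator b \<sigma> \<phi>) \<omega> + bias M b \<sigma> \<gamma> U \<phi> X \<beta> n \<omega>"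
    have "?Q ?T"
    proof (cases "\<beta> < 1")
      case True
      \<comment> \<open>For \<open>\<beta> < 1\<close> the exponent
        \<open>\<theta> = 1 / (2 + \<beta>)\<close> exceeds \<open>1/3\<close>, so errors of order
        \<open>\<gamma>\<^sup>2\<close> are still negligible and only the third-order noise term is
        counted in \<open>s\<close>.\<close>
      have t: "1 < \<theta> * 3" using \<beta>(1) True by (simp add: \<theta>' field_simps)
      obtain C where C: "0 \<le> C"
        "\<And>k x. 1 \<le> k \<Longrightarrow> \<bar>E.drift_rem \<phi> k x + E.hess_rem \<phi> k x\<bar> \<le> C * \<gamma> k * sqrt (V x)"
        "\<And>k x. 1 \<le> k \<Longrightarrow> \<bar>E.drift_rem \<phi> k x + E.hess_rem \<phi> k x\<bar> \<le> C * (\<gamma> k)\<^sup>2 * V x"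
        using E.drift_hess_rem_le[OF \<phi>(1)] by blast
      show ?thesis
      proof (rule estimate[where T = ?T and s = "\<lambda>k x. \<gamma> k * generator b \<sigma> \<phi> x + E.skew_rem \<phi> k x"
            and l = "\<lambda>k x. E.drift_rem \<phi> k x + E.hess_rem \<phi> k x" and e = "\<lambda>k. (\<gamma> k)\<^sup>2" and Cl = C])
        fix k :: nat and x
        show "E.transition k \<phi> x - \<phi> x = (\<gamma> k * generator b \<sigma> \<phi> x + E.skew_rem \<phi> k x) + (E.drift_rem \<phi> k x + E.hess_rem \<phi> k x)"
          using E.transition_decomposition[of k \<phi> x] by simp
      next
        show "(\<lambda>x. E.drift_rem \<phi> k x + E.hess_rem \<phi> k x) \<in> borel_measurable borel" for k
          by (intro borel_measurable_add rem_meas)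
        have "\<forall>\<^sub>F k in sequentially. \<gamma> k = (\<gamma> k)\<^sup>2 / \<gamma> k"
          using E.\<gamma>_pos by (intro eventually_sequentiallyI[of 1]) (simp add: power2_eq_square)
        then show "(\<lambda>k. (\<gamma> k)\<^sup>2 / \<gamma> k) \<longlonglongrightarrow> 0" by (rule Lim_transform_eventually[OF steps(3)])
        show "(\<lambda>n. (1 + (\<Sum>k=1..n. (\<gamma> k)\<^sup>2))\<^sup>2 / Gam \<gamma> n) \<longlonglongrightarrow> 0"
          by (rule square_sum_small_sq[OF E.\<gamma>_pos \<theta> steps(4) t])
        show "?T n \<omega> = (\<Sum>k=1..n. \<gamma> k * generator b \<sigma> \<phi> (scheme b \<sigma> \<gamma> X0 U (k - 1) \<omega>)
             + E.skew_rem \<phi> k (scheme b \<sigma> \<gamma> X0 U (k - 1) \<omega>)) / sqrt (Gam \<gamma> n)" if "1 \<le> n" for n \<omega>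
          unfolding scaled[OF that] bias_def bias_E using True by (simp add: X_def sum.distrib add_divide_distrib)
      qed (use C in auto)
    next
      \<comment> \<open>Now \<open>\<beta> = 1\<close> and \<open>\<theta> = 1/3\<close>: errors of
        order \<open>\<gamma>\<^sup>2\<close> are no longer covered, so all three Taylor errors go
        into \<open>s\<close> and nothing remains in \<open>l\<close>.\<close>
      case False
      have drift: "1 / sqrt (Gam \<gamma> n) * (\<Sum>k=1..n. (\<gamma> k)\<^sup>2 * integral {0..1} (\<lambda>t. (1 - t) *
              trace (hess \<phi> (X (k - 1) \<omega> + (t * \<gamma> k) *\<^sub>R b (X (k - 1) \<omega>)) ** outer (b (X (k - 1) \<omega>)) (b (X (k - 1) \<omega>)))))
          = (\<Sum>k=1..n. E.drift_rem \<phi> k (X (k - 1) \<omega>)) / sqrt (Gam \<gamma> n)" for n \<omega>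
        unfolding E.drift_rem_eq[OF Ck_hoelderD(1)[OF \<phi>(1)]] by simp
      have hess: "1 / (2 * sqrt (Gam \<gamma> n)) * (\<Sum>k=1..n. \<gamma> k *
            trace ((hess \<phi> (X (k - 1) \<omega> + \<gamma> k *\<^sub>R b (X (k - 1) \<omega>)) - hess \<phi> (X (k - 1) \<omega>)) ** diffusion_matrix \<sigma> (X (k - 1) \<omega>)))
          = (\<Sum>k=1..n. E.hess_rem \<phi> k (X (k - 1) \<omega>)) / sqrt (Gam \<gamma> n)" for n \<omega>
        unfolding E.hess_rem_def E.noiseless_def
        by (simp add: sum_divide_distrib sum_distrib_left mult_ac)
      show ?thesis
      proof (rule estimate[where T = ?T and s = "\<lambda>k x. \<gamma> k * generator b \<sigma> \<phi> x + (E.drift_rem \<phi> k x + E.hess_rem \<phi> k x + E.skew_rem \<phi> k x)"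
            and l = "\<lambda>k x. 0" and e = "\<lambda>k. 0" and Cl = 0])
        show "E.transition k \<phi> x - \<phi> x = (\<gamma> k * generator b \<sigma> \<phi> x + (E.drift_rem \<phi> k x + E.hess_rem \<phi> k x + E.skew_rem \<phi> k x)) + 0" for k x
          using E.transition_decomposition[of k \<phi> x] by simp
        show "(\<lambda>n. (1 + (\<Sum>k=1..n. 0 :: real))\<^sup>2 / Gam \<gamma> n) \<longlonglongrightarrow> 0"
          by (rule square_sum_small[OF E.\<gamma>_pos _ _ steps(4)]) auto
        show "?T n \<omega> = (\<Sum>k=1..n. \<gamma> k * generator b \<sigma> \<phi> (scheme b \<sigma> \<gamma> X0 U (k - 1) \<omega>)
             + (E.drift_rem \<phi> k (scheme b \<sigma> \<gamma> X0 U (k - 1) \<omega>) + E.hess_rem \<phi> k (scheme b \<sigma> \<gamma> X0 U (k - 1) \<omega>)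
               + E.skew_rem \<phi> k (scheme b \<sigma> \<gamma> X0 U (k - 1) \<omega>))) / sqrt (Gam \<gamma> n)" if "1 \<le> n" for n \<omega>
          unfolding scaled[OF that] bias_def bias_E drift hess using False
          by (simp add: X_def sum.distrib add_divide_distrib)
      qed auto
    qed
    then show "?Q (\<lambda>n \<omega>. sqrt (Gam \<gamma> n) * emp_measure \<gamma> X n (generator b \<sigma> \<phi>) \<omega> + bias M b \<sigma> \<gamma> U \<phi> X \<beta> n \<omega>)" .
  qed
qed

end
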